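(* Let $n\ge 1$ and let $X$ be one of: the space of $n\times n$ complex matrices with $G=\operatorname{GL}_n(\mathbb{C})\times\operatorname{GL}_n(\mathbb{C})$; the space of $n\times n$ complex symmetric matrices with $G=\operatorname{GL}_n(\mathbb{C})$; the space of $2n\times 2n$ complex skew-symmetric matrices with $G=\operatorname{GL}_{2n}(\mathbb{C})$. Let $f$ be respectively the determinant of the generic matrix, the determinant of the generic symmetric matrix, the Pfaffian of the generic skew-symmetric matrix, and let $O=\{f\neq0\}\subset X$ be the dense orbit. Let $S$ be the coordinate ring of $X$, and for $\alpha\in\mathbb{C}$ let $F_\alpha=S_f\cdot f^\alpha$, a $\mathcal{D}_X$-module depending only on the class of $\alpha$ in $\mathbb{C}/\mathbb{Z}$. Let $L_\alpha$ be the irreducible local system on $O$ whose monodromy is given by $e^{2\pi i\alpha}$. If $L_\alpha$ is not $G$-equivariant, then the simple object of $\operatorname{mod}^{rh}_\Lambda(\mathcal{D}_X)$ corresponding to $L_\alpha$ is $F_\alpha$.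
   Context: $G$ acts by the natural row and column operations. $\Lambda$ is the union of the conormal varieties to the $G$-orbits on $X$, and $\operatorname{mod}^{rh}_\Lambda(\mathcal{D}_X)$ is the category of regular holonomic $\mathcal{D}_X$-modules with characteristic variety contained in $\Lambda$; by the Riemann--Hilbert correspondence its simple objects are classified by irreducible local systems on $G$-orbits (the simple object corresponding to a local system $L$ on an orbit is the minimal extension of the associated integrable connection). The fundamental group of $O$ is $\mathbb{Z}$, so an irreducible local system on $O$ has rank one and is determined by a monodromy $\lambda=e^{2\pi i\alpha}\in\mathbb{C}^*$, $\alpha\in\mathbb{C}/\mathbb{Z}$; the convention is that the restriction of $F_\alpha$ to $O$ is the rank one integrable connection whose corresponding local system has monodromy $e^{2\pi i\alpha}$. $S_f$ is the localization of $S$ at $f$, and $S_f\cdot f^\alpha$ is the free rank one $S_f$-module on the symbol $f^\alpha$ with derivations acting by $\partial(g f^\alpha)=(\partial(g)+\alpha g\,\partial(f)/f)f^\alpha$. *)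

theory Defs
  imports
    "HOL-Complex_Analysis.Complex_Analysis"
    "HOL-Computational_Algebra.Formal_Laurent_Series"
    "HOL-Algebra.Module"
begin

text \<open>Throughout, \<open>X\<close> is a complex linear subspace of a space of square matrices and \<open>f\<close> a polynomial
  function on it. The principal open subset of \<open>X\<close> where \<open>f\<close> does not vanish is affine, and
  \<open>X\<close> itself is the case \<open>f = 1\<close>.\<close>

type_synonym 'm cmat = "complex ^ 'm ^ 'm"

definition mscale :: "complex \<Rightarrow> 'm::finite cmat \<Rightarrow> 'm cmat" where
  "mscale c A = (\<chi> i j. c * A $ i $ j)"

definition mpair :: "'m::finite cmat \<Rightarrow> 'm cmat \<Rightarrow> complex" where
  "mpair A B = (\<Sum>i\<in>UNIV. \<Sum>j\<in>UNIV. A $ i $ j * B $ i $ j)"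


section \<open>Coordinate rings\<close>

inductive_set poly_funs :: "('m::finite cmat \<Rightarrow> complex) set" where
  const: "(\<lambda>_. c) \<in> poly_funs"
| entry: "(\<lambda>A. A $ i $ j) \<in> poly_funs"
| add: "p \<in> poly_funs \<Longrightarrow> q \<in> poly_funs \<Longrightarrow> (\<lambda>A. p A + q A) \<in> poly_funs"
| mult: "p \<in> poly_funs \<Longrightarrow> q \<in> poly_funs \<Longrightarrow> (\<lambda>A. p A * q A) \<in> poly_funs"

definition basic_open :: "'m::finite cmat set \<Rightarrow> ('m cmat \<Rightarrow> complex) \<Rightarrow> 'm cmat set" where
  "basic_open X f = {A \<in> X. f A \<noteq> 0}"

definition restr :: "'x set \<Rightarrow> ('x \<Rightarrow> complex) \<Rightarrow> 'x \<Rightarrow> complex" where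
  "restr U g = (\<lambda>A. if A \<in> U then g A else 0)"

text \<open>The ring \<open>S\<^sub>f\<close> of regular functions on \<open>basic_open X f\<close>; a regular function is represented by
  its extension by zero to the whole matrix space. For \<open>f = 1\<close> this is the coordinate ring \<open>S\<close> of \<open>X\<close>.\<close>

definition coord_ring :: "'m::finite cmat set \<Rightarrow> ('m cmat \<Rightarrow> complex) \<Rightarrow> ('m cmat \<Rightarrow> complex) ring" where
  "coord_ring X f =
     \<lparr>carrier = {restr (basic_open X f) (\<lambda>A. p A / f A ^ k) | p k. p \<in> poly_funs},
      monoid.mult = (\<lambda>g h A. g A * h A),
      one = restr (basic_open X f) (\<lambda>_. 1),
      zero = (\<lambda>_. 0),
      add = (\<lambda>g h A. g A + h A)\<rparr>"

abbreviation whole :: "'m::finite cmat \<Rightarrow> complex" where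
  "whole \<equiv> (\<lambda>_. 1)"

definition dirder :: "'m::finite cmat set \<Rightarrow> 'm cmat \<Rightarrow> ('m cmat \<Rightarrow> complex) \<Rightarrow> 'm cmat \<Rightarrow> complex" where
  "dirder U v g = restr U (\<lambda>A. deriv (\<lambda>t. g (A + mscale t v)) 0)"

text \<open>Linear coordinates: \<open>b 0, \<dots>, b (N - 1)\<close> is a basis of \<open>X\<close> and \<open>x 0, \<dots>, x (N - 1)\<close> are the
  dual coordinate functions, so that \<open>N\<close> is the complex dimension of \<open>X\<close>.\<close>

definition linear_coords ::
  "'m::finite cmat set \<Rightarrow> nat \<Rightarrow> (nat \<Rightarrow> 'm cmat) \<Rightarrow> (nat \<Rightarrow> 'm cmat \<Rightarrow> complex) \<Rightarrow> bool" where
  "linear_coords X N b x \<longleftrightarrow>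
     (\<forall>j<N. b j \<in> X \<and> x j \<in> carrier (coord_ring X whole)) \<and>
     (\<forall>A\<in>X. A = (\<Sum>j<N. mscale (x j A) (b j))) \<and>
     (\<forall>c. \<forall>i<N. x i (\<Sum>j<N. mscale (c j) (b j)) = c i)"


section \<open>D-modules\<close>

text \<open>A D-module on \<open>basic_open X f\<close> is a module over the coordinate ring together with commuting
  operators \<open>der v\<close>, for the constant vector fields \<open>v \<in> X\<close>, that are linear in \<open>v\<close> and satisfy the
  Leibniz rule. These are the generators and relations of the ring of differential operators.\<close>

record ('v, 'a) dmod = "('v \<Rightarrow> complex, 'a) module" +
  der :: "'v \<Rightarrow> 'a \<Rightarrow> 'a"

abbreviation cscale ::
  "'m::finite cmat set \<Rightarrow> ('m cmat \<Rightarrow> complex) \<Rightarrow> ('m cmat, 'a) dmod \<Rightarrow> complex \<Rightarrow> 'a \<Rightarrow> 'a" where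
  "cscale X f M c m \<equiv> restr (basic_open X f) (\<lambda>_. c) \<odot>\<^bsub>M\<^esub> m"

definition dmodule ::
  "'m::finite cmat set \<Rightarrow> ('m cmat \<Rightarrow> complex) \<Rightarrow> ('m cmat, 'a) dmod \<Rightarrow> bool" where
  "dmodule X f M \<longleftrightarrow>
     Module.module (coord_ring X f) M \<and>
     (\<forall>v\<in>X. \<forall>m\<in>carrier M. der M v m \<in> carrier M) \<and>
     (\<forall>v\<in>X. \<forall>m\<in>carrier M. \<forall>m'\<in>carrier M. der M v (m \<oplus>\<^bsub>M\<^esub> m') = der M v m \<oplus>\<^bsub>M\<^esub> der M v m') \<and>
     (\<forall>v\<in>X. \<forall>w\<in>X. \<forall>m\<in>carrier M. der M (v + w) m = der M v m \<oplus>\<^bsub>M\<^esub> der M w m) \<and>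
     (\<forall>c. \<forall>v\<in>X. \<forall>m\<in>carrier M. der M (mscale c v) m = cscale X f M c (der M v m)) \<and>
     (\<forall>v\<in>X. \<forall>g\<in>carrier (coord_ring X f). \<forall>m\<in>carrier M.
        der M v (g \<odot>\<^bsub>M\<^esub> m) = dirder (basic_open X f) v g \<odot>\<^bsub>M\<^esub> m \<oplus>\<^bsub>M\<^esub> g \<odot>\<^bsub>M\<^esub> der M v m) \<and>
     (\<forall>v\<in>X. \<forall>w\<in>X. \<forall>m\<in>carrier M. der M v (der M w m) = der M w (der M v m))"

definition dsubmodule ::
  "'m::finite cmat set \<Rightarrow> ('m cmat \<Rightarrow> complex) \<Rightarrow> ('m cmat, 'a) dmod \<Rightarrow> 'a set \<Rightarrow> bool" where
  "dsubmodule X f M P \<longleftrightarrow>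
     submodule P (coord_ring X f) M \<and> (\<forall>v\<in>X. \<forall>m\<in>P. der M v m \<in> P)"

definition simple_dmodule ::
  "'m::finite cmat set \<Rightarrow> ('m cmat \<Rightarrow> complex) \<Rightarrow> ('m cmat, 'a) dmod \<Rightarrow> bool" where
  "simple_dmodule X f M \<longleftrightarrow>
     dmodule X f M \<and> carrier M \<noteq> {\<zero>\<^bsub>M\<^esub>} \<and>
     (\<forall>P. dsubmodule X f M P \<longrightarrow> P = {\<zero>\<^bsub>M\<^esub>} \<or> P = carrier M)"

text \<open>\<open>F\<^sub>\<alpha> = S\<^sub>f \<cdot> f\<^sup>\<alpha>\<close>, where the element \<open>g f\<^sup>\<alpha>\<close> is represented by \<open>g\<close>. The same record serves as a
  D-module on \<open>X\<close> and on \<open>basic_open X f\<close>. The components \<open>mult\<close> and \<open>one\<close> play no role in a module.\<close>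

definition F_mod ::
  "'m::finite cmat set \<Rightarrow> ('m cmat \<Rightarrow> complex) \<Rightarrow> complex \<Rightarrow> ('m cmat, 'm cmat \<Rightarrow> complex) dmod" where
  "F_mod X f \<alpha> =
     \<lparr>carrier = carrier (coord_ring X f),
      monoid.mult = monoid.mult (coord_ring X f),
      one = one (coord_ring X f),
      zero = zero (coord_ring X f),
      add = add (coord_ring X f),
      module.smult = (\<lambda>h g A. h A * g A),
      der = (\<lambda>v g A. dirder (basic_open X f) v g A
                      + \<alpha> * g A * dirder (basic_open X f) v f A / f A)\<rparr>"


section \<open>Characteristic varieties\<close>

definition fin_gen_submodule ::
  "'m::finite cmat set \<Rightarrow> ('m cmat \<Rightarrow> complex) \<Rightarrow> ('m cmat, 'a) dmod \<Rightarrow> 'a set \<Rightarrow> bool" where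
  "fin_gen_submodule X f M P \<longleftrightarrow>
     submodule P (coord_ring X f) M \<and>
     (\<exists>E. finite E \<and> E \<subseteq> P \<and> (\<forall>Q. submodule Q (coord_ring X f) M \<and> E \<subseteq> Q \<longrightarrow> P \<subseteq> Q))"

definition good_filtration ::
  "'m::finite cmat set \<Rightarrow> ('m cmat, 'a) dmod \<Rightarrow> (nat \<Rightarrow> 'a set) \<Rightarrow> bool" where
  "good_filtration X M Fil \<longleftrightarrow>
     (\<forall>k. fin_gen_submodule X whole M (Fil k)) \<and>
     (\<forall>k. Fil k \<subseteq> Fil (Suc k)) \<and>
     (\<Union>k. Fil k) = carrier M \<and>
     (\<forall>k. \<forall>v\<in>X. \<forall>m\<in>Fil k. der M v m \<in> Fil (Suc k)) \<and>
     (\<exists>k0. \<forall>k\<ge>k0. \<forall>Q. submodule Q (coord_ring X whole) M \<and> Fil k \<subseteq> Q \<and>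
                        (\<forall>v\<in>X. \<forall>m\<in>Fil k. der M v m \<in> Q) \<longrightarrow> Fil (Suc k) \<subseteq> Q)"

text \<open>\<open>symb_op X M P q d\<close>: the operator \<open>P\<close> on \<open>M\<close> is the action of a differential operator of order
  at most \<open>d\<close> whose symbol of order \<open>d\<close> is \<open>q\<close>. The cotangent bundle of \<open>X\<close> is \<open>X \<times> X\<close>, a covector at
  \<open>x\<close> being represented by \<open>\<xi> \<in> X\<close> through \<open>v \<mapsto> mpair v \<xi>\<close>; this requires \<open>mpair\<close> to be nondegenerate
  on \<open>X\<close>, which is the case for all, symmetric, and skew-symmetric matrices.\<close>

inductive symb_op ::
  "'m::finite cmat set \<Rightarrow> ('m cmat, 'a) dmod \<Rightarrow> ('a \<Rightarrow> 'a) \<Rightarrow> ('m cmat \<Rightarrow> 'm cmat \<Rightarrow> complex) \<Rightarrow> nat \<Rightarrow> bool"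
  for X M where
  func: "g \<in> carrier (coord_ring X whole) \<Longrightarrow> symb_op X M (\<lambda>m. g \<odot>\<^bsub>M\<^esub> m) (\<lambda>x \<xi>. g x) 0"
| field: "v \<in> X \<Longrightarrow> symb_op X M (der M v) (\<lambda>x \<xi>. mpair v \<xi>) 1"
| add: "symb_op X M P q d \<Longrightarrow> symb_op X M P' q' d \<Longrightarrow>
          symb_op X M (\<lambda>m. P m \<oplus>\<^bsub>M\<^esub> P' m) (\<lambda>x \<xi>. q x \<xi> + q' x \<xi>) d"
| comp: "symb_op X M P q d \<Longrightarrow> symb_op X M P' q' d' \<Longrightarrow>
          symb_op X M (\<lambda>m. P (P' m)) (\<lambda>x \<xi>. q x \<xi> * q' x \<xi>) (d + d')"
| lower: "symb_op X M P q d \<Longrightarrow> symb_op X M P (\<lambda>x \<xi>. 0) (Suc d)"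

text \<open>The zero set of the annihilator of the associated graded module. The annihilator is a
  homogeneous ideal, so it is enough to use homogeneous symbols; a symbol of degree \<open>d\<close> annihilates
  the graded module iff \<open>P\<close> maps each \<open>Fil k\<close> to \<open>Fil (k + d - 1)\<close>, where \<open>Fil (-1) = 0\<close>.\<close>

definition char_variety ::
  "'m::finite cmat set \<Rightarrow> ('m cmat, 'a) dmod \<Rightarrow> (nat \<Rightarrow> 'a set) \<Rightarrow> ('m cmat \<times> 'm cmat) set" where
  "char_variety X M Fil =
     {(x, \<xi>). x \<in> X \<and> \<xi> \<in> X \<and>
        (\<forall>P q d. symb_op X M P q d \<and>
           (\<forall>k. \<forall>m\<in>Fil k. P m \<in> (if k + d = 0 then {\<zero>\<^bsub>M\<^esub>} else Fil (k + d - 1))) \<longrightarrow> q x \<xi> = 0)}"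

definition orbit :: "'g set \<Rightarrow> ('g \<Rightarrow> 'x \<Rightarrow> 'x) \<Rightarrow> 'x \<Rightarrow> 'x set" where
  "orbit G act x = (\<lambda>g. act g x) ` G"

definition tangent_space :: "'m::finite cmat set \<Rightarrow> 'm cmat \<Rightarrow> 'm cmat set" where
  "tangent_space Y x =
     {v. \<exists>\<gamma> :: real \<Rightarrow> 'm cmat. \<gamma> 0 = x \<and> (\<forall>t. \<gamma> t \<in> Y) \<and> (\<gamma> has_vector_derivative v) (at 0)}"

definition conormal_variety :: "'m::finite cmat set \<Rightarrow> 'm cmat set \<Rightarrow> ('m cmat \<times> 'm cmat) set" where
  "conormal_variety X Y =
     closure {(x, \<xi>). x \<in> Y \<and> \<xi> \<in> X \<and> (\<forall>v\<in>tangent_space Y x. mpair v \<xi> = 0)}"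

definition conormal_union ::
  "'m::finite cmat set \<Rightarrow> 'g set \<Rightarrow> ('g \<Rightarrow> 'm cmat \<Rightarrow> 'm cmat) \<Rightarrow> ('m cmat \<times> 'm cmat) set" where
  "conormal_union X G act = (\<Union>x\<in>X. conormal_variety X (orbit G act x))"


section \<open>Holonomic modules\<close>

text \<open>\<open>bernstein X N b x M E k\<close> consists of the elements obtained from the complex span of \<open>E\<close> by
  the operators of degree at most \<open>k\<close> in the Bernstein filtration of the Weyl algebra.\<close>

inductive_set bernstein ::
  "'m::finite cmat set \<Rightarrow> nat \<Rightarrow> (nat \<Rightarrow> 'm cmat) \<Rightarrow> (nat \<Rightarrow> 'm cmat \<Rightarrow> complex) \<Rightarrow>
     ('m cmat, 'a) dmod \<Rightarrow> 'a set \<Rightarrow> (nat \<times> 'a) set"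
  for X N b x M E where
  zero: "(0, \<zero>\<^bsub>M\<^esub>) \<in> bernstein X N b x M E"
| gen: "e \<in> E \<Longrightarrow> (0, e) \<in> bernstein X N b x M E"
| add: "(k, m) \<in> bernstein X N b x M E \<Longrightarrow> (k, m') \<in> bernstein X N b x M E \<Longrightarrow>
          (k, m \<oplus>\<^bsub>M\<^esub> m') \<in> bernstein X N b x M E"
| scale: "(k, m) \<in> bernstein X N b x M E \<Longrightarrow> (k, cscale X whole M c m) \<in> bernstein X N b x M E"
| mono: "(k, m) \<in> bernstein X N b x M E \<Longrightarrow> (Suc k, m) \<in> bernstein X N b x M E"
| coord: "(k, m) \<in> bernstein X N b x M E \<Longrightarrow> j < N \<Longrightarrow> (Suc k, x j \<odot>\<^bsub>M\<^esub> m) \<in> bernstein X N b x M E"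
| der: "(k, m) \<in> bernstein X N b x M E \<Longrightarrow> j < N \<Longrightarrow> (Suc k, der M (b j) m) \<in> bernstein X N b x M E"

definition csubspace :: "'m::finite cmat set \<Rightarrow> ('m cmat, 'a) dmod \<Rightarrow> 'a set \<Rightarrow> bool" where
  "csubspace X M V \<longleftrightarrow>
     V \<subseteq> carrier M \<and> \<zero>\<^bsub>M\<^esub> \<in> V \<and> (\<forall>m\<in>V. \<forall>m'\<in>V. m \<oplus>\<^bsub>M\<^esub> m' \<in> V) \<and>
     (\<forall>c. \<forall>m\<in>V. cscale X whole M c m \<in> V)"

text \<open>A finitely generated module over the Weyl algebra is holonomic iff it is zero or its dimension,
  the degree of growth of a good filtration over the Bernstein filtration, equals \<open>dim X\<close>. By
  Bernstein's inequality the dimension of a nonzero module is at least \<open>dim X\<close>, so the condition is an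
  upper bound.\<close>

definition holonomic :: "'m::finite cmat set \<Rightarrow> ('m cmat, 'a) dmod \<Rightarrow> bool" where
  "holonomic X M \<longleftrightarrow>
     (\<exists>N b x E. linear_coords X N b x \<and> finite E \<and> E \<subseteq> carrier M \<and>
        (\<forall>P. dsubmodule X whole M P \<and> E \<subseteq> P \<longrightarrow> P = carrier M) \<and>
        (\<exists>C. \<forall>k. \<exists>B. finite B \<and> B \<subseteq> carrier M \<and> card B \<le> C * (k + 1) ^ N \<and>
           (\<forall>V. csubspace X M V \<and> B \<subseteq> V \<longrightarrow> {m. (k, m) \<in> bernstein X N b x M E} \<subseteq> V)))"


section \<open>Regularity\<close>

text \<open>Regularity is tested on curves: a holonomic complex is regular iff all cohomology modules of its
  derived pullbacks to the punctured formal germs of curves are regular differential modules over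
  \<open>K = \<complex>((t))\<close>. (Every place of the function field of a curve in \<open>X\<close> gives such a germ, including
  the places at infinity.) In linear coordinates a germ is an arbitrary \<open>N\<close>-tuple \<open>\<phi>\<close> of Laurent series.

  No tensor product is needed if one passes to \<open>K\<close>-duals, which preserves regularity. The derived
  pullback is computed by the Koszul complex of the operators \<open>x j \<otimes> 1 - 1 \<otimes> \<phi> j\<close> on the complex
  tensor product of \<open>M\<close> and \<open>K\<close>. Its \<open>K\<close>-dual is the Koszul cochain complex below, on the space of
  complex linear maps \<open>M \<rightarrow> K\<close>; its cohomology in degree \<open>i\<close> is the \<open>K\<close>-dual of the \<open>i\<close>-th derived
  pullback. The pulled back connection acts by \<open>d/dt + (\<Sum>j. \<phi> j' \<partial>\<^sub>j)\<close>, and \<open>pull_conn\<close> is its dual.\<close>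

definition clinear_fls ::
  "'m::finite cmat set \<Rightarrow> ('m cmat, 'a) dmod \<Rightarrow> ('a \<Rightarrow> complex fls) \<Rightarrow> bool" where
  "clinear_fls X M u \<longleftrightarrow>
     (\<forall>m\<in>carrier M. \<forall>m'\<in>carrier M. u (m \<oplus>\<^bsub>M\<^esub> m') = u m + u m') \<and>
     (\<forall>c. \<forall>m\<in>carrier M. u (cscale X whole M c m) = fls_const c * u m)"

text \<open>A cochain of degree \<open>i\<close> assigns a complex linear map to each \<open>i\<close>-element subset of \<open>{..<N}\<close>.\<close>

definition cochain ::
  "'m::finite cmat set \<Rightarrow> nat \<Rightarrow> ('m cmat, 'a) dmod \<Rightarrow> nat \<Rightarrow> (nat set \<Rightarrow> 'a \<Rightarrow> complex fls) \<Rightarrow> bool" where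
  "cochain X N M i z \<longleftrightarrow> (\<forall>J. J \<subseteq> {..<N} \<and> card J = i \<longrightarrow> clinear_fls X M (z J))"

definition koszul_diff ::
  "(nat \<Rightarrow> 'm::finite cmat \<Rightarrow> complex) \<Rightarrow> (nat \<Rightarrow> complex fls) \<Rightarrow> ('m cmat, 'a) dmod \<Rightarrow>
     (nat set \<Rightarrow> 'a \<Rightarrow> complex fls) \<Rightarrow> nat set \<Rightarrow> 'a \<Rightarrow> complex fls" where
  "koszul_diff x \<phi> M z J m =
     (\<Sum>j\<in>J. (-1) ^ card {k \<in> J. k < j} * (z (J - {j}) (x j \<odot>\<^bsub>M\<^esub> m) - \<phi> j * z (J - {j}) m))"

definition cocycle ::
  "'m::finite cmat set \<Rightarrow> nat \<Rightarrow> (nat \<Rightarrow> 'm cmat \<Rightarrow> complex) \<Rightarrow> (nat \<Rightarrow> complex fls) \<Rightarrow>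
     ('m cmat, 'a) dmod \<Rightarrow> nat \<Rightarrow> (nat set \<Rightarrow> 'a \<Rightarrow> complex fls) \<Rightarrow> bool" where
  "cocycle X N x \<phi> M i z \<longleftrightarrow>
     cochain X N M i z \<and>
     (\<forall>J. J \<subseteq> {..<N} \<and> card J = Suc i \<longrightarrow> (\<forall>m\<in>carrier M. koszul_diff x \<phi> M z J m = 0))"

text \<open>In degree \<open>0\<close> this says that \<open>z {}\<close> vanishes on \<open>M\<close>.\<close>

definition coboundary ::
  "'m::finite cmat set \<Rightarrow> nat \<Rightarrow> (nat \<Rightarrow> 'm cmat \<Rightarrow> complex) \<Rightarrow> (nat \<Rightarrow> complex fls) \<Rightarrow>
     ('m cmat, 'a) dmod \<Rightarrow> nat \<Rightarrow> (nat set \<Rightarrow> 'a \<Rightarrow> complex fls) \<Rightarrow> bool" where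
  "coboundary X N x \<phi> M i z \<longleftrightarrow>
     (\<exists>c. (\<forall>k. Suc k = i \<longrightarrow> cochain X N M k c) \<and>
       (\<forall>J. J \<subseteq> {..<N} \<and> card J = i \<longrightarrow> (\<forall>m\<in>carrier M. z J m = koszul_diff x \<phi> M c J m)))"

definition pull_conn ::
  "nat \<Rightarrow> (nat \<Rightarrow> 'm::finite cmat) \<Rightarrow> (nat \<Rightarrow> complex fls) \<Rightarrow> ('m cmat, 'a) dmod \<Rightarrow>
     ('a \<Rightarrow> complex fls) \<Rightarrow> 'a \<Rightarrow> complex fls" where
  "pull_conn N b \<phi> M u m = fls_deriv (u m) - (\<Sum>j<N. fls_deriv (\<phi> j) * u (der M (b j) m))"

text \<open>A differential module over \<open>K\<close> is regular iff each of its elements lies in a finitely generated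
  submodule over \<open>\<complex>[[t]]\<close> that is stable under \<open>t \<nabla>\<close>.\<close>

definition regular :: "'m::finite cmat set \<Rightarrow> ('m cmat, 'a) dmod \<Rightarrow> bool" where
  "regular X M \<longleftrightarrow>
     (\<exists>N b x. linear_coords X N b x \<and>
        (\<forall>\<phi> i z. cocycle X N x \<phi> M i z \<longrightarrow>
           (\<exists>r Z. \<exists>a :: nat \<Rightarrow> nat \<Rightarrow> complex fps.
              0 < r \<and> Z 0 = z \<and>
              (\<forall>k<r. cocycle X N x \<phi> M i (Z k)) \<and>
              (\<forall>k<r. coboundary X N x \<phi> M i
                 (\<lambda>J m. fls_X * pull_conn N b \<phi> M (Z k J) m
                         - (\<Sum>l<r. fps_to_fls (a k l) * Z l J m))))))"

text \<open>The objects of the category of regular holonomic D-modules on \<open>X\<close> with characteristic variety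
  contained in \<open>\<Lambda>\<close>. The characteristic variety does not depend on the good filtration.\<close>

definition mod_rh ::
  "'m::finite cmat set \<Rightarrow> ('m cmat \<times> 'm cmat) set \<Rightarrow> ('m cmat, 'a) dmod \<Rightarrow> bool" where
  "mod_rh X \<Lambda> M \<longleftrightarrow>
     dmodule X whole M \<and> holonomic X M \<and> regular X M \<and>
     (\<exists>Fil. good_filtration X M Fil \<and> char_variety X M Fil \<subseteq> \<Lambda>)"


section \<open>Local systems\<close>

text \<open>A local system of rank \<open>CARD('r)\<close> as a representation of the fundamental groupoid, with a frame
  chosen in each fibre: \<open>L p\<close> is the transport along \<open>p\<close>, from the fibre at \<open>pathstart p\<close> to the
  fibre at \<open>pathfinish p\<close>.\<close>

definition local_system ::
  "'x::topological_space set \<Rightarrow> ((real \<Rightarrow> 'x) \<Rightarrow> complex ^ 'r ^ 'r::finite) \<Rightarrow> bool" where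
  "local_system U L \<longleftrightarrow>
     (\<forall>p. path p \<and> path_image p \<subseteq> U \<longrightarrow> invertible (L p)) \<and>
     (\<forall>p q. homotopic_paths U p q \<longrightarrow> L p = L q) \<and>
     (\<forall>p q. path p \<and> path_image p \<subseteq> U \<and> path q \<and> path_image q \<subseteq> U \<and> pathfinish p = pathstart q
        \<longrightarrow> L (p +++ q) = L q ** L p)"

text \<open>The fundamental group of \<open>O\<close> is identified with \<open>\<int>\<close> by the winding number of \<open>f\<close> around \<open>0\<close>.\<close>

definition has_monodromy ::
  "'x::topological_space set \<Rightarrow> ('x \<Rightarrow> complex) \<Rightarrow> complex \<Rightarrow>
     ((real \<Rightarrow> 'x) \<Rightarrow> complex ^ 'r ^ 'r::finite) \<Rightarrow> bool" where
  "has_monodromy U f \<alpha> L \<longleftrightarrow>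
     (\<forall>p. path p \<and> path_image p \<subseteq> U \<and> pathfinish p = pathstart p \<longrightarrow>
        L p = mat (exp (2 * of_real pi * \<i> * \<alpha> * winding_number (f \<circ> p) 0)))"

text \<open>A \<open>G\<close>-equivariant structure: an isomorphism \<open>\<theta>\<close> between the pullbacks of \<open>L\<close> to \<open>G \<times> U\<close> along the
  projection and along the action, subject to the cocycle condition.\<close>

definition equivariant ::
  "'g::topological_space set \<Rightarrow> ('g \<Rightarrow> 'g \<Rightarrow> 'g) \<Rightarrow> ('g \<Rightarrow> 'x \<Rightarrow> 'x) \<Rightarrow> 'x::topological_space set \<Rightarrow>
     ((real \<Rightarrow> 'x) \<Rightarrow> complex ^ 'r ^ 'r::finite) \<Rightarrow> bool" where
  "equivariant G gmul act U L \<longleftrightarrow>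
     (\<exists>\<theta> :: 'g \<Rightarrow> 'x \<Rightarrow> complex ^ 'r ^ 'r.
        (\<forall>g\<in>G. \<forall>x\<in>U. invertible (\<theta> g x)) \<and>
        (\<forall>p q. path p \<and> path_image p \<subseteq> G \<and> path q \<and> path_image q \<subseteq> U \<longrightarrow>
           L (\<lambda>t. act (p t) (q t)) ** \<theta> (pathstart p) (pathstart q)
             = \<theta> (pathfinish p) (pathfinish q) ** L q) \<and>
        (\<forall>g\<in>G. \<forall>h\<in>G. \<forall>x\<in>U. \<theta> (gmul g h) x = \<theta> g (act h x) ** \<theta> h x))"


section \<open>Connections and minimal extensions\<close>

definition integrable_connection ::
  "'m::finite cmat set \<Rightarrow> ('m cmat \<Rightarrow> complex) \<Rightarrow> ('m cmat, 'a) dmod \<Rightarrow> bool" where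
  "integrable_connection X f N \<longleftrightarrow> dmodule X f N \<and> fin_gen_submodule X f N (carrier N)"

text \<open>\<open>u\<close> is a D-linear map from \<open>N\<close> to the holomorphic functions on the open set \<open>V\<close>.\<close>

definition solution ::
  "'m::finite cmat set \<Rightarrow> ('m cmat \<Rightarrow> complex) \<Rightarrow> ('m cmat, 'a) dmod \<Rightarrow> 'm cmat set \<Rightarrow>
     ('a \<Rightarrow> 'm cmat \<Rightarrow> complex) \<Rightarrow> bool" where
  "solution X f N V u \<longleftrightarrow>
     (\<forall>y\<in>V. \<forall>m\<in>carrier N.
        (\<forall>m'\<in>carrier N. u (m \<oplus>\<^bsub>N\<^esub> m') y = u m y + u m' y) \<and>
        (\<forall>g\<in>carrier (coord_ring X f). u (g \<odot>\<^bsub>N\<^esub> m) y = g y * u m y) \<and>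
        (\<exists>D. (u m has_derivative D) (at y within X) \<and> (\<forall>h\<in>X. D h = u (der N h m) y)))"

definition fibre_dual ::
  "'m::finite cmat set \<Rightarrow> ('m cmat \<Rightarrow> complex) \<Rightarrow> ('m cmat, 'a) dmod \<Rightarrow> 'm cmat \<Rightarrow> ('a \<Rightarrow> complex) set" where
  "fibre_dual X f N y =
     {l. (\<forall>m\<in>carrier N. \<forall>m'\<in>carrier N. l (m \<oplus>\<^bsub>N\<^esub> m') = l m + l m') \<and>
         (\<forall>g\<in>carrier (coord_ring X f). \<forall>m\<in>carrier N. l (g \<odot>\<^bsub>N\<^esub> m) = g y * l m)}"

text \<open>The local system of the connection \<open>N\<close> is the local system of its holomorphic solutions (so that
  the one of \<open>F\<^sub>\<alpha>\<close> consists of the branches of \<open>f\<^sup>\<alpha>\<close> and has monodromy \<open>exp (2 \<pi> \<i> \<alpha>)\<close>). Evaluation at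
  \<open>y\<close> identifies the stalk of the solutions at \<open>y\<close> with the dual of the fibre of \<open>N\<close> at \<open>y\<close>. The
  isomorphism \<open>\<psi>\<close> from \<open>L\<close> must carry the local flat sections of \<open>L\<close> to solutions.\<close>

definition has_local_system ::
  "'m::finite cmat set \<Rightarrow> ('m cmat \<Rightarrow> complex) \<Rightarrow> ('m cmat, 'a) dmod \<Rightarrow>
     ((real \<Rightarrow> 'm cmat) \<Rightarrow> complex ^ 'r ^ 'r::finite) \<Rightarrow> bool" where
  "has_local_system X f N L \<longleftrightarrow>
     (\<exists>\<psi> :: 'm cmat \<Rightarrow> complex ^ 'r \<Rightarrow> 'a \<Rightarrow> complex.
        (\<forall>y\<in>basic_open X f.
           (\<forall>w w'. \<forall>m\<in>carrier N. \<psi> y (w + w') m = \<psi> y w m + \<psi> y w' m) \<and>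
           (\<forall>c w. \<forall>m\<in>carrier N. \<psi> y (c *s w) m = c * \<psi> y w m) \<and>
           (\<forall>w. \<psi> y w \<in> fibre_dual X f N y) \<and>
           (\<forall>l\<in>fibre_dual X f N y. \<exists>!w. \<forall>m\<in>carrier N. \<psi> y w m = l m)) \<and>
        (\<forall>y\<in>basic_open X f. \<forall>w. \<exists>V u.
           openin (top_of_set X) V \<and> y \<in> V \<and> V \<subseteq> basic_open X f \<and> solution X f N V u \<and>
           (\<forall>p. path p \<and> path_image p \<subseteq> V \<and> pathstart p = y \<longrightarrow>
              (\<forall>m\<in>carrier N. \<psi> (pathfinish p) (L p *v w) m = u m (pathfinish p)))))"

text \<open>\<open>N\<close> is the restriction to \<open>basic_open X f\<close>, that is the localization at \<open>f\<close>, of the D-module \<open>M\<close>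
  on \<open>X\<close>.\<close>

definition is_restriction ::
  "'m::finite cmat set \<Rightarrow> ('m cmat \<Rightarrow> complex) \<Rightarrow> ('m cmat, 'a) dmod \<Rightarrow> ('m cmat, 'b) dmod \<Rightarrow> bool" where
  "is_restriction X f M N \<longleftrightarrow>
     dmodule X whole M \<and> dmodule X f N \<and>
     (\<exists>\<iota>. \<iota> \<in> carrier M \<rightarrow> carrier N \<and>
        (\<forall>m\<in>carrier M. \<forall>m'\<in>carrier M. \<iota> (m \<oplus>\<^bsub>M\<^esub> m') = \<iota> m \<oplus>\<^bsub>N\<^esub> \<iota> m') \<and>
        (\<forall>g\<in>carrier (coord_ring X whole). \<forall>m\<in>carrier M.
           \<iota> (g \<odot>\<^bsub>M\<^esub> m) = restr (basic_open X f) g \<odot>\<^bsub>N\<^esub> \<iota> m) \<and>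
        (\<forall>v\<in>X. \<forall>m\<in>carrier M. \<iota> (der M v m) = der N v (\<iota> m)) \<and>
        (\<forall>m\<in>carrier M. \<iota> m = \<zero>\<^bsub>N\<^esub> \<longrightarrow> (\<exists>k. restr X (\<lambda>A. f A ^ k) \<odot>\<^bsub>M\<^esub> m = \<zero>\<^bsub>M\<^esub>)) \<and>
        (\<forall>n\<in>carrier N. \<exists>k. \<exists>m\<in>carrier M. restr (basic_open X f) (\<lambda>A. f A ^ k) \<odot>\<^bsub>N\<^esub> n = \<iota> m))"

text \<open>\<open>M\<close> is the minimal extension of \<open>N\<close>: it restricts to \<open>N\<close> and has no nonzero submodule or quotient
  supported on the zero set of \<open>f\<close>, that is with all elements killed by powers of \<open>f\<close>.\<close>

definition minimal_extension ::
  "'m::finite cmat set \<Rightarrow> ('m cmat \<Rightarrow> complex) \<Rightarrow> ('m cmat, 'b) dmod \<Rightarrow> ('m cmat, 'a) dmod \<Rightarrow> bool" where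
  "minimal_extension X f N M \<longleftrightarrow>
     is_restriction X f M N \<and>
     (\<forall>P. dsubmodule X whole M P \<and>
          (\<forall>m\<in>P. \<exists>k. restr X (\<lambda>A. f A ^ k) \<odot>\<^bsub>M\<^esub> m = \<zero>\<^bsub>M\<^esub>) \<longrightarrow> P = {\<zero>\<^bsub>M\<^esub>}) \<and>
     (\<forall>P. dsubmodule X whole M P \<and>
          (\<forall>m\<in>carrier M. \<exists>k. restr X (\<lambda>A. f A ^ k) \<odot>\<^bsub>M\<^esub> m \<in> P) \<longrightarrow> P = carrier M)"

text \<open>\<open>M\<close> is the simple object of \<open>mod_rh X \<Lambda>\<close> corresponding to the local system \<open>L\<close> on
  \<open>basic_open X f\<close>. Since \<open>M\<close> is regular, so is its restriction \<open>N\<close>, which therefore is the integrable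
  connection that the Riemann--Hilbert correspondence associates with \<open>L\<close>.\<close>

definition simple_object_of ::
  "'m::finite cmat set \<Rightarrow> ('m cmat \<Rightarrow> complex) \<Rightarrow> ('m cmat \<times> 'm cmat) set \<Rightarrow>
     ((real \<Rightarrow> 'm cmat) \<Rightarrow> complex ^ 'r ^ 'r::finite) \<Rightarrow> ('m cmat, 'a) dmod \<Rightarrow> bool" where
  "simple_object_of X f \<Lambda> L M \<longleftrightarrow>
     mod_rh X \<Lambda> M \<and> simple_dmodule X whole M \<and>
     (\<exists>N :: ('m cmat, 'a) dmod.
        integrable_connection X f N \<and> has_local_system X f N L \<and> minimal_extension X f N M)"


section \<open>The three spaces of matrices\<close>

definition sym_mats :: "'m::finite cmat set" where
  "sym_mats = {A. transpose A = A}"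

definition skew_mats :: "'m::finite cmat set" where
  "skew_mats = {A. transpose A = - A}"

definition GL :: "'m::finite cmat set" where
  "GL = {g. invertible g}"

definition pair_mul :: "'m::finite cmat \<times> 'm cmat \<Rightarrow> 'm cmat \<times> 'm cmat \<Rightarrow> 'm cmat \<times> 'm cmat" where
  "pair_mul g h = (fst g ** fst h, snd g ** snd h)"

definition act2 :: "'m::finite cmat \<times> 'm cmat \<Rightarrow> 'm cmat \<Rightarrow> 'm cmat" where
  "act2 g A = fst g ** A ** transpose (snd g)"

definition act1 :: "'m::finite cmat \<Rightarrow> 'm cmat \<Rightarrow> 'm cmat" where
  "act1 g A = g ** A ** transpose g"

text \<open>The index type \<open>'n + 'n\<close> of size \<open>2 n\<close> is thought of as enumerated in the order
  \<open>Inl 1, Inr 1, Inl 2, Inr 2, \<dots>\<close>; the formula does not depend on how \<open>'n\<close> is enumerated.\<close>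

definition pfaffian :: "('n::finite + 'n) cmat \<Rightarrow> complex" where
  "pfaffian A =
     (\<Sum>p | p permutes UNIV. of_int (sign p) * (\<Prod>i\<in>UNIV. A $ p (Inl i) $ p (Inr i)))
       / (2 ^ CARD('n) * fact CARD('n))"

end

theory Submission
  imports Defs "HOL-Library.Function_Algebras"
begin

text \<open>Under the group the polynomial \<open>f\<close> is multiplied by the \<open>c\<close>-th power of a character \<open>\<kappa>\<close>:
  \<open>\<kappa>\<close> is \<open>det g * det h\<close> with \<open>c = 1\<close> for general matrices, \<open>det g\<close> with \<open>c = 2\<close> for symmetric matrices
  and \<open>det g\<close> with \<open>c = 1\<close> for the Pfaffian. If \<open>c * \<alpha>\<close> is an integer \<open>k\<close>, then \<open>\<kappa>\<^sup>k\<close> turns \<open>f\<^sup>\<alpha>\<close> into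
  \<open>f\<^sup>\<alpha> \<circ> g\<close>, and it makes \<open>L\<^sub>\<alpha>\<close> equivariant (\<open>equivariant_if_integral\<close>). So it suffices to treat
  the case \<open>c * \<alpha> \<notin> \<int>\<close>.

  In that case \<open>F\<^sub>\<alpha>\<close> is a simple D-module. A nonzero submodule contains some \<open>f\<^sup>k f\<^sup>\<alpha>\<close>, since
  differentiation lowers the degree of a numerator (\<open>nonzero_submodule_contains_power\<close>). To reach all
  of \<open>F\<^sub>\<alpha>\<close> one has to pass from \<open>f\<^sup>m\<^sup>+\<^sup>1 f\<^sup>\<alpha>\<close> to \<open>f\<^sup>m f\<^sup>\<alpha>\<close>. This is what the Cayley operator \<open>f(\<partial>)\<close> does, up
  to the value of its Bernstein polynomial \<open>\<Prod> (s + 1 + i / c)\<close> or, for the Pfaffian, \<open>\<Prod> (s + 1 + 2 i)\<close>,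
  at \<open>s = \<alpha> + m\<close>, where \<open>i\<close> runs from \<open>0\<close> to \<open>n - 1\<close>. Here
  the operator is split into steps that need nothing but the invariance of \<open>f\<close> under row and column
  operations (\<open>lowering_step\<close>): each step replaces the minor of \<open>f\<close> on an index set \<open>R\<close>, that is
  \<open>f (cut J R A)\<close>, by one of its derivatives, which is the minor on a smaller set, and costs the factor
  \<open>c * (\<alpha> + m) + c + card (- R)\<close>. None of these factors vanishes, as \<open>c * \<alpha>\<close> is not an integer.

  Simplicity gives most of the rest. The generator \<open>f\<^sup>\<alpha>\<close> defines a good filtration and a Bernstein
  filtration whose growth is that of the polynomials in \<open>dim X\<close> variables (\<open>F_mod_holonomic\<close>); and
  \<open>F\<^sub>\<alpha>\<close>, being both simple and equal to its localization, is the minimal extension of its restriction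
  to \<open>O\<close> (\<open>F_mod_minimal_extension\<close>), whose solutions are the branches of \<open>f\<^sup>\<alpha>\<close> (\<open>F_mod_local_system\<close>).
  A linear vector field \<open>w\<close> for which \<open>w f\<close> is a multiple of \<open>f\<close> maps each step of the order filtration to
  itself, so its symbol vanishes on the characteristic variety (\<open>char_variety_field\<close>). For the row and column
  fields this says \<open>y\<^sup>T \<xi> = 0\<close> and \<open>\<xi> y\<^sup>T = 0\<close>, and then \<open>\<xi>\<close> is conormal to the orbit of \<open>y\<close>, because
  a curve of matrices of constant rank through \<open>y\<close> has a tangent vector that pairs the left kernel of
  \<open>y\<close> with its right kernel to zero (\<open>conormal_unionI\<close>).

  For regularity (\<open>F_mod_regular\<close>), consider a germ of a curve with coordinates \<open>\<phi>\<^sub>j\<close>.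
  The differences \<open>x\<^sub>j - \<phi>\<^sub>j\<close> form a regular sequence on \<open>\<complex>((t)) \<otimes> S\<^sub>f\<close>. So the Koszul complex of functionals
  has cohomology in degree zero only, where the connection has rank at most one, and in it \<open>t d/dt\<close> acts
  through elements \<open>t s' / s\<close> with Laurent series \<open>s\<close>, which have no pole.\<close>

(* The symbol $ denotes the components of vectors and matrices. *)
no_notation fps_nth (infixl \<open>$\<close> 75)

section \<open>Polynomial and regular functions\<close>

lemma mscale_nth [simp]: "mscale c A $ i $ j = c * A $ i $ j"
  by (simp add: mscale_def)

lemma mscale_simps [simp]: "mscale 0 A = 0" "mscale 1 A = A" "mscale c 0 = 0"
  "mscale a (mscale b A) = mscale (a * b) A"
  by (simp_all add: vec_eq_iff)

lemma mscale_add: "mscale c (A + B) = mscale c A + mscale c B"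
  "mscale (a + b) A = mscale a A + mscale b A"
  by (simp_all add: vec_eq_iff algebra_simps)

lemma poly_funs_sum: "(\<And>i. i \<in> I \<Longrightarrow> p i \<in> poly_funs) \<Longrightarrow> (\<lambda>A. \<Sum>i\<in>I. p i A) \<in> poly_funs"
  by (induction I rule: infinite_finite_induct) (auto intro: poly_funs.intros)

lemma poly_funs_prod: "(\<And>i. i \<in> I \<Longrightarrow> p i \<in> poly_funs) \<Longrightarrow> (\<lambda>A. \<Prod>i\<in>I. p i A) \<in> poly_funs"
  by (induction I rule: infinite_finite_induct) (auto intro: poly_funs.intros)

lemma poly_funs_power: "p \<in> poly_funs \<Longrightarrow> (\<lambda>A. p A ^ k) \<in> poly_funs"
  by (induction k) (auto intro: poly_funs.intros)

lemma poly_funs_cmult: "p \<in> poly_funs \<Longrightarrow> (\<lambda>A. c * p A) \<in> poly_funs"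
  by (auto intro: poly_funs.intros)

lemma poly_funs_uminus: "p \<in> poly_funs \<Longrightarrow> (\<lambda>A. - p A) \<in> poly_funs"
  using poly_funs_cmult[of p "-1"] by simp

lemma poly_funs_diff: "p \<in> poly_funs \<Longrightarrow> q \<in> poly_funs \<Longrightarrow> (\<lambda>A. p A - q A) \<in> poly_funs"
  using poly_funs.add[OF _ poly_funs_uminus, of p q] by simp

lemmas poly_funs_intros = poly_funs.intros poly_funs_sum poly_funs_prod poly_funs_power
  poly_funs_uminus poly_funs_diff

lemma poly_funs_compose:
  assumes "p \<in> poly_funs" "\<And>i j. (\<lambda>A. h A $ i $ j) \<in> poly_funs"
  shows "(\<lambda>A. p (h A)) \<in> poly_funs"
  using assms(1) by induction (auto intro: poly_funs.intros assms(2))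

lemma poly_funs_continuous: "p \<in> poly_funs \<Longrightarrow> continuous_on S p"
  by (induction rule: poly_funs.induct) (auto intro!: continuous_intros)

definition pdd :: "'m::finite cmat \<Rightarrow> ('m cmat \<Rightarrow> complex) \<Rightarrow> 'm cmat \<Rightarrow> complex" where
  "pdd v p A = deriv (\<lambda>t. p (A + mscale t v)) 0"

text \<open>The second order term \<open>t\<^sup>2 C\<close> does not affect the derivative at \<open>0\<close>. It is carried along for the sake
  of congruences \<open>g A g\<^sup>T\<close> with \<open>g\<close> elementary, which are quadratic in the parameter.\<close>

lemma poly_funs_deriv_aux:
  assumes "p \<in> poly_funs"
  shows "\<exists>q\<in>poly_funs. \<forall>A C. ((\<lambda>t. p (A + mscale t v + mscale (t * t) C)) has_field_derivative q A) (at 0)"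
  using assms
proof induction
  case (const c)
  show ?case by (rule bexI[of _ "\<lambda>_. 0"]) (auto intro: poly_funs.intros)
next
  case (entry i j)
  have "((\<lambda>t. (A + mscale t v + mscale (t * t) C) $ i $ j) has_field_derivative v $ i $ j) (at 0)" for A C
    by (auto intro!: derivative_eq_intros)
  then show ?case by (intro bexI[of _ "\<lambda>_. v $ i $ j"]) (auto intro: poly_funs.intros)
next
  case (add p q)
  then obtain p' q' where "p' \<in> poly_funs" "q' \<in> poly_funs"
    "\<And>A C. ((\<lambda>t. p (A + mscale t v + mscale (t * t) C)) has_field_derivative p' A) (at 0)"
    "\<And>A C. ((\<lambda>t. q (A + mscale t v + mscale (t * t) C)) has_field_derivative q' A) (at 0)" by blast
  then show ?case
    by (intro bexI[of _ "\<lambda>A. p' A + q' A"]) (auto intro!: poly_funs.intros derivative_intros)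
next
  case (mult p q)
  then obtain p' q' where *: "p' \<in> poly_funs" "q' \<in> poly_funs"
    "\<And>A C. ((\<lambda>t. p (A + mscale t v + mscale (t * t) C)) has_field_derivative p' A) (at 0)"
    "\<And>A C. ((\<lambda>t. q (A + mscale t v + mscale (t * t) C)) has_field_derivative q' A) (at 0)" by blast
  have "((\<lambda>t. p (A + mscale t v + mscale (t * t) C) * q (A + mscale t v + mscale (t * t) C))
      has_field_derivative (p' A * q A + q' A * p A)) (at 0)" for A C
    using DERIV_mult[OF *(3,4)[of A C]] by simp
  then show ?case using *(1,2) mult(1,2)
    by (intro bexI[of _ "\<lambda>A. p' A * q A + q' A * p A"]) (auto intro!: poly_funs.intros)
qed

lemma has_pdd_curve:
  assumes "p \<in> poly_funs"
  shows "((\<lambda>t. p (A + mscale t v + mscale (t * t) C)) has_field_derivative pdd v p A) (at 0)"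
proof -
  obtain q where q: "\<forall>A C. ((\<lambda>t. p (A + mscale t v + mscale (t * t) C)) has_field_derivative q A) (at 0)"
    using poly_funs_deriv_aux[OF assms] by blast
  from q[rule_format, of A 0] have "pdd v p A = q A" unfolding pdd_def by (intro DERIV_imp_deriv) simp
  with q show ?thesis by simp
qed

lemma has_pdd: "p \<in> poly_funs \<Longrightarrow> ((\<lambda>t. p (A + mscale t v)) has_field_derivative pdd v p A) (at 0)"
  using has_pdd_curve[of p A v 0] by simp

lemma pdd_eqI: "((\<lambda>t. p (A + mscale t v)) has_field_derivative D) (at 0) \<Longrightarrow> pdd v p A = D"
  unfolding pdd_def by (rule DERIV_imp_deriv)

lemma pdd_poly [intro]: assumes "p \<in> poly_funs" shows "pdd v p \<in> poly_funs"
proof -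
  obtain q where q: "q \<in> poly_funs"
    "\<forall>A C. ((\<lambda>t. p (A + mscale t v + mscale (t * t) C)) has_field_derivative q A) (at 0)"
    using poly_funs_deriv_aux[OF assms] by blast
  have "pdd v p = q" using q(2)[rule_format, of _ 0] by (intro ext pdd_eqI) simp
  then show ?thesis using q(1) by simp
qed

lemma pdd_const [simp]: "pdd v (\<lambda>_. c) = (\<lambda>_. 0)"
  by (rule ext, rule pdd_eqI) simp

lemma pdd_entry [simp]: "pdd v (\<lambda>A. A $ i $ j) = (\<lambda>_. v $ i $ j)"
  by (rule ext, rule pdd_eqI) (auto intro!: derivative_eq_intros)

lemma pdd_add:
  "p \<in> poly_funs \<Longrightarrow> q \<in> poly_funs \<Longrightarrow> pdd v (\<lambda>A. p A + q A) = (\<lambda>A. pdd v p A + pdd v q A)"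
  by (rule ext, rule pdd_eqI) (auto intro!: derivative_intros has_pdd)

lemma pdd_mult:
  assumes "p \<in> poly_funs" "q \<in> poly_funs"
  shows "pdd v (\<lambda>A. p A * q A) = (\<lambda>A. pdd v p A * q A + p A * pdd v q A)"
proof (rule ext, rule pdd_eqI)
  fix A
  from DERIV_mult[OF has_pdd[OF assms(1), of A v] has_pdd[OF assms(2), of A v]]
  show "((\<lambda>t. p (A + mscale t v) * q (A + mscale t v)) has_field_derivative
      pdd v p A * q A + p A * pdd v q A) (at 0)" by (simp add: algebra_simps)
qed

lemma pdd_cmult: "p \<in> poly_funs \<Longrightarrow> pdd v (\<lambda>A. c * p A) = (\<lambda>A. c * pdd v p A)"
  by (simp add: pdd_mult poly_funs.const)

lemma pdd_sum:
  "(\<And>i. i \<in> I \<Longrightarrow> p i \<in> poly_funs) \<Longrightarrow> pdd v (\<lambda>A. \<Sum>i\<in>I. p i A) = (\<lambda>A. \<Sum>i\<in>I. pdd v (p i) A)"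
  by (induction I rule: infinite_finite_induct) (auto simp: pdd_add poly_funs_sum)

lemma pdd_dir_linear:
  assumes "p \<in> poly_funs"
  shows "pdd (v + w) p A = pdd v p A + pdd w p A" and "pdd (mscale c v) p A = c * pdd v p A"
  using assms
  by (induction arbitrary: A) (simp_all add: pdd_add pdd_mult algebra_simps)

lemma pdd_dir_zero [simp]: "p \<in> poly_funs \<Longrightarrow> pdd 0 p A = 0"
  using pdd_dir_linear(2)[of p 0 0 A] by simp

lemma pdd_dir_sum: "p \<in> poly_funs \<Longrightarrow> pdd (\<Sum>j\<in>I. mscale (c j) (v j)) p A = (\<Sum>j\<in>I. c j * pdd (v j) p A)"
  by (induction I rule: infinite_finite_induct) (auto simp: pdd_dir_linear)

lemma pdd_commute:
  assumes "p \<in> poly_funs"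
  shows "pdd v (pdd w p) A = pdd w (pdd v p) A"
  using assms
  by (induction arbitrary: A) (simp_all add: pdd_add pdd_mult pdd_poly poly_funs.mult algebra_simps)

lemma pdd_power_aux:
  assumes "p \<in> poly_funs"
  shows "p A * pdd v (\<lambda>A. p A ^ k) A = of_nat k * p A ^ k * pdd v p A"
proof (induction k)
  case (Suc k)
  show ?case using Suc assms by (simp add: pdd_mult poly_funs_power algebra_simps)
qed simp

section \<open>Modules of twisted regular functions\<close>

lemma restr_apply [simp]: "A \<in> U \<Longrightarrow> restr U g A = g A" "A \<notin> U \<Longrightarrow> restr U g A = 0"
  by (simp_all add: restr_def)

lemma coord_ring_simps [simp]:
  "monoid.mult (coord_ring X f) = (\<lambda>g h A. g A * h A)"
  "one (coord_ring X f) = restr (basic_open X f) (\<lambda>_. 1)"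
  "zero (coord_ring X f) = (\<lambda>_. 0)"
  "add (coord_ring X f) = (\<lambda>g h A. g A + h A)"
  by (simp_all add: coord_ring_def)

lemma F_mod_simps [simp]:
  "carrier (F_mod X f \<alpha>) = carrier (coord_ring X f)"
  "zero (F_mod X f \<alpha>) = (\<lambda>_. 0)"
  "add (F_mod X f \<alpha>) = (\<lambda>g h A. g A + h A)"
  "module.smult (F_mod X f \<alpha>) = (\<lambda>h g A. h A * g A)"
  by (simp_all add: F_mod_def)

locale matrix_space =
  fixes X :: "'m::finite cmat set" and f :: "'m cmat \<Rightarrow> complex"
  assumes zero_in: "0 \<in> X"
    and add_in: "A \<in> X \<Longrightarrow> B \<in> X \<Longrightarrow> A + B \<in> X"
    and scale_in: "A \<in> X \<Longrightarrow> mscale c A \<in> X"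
    and f_poly: "f \<in> poly_funs"
    and f_nonzero: "\<exists>A\<in>X. f A \<noteq> 0"
begin

abbreviation "U \<equiv> basic_open X f"
abbreviation "RF \<equiv> carrier (coord_ring X f)"

definition frac :: "('m cmat \<Rightarrow> complex) \<Rightarrow> nat \<Rightarrow> 'm cmat \<Rightarrow> complex" where
  "frac p k = restr U (\<lambda>A. p A / f A ^ k)"

lemma U_iff: "A \<in> U \<longleftrightarrow> A \<in> X \<and> f A \<noteq> 0"
  by (auto simp: basic_open_def)

lemma whole_space: "matrix_space X whole"
  by unfold_locales (auto intro: zero_in add_in scale_in poly_funs.const)

lemma basic_open_whole [simp]: "basic_open X whole = X"
  by (auto simp: basic_open_def)

lemma sum_in: "(\<And>i. i \<in> I \<Longrightarrow> A i \<in> X) \<Longrightarrow> (\<Sum>i\<in>I. mscale (c i) (A i)) \<in> X"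
  by (induction I rule: infinite_finite_induct) (auto intro: zero_in add_in scale_in)

lemma line_in: "A \<in> X \<Longrightarrow> v \<in> X \<Longrightarrow> A + mscale t v \<in> X"
  by (auto intro: add_in scale_in)

lemma frac_eq: "A \<in> U \<Longrightarrow> frac p k A = p A / f A ^ k" and frac_out: "A \<notin> U \<Longrightarrow> frac p k A = 0"
  by (simp_all add: frac_def)

lemma RF_iff: "g \<in> RF \<longleftrightarrow> (\<exists>p\<in>poly_funs. \<exists>k. g = frac p k)"
  by (auto simp: coord_ring_def frac_def)

lemma frac_in [intro]: "p \<in> poly_funs \<Longrightarrow> frac p k \<in> RF"
  by (auto simp: RF_iff)

lemma RF_out: "g \<in> RF \<Longrightarrow> A \<notin> U \<Longrightarrow> g A = 0"
  by (auto simp: RF_iff frac_out)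

lemma RF_add [intro]: assumes "g \<in> RF" "h \<in> RF" shows "(\<lambda>A. g A + h A) \<in> RF"
proof -
  obtain p k q l where *: "p \<in> poly_funs" "q \<in> poly_funs" "g = frac p k" "h = frac q l"
    using assms by (auto simp: RF_iff)
  have "(\<lambda>A. g A + h A) = frac (\<lambda>A. p A * f A ^ l + q A * f A ^ k) (k + l)"
  proof
    fix A show "g A + h A = frac (\<lambda>A. p A * f A ^ l + q A * f A ^ k) (k + l) A"
      by (cases "A \<in> U") (auto simp: * frac_eq frac_out U_iff field_simps power_add)
  qed
  then show ?thesis using * f_poly by (auto intro!: poly_funs_intros)
qed

lemma RF_mult [intro]: assumes "g \<in> RF" "h \<in> RF" shows "(\<lambda>A. g A * h A) \<in> RF"
proof -
  obtain p k q l where *: "p \<in> poly_funs" "q \<in> poly_funs" "g = frac p k" "h = frac q l"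
    using assms by (auto simp: RF_iff)
  have "(\<lambda>A. g A * h A) = frac (\<lambda>A. p A * q A) (k + l)"
  proof
    fix A show "g A * h A = frac (\<lambda>A. p A * q A) (k + l) A"
      by (cases "A \<in> U") (auto simp: * frac_eq frac_out U_iff field_simps power_add)
  qed
  then show ?thesis using * by (auto intro!: poly_funs_intros)
qed

lemma restr_poly_eq: "restr U p = frac p 0"
  by (simp add: frac_def)

lemma RF_poly [intro]: "p \<in> poly_funs \<Longrightarrow> restr U p \<in> RF"
  unfolding restr_poly_eq by blast

lemma RF_zero [intro, simp]: "(\<lambda>_. 0) \<in> RF"
proof -
  have "(\<lambda>_. 0) = frac (\<lambda>_. 0) 0" by (auto simp: frac_def restr_def)
  then show ?thesis by (metis frac_in poly_funs.const)
qed

lemma RF_pmult [intro]: assumes "p \<in> poly_funs" "g \<in> RF" shows "(\<lambda>A. p A * g A) \<in> RF"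
proof -
  have "(\<lambda>A. p A * g A) = (\<lambda>A. restr U p A * g A)"
    by (rule ext) (metis RF_out assms(2) mult_zero_right restr_apply(1))
  then show ?thesis using assms by auto
qed

lemma RF_cmult [intro]: "g \<in> RF \<Longrightarrow> (\<lambda>A. c * g A) \<in> RF"
  using RF_pmult[of "\<lambda>_. c" g] by (auto intro: poly_funs.const)

lemma RF_uminus [intro]: "g \<in> RF \<Longrightarrow> (\<lambda>A. - g A) \<in> RF"
  using RF_cmult[of g "-1"] by simp

lemma RF_sum: "(\<And>i. i \<in> I \<Longrightarrow> g i \<in> RF) \<Longrightarrow> (\<lambda>A. \<Sum>i\<in>I. g i A) \<in> RF"
  by (induction I rule: infinite_finite_induct) auto

lemma RF_div_f [intro]: assumes "g \<in> RF" shows "(\<lambda>A. g A / f A ^ k) \<in> RF"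
proof -
  have "(\<lambda>A. g A / f A ^ k) = (\<lambda>A. g A * frac (\<lambda>_. 1) k A)"
  proof
    fix A show "g A / f A ^ k = g A * frac (\<lambda>_. 1) k A"
      by (cases "A \<in> U") (auto simp: frac_eq RF_out[OF assms])
  qed
  then show ?thesis using assms by (auto intro: poly_funs.const)
qed

text \<open>Along a line in \<open>X\<close> the set \<open>U\<close> is open, so the extension by zero is invisible to
  derivatives at points of \<open>U\<close>.\<close>

lemma eventually_line_U:
  assumes "A \<in> U" "v \<in> X"
  shows "eventually (\<lambda>t. A + mscale t v \<in> U) (nhds 0)"
proof -
  have "isCont (\<lambda>t. f (A + mscale t v)) 0"
    using has_pdd[OF f_poly, of A v] by (rule DERIV_isCont)
  then have "((\<lambda>t. f (A + mscale t v)) \<longlongrightarrow> f A) (nhds 0)"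
    using tendsto_at_iff_tendsto_nhds[of "\<lambda>t. f (A + mscale t v)" 0] by (simp add: isCont_def)
  moreover have "f A \<noteq> 0" using assms by (simp add: U_iff)
  ultimately have "eventually (\<lambda>t. f (A + mscale t v) \<noteq> 0) (nhds 0)"
    by (rule tendsto_imp_eventually_ne)
  then show ?thesis
    by eventually_elim (use assms in \<open>auto simp: U_iff intro: line_in\<close>)
qed

lemma restr_deriv_iff:
  assumes "A \<in> U" "v \<in> X"
  shows "((\<lambda>t. restr U h (A + mscale t v)) has_field_derivative D) (at 0) \<longleftrightarrow>
    ((\<lambda>t. h (A + mscale t v)) has_field_derivative D) (at 0)"
proof (rule DERIV_cong_ev)
  show "eventually (\<lambda>t. restr U h (A + mscale t v) = h (A + mscale t v)) (nhds 0)"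
    using eventually_line_U[OF assms] by eventually_elim simp
qed simp_all

lemma frac_deriv:
  assumes "p \<in> poly_funs" "A \<in> U" "v \<in> X"
  shows "((\<lambda>t. frac p k (A + mscale t v)) has_field_derivative
     (pdd v p A * f A - of_nat k * p A * pdd v f A) / f A ^ Suc k) (at 0)"
  unfolding frac_def restr_deriv_iff[OF assms(2,3)]
proof -
  have nz: "f A \<noteq> 0" using assms by (simp add: U_iff)
  have fk: "((\<lambda>t. f (A + mscale t v) ^ k) has_field_derivative of_nat k * f A ^ (k - 1) * pdd v f A) (at 0)"
    using DERIV_power[OF has_pdd[OF f_poly, of A v], of k] by (simp add: algebra_simps)
  have "((\<lambda>t. p (A + mscale t v) / f (A + mscale t v) ^ k) has_field_derivative
     (pdd v p A * f A ^ k - p A * (of_nat k * f A ^ (k - 1) * pdd v f A)) / (f A ^ k * f A ^ k)) (at 0)"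
    using DERIV_divide[OF has_pdd[OF assms(1), of A v] fk] nz by simp
  moreover have "(pdd v p A * f A ^ k - p A * (of_nat k * f A ^ (k - 1) * pdd v f A)) / (f A ^ k * f A ^ k)
    = (pdd v p A * f A - of_nat k * p A * pdd v f A) / f A ^ Suc k"
    by (cases k) (use nz in \<open>auto simp: field_simps\<close>)
  ultimately show "((\<lambda>t. p (A + mscale t v) / f (A + mscale t v) ^ k) has_field_derivative
     (pdd v p A * f A - of_nat k * p A * pdd v f A) / f A ^ Suc k) (at 0)" by simp
qed

lemma dirder_frac:
  assumes "p \<in> poly_funs" "v \<in> X"
  shows "dirder U v (frac p k) = frac (\<lambda>A. pdd v p A * f A - of_nat k * p A * pdd v f A) (Suc k)"
proof
  fix A show "dirder U v (frac p k) A = frac (\<lambda>A. pdd v p A * f A - of_nat k * p A * pdd v f A) (Suc k) A"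
    using DERIV_imp_deriv[OF frac_deriv[OF assms(1) _ assms(2)], of A k]
    by (cases "A \<in> U") (simp_all add: dirder_def frac_eq frac_out)
qed

lemma dirder_in [intro]: "g \<in> RF \<Longrightarrow> v \<in> X \<Longrightarrow> dirder U v g \<in> RF"
  by (auto simp: RF_iff dirder_frac intro!: bexI poly_funs_intros pdd_poly f_poly)

lemma RF_deriv:
  assumes "g \<in> RF" "A \<in> U" "v \<in> X"
  shows "((\<lambda>t. g (A + mscale t v)) has_field_derivative dirder U v g A) (at 0)"
  using assms frac_deriv by (auto simp: RF_iff dirder_frac frac_eq)

lemma dirder_eqI: "A \<in> U \<Longrightarrow> ((\<lambda>t. g (A + mscale t v)) has_field_derivative D) (at 0) \<Longrightarrow> dirder U v g A = D"
  by (simp add: dirder_def DERIV_imp_deriv)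

lemma dirder_out: "A \<notin> U \<Longrightarrow> dirder U v g A = 0"
  by (simp add: dirder_def)

lemma dirder_poly: "p \<in> poly_funs \<Longrightarrow> dirder U v p = restr U (pdd v p)"
  by (simp add: dirder_def pdd_def[abs_def])

lemma dirder_restr: assumes "p \<in> poly_funs" "v \<in> X" shows "dirder U v (restr U p) = restr U (pdd v p)"
proof
  fix A show "dirder U v (restr U p) A = restr U (pdd v p) A"
    using restr_deriv_iff[of A v p "pdd v p A"] has_pdd[OF assms(1), of A v] assms(2)
    by (cases "A \<in> U") (auto simp: dirder_out intro!: dirder_eqI)
qed

lemma dirder_add:
  assumes "g \<in> RF" "h \<in> RF" "v \<in> X"
  shows "dirder U v (\<lambda>A. g A + h A) = (\<lambda>A. dirder U v g A + dirder U v h A)"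
proof
  fix A show "dirder U v (\<lambda>A. g A + h A) A = dirder U v g A + dirder U v h A"
    by (cases "A \<in> U") (auto simp: dirder_out intro!: dirder_eqI DERIV_add RF_deriv assms)
qed

lemma dirder_mult:
  assumes "g \<in> RF" "h \<in> RF" "v \<in> X"
  shows "dirder U v (\<lambda>A. g A * h A) = (\<lambda>A. dirder U v g A * h A + g A * dirder U v h A)"
proof
  fix A show "dirder U v (\<lambda>A. g A * h A) A = dirder U v g A * h A + g A * dirder U v h A"
  proof (cases "A \<in> U")
    case True
    from DERIV_mult[OF RF_deriv[OF assms(1) True assms(3)] RF_deriv[OF assms(2) True assms(3)]]
    show ?thesis by (intro dirder_eqI[OF True]) (simp add: algebra_simps)
  qed (simp add: dirder_out)
qed

lemma dirder_pmult:
  assumes "p \<in> poly_funs" "h \<in> RF" "v \<in> X"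
  shows "dirder U v (\<lambda>A. p A * h A) = (\<lambda>A. pdd v p A * h A + p A * dirder U v h A)"
proof -
  have "(\<lambda>A. p A * h A) = (\<lambda>A. restr U p A * h A)"
    by (rule ext) (metis RF_out assms(2) mult_zero_right restr_apply(1))
  then have "dirder U v (\<lambda>A. p A * h A) = (\<lambda>A. restr U (pdd v p) A * h A + restr U p A * dirder U v h A)"
    using dirder_mult[of "restr U p" h v] assms by (auto simp: dirder_restr)
  also have "\<dots> = (\<lambda>A. pdd v p A * h A + p A * dirder U v h A)"
    by (rule ext) (metis RF_out assms(2) dirder_out mult_zero_right restr_apply)
  finally show ?thesis .
qed

lemma dirder_dir:
  assumes "g \<in> RF" "v \<in> X" "w \<in> X"
  shows "dirder U (v + w) g = (\<lambda>A. dirder U v g A + dirder U w g A)"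
    and "dirder U (mscale c v) g = (\<lambda>A. c * dirder U v g A)"
proof -
  obtain p k where *: "p \<in> poly_funs" "g = frac p k" using assms by (auto simp: RF_iff)
  show "dirder U (v + w) g = (\<lambda>A. dirder U v g A + dirder U w g A)"
  proof
    fix A show "dirder U (v + w) g A = dirder U v g A + dirder U w g A"
      by (cases "A \<in> U") (use * assms f_poly in \<open>auto simp: dirder_frac dirder_out add_in frac_eq frac_out pdd_dir_linear
          add_divide_distrib[symmetric] algebra_simps\<close>)
  qed
  show "dirder U (mscale c v) g = (\<lambda>A. c * dirder U v g A)"
  proof
    fix A show "dirder U (mscale c v) g A = c * dirder U v g A"
      by (cases "A \<in> U") (use * assms f_poly in \<open>auto simp: dirder_frac dirder_out scale_in frac_eq frac_out pdd_dir_linear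
          algebra_simps\<close>)
  qed
qed

text \<open>The commutator of two derivations is a derivation; it vanishes on polynomials, hence also on their
  quotients.\<close>

lemma dirder_commute:
  assumes "g \<in> RF" "v \<in> X" "w \<in> X"
  shows "dirder U v (dirder U w g) = dirder U w (dirder U v g)"
proof
  fix A
  obtain p k where *: "p \<in> poly_funs" "g = frac p k" using assms by (auto simp: RF_iff)
  show "dirder U v (dirder U w g) A = dirder U w (dirder U v g) A"
  proof (cases "A \<in> U")
    case True
    define h where "h = (\<lambda>A. f A ^ k)"
    have h: "h \<in> poly_funs" unfolding h_def by (intro poly_funs_power f_poly)
    have hg: "(\<lambda>A. h A * g A) = restr U p"
      by (rule ext) (auto simp: * h_def frac_def restr_def U_iff)
    have second: "dirder U v (dirder U w (\<lambda>A. h A * g A)) A = pdd v (pdd w h) A * g A + pdd w h A * dirder U v g A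
      + (pdd v h A * dirder U w g A + h A * dirder U v (dirder U w g) A)" if "v \<in> X" "w \<in> X" for v w
      using assms(1) h that by (simp add: dirder_pmult dirder_add RF_pmult dirder_in pdd_poly)
    have "dirder U v (dirder U w (\<lambda>A. h A * g A)) A - dirder U w (dirder U v (\<lambda>A. h A * g A)) A
      = h A * (dirder U v (dirder U w g) A - dirder U w (dirder U v g) A)"
      unfolding second[OF assms(2,3)] second[OF assms(3,2)] pdd_commute[OF h, of v w]
      by (simp add: algebra_simps)
    moreover have "dirder U v (dirder U w (\<lambda>A. h A * g A)) A = dirder U w (dirder U v (\<lambda>A. h A * g A)) A"
      unfolding hg using assms * True by (simp add: dirder_restr pdd_poly pdd_commute[of p v w])
    moreover have "h A \<noteq> 0" using True by (simp add: h_def U_iff)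
    ultimately show ?thesis by simp
  qed (simp add: dirder_out)
qed

lemma coord_ring_abelian_group: "abelian_group (coord_ring X f)"
proof (rule abelian_groupI)
  fix x assume "x \<in> RF"
  then show "\<exists>y\<in>RF. y \<oplus>\<^bsub>coord_ring X f\<^esub> x = \<zero>\<^bsub>coord_ring X f\<^esub>"
    by (intro bexI[of _ "\<lambda>A. - x A"]) auto
qed (auto simp: algebra_simps)

lemma coord_ring_cring: "cring (coord_ring X f)"
proof (rule cringI[OF coord_ring_abelian_group])
  show "Group.comm_monoid (coord_ring X f)"
  proof (rule comm_monoidI)
    fix x assume "x \<in> RF"
    then show "\<one>\<^bsub>coord_ring X f\<^esub> \<otimes>\<^bsub>coord_ring X f\<^esub> x = x"
      by (auto simp: fun_eq_iff restr_def RF_out)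
  qed (auto simp: algebra_simps intro: poly_funs.const)
qed (auto simp: algebra_simps)

lemma F_mod_abelian_group: "abelian_group (F_mod X f \<alpha>)"
proof (rule abelian_groupI)
  fix x assume "x \<in> carrier (F_mod X f \<alpha>)"
  then show "\<exists>y\<in>carrier (F_mod X f \<alpha>). y \<oplus>\<^bsub>F_mod X f \<alpha>\<^esub> x = \<zero>\<^bsub>F_mod X f \<alpha>\<^esub>"
    by (intro bexI[of _ "\<lambda>A. - x A"]) auto
qed (auto simp: algebra_simps)

text \<open>The derivation of \<open>S\<^sub>f f\<^sup>\<alpha>\<close> on the coefficient of the symbol \<open>f\<^sup>\<alpha>\<close>.\<close>

definition nabla :: "complex \<Rightarrow> 'm cmat \<Rightarrow> ('m cmat \<Rightarrow> complex) \<Rightarrow> 'm cmat \<Rightarrow> complex" where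
  "nabla \<alpha> v g = (\<lambda>A. dirder U v g A + \<alpha> * (g A * pdd v f A / f A))"

lemma der_F_mod: assumes "g \<in> RF" shows "der (F_mod X f \<alpha>) v g = nabla \<alpha> v g"
proof
  fix A show "der (F_mod X f \<alpha>) v g A = nabla \<alpha> v g A"
    by (cases "A \<in> U") (auto simp: F_mod_def nabla_def dirder_poly f_poly RF_out[OF assms])
qed

lemma nabla_in [intro]: assumes "g \<in> RF" "v \<in> X" shows "nabla \<alpha> v g \<in> RF"
proof -
  have "(\<lambda>A. (pdd v f A * g A) / f A ^ 1) \<in> RF" by (intro RF_div_f RF_pmult pdd_poly f_poly assms)
  from RF_add[OF dirder_in[OF assms] RF_cmult[OF this, of \<alpha>]] show ?thesis
    by (simp add: nabla_def mult_ac)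
qed

lemma nabla_out: "g \<in> RF \<Longrightarrow> A \<notin> U \<Longrightarrow> nabla \<alpha> v g A = 0"
  by (simp add: nabla_def dirder_out RF_out)

lemma nabla_add: "g \<in> RF \<Longrightarrow> h \<in> RF \<Longrightarrow> v \<in> X \<Longrightarrow>
    nabla \<alpha> v (\<lambda>A. g A + h A) = (\<lambda>A. nabla \<alpha> v g A + nabla \<alpha> v h A)"
  by (simp add: nabla_def dirder_add algebra_simps add_divide_distrib)

lemma nabla_mult: "g \<in> RF \<Longrightarrow> h \<in> RF \<Longrightarrow> v \<in> X \<Longrightarrow>
    nabla \<alpha> v (\<lambda>A. g A * h A) = (\<lambda>A. dirder U v g A * h A + g A * nabla \<alpha> v h A)"
  by (simp add: nabla_def dirder_mult algebra_simps)

lemma nabla_pmult: "p \<in> poly_funs \<Longrightarrow> h \<in> RF \<Longrightarrow> v \<in> X \<Longrightarrow>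
    nabla \<alpha> v (\<lambda>A. p A * h A) = (\<lambda>A. pdd v p A * h A + p A * nabla \<alpha> v h A)"
  unfolding nabla_def by (subst dirder_pmult) (auto simp: fun_eq_iff algebra_simps)

lemma nabla_cmult: "h \<in> RF \<Longrightarrow> v \<in> X \<Longrightarrow> nabla \<alpha> v (\<lambda>A. c * h A) = (\<lambda>A. c * nabla \<alpha> v h A)"
  using nabla_pmult[of "\<lambda>_. c" h v \<alpha>] by (simp add: poly_funs.const)

lemma nabla_dir: "g \<in> RF \<Longrightarrow> v \<in> X \<Longrightarrow> w \<in> X \<Longrightarrow> nabla \<alpha> (v + w) g = (\<lambda>A. nabla \<alpha> v g A + nabla \<alpha> w g A)"
  "g \<in> RF \<Longrightarrow> v \<in> X \<Longrightarrow> nabla \<alpha> (mscale c v) g = (\<lambda>A. c * nabla \<alpha> v g A)"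
  using dirder_dir[of g v w] dirder_dir(2)[of g v v c]
  by (simp_all add: nabla_def pdd_dir_linear[OF f_poly] algebra_simps add_divide_distrib)

lemma nabla_dir_sum:
  assumes "g \<in> RF" "\<And>j. j \<in> I \<Longrightarrow> v j \<in> X"
  shows "nabla \<alpha> (\<Sum>j\<in>I. mscale (c j) (v j)) g = (\<lambda>A. \<Sum>j\<in>I. c j * nabla \<alpha> (v j) g A)"
  using assms(2)
proof (induction I rule: infinite_finite_induct)
  case (insert x F)
  then show ?case using assms(1) by (simp add: nabla_dir sum_in scale_in)
qed (use nabla_dir(2)[OF assms(1) zero_in, of \<alpha> 0] in \<open>simp_all\<close>)

lemma nabla_frac:
  assumes "p \<in> poly_funs" "v \<in> X"
  shows "nabla \<alpha> v (frac p k) = frac (\<lambda>A. pdd v p A * f A + (\<alpha> - of_nat k) * p A * pdd v f A) (Suc k)"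
proof
  fix A show "nabla \<alpha> v (frac p k) A = frac (\<lambda>A. pdd v p A * f A + (\<alpha> - of_nat k) * p A * pdd v f A) (Suc k) A"
    by (cases "A \<in> U") (use assms in \<open>auto simp: nabla_def dirder_frac frac_eq frac_out U_iff dirder_out field_simps\<close>)
qed

lemma nabla_commute:
  assumes "g \<in> RF" "v \<in> X" "w \<in> X"
  shows "nabla \<alpha> v (nabla \<alpha> w g) = nabla \<alpha> w (nabla \<alpha> v g)"
proof
  fix A
  define l where "l = (\<lambda>v. frac (pdd v f) 1)"
  have l: "l v \<in> RF" for v unfolding l_def using f_poly by auto
  have nl: "nabla \<alpha> v h = (\<lambda>A. dirder U v h A + \<alpha> * (l v A * h A))" if "h \<in> RF" for v h
  proof
    fix A show "nabla \<alpha> v h A = dirder U v h A + \<alpha> * (l v A * h A)"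
      by (cases "A \<in> U") (simp_all add: nabla_def l_def frac_eq RF_out[OF that])
  qed
  have comm: "dirder U v (l w) A = dirder U w (l v) A"
    unfolding l_def using assms f_poly
    by (cases "A \<in> U") (auto simp: dirder_frac pdd_poly frac_eq frac_out pdd_commute[of f v w] algebra_simps)
  have lg: "(\<lambda>A. \<alpha> * (l v A * h A)) \<in> RF" if "h \<in> RF" for v h by (intro RF_cmult RF_mult l that)
  have dl: "dirder U v (\<lambda>A. \<alpha> * (l w A * h A)) = (\<lambda>A. \<alpha> * (dirder U v (l w) A * h A + l w A * dirder U v h A))"
    if "h \<in> RF" "v \<in> X" for v w h
    using that l dirder_pmult[of "\<lambda>_. \<alpha>" "\<lambda>A. l w A * h A" v] by (auto simp: dirder_mult poly_funs.const RF_mult)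
  have *: "nabla \<alpha> v (nabla \<alpha> w g) A = dirder U v (dirder U w g) A
      + \<alpha> * (dirder U v (l w) A * g A + l w A * dirder U v g A)
      + \<alpha> * (l v A * (dirder U w g A + \<alpha> * (l w A * g A)))" if "v \<in> X" "w \<in> X" for v w
    using that assms by (simp add: nl dirder_in lg RF_add dirder_add dl)
  show "nabla \<alpha> v (nabla \<alpha> w g) A = nabla \<alpha> w (nabla \<alpha> v g) A"
    unfolding *[OF assms(2,3)] *[OF assms(3,2)] using comm dirder_commute[OF assms]
    by (simp add: algebra_simps)
qed

lemma F_mod_dmodule_gen:
  assumes h: "matrix_space X h" and sub: "U \<subseteq> basic_open X h"
    and res: "\<And>g. g \<in> carrier (coord_ring X h) \<Longrightarrow> restr U g \<in> RF"
  shows "dmodule X h (F_mod X f \<alpha>)"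
proof -
  have eq: "(\<lambda>A. g A * m A) = (\<lambda>A. restr U g A * m A)" if "m \<in> RF" for g m
    using that RF_out[of m] by (auto simp: fun_eq_iff restr_def)
  have cl: "(\<lambda>A. g A * m A) \<in> RF" if "m \<in> RF" "g \<in> carrier (coord_ring X h)" for g m
    by (subst eq[OF that(1)]) (intro RF_mult res that)
  have mod: "Module.module (coord_ring X h) (F_mod X f \<alpha>)"
  proof (rule moduleI)
    show "cring (coord_ring X h)" by (rule matrix_space.coord_ring_cring[OF h])
    show "abelian_group (F_mod X f \<alpha>)" by (rule F_mod_abelian_group)
    fix x assume "x \<in> carrier (F_mod X f \<alpha>)"
    then show "\<one>\<^bsub>coord_ring X h\<^esub> \<odot>\<^bsub>F_mod X f \<alpha>\<^esub> x = x"
      using sub RF_out[of x] by (auto simp: fun_eq_iff restr_def)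
  qed (auto simp: algebra_simps cl)
  have dres: "dirder U v (restr U g) A = dirder (basic_open X h) v g A" if "A \<in> U" "v \<in> X" for v g A
    using that sub DERIV_cong_ev
  proof -
    have "eventually (\<lambda>t. restr U g (A + mscale t v) = g (A + mscale t v)) (nhds 0)"
      using eventually_line_U[OF that] by eventually_elim simp
    then have "deriv (\<lambda>t. restr U g (A + mscale t v)) 0 = deriv (\<lambda>t. g (A + mscale t v)) 0"
      by (intro deriv_cong_ev) auto
    then show ?thesis using that sub by (auto simp: dirder_def)
  qed
  have leib: "nabla \<alpha> v (\<lambda>A. g A * m A) = (\<lambda>A. dirder (basic_open X h) v g A * m A + g A * nabla \<alpha> v m A)"
    if "v \<in> X" "g \<in> carrier (coord_ring X h)" "m \<in> RF" for v g m
  proof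
    fix A show "nabla \<alpha> v (\<lambda>A. g A * m A) A = dirder (basic_open X h) v g A * m A + g A * nabla \<alpha> v m A"
    proof (cases "A \<in> U")
      case True then show ?thesis
        by (subst eq[OF that(3)], subst nabla_mult[OF res[OF that(2)] that(3,1)]) (use that dres in simp)
    next
      case False then show ?thesis
        using cl[OF that(3,2)] by (simp add: nabla_out that RF_out)
    qed
  qed
  have cs: "cscale X h (F_mod X f \<alpha>) c m = (\<lambda>A. c * m A)" if "m \<in> RF" for c m
    using that sub RF_out[of m] by (auto simp: fun_eq_iff restr_def)
  show ?thesis
    unfolding dmodule_def
    using mod by (auto simp: der_F_mod nabla_in nabla_add nabla_dir nabla_commute leib RF_add cl cs[simplified])
qed

lemma F_mod_dmodule: "dmodule X f (F_mod X f \<alpha>)"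
proof (rule F_mod_dmodule_gen)
  show "matrix_space X f" by (rule matrix_space_axioms)
  show "restr U g \<in> RF" if "g \<in> RF" for g
    using that RF_out[OF that] by (metis (no_types, lifting) ext restr_def)
qed simp

lemma whole_ring_iff: "g \<in> carrier (coord_ring X whole) \<longleftrightarrow> (\<exists>p\<in>poly_funs. g = restr X p)"
  by (auto simp: coord_ring_def)

lemma restr_smult: assumes "m \<in> RF" shows "(\<lambda>A. restr X p A * m A) = (\<lambda>A. p A * m A)"
  using RF_out[OF assms] by (auto simp: fun_eq_iff restr_def U_iff)

lemma F_mod_dmodule_whole: "dmodule X whole (F_mod X f \<alpha>)"
proof (rule F_mod_dmodule_gen)
  show "matrix_space X whole" by (rule whole_space)
  show "U \<subseteq> basic_open X whole" by (auto simp: U_iff)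
  fix g assume "g \<in> carrier (coord_ring X whole)"
  then obtain p where p: "p \<in> poly_funs" "g = restr X p" by (auto simp: whole_ring_iff)
  then have "restr U g = restr U p" by (auto simp: fun_eq_iff restr_def U_iff)
  then show "restr U g \<in> RF" using p by auto
qed

lemma a_inv_F_mod: assumes "g \<in> RF" shows "\<ominus>\<^bsub>F_mod X f \<alpha>\<^esub> g = (\<lambda>A. - g A)"
  using abelian_group.minus_equality[OF F_mod_abelian_group[of \<alpha>], of "\<lambda>A. - g A" g] assms by auto

lemma submodule_whole_iff:
  "submodule P (coord_ring X whole) (F_mod X f \<alpha>) \<longleftrightarrow> P \<subseteq> RF \<and> (\<lambda>_. 0) \<in> P \<and>
     (\<forall>g\<in>P. \<forall>h\<in>P. (\<lambda>A. g A + h A) \<in> P) \<and> (\<forall>p\<in>poly_funs. \<forall>g\<in>P. (\<lambda>A. p A * g A) \<in> P)" (is "_ \<longleftrightarrow> ?R")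
proof -
  interpret Mo: module "coord_ring X whole" "F_mod X f \<alpha>"
    using F_mod_dmodule_whole by (simp add: dmodule_def)
  show ?thesis
  proof
    assume P: "submodule P (coord_ring X whole) (F_mod X f \<alpha>)"
    have sub: "P \<subseteq> RF" and ne: "P \<noteq> {}" using Mo.submoduleE(1,2)[OF P] by auto
    have sm: "(\<lambda>A. p A * g A) \<in> P" if "p \<in> poly_funs" "g \<in> P" for p g
    proof -
      have "restr X p \<in> carrier (coord_ring X whole)" using that by (auto simp: whole_ring_iff)
      from Mo.submoduleE(4)[OF P this that(2)] show ?thesis using that sub by (auto simp: restr_smult)
    qed
    obtain g where "g \<in> P" using ne by blast
    then have "(\<lambda>_. 0) \<in> P" using sm[of "\<lambda>_. 0" g] by (simp add: poly_funs.const)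
    then show ?R using sub sm Mo.submoduleE(5)[OF P] by auto
  next
    assume R: ?R
    then have Rm: "\<forall>p\<in>poly_funs. \<forall>g\<in>P. (\<lambda>A. p A * g A) \<in> P" by blast
    show "submodule P (coord_ring X whole) (F_mod X f \<alpha>)"
    proof (rule Mo.submoduleI)
      fix a assume a: "a \<in> P"
      then have "(\<lambda>A. (-1) * a A) \<in> P"
        using bspec[OF bspec[OF Rm poly_funs.const[of "-1"]] a] by simp
      moreover have "a \<in> RF" using a R by blast
      ultimately show "\<ominus>\<^bsub>F_mod X f \<alpha>\<^esub> a \<in> P" by (simp add: a_inv_F_mod)
    next
      fix a x assume "a \<in> carrier (coord_ring X whole)" "x \<in> P"
      then obtain p where p: "p \<in> poly_funs" "a = restr X p" by (auto simp: whole_ring_iff)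
      have "x \<in> RF" using R \<open>x \<in> P\<close> by blast
      then show "a \<odot>\<^bsub>F_mod X f \<alpha>\<^esub> x \<in> P"
        using bspec[OF bspec[OF Rm p(1)] \<open>x \<in> P\<close>] by (simp add: p(2) restr_smult)
    qed (use R in auto)
  qed
qed

lemma dsubmodule_whole_iff:
  "dsubmodule X whole (F_mod X f \<alpha>) P \<longleftrightarrow> P \<subseteq> RF \<and> (\<lambda>_. 0) \<in> P \<and>
     (\<forall>g\<in>P. \<forall>h\<in>P. (\<lambda>A. g A + h A) \<in> P) \<and> (\<forall>p\<in>poly_funs. \<forall>g\<in>P. (\<lambda>A. p A * g A) \<in> P) \<and>
     (\<forall>v\<in>X. \<forall>g\<in>P. nabla \<alpha> v g \<in> P)"
proof (cases "P \<subseteq> RF")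
  case True
  then have "(\<forall>v\<in>X. \<forall>m\<in>P. der (F_mod X f \<alpha>) v m \<in> P) = (\<forall>v\<in>X. \<forall>g\<in>P. nabla \<alpha> v g \<in> P)"
    by (intro ball_cong refl) (auto simp: der_F_mod subset_iff)
  then show ?thesis unfolding dsubmodule_def submodule_whole_iff by (simp only: conj_assoc)
qed (simp add: dsubmodule_def submodule_whole_iff)

end

section \<open>Submodules contain a power of \<open>f\<close>\<close>

inductive pdeg :: "nat \<Rightarrow> ('m::finite cmat \<Rightarrow> complex) \<Rightarrow> bool" where
  const: "pdeg d (\<lambda>_. c)"
| entry: "pdeg (Suc d) (\<lambda>A. A $ i $ j)"
| add: "pdeg d p \<Longrightarrow> pdeg d q \<Longrightarrow> pdeg d (\<lambda>A. p A + q A)"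
| mult: "pdeg d p \<Longrightarrow> pdeg e q \<Longrightarrow> pdeg (d + e) (\<lambda>A. p A * q A)"

lemma pdeg_poly: "pdeg d p \<Longrightarrow> p \<in> poly_funs"
  by (induction rule: pdeg.induct) (auto intro: poly_funs.intros)

lemma pdeg_mono: assumes "pdeg d p" "d \<le> e" shows "pdeg e p"
  using pdeg.mult[OF pdeg.const[of "e - d" 1] assms(1)] assms(2) by simp

lemma poly_pdeg: "p \<in> poly_funs \<Longrightarrow> \<exists>d. pdeg d p"
proof (induction rule: poly_funs.induct)
  case (add p q)
  then obtain d e where "pdeg d p" "pdeg e q" by blast
  then have "pdeg (max d e) p" "pdeg (max d e) q" by (auto intro: pdeg_mono)
  then show ?case by (blast intro: pdeg.add)
qed (blast intro: pdeg.intros)+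

lemma pdeg_pdd: "pdeg d p \<Longrightarrow> (d = 0 \<longrightarrow> pdd v p = (\<lambda>_. 0)) \<and> pdeg (d - 1) (pdd v p)"
proof (induction rule: pdeg.induct)
  case (add d p q)
  then show ?case by (auto simp: pdd_add pdeg_poly intro!: pdeg.add)
next
  case (mult d p e q)
  have eq: "pdd v (\<lambda>A. p A * q A) = (\<lambda>A. pdd v p A * q A + p A * pdd v q A)"
    using mult by (intro pdd_mult pdeg_poly)
  show ?case
  proof (cases "d = 0 \<and> e = 0")
    case True
    then show ?thesis using mult unfolding eq by (auto intro: pdeg.const)
  next
    case False
    have "pdeg (d + e - 1) (\<lambda>A. pdd v p A * q A)"
    proof (cases "d = 0")
      case True then show ?thesis using mult by (auto intro: pdeg.const)
    next
      case False then show ?thesis using mult pdeg.mult[of "d - 1" "pdd v p" e q] by auto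
    qed
    moreover have "pdeg (d + e - 1) (\<lambda>A. p A * pdd v q A)"
    proof (cases "e = 0")
      case True then show ?thesis using mult by (auto intro: pdeg.const)
    next
      case False then show ?thesis using mult pdeg.mult[of d p "e - 1" "pdd v q"] by auto
    qed
    ultimately show ?thesis using False unfolding eq by (auto intro: pdeg.add)
  qed
qed (auto intro: pdeg.intros)

lemma has_pdd_at:
  assumes "p \<in> poly_funs"
  shows "((\<lambda>t. p (A + mscale t v)) has_field_derivative pdd v p (A + mscale s v)) (at s)"
proof -
  have "((\<lambda>t. p (A + mscale (t + s) v)) has_field_derivative pdd v p (A + mscale s v)) (at 0)"
    using has_pdd[OF assms, of "A + mscale s v" v] by (simp add: mscale_add(2) add_ac)
  then show ?thesis using DERIV_shift[of "\<lambda>t. p (A + mscale t v)" _ 0 s] by simp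
qed

context matrix_space
begin

lemma constant_if_pdd_zero:
  assumes "p \<in> poly_funs" "\<And>v A. v \<in> X \<Longrightarrow> A \<in> X \<Longrightarrow> pdd v p A = 0" "A \<in> X"
  shows "p A = p 0"
proof -
  have d0: "((\<lambda>t. p (mscale t A)) has_field_derivative 0) (at t within UNIV)" for t
    using has_pdd_at[OF assms(1), of 0 A t] assms(2)[OF assms(3) scale_in[OF assms(3)], of t] by simp
  obtain c where c: "\<And>t. t \<in> UNIV \<Longrightarrow> p (mscale t A) = c"
    using has_field_derivative_zero_constant[OF convex_UNIV d0] by blast
  show ?thesis using c[of 1] c[of 0] by simp
qed

lemma dsub_facts:
  assumes "dsubmodule X whole (F_mod X f \<alpha>) P"
  shows dsub_RF: "P \<subseteq> RF" and dsub_zero: "(\<lambda>_. 0) \<in> P"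
    and dsub_add: "\<And>g h. g \<in> P \<Longrightarrow> h \<in> P \<Longrightarrow> (\<lambda>A. g A + h A) \<in> P"
    and dsub_pmult: "\<And>p g. p \<in> poly_funs \<Longrightarrow> g \<in> P \<Longrightarrow> (\<lambda>A. p A * g A) \<in> P"
    and dsub_nabla: "\<And>v g. v \<in> X \<Longrightarrow> g \<in> P \<Longrightarrow> nabla \<alpha> v g \<in> P"
proof -
  note * = assms[unfolded dsubmodule_whole_iff]
  show "P \<subseteq> RF" by (rule conjunct1[OF *])
  show "(\<lambda>_. 0) \<in> P" by (rule conjunct1[OF conjunct2[OF *]])
  show "(\<lambda>A. g A + h A) \<in> P" if "g \<in> P" "h \<in> P" for g h
    using * that by (elim conjE) (drule (1) bspec, drule (1) bspec, assumption)
  show "(\<lambda>A. p A * g A) \<in> P" if "p \<in> poly_funs" "g \<in> P" for p g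
    using conjunct1[OF conjunct2[OF conjunct2[OF conjunct2[OF *]]]] that by blast
  show "nabla \<alpha> v g \<in> P" if "v \<in> X" "g \<in> P" for v g
    using conjunct2[OF conjunct2[OF conjunct2[OF conjunct2[OF *]]]] that by blast
qed

lemma dsub_cmult: "dsubmodule X whole (F_mod X f \<alpha>) P \<Longrightarrow> g \<in> P \<Longrightarrow> (\<lambda>A. c * g A) \<in> P"
  using dsub_pmult[of \<alpha> P "\<lambda>_. c" g] by (simp add: poly_funs.const)

lemma dsub_sum: "dsubmodule X whole (F_mod X f \<alpha>) P \<Longrightarrow> (\<And>i. i \<in> I \<Longrightarrow> g i \<in> P) \<Longrightarrow> (\<lambda>A. \<Sum>i\<in>I. g i A) \<in> P"
  by (induction I rule: infinite_finite_induct) (auto simp: dsub_zero intro: dsub_add)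

lemma dsub_diff:
  assumes "dsubmodule X whole (F_mod X f \<alpha>) P" "g \<in> P" "h \<in> P"
  shows "(\<lambda>A. g A - h A) \<in> P"
  using dsub_add[OF assms(1,2) dsub_cmult[OF assms(1,3), of "-1"]] by simp

text \<open>For \<open>g = f\<^sup>k p\<close> the combination \<open>f * \<nabla>\<^sub>v g - (k + \<alpha>) * \<partial>\<^sub>v f * g\<close> of elements of the submodule is
  \<open>f\<^sup>k\<^sup>+\<^sup>1 * \<partial>\<^sub>v p\<close>. The degree of the numerator drops until it is a nonzero constant.\<close>

lemma nonzero_submodule_contains_power:
  assumes P: "dsubmodule X whole (F_mod X f \<alpha>) P" and ne: "P \<noteq> {\<lambda>_. 0}"
  shows "\<exists>k. restr U (\<lambda>A. f A ^ k) \<in> P"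
proof -
  have lower: "\<exists>k. restr U (\<lambda>A. f A ^ k) \<in> P"
    if "pdeg d p" "\<exists>A\<in>X. p A \<noteq> 0" "restr U (\<lambda>A. f A ^ k * p A) \<in> P" for d p k
    using that
  proof (induction d arbitrary: p k rule: less_induct)
    case (less d)
    have p: "p \<in> poly_funs" using less.prems(1) by (rule pdeg_poly)
    show ?case
    proof (cases "\<forall>v\<in>X. \<forall>A\<in>X. pdd v p A = 0")
      case True
      then have c: "p A = p 0" if "A \<in> X" for A using constant_if_pdd_zero[OF p _ that] by blast
      then have c0: "p 0 \<noteq> 0" using less.prems(2) by metis
      have "(\<lambda>A. (1 / p 0) * restr U (\<lambda>A. f A ^ k * p A) A) = restr U (\<lambda>A. f A ^ k)"
        using c c0 by (auto simp: fun_eq_iff restr_def U_iff)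
      with dsub_cmult[OF P less.prems(3), of "1 / p 0"] show ?thesis by metis
    next
      case False
      then obtain v A where v: "v \<in> X" "A \<in> X" "pdd v p A \<noteq> 0" by blast
      have d: "d \<noteq> 0" "pdeg (d - 1) (pdd v p)" using pdeg_pdd[OF less.prems(1), of v] v(3) by auto
      have fk: "(\<lambda>A. f A ^ k) \<in> poly_funs" by (intro poly_funs_power f_poly)
      define h where "h = restr U (\<lambda>A. f A ^ k * p A)"
      have hP: "h \<in> P" using less.prems(3) by (simp add: h_def)
      have nh: "nabla \<alpha> v h = frac (\<lambda>A. pdd v (\<lambda>A. f A ^ k * p A) A * f A + \<alpha> * (f A ^ k * p A) * pdd v f A) 1"
        unfolding h_def restr_poly_eq using nabla_frac[of "\<lambda>A. f A ^ k * p A" v \<alpha> 0] fk p v(1)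
        by (simp add: poly_funs.mult)
      have "(\<lambda>A. f A * nabla \<alpha> v h A - ((of_nat k + \<alpha>) * pdd v f A) * h A) = restr U (\<lambda>A. f A ^ Suc k * pdd v p A)"
      proof
        fix A
        show "f A * nabla \<alpha> v h A - ((of_nat k + \<alpha>) * pdd v f A) * h A = restr U (\<lambda>A. f A ^ Suc k * pdd v p A) A"
        proof (cases "A \<in> U")
          case True
          then have nz: "f A \<noteq> 0" by (simp add: U_iff)
          have D: "pdd v (\<lambda>A. f A ^ k) A = of_nat k * f A ^ k * pdd v f A / f A"
            using pdd_power_aux[OF f_poly, of A v k] nz by (simp add: field_simps)
          show ?thesis unfolding nh[unfolded pdd_mult[OF fk p]] using True nz
            by (simp add: h_def frac_eq D field_simps)
        next
          case False
          then show ?thesis unfolding nh by (simp add: h_def frac_out)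
        qed
      qed
      moreover have "(\<lambda>A. f A * nabla \<alpha> v h A - ((of_nat k + \<alpha>) * pdd v f A) * h A) \<in> P"
        using poly_funs_cmult[OF pdd_poly[OF f_poly], of "of_nat k + \<alpha>" v]
        by (intro dsub_diff[OF P] dsub_pmult[OF P] dsub_nabla[OF P] f_poly v(1) hP)
      ultimately have "restr U (\<lambda>A. f A ^ Suc k * pdd v p A) \<in> P" by simp
      with less.IH[of "d - 1" "pdd v p" "Suc k"] d v show ?thesis by auto
    qed
  qed
  from ne dsub_zero[OF P] obtain g where g: "g \<in> P" "g \<noteq> (\<lambda>_. 0)" by blast
  have "g \<in> RF" using dsub_RF[OF P] g(1) by blast
  then obtain p l where p: "p \<in> poly_funs" "g = frac p l" unfolding RF_iff by blast
  from g(2) obtain A where "A \<in> U" "p A \<noteq> 0" unfolding p(2) by (auto simp: fun_eq_iff frac_def restr_def split: if_splits)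
  then have "\<exists>A\<in>X. p A \<noteq> 0" by (auto simp: U_iff)
  moreover have "(\<lambda>A. f A ^ l * g A) = restr U (\<lambda>A. f A ^ 0 * p A)"
    by (auto simp: p fun_eq_iff frac_def restr_def U_iff)
  moreover have "(\<lambda>A. f A ^ l * g A) \<in> P" by (intro dsub_pmult[OF P] poly_funs_power f_poly g(1))
  moreover obtain d where "pdeg d p" using poly_pdeg[OF p(1)] by blast
  ultimately show ?thesis using lower[of d p 0] by auto
qed

text \<open>The element \<open>g f\<^sup>m f\<^sup>\<alpha>\<close> for a polynomial \<open>g\<close> and an integer \<open>m\<close>.\<close>

definition tw :: "('m cmat \<Rightarrow> complex) \<Rightarrow> int \<Rightarrow> 'm cmat \<Rightarrow> complex" where
  "tw g m = restr U (\<lambda>A. g A * f A powi m)"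

lemma tw_eq: "A \<in> U \<Longrightarrow> tw g m A = g A * f A powi m" and tw_out: "A \<notin> U \<Longrightarrow> tw g m A = 0"
  by (simp_all add: tw_def)

lemma tw_eqI: "(\<And>A. A \<in> U \<Longrightarrow> g A * f A powi m = h A * f A powi n) \<Longrightarrow> tw g m = tw h n"
  by (auto simp: tw_def fun_eq_iff restr_def)

lemma nabla_tw:
  assumes g: "g \<in> poly_funs" and v: "v \<in> X"
  shows "nabla \<alpha> v (tw g m) = tw (\<lambda>A. pdd v g A * f A + (\<alpha> + of_int m) * g A * pdd v f A) (m - 1)"
proof (cases "m \<ge> 0")
  case True
  then obtain n where m: "m = int n" using nonneg_int_cases by blast
  have fn: "(\<lambda>A. f A ^ n) \<in> poly_funs" by (intro poly_funs_power f_poly)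
  have "tw g m = frac (\<lambda>A. g A * f A ^ n) 0" by (simp add: tw_def m frac_def)
  then have *: "nabla \<alpha> v (tw g m) = frac (\<lambda>A. pdd v (\<lambda>A. g A * f A ^ n) A * f A + \<alpha> * (g A * f A ^ n) * pdd v f A) 1"
    using nabla_frac[of "\<lambda>A. g A * f A ^ n" v \<alpha> 0] g fn v by (simp add: poly_funs.mult)
  show ?thesis unfolding *
  proof
    fix A
    show "frac (\<lambda>A. pdd v (\<lambda>A. g A * f A ^ n) A * f A + \<alpha> * (g A * f A ^ n) * pdd v f A) 1 A =
      tw (\<lambda>A. pdd v g A * f A + (\<alpha> + of_int m) * g A * pdd v f A) (m - 1) A"
    proof (cases "A \<in> U")
      case True
      then have nz: "f A \<noteq> 0" by (simp add: U_iff)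
      have "pdd v (\<lambda>A. g A * f A ^ n) A * f A = pdd v g A * f A ^ n * f A + g A * (f A * pdd v (\<lambda>A. f A ^ n) A)"
        by (simp add: pdd_mult[OF g fn] algebra_simps)
      also have "\<dots> = f A ^ n * (pdd v g A * f A + of_nat n * g A * pdd v f A)"
        unfolding pdd_power_aux[OF f_poly] by (simp add: algebra_simps)
      finally show ?thesis using True nz
        by (simp add: frac_eq tw_eq m power_int_diff algebra_simps add_divide_distrib)
    qed (simp add: frac_out tw_out)
  qed
next
  case False
  then obtain n where m: "m = - int n" by (metis linorder_not_le nat_less_le neg_int_cases order.strict_iff_not)
  have "tw g m = frac g n" by (simp add: tw_def m frac_def power_int_minus divide_inverse)
  then have *: "nabla \<alpha> v (tw g m) = frac (\<lambda>A. pdd v g A * f A + (\<alpha> - of_nat n) * g A * pdd v f A) (Suc n)"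
    using nabla_frac[OF g v, of \<alpha> n] by simp
  show ?thesis unfolding *
  proof
    fix A
    have "f A powi (- int n - 1) = 1 / f A ^ Suc n" if "f A \<noteq> 0"
    proof -
      have "- int n - 1 = - int (Suc n)" by simp
      then show ?thesis using that by (simp only: power_int_minus power_int_of_nat) (simp add: divide_inverse)
    qed
    then show "frac (\<lambda>A. pdd v g A * f A + (\<alpha> - of_nat n) * g A * pdd v f A) (Suc n) A =
      tw (\<lambda>A. pdd v g A * f A + (\<alpha> + of_int m) * g A * pdd v f A) (m - 1) A"
      by (cases "A \<in> U") (simp_all add: frac_eq tw_eq frac_out tw_out m U_iff)
  qed
qed

text \<open>Multiplication by \<open>f\<close> raises the power of \<open>f\<close>, so a submodule that contains one power and can be
  lowered contains \<open>f\<^sup>m\<close> for all \<open>m \<in> \<int>\<close>, hence all fractions.\<close>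

lemma simple_if_lowering:
  assumes lower: "\<And>P m. dsubmodule X whole (F_mod X f \<alpha>) P \<Longrightarrow> tw f m \<in> P \<Longrightarrow> tw (\<lambda>_. 1) m \<in> P"
  shows "simple_dmodule X whole (F_mod X f \<alpha>)"
proof -
  have "P = RF" if P: "dsubmodule X whole (F_mod X f \<alpha>) P" and ne: "P \<noteq> {\<lambda>_. 0}" for P
  proof
    show "P \<subseteq> RF" by (rule dsub_RF[OF P])
    obtain k where k: "restr U (\<lambda>A. f A ^ k) \<in> P" using nonzero_submodule_contains_power[OF P ne] by blast
    have step: "tw (\<lambda>_. 1) (int k - int j) \<in> P" for j
    proof (induction j)
      case 0 show ?case using k by (simp add: tw_def)
    next
      case (Suc j)
      have "tw f (int k - int (Suc j)) = tw (\<lambda>_. 1) (int k - int j)"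
      proof (rule tw_eqI)
        fix A assume "A \<in> U"
        then have "f A \<noteq> 0" by (simp add: U_iff)
        then have "f A powi (1 + (int k - int (Suc j))) = f A * f A powi (int k - int (Suc j))"
          by (subst power_int_add) auto
        moreover have "1 + (int k - int (Suc j)) = int k - int j" by simp
        ultimately show "f A * f A powi (int k - int (Suc j)) = 1 * f A powi (int k - int j)"
          by (simp only: mult_1)
      qed
      then show ?case using lower[OF P, of "int k - int (Suc j)"] Suc by simp
    qed
    show "RF \<subseteq> P"
    proof
      fix g assume "g \<in> RF"
      then obtain p l where p: "p \<in> poly_funs" "g = frac p l" by (auto simp: RF_iff)
      have "g = (\<lambda>A. p A * tw (\<lambda>_. 1) (int k - int (k + l)) A)"
        by (auto simp: p(2) fun_eq_iff frac_def tw_def restr_def power_int_minus divide_inverse)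
      then show "g \<in> P" using dsub_pmult[OF P p(1) step[of "k + l"]] by simp
    qed
  qed
  moreover have "RF \<noteq> {\<lambda>_. 0}"
  proof
    assume "RF = {\<lambda>_. 0}"
    moreover have "restr U (\<lambda>_. 1) \<in> RF" by (intro RF_poly poly_funs.const)
    ultimately have "restr U (\<lambda>_. 1::complex) = (\<lambda>_. 0)" by blast
    moreover obtain A where "A \<in> U" using f_nonzero by (auto simp: U_iff)
    ultimately show False by (metis restr_apply(1) zero_neq_one)
  qed
  ultimately show ?thesis unfolding simple_dmodule_def using F_mod_dmodule_whole by auto
qed

end

section \<open>Lowering the power of \<open>f\<close>\<close>

text \<open>The directions \<open>a b\<^sup>T + \<sigma> b a\<^sup>T\<close> span the space of all, of symmetric and of skew-symmetric matrices
  for \<open>\<sigma> = 0, 1, -1\<close>; the three cases are treated at once.\<close>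

definition pol :: "complex \<Rightarrow> complex ^ 'm \<Rightarrow> complex ^ 'm \<Rightarrow> 'm::finite cmat" where
  "pol \<sigma> a b = (\<chi> i j. a $ i * b $ j + \<sigma> * b $ i * a $ j)"

text \<open>Replacing the entries of \<open>A\<close> outside \<open>R \<times> R\<close> by those of a fixed matrix \<open>J\<close>, block diagonal with
  respect to \<open>R\<close> and its complement, turns \<open>f\<close> into its principal minor on \<open>R\<close>, up to a constant.\<close>

definition cut :: "'m::finite cmat \<Rightarrow> 'm set \<Rightarrow> 'm cmat \<Rightarrow> 'm cmat" where
  "cut J R A = (\<chi> i j. if i \<in> R \<and> j \<in> R then A $ i $ j else J $ i $ j)"

abbreviation unit :: "'m \<Rightarrow> complex ^ 'm::finite" where "unit i \<equiv> axis i 1"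

lemma pol_nth [simp]: "pol \<sigma> a b $ i $ j = a $ i * b $ j + \<sigma> * b $ i * a $ j"
  by (simp add: pol_def)

lemma cut_nth [simp]: "cut J R A $ i $ j = (if i \<in> R \<and> j \<in> R then A $ i $ j else J $ i $ j)"
  by (simp add: cut_def)

lemma unit_nth: "unit i $ j = (if i = j then 1 else 0)"
  by (simp add: axis_def)

lemma pol_expand_right: "pol \<sigma> a b = (\<Sum>l\<in>UNIV. mscale (b $ l) (pol \<sigma> a (unit l)))"
  by (simp add: vec_eq_iff unit_nth algebra_simps sum.distrib if_distrib[of "\<lambda>x. _ * x"] cong: if_cong)

lemma pol_expand_left: "pol \<sigma> a b = (\<Sum>l\<in>UNIV. mscale (a $ l) (pol \<sigma> (unit l) b))"
  by (simp add: vec_eq_iff unit_nth algebra_simps sum.distrib if_distrib[of "\<lambda>x. _ * x"] cong: if_cong)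

text \<open>The axioms \<open>row_inv\<close> and \<open>col_inv\<close> are the infinitesimal form of the semi-invariance of \<open>f\<close>: adding a
  multiple of row \<open>k\<close> to row \<open>i\<close>, with the corresponding column operation if \<open>\<sigma> \<noteq> 0\<close>, preserves \<open>f\<close>
  for \<open>i \<noteq> k\<close>, and rescaling a row multiplies \<open>f\<close> by the \<open>c\<close>-th power of the factor.\<close>

locale polarized_space = matrix_space X f for X :: "'m::finite cmat set" and f +
  fixes \<sigma> c :: complex and J :: "'m cmat"
  assumes pol_in: "pol \<sigma> a b \<in> X"
    and row_inv: "A \<in> X \<Longrightarrow> pdd (pol \<sigma> (unit i) (A $ k)) f A = (if i = k then c * f A else 0)"
    and col_inv: "A \<in> X \<Longrightarrow> pdd (pol \<sigma> (column k A) (unit i)) f A = (if i = k then c * f A else 0)"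
    and cut_in: "A \<in> X \<Longrightarrow> cut J R A \<in> X"
begin

lemma poly_cut: "p \<in> poly_funs \<Longrightarrow> (\<lambda>A. p (cut J R A)) \<in> poly_funs"
proof (erule poly_funs_compose)
  fix i j show "(\<lambda>A. cut J R A $ i $ j) \<in> poly_funs"
    by (cases "i \<in> R \<and> j \<in> R") (auto intro: poly_funs.intros)
qed

lemma pdd_cut: "pdd w (\<lambda>A. p (cut J R A)) A = pdd (cut 0 R w) p (cut J R A)"
proof -
  have "cut J R (A + mscale t w) = cut J R A + mscale t (cut 0 R w)" for t
    by (simp add: vec_eq_iff)
  then show ?thesis by (simp add: pdd_def)
qed

lemma row_inv_sum:
  assumes "A \<in> X"
  shows "(\<Sum>l\<in>UNIV. A $ k $ l * pdd (pol \<sigma> (unit i) (unit l)) f A) = (if i = k then c * f A else 0)"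
  using row_inv[OF assms, of i k] unfolding pol_expand_right[of \<sigma> "unit i" "A $ k"] pdd_dir_sum[OF f_poly] .

lemma col_inv_sum:
  assumes "A \<in> X"
  shows "(\<Sum>l\<in>UNIV. A $ l $ k * pdd (pol \<sigma> (unit l) (unit i)) f A) = (if i = k then c * f A else 0)"
  using col_inv[OF assms, of k i] unfolding pol_expand_left[of \<sigma> "column k A"] pdd_dir_sum[OF f_poly]
  by (simp add: column_def)

text \<open>Let \<open>\<partial>\<^sub>a\<^sub>b\<close> be the derivative along \<open>pol \<sigma> (unit a) (unit b)\<close>, let \<open>T\<close> be the minor \<open>f (cut J R A)\<close> and let
  \<open>\<mu>\<^sub>k\<close> be the minor of \<open>\<partial>\<^sub>i\<^sub>'\<^sub>k f\<close>. Row invariance removes the derivatives of \<open>f\<^sup>m\<close> from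
  \<open>\<Sum>\<^sub>l A\<^sub>j\<^sub>l \<nabla>\<^sub>i\<^sub>'\<^sub>l\<close> up to a multiple of \<open>T f\<^sup>m\<close> and leaves \<open>\<beta>\<^sub>j f\<^sup>m\<close> with \<open>\<beta>\<^sub>j = \<Sum>\<^sub>k\<^sub>\<in>\<^sub>R A\<^sub>j\<^sub>k \<mu>\<^sub>k\<close>. Applying
  \<open>\<Sum>\<^sub>j \<nabla>\<^sub>j\<^sub>i\<close> to these elements gives a multiple of \<open>\<mu>\<^sub>i f\<^sup>m\<close>. The derivatives of \<open>f\<^sup>m\<close> contribute
  \<open>c * (\<alpha> + m)\<close>, by column invariance. For \<open>j \<in> R\<close> row invariance of the minor says that \<open>\<beta>\<^sub>j\<close> is
  \<open>c T\<close> or \<open>0\<close>, and these \<open>j\<close> contribute \<open>c\<close>; each \<open>j \<notin> R\<close> contributes \<open>1\<close>, because there the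
  coefficients \<open>A\<^sub>j\<^sub>k\<close> are differentiated and \<open>\<mu>\<^sub>k\<close> does not depend on row \<open>j\<close>.\<close>

lemma lowering_step:
  assumes P: "dsubmodule X whole (F_mod X f \<alpha>) P"
    and R: "i \<in> R" "i' \<in> R" "\<And>k l. k \<in> R \<Longrightarrow> l \<notin> R \<Longrightarrow> J $ k $ l = 0"
    and T: "tw (\<lambda>A. f (cut J R A)) m \<in> P"
    and nz: "c * (\<alpha> + of_int m) + c + of_nat (card (- R)) \<noteq> 0"
  shows "tw (\<lambda>A. pdd (pol \<sigma> (unit i') (unit i)) f (cut J R A)) m \<in> P"
proof -
  define T where "T = (\<lambda>A. f (cut J R A))"
  define \<mu> where "\<mu> k = (\<lambda>A. pdd (pol \<sigma> (unit i') (unit k)) f (cut J R A))" for k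
  define \<beta> where "\<beta> j = (\<lambda>A. \<Sum>k\<in>R. A $ j $ k * \<mu> k A)" for j
  have Tp: "T \<in> poly_funs" unfolding T_def by (intro poly_cut f_poly)
  have \<mu>p: "\<mu> k \<in> poly_funs" for k unfolding \<mu>_def by (intro poly_cut pdd_poly f_poly)
  have \<beta>p: "\<beta> j \<in> poly_funs" for j unfolding \<beta>_def
    by (intro poly_funs_sum poly_funs.mult poly_funs.entry \<mu>p)
  have cut_pol: "cut 0 R (pol \<sigma> (unit a) (unit b)) = (if a \<in> R \<and> b \<in> R then pol \<sigma> (unit a) (unit b) else 0)" for a b
    by (auto simp: vec_eq_iff unit_nth)
  have TP: "tw T m \<in> P" using T by (simp add: T_def)
  have dT: "pdd (pol \<sigma> (unit i') (unit l)) T A = (if l \<in> R then \<mu> l A else 0)" for l A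
    unfolding T_def pdd_cut cut_pol using R(2) by (simp add: \<mu>_def f_poly)
  have \<beta>P: "tw (\<beta> j) m \<in> P" for j
  proof -
    let ?\<delta> = "if i' = j then c else 0 :: complex"
    have "(\<lambda>A. \<Sum>l\<in>UNIV. A $ j $ l * nabla \<alpha> (pol \<sigma> (unit i') (unit l)) (tw T m) A) \<in> P"
      by (intro dsub_sum[OF P] dsub_pmult[OF P] dsub_nabla[OF P] poly_funs.entry pol_in TP)
    then have "(\<lambda>A. (\<Sum>l\<in>UNIV. A $ j $ l * nabla \<alpha> (pol \<sigma> (unit i') (unit l)) (tw T m) A)
      - ((\<alpha> + of_int m) * ?\<delta>) * tw T m A) \<in> P"
      by (intro dsub_diff[OF P] dsub_cmult[OF P] TP)
    moreover have "(\<lambda>A. (\<Sum>l\<in>UNIV. A $ j $ l * nabla \<alpha> (pol \<sigma> (unit i') (unit l)) (tw T m) A)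
      - ((\<alpha> + of_int m) * ?\<delta>) * tw T m A) = tw (\<beta> j) m"
    proof
      fix A
      show "(\<Sum>l\<in>UNIV. A $ j $ l * nabla \<alpha> (pol \<sigma> (unit i') (unit l)) (tw T m) A)
        - ((\<alpha> + of_int m) * ?\<delta>) * tw T m A = tw (\<beta> j) m A"
      proof (cases "A \<in> U")
        case True
        then have nzA: "f A \<noteq> 0" and AX: "A \<in> X" by (auto simp: U_iff)
        have m1: "f A powi m = f A * f A powi (m - 1)" using nzA by (simp add: power_int_diff)
        have "(\<Sum>l\<in>UNIV. A $ j $ l * nabla \<alpha> (pol \<sigma> (unit i') (unit l)) (tw T m) A)
          = (\<Sum>l\<in>UNIV. A $ j $ l * (if l \<in> R then \<mu> l A else 0)) * f A powi m
            + (\<alpha> + of_int m) * T A * (\<Sum>l\<in>UNIV. A $ j $ l * pdd (pol \<sigma> (unit i') (unit l)) f A) * f A powi (m - 1)"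
          by (simp add: nabla_tw[OF Tp pol_in] dT tw_eq[OF True] m1 sum_distrib_left sum_distrib_right
              sum.distrib[symmetric] algebra_simps cong: if_cong)
        moreover have "(\<Sum>l\<in>UNIV. A $ j $ l * (if l \<in> R then \<mu> l A else 0)) = \<beta> j A"
          unfolding \<beta>_def by (simp add: if_distrib[of "\<lambda>x. _ * x"] sum.If_cases cong: if_cong)
        ultimately show ?thesis unfolding row_inv_sum[OF AX]
          by (simp add: tw_eq[OF True] m1 algebra_simps)
      qed (simp add: tw_out nabla_tw[OF Tp pol_in])
    qed
    ultimately show ?thesis by simp
  qed
  have \<beta>R: "\<beta> j A = (if i' = j then c * T A else 0)" if "j \<in> R" "A \<in> X" for j A
  proof -
    have "(\<Sum>l\<in>UNIV. cut J R A $ j $ l * pdd (pol \<sigma> (unit i') (unit l)) f (cut J R A)) = \<beta> j A"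
      unfolding \<beta>_def \<mu>_def using that R(3)[OF that(1)]
      by (intro sum.mono_neutral_cong_right) auto
    then show ?thesis using row_inv_sum[OF cut_in[OF that(2), of R], of j i'] by (simp add: T_def)
  qed
  have d\<beta>_out: "pdd (pol \<sigma> (unit j) (unit i)) (\<beta> j) A = \<mu> i A" if "j \<notin> R" for j A
  proof -
    have d\<mu>: "pdd (pol \<sigma> (unit j) (unit i)) (\<mu> k) A = 0" for k
      unfolding \<mu>_def pdd_cut cut_pol using that by (simp add: pdd_poly f_poly)
    have "pdd (pol \<sigma> (unit j) (unit i)) (\<beta> j) A = (\<Sum>k\<in>R. pol \<sigma> (unit j) (unit i) $ j $ k * \<mu> k A)"
      unfolding \<beta>_def by (subst pdd_sum) (auto simp: pdd_mult poly_funs.entry \<mu>p d\<mu> intro!: poly_funs.mult)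
    also have "\<dots> = (\<Sum>k\<in>R. if k = i then \<mu> k A else 0)"
      using that R(1) by (intro sum.cong) (auto simp: unit_nth)
    finally show ?thesis using R(1) by (simp add: sum.delta)
  qed
  have d\<beta>_in: "pdd (pol \<sigma> (unit j) (unit i)) (\<beta> j) A = (if i' = j then c * \<mu> i A else 0)"
    if "j \<in> R" "A \<in> X" for j A
  proof -
    have "pdd (pol \<sigma> (unit j) (unit i)) (\<beta> j) A = pdd (pol \<sigma> (unit j) (unit i)) (\<lambda>A. if i' = j then c * T A else 0) A"
      unfolding pdd_def using \<beta>R[OF that(1)] line_in[OF that(2) pol_in] by simp
    then show ?thesis using R(1) dT[of i A] by (cases "i' = j") (simp_all add: pdd_cmult[OF Tp])
  qed
  have "(\<lambda>A. \<Sum>j\<in>UNIV. nabla \<alpha> (pol \<sigma> (unit j) (unit i)) (tw (\<beta> j) m) A) \<in> P"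
    by (intro dsub_sum[OF P] dsub_nabla[OF P] pol_in \<beta>P)
  moreover have "(\<lambda>A. \<Sum>j\<in>UNIV. nabla \<alpha> (pol \<sigma> (unit j) (unit i)) (tw (\<beta> j) m) A)
    = (\<lambda>A. (c * (\<alpha> + of_int m) + c + of_nat (card (- R))) * tw (\<mu> i) m A)"
  proof
    fix A
    show "(\<Sum>j\<in>UNIV. nabla \<alpha> (pol \<sigma> (unit j) (unit i)) (tw (\<beta> j) m) A)
      = (c * (\<alpha> + of_int m) + c + of_nat (card (- R))) * tw (\<mu> i) m A"
    proof (cases "A \<in> U")
      case True
      then have nzA: "f A \<noteq> 0" and AX: "A \<in> X" by (auto simp: U_iff)
      have m1: "f A powi m = f A * f A powi (m - 1)" using nzA by (simp add: power_int_diff)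
      have "(\<Sum>j\<in>UNIV. nabla \<alpha> (pol \<sigma> (unit j) (unit i)) (tw (\<beta> j) m) A)
        = (\<Sum>j\<in>UNIV. pdd (pol \<sigma> (unit j) (unit i)) (\<beta> j) A) * f A powi m
          + (\<alpha> + of_int m) * (\<Sum>j\<in>UNIV. \<beta> j A * pdd (pol \<sigma> (unit j) (unit i)) f A) * f A powi (m - 1)"
        by (simp add: nabla_tw[OF \<beta>p pol_in] tw_eq[OF True] m1 sum_distrib_left sum_distrib_right
            sum.distrib[symmetric] algebra_simps)
      moreover have "(\<Sum>j\<in>UNIV. pdd (pol \<sigma> (unit j) (unit i)) (\<beta> j) A) = (c + of_nat (card (- R))) * \<mu> i A"
      proof -
        have "(\<Sum>j\<in>UNIV. pdd (pol \<sigma> (unit j) (unit i)) (\<beta> j) A)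
          = (\<Sum>j\<in>R. pdd (pol \<sigma> (unit j) (unit i)) (\<beta> j) A) + (\<Sum>j\<in>-R. pdd (pol \<sigma> (unit j) (unit i)) (\<beta> j) A)"
          by (subst sum.union_disjoint[symmetric]) auto
        also have "(\<Sum>j\<in>-R. pdd (pol \<sigma> (unit j) (unit i)) (\<beta> j) A) = of_nat (card (- R)) * \<mu> i A"
          by (simp add: d\<beta>_out)
        also have "(\<Sum>j\<in>R. pdd (pol \<sigma> (unit j) (unit i)) (\<beta> j) A) = c * \<mu> i A"
          using R(2) by (simp add: d\<beta>_in AX sum.delta')
        finally show ?thesis by (simp add: algebra_simps)
      qed
      moreover have "(\<Sum>j\<in>UNIV. \<beta> j A * pdd (pol \<sigma> (unit j) (unit i)) f A) = c * f A * \<mu> i A"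
      proof -
        have "(\<Sum>j\<in>UNIV. \<beta> j A * pdd (pol \<sigma> (unit j) (unit i)) f A)
          = (\<Sum>k\<in>R. \<mu> k A * (\<Sum>j\<in>UNIV. A $ j $ k * pdd (pol \<sigma> (unit j) (unit i)) f A))"
          unfolding \<beta>_def sum_distrib_left sum_distrib_right
          by (subst sum.swap) (simp add: mult_ac)
        also have "\<dots> = (\<Sum>k\<in>R. if i = k then c * f A * \<mu> k A else 0)"
          unfolding col_inv_sum[OF AX] by (intro sum.cong) auto
        finally show ?thesis using R(1) by (simp add: sum.delta)
      qed
      ultimately show ?thesis by (simp add: tw_eq[OF True] m1 algebra_simps)
    qed (simp add: tw_out nabla_tw[OF \<beta>p pol_in])
  qed
  ultimately have "(\<lambda>A. (c * (\<alpha> + of_int m) + c + of_nat (card (- R))) * tw (\<mu> i) m A) \<in> P" by simp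
  from dsub_cmult[OF P this, of "1 / (c * (\<alpha> + of_int m) + c + of_nat (card (- R)))"]
  show ?thesis using nz by (simp add: \<mu>_def)
qed

end

section \<open>Linear coordinates\<close>

interpretation cmat: vector_space "mscale :: complex \<Rightarrow> 'm::finite cmat \<Rightarrow> 'm cmat"
  by unfold_locales (auto simp: vec_eq_iff algebra_simps)

definition matrix_unit :: "'m \<Rightarrow> 'm \<Rightarrow> 'm::finite cmat" where
  "matrix_unit k l = (\<chi> i j. if i = k \<and> j = l then 1 else 0)"

lemma sum_matrix_units: "A = (\<Sum>k\<in>UNIV. \<Sum>l\<in>UNIV. mscale (A $ k $ l) (matrix_unit k l))"
proof -
  have "(\<Sum>k\<in>UNIV. \<Sum>l\<in>UNIV. A $ k $ l * (if i = k \<and> j = l then 1 else 0)) = A $ i $ j" for i j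
  proof -
    have "(\<Sum>l\<in>UNIV. A $ k $ l * (if i = k \<and> j = l then 1 else 0)) = (if k = i then A $ k $ j else 0)" for k
      by (cases "k = i") (auto simp: if_distrib[of "\<lambda>x. _ * x"] cong: if_cong)
    then show ?thesis by simp
  qed
  then show ?thesis by (simp add: vec_eq_iff matrix_unit_def)
qed

lemma cmat_independent_finite:
  assumes "cmat.independent (B :: 'm::finite cmat set)" shows "finite B"
proof -
  define T :: "'m cmat set" where "T = (\<lambda>(k, l). matrix_unit k l) ` UNIV"
  have "A \<in> cmat.span T" for A
    by (subst sum_matrix_units, intro cmat.span_sum cmat.span_scale cmat.span_base) (auto simp: T_def)
  moreover have "finite T" by (simp add: T_def)
  ultimately show ?thesis using cmat.independent_span_bound[of T B] assms by blast
qed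

text \<open>The coordinate functions are restrictions of polynomials of degree \<open>1\<close>; this is needed for counting
  degrees, and \<open>linear_coords\<close> requires them to be restrictions of polynomials only.\<close>

locale coord_space = matrix_space X f for X :: "'m::finite cmat set" and f +
  fixes N b x
  assumes coords: "linear_coords X N b x"
    and x_deg: "j < N \<Longrightarrow> \<exists>q. pdeg 1 q \<and> x j = restr X q"

lemma (in matrix_space) coord_space_exists: "\<exists>N b x. coord_space X f N b x"
proof -
  obtain B where B: "B \<subseteq> X" "cmat.independent B" "X \<subseteq> cmat.span B"
    using cmat.maximal_independent_subset by blast
  have fin: "finite B" by (rule cmat_independent_finite[OF B(2)])
  obtain b where b: "bij_betw b {0..<card B} B" using ex_bij_betw_nat_finite[OF fin] by blast
  define N where "N = card B"
  have b': "bij_betw b {..<N} B" using b by (simp add: N_def lessThan_atLeast0)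
  define E where "E = cmat.extend_basis B"
  have E: "cmat.independent E" "B \<subseteq> E" "cmat.span E = UNIV"
    using B(2) by (auto simp: E_def cmat.independent_extend_basis cmat.extend_basis_superset cmat.span_extend_basis)
  define q where "q j A = cmat.representation E A (b j)" for j A
  have q_add: "q j (A + A') = q j A + q j A'" and q_scale: "q j (mscale c A) = c * q j A" for j A A' c
    using E by (simp_all add: q_def cmat.representation_add cmat.representation_scale)
  have q_zero: "q j 0 = 0" for j using q_scale[of j 0 0] by simp
  have q_sum: "q j (\<Sum>i\<in>I. A i) = (\<Sum>i\<in>I. q j (A i))" for j and I :: "'i set" and A
    by (induction I rule: infinite_finite_induct) (auto simp: q_zero q_add)
  have qdeg: "pdeg 1 (q j)" for j
  proof -
    have qeq: "q j = (\<lambda>A. \<Sum>k\<in>UNIV. \<Sum>l\<in>UNIV. q j (matrix_unit k l) * A $ k $ l)"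
      by (rule ext, subst sum_matrix_units) (simp add: q_sum q_scale mult.commute)
    have ps: "pdeg 1 (\<lambda>A. \<Sum>i\<in>I. h i A)" if "\<And>i. i \<in> I \<Longrightarrow> pdeg 1 (h i)" for I :: "'m set" and h
      using that by (induction I rule: infinite_finite_induct) (auto intro: pdeg.intros)
    have pm: "pdeg 1 (\<lambda>A. q j (matrix_unit k l) * A $ k $ l)" for k l
      using pdeg.mult[OF pdeg.const[of 0 "q j (matrix_unit k l)"] pdeg.entry[of 0 k l]] by simp
    show ?thesis by (subst qeq) (intro ps pm)
  qed
  have bX: "b j \<in> X" and bB: "b j \<in> B" if "j < N" for j using that b' B(1) by (auto simp: bij_betw_def)
  have q_b: "q i (b j) = (if i = j then 1 else 0)" if "i < N" "j < N" for i j
  proof -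
    have "cmat.representation E (b j) = (\<lambda>v. if v = b j then 1 else 0)"
      using E bB[OF that(2)] by (intro cmat.representation_basis) auto
    moreover have "b i = b j \<longleftrightarrow> i = j" using b' that by (auto simp: bij_betw_def inj_on_def)
    ultimately show ?thesis by (simp add: q_def)
  qed
  have q_expand: "A = (\<Sum>j<N. mscale (q j A) (b j))" if "A \<in> X" for A
  proof -
    have As: "A \<in> cmat.span B" using that B(3) by blast
    have "cmat.representation E A = cmat.representation B A"
      by (rule cmat.representation_extend[OF E(1) As E(2)])
    moreover have "(\<Sum>v\<in>B. mscale (cmat.representation B A v) v) = A"
      by (rule cmat.sum_representation_eq[OF B(2) As fin subset_refl])
    ultimately show ?thesis using sum.reindex_bij_betw[OF b', of "\<lambda>v. mscale (cmat.representation B A v) v"]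
      by (simp add: q_def)
  qed
  have "linear_coords X N b (\<lambda>j. restr X (q j))"
    unfolding linear_coords_def
  proof (intro conjI allI ballI impI)
    fix j assume "j < N"
    then show "b j \<in> X" by (rule bX)
    show "restr X (q j) \<in> carrier (coord_ring X whole)"
      using pdeg_poly[OF qdeg] by (auto simp: whole_ring_iff)
  next
    fix A assume "A \<in> X" then show "A = (\<Sum>j<N. mscale (restr X (q j) A) (b j))" using q_expand by simp
  next
    fix c :: "nat \<Rightarrow> complex" and i assume i: "i < N"
    have "(\<Sum>j<N. mscale (c j) (b j)) \<in> X" by (intro sum_in bX) auto
    then show "restr X (q i) (\<Sum>j<N. mscale (c j) (b j)) = c i"
      using i by (simp add: q_sum q_scale q_b if_distrib[of "\<lambda>x. _ * x"] cong: if_cong)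
  qed
  then have "coord_space X f N b (\<lambda>j. restr X (q j))"
    using qdeg by unfold_locales auto
  then show ?thesis by blast
qed

context coord_space
begin

lemma b_in: "j < N \<Longrightarrow> b j \<in> X"
  and x_ring: "j < N \<Longrightarrow> x j \<in> carrier (coord_ring X whole)"
  and x_expand: "A \<in> X \<Longrightarrow> A = (\<Sum>j<N. mscale (x j A) (b j))"
  and x_dual: "i < N \<Longrightarrow> x i (\<Sum>j<N. mscale (c j) (b j)) = c i"
  using coords by (auto simp: linear_coords_def)

definition xp :: "nat \<Rightarrow> 'm cmat \<Rightarrow> complex" where
  "xp j = (SOME q. pdeg 1 q \<and> x j = restr X q)"

lemma xp: assumes "j < N" shows "pdeg 1 (xp j)" "x j = restr X (xp j)" "xp j \<in> poly_funs"
  using someI_ex[OF x_deg[OF assms]] pdeg_poly[of 1 "xp j"] by (auto simp: xp_def)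

lemma x_eq: "j < N \<Longrightarrow> A \<in> X \<Longrightarrow> x j A = xp j A"
  by (simp add: xp)

lemma x_smult: "j < N \<Longrightarrow> m \<in> RF \<Longrightarrow> (\<lambda>A. x j A * m A) = (\<lambda>A. xp j A * m A)"
  by (simp add: xp(2) restr_smult)

lemma x_add: assumes "j < N" "A \<in> X" "B \<in> X" shows "x j (A + B) = x j A + x j B"
proof -
  have "A + B = (\<Sum>j<N. mscale (x j A + x j B) (b j))"
    using x_expand[OF assms(2)] x_expand[OF assms(3)] by (simp add: mscale_add sum.distrib)
  then show ?thesis using x_dual[OF assms(1), of "\<lambda>j. x j A + x j B"] by simp
qed

lemma x_scale: assumes "j < N" "A \<in> X" shows "x j (mscale c A) = c * x j A"
proof -
  have "mscale c A = (\<Sum>j<N. mscale (c * x j A) (b j))"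
    by (subst x_expand[OF assms(2)]) (simp add: cmat.scale_sum_right)
  then show ?thesis using x_dual[OF assms(1), of "\<lambda>j. c * x j A"] by simp
qed

lemma x_b: "i < N \<Longrightarrow> j < N \<Longrightarrow> x i (b j) = (if i = j then 1 else 0)"
proof -
  assume ij: "i < N" "j < N"
  have "b j = (\<Sum>k<N. mscale (if k = j then 1 else 0) (b k))"
    using ij by (simp add: if_distrib[of "\<lambda>c. mscale c _"] cong: if_cong)
  then show ?thesis using x_dual[OF ij(1), of "\<lambda>k. if k = j then 1 else 0"] by simp
qed

lemma pdd_xp: assumes "j < N" "v \<in> X" "A \<in> X" shows "pdd v (xp j) A = x j v"
proof (rule pdd_eqI)
  have "xp j (A + mscale t v) = x j A + t * x j v" for t
    using assms line_in[OF assms(3,2), of t] by (metis x_eq x_add x_scale scale_in)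
  then show "((\<lambda>t. xp j (A + mscale t v)) has_field_derivative x j v) (at 0)"
    by (auto intro!: derivative_eq_intros)
qed

lemma entry_expand: "A \<in> X \<Longrightarrow> A $ k $ l = (\<Sum>j<N. x j A * b j $ k $ l)"
  by (subst x_expand) simp_all

end

section \<open>Holonomicity\<close>

inductive_set mono_span :: "nat \<Rightarrow> (nat \<Rightarrow> 'c \<Rightarrow> complex) \<Rightarrow> nat \<Rightarrow> ('c \<Rightarrow> complex) set"
  for N x D where
  base: "(\<Sum>j<N. e j) \<le> D \<Longrightarrow> (\<lambda>A. \<Prod>j<N. x j A ^ e j) \<in> mono_span N x D"
| add: "g \<in> mono_span N x D \<Longrightarrow> h \<in> mono_span N x D \<Longrightarrow> (\<lambda>A. g A + h A) \<in> mono_span N x D"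
| scale: "g \<in> mono_span N x D \<Longrightarrow> (\<lambda>A. c * g A) \<in> mono_span N x D"

lemma mono_span_mult:
  assumes "g \<in> mono_span N x D" "h \<in> mono_span N x D'"
  shows "(\<lambda>A. g A * h A) \<in> mono_span N x (D + D')"
  using assms(1)
proof induction
  case (base e)
  from assms(2) show ?case
  proof induction
    case (base e')
    have "(\<lambda>A. (\<Prod>j<N. x j A ^ e j) * (\<Prod>j<N. x j A ^ e' j)) = (\<lambda>A. \<Prod>j<N. x j A ^ (e j + e' j))"
      by (simp add: power_add prod.distrib)
    then show ?case using base \<open>(\<Sum>j<N. e j) \<le> D\<close> mono_span.base[of "\<lambda>j. e j + e' j" N "D + D'" x]
      by (simp add: sum.distrib)
  next
    case (add g h)
    then show ?case using mono_span.add by (auto simp: distrib_left)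
  next
    case (scale g c)
    then show ?case using mono_span.scale[of _ N x _ c] by (auto simp: mult.left_commute)
  qed
next
  case (add g h)
  then show ?case using mono_span.add by (auto simp: distrib_right)
next
  case (scale g c)
  then show ?case using mono_span.scale[of _ N x _ c] by (auto simp: mult.assoc)
qed

lemma mono_span_const: "(\<lambda>A. c) \<in> mono_span N x D"
  using mono_span.scale[OF mono_span.base[of "\<lambda>_. 0" N D x], of c] by simp

lemma mono_span_sum: "(\<And>i. i \<in> I \<Longrightarrow> g i \<in> mono_span N x D) \<Longrightarrow> (\<lambda>A. \<Sum>i\<in>I. g i A) \<in> mono_span N x D"
  by (induction I rule: infinite_finite_induct) (auto intro: mono_span_const mono_span.add)

context coord_space
begin

lemma pdeg_mono_span: "pdeg d p \<Longrightarrow> \<exists>g\<in>mono_span N x d. \<forall>A\<in>X. p A = g A"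
proof (induction rule: pdeg.induct)
  case (const d c)
  show ?case by (rule bexI[OF _ mono_span_const[of c]]) simp
next
  case (entry d k l)
  have "x j \<in> mono_span N x (Suc d)" if "j < N" for j
  proof -
    have "x j A ^ (if i = j then 1 else 0) = (if i = j then x j A else 1)" for i A by simp
    moreover have "x i A ^ (if i = j then 1 else 0) = (if i = j then x j A else 1)" for i A by simp
    ultimately have "(\<lambda>A. \<Prod>i<N. x i A ^ (if i = j then 1 else 0)) = x j" using that by simp
    then show ?thesis using mono_span.base[of "\<lambda>i. if i = j then 1 else 0" N "Suc d" x] that by simp
  qed
  then have "(\<lambda>A. \<Sum>j<N. b j $ k $ l * x j A) \<in> mono_span N x (Suc d)"
    by (intro mono_span_sum mono_span.scale) auto
  then show ?case by (rule bexI[rotated]) (simp add: entry_expand mult.commute)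
next
  case (add d p q)
  then obtain g h where *: "g \<in> mono_span N x d" "h \<in> mono_span N x d" "\<forall>A\<in>X. p A = g A" "\<forall>A\<in>X. q A = h A"
    by blast
  show ?case by (rule bexI[OF _ mono_span.add[OF *(1,2)]]) (use * in simp)
next
  case (mult d p e q)
  then obtain g h where *: "g \<in> mono_span N x d" "h \<in> mono_span N x e" "\<forall>A\<in>X. p A = g A" "\<forall>A\<in>X. q A = h A"
    by blast
  show ?case by (rule bexI[OF _ mono_span_mult[OF *(1,2)]]) (use * in simp)
qed

text \<open>Multiplication by a coordinate and differentiation add at most \<open>1\<close> to the pole order and at most
  \<open>d + 1\<close> to the degree of the numerator, \<open>d\<close> being the degree of \<open>f\<close>.\<close>

lemma bernstein_level:
  assumes d: "pdeg d f"
    and z: "(k, m) \<in> bernstein X N b x (F_mod X f \<alpha>) {restr U (\<lambda>_. 1)}"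
  shows "\<exists>p. pdeg (k * (d + 1)) p \<and> m = frac p k"
  using z
proof induction
  case zero
  show ?case by (rule exI[of _ "\<lambda>_. 0"]) (auto simp: frac_def restr_def fun_eq_iff intro: pdeg.const)
next
  case (gen e)
  then show ?case by (intro exI[of _ "\<lambda>_. 1"]) (auto simp: frac_def intro: pdeg.const)
next
  case (add k m m')
  then obtain p q where *: "pdeg (k * (d + 1)) p" "m = frac p k" "pdeg (k * (d + 1)) q" "m' = frac q k" by auto
  have "(\<lambda>A. m A + m' A) = frac (\<lambda>A. p A + q A) k"
    by (auto simp: * frac_def restr_def fun_eq_iff add_divide_distrib)
  then show ?case using pdeg.add[OF *(1,3)] by (auto intro!: exI[of _ "\<lambda>A. p A + q A"])
next
  case (scale k m c)
  then obtain p where *: "pdeg (k * (d + 1)) p" "m = frac p k" by auto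
  have "(\<lambda>A. restr X (\<lambda>_. c) A * m A) = frac (\<lambda>A. c * p A) k"
    by (auto simp: * frac_def restr_def fun_eq_iff U_iff)
  then show ?case using pdeg.mult[OF pdeg.const[of 0 c] *(1)] by (auto intro!: exI[of _ "\<lambda>A. c * p A"])
next
  case (mono k m)
  then obtain p where *: "pdeg (k * (d + 1)) p" "m = frac p k" by auto
  have "m = frac (\<lambda>A. p A * f A) (Suc k)"
    by (auto simp: * frac_def restr_def fun_eq_iff U_iff)
  then show ?case using pdeg_mono[OF pdeg.mult[OF *(1) d], of "Suc k * (d + 1)"]
    by (auto intro!: exI[of _ "\<lambda>A. p A * f A"] simp: algebra_simps)
next
  case (coord k m j)
  then obtain p where *: "pdeg (k * (d + 1)) p" "m = frac p k" by auto
  have "(\<lambda>A. x j A * m A) = frac (\<lambda>A. xp j A * p A * f A) (Suc k)"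
    using coord by (auto simp: * frac_def restr_def fun_eq_iff U_iff x_eq)
  moreover have "pdeg (Suc k * (d + 1)) (\<lambda>A. xp j A * p A * f A)"
    using pdeg.mult[OF pdeg.mult[OF xp(1)[OF coord(2)] *(1)] d] by (simp add: algebra_simps)
  ultimately show ?case by (auto intro!: exI[of _ "\<lambda>A. xp j A * p A * f A"])
next
  case (der k m j)
  then obtain p where *: "pdeg (k * (d + 1)) p" "m = frac p k" by auto
  have pp: "p \<in> poly_funs" "m \<in> RF" using * pdeg_poly by auto
  define h where "h = (\<lambda>A. pdd (b j) p A * f A + (\<alpha> - of_nat k) * p A * pdd (b j) f A)"
  have dd: "pdeg e q \<Longrightarrow> pdeg e (pdd (b j) q)" for e q using pdeg_pdd[of e q "b j"] by (auto intro: pdeg_mono)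
  have "pdeg (k * (d + 1) + d) h"
    unfolding h_def
    using pdeg.mult[OF dd[OF *(1)] d] pdeg.mult[OF pdeg.mult[OF pdeg.const[of 0] *(1)] dd[OF d]]
    by (intro pdeg.add) auto
  then have "pdeg (Suc k * (d + 1)) h" by (rule pdeg_mono) simp
  moreover have "der (F_mod X f \<alpha>) (b j) m = frac h (Suc k)"
    using nabla_frac[OF pp(1) b_in, of j \<alpha> k] der pp(2) by (simp add: der_F_mod *(2) h_def)
  ultimately show ?case by auto
qed

text \<open>By the bound on numerators, level \<open>k\<close> of the Bernstein filtration lies in the span of the monomials of
  degree at most \<open>k * (d + 1)\<close> divided by \<open>f\<^sup>k\<close>, and their number grows like \<open>k\<^sup>N\<close>.\<close>

lemma F_mod_holonomic:
  assumes simple: "simple_dmodule X whole (F_mod X f \<alpha>)"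
  shows "holonomic X (F_mod X f \<alpha>)"
proof -
  define E where "E = {restr U (\<lambda>_. 1 :: complex)}"
  obtain d where d: "pdeg d f" using poly_pdeg[OF f_poly] by blast
  have one: "restr U (\<lambda>_. 1) \<in> RF" by (intro RF_poly poly_funs.const)
  have E_ne: "\<not> E \<subseteq> {\<lambda>_. 0}"
  proof
    assume "E \<subseteq> {\<lambda>_. 0}"
    then have "restr U (\<lambda>_. 1::complex) = (\<lambda>_. 0)" by (simp add: E_def)
    moreover obtain A where "A \<in> U" using f_nonzero by (auto simp: U_iff)
    ultimately show False by (metis restr_apply(1) zero_neq_one)
  qed
  have gen: "P = RF" if "dsubmodule X whole (F_mod X f \<alpha>) P" "E \<subseteq> P" for P
    using simple that E_ne unfolding simple_dmodule_def by auto
  define mon where "mon k e = restr U (\<lambda>A. (\<Prod>j<N. x j A ^ e j) / f A ^ k)" for k and e :: "nat \<Rightarrow> nat"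
  define ex where "ex k = PiE {..<N} (\<lambda>_. {..k * (d + 1)})" for k
  have K: "\<exists>B. finite B \<and> B \<subseteq> RF \<and> card B \<le> (d + 1) ^ N * (k + 1) ^ N \<and>
     (\<forall>V. csubspace X (F_mod X f \<alpha>) V \<and> B \<subseteq> V \<longrightarrow>
        {m. (k, m) \<in> bernstein X N b x (F_mod X f \<alpha>) E} \<subseteq> V)" for k
  proof (intro exI[of _ "mon k ` ex k"] conjI allI impI)
    have fin: "finite (ex k)" unfolding ex_def by (intro finite_PiE) auto
    then show "finite (mon k ` ex k)" by simp
    have "card (mon k ` ex k) \<le> card (ex k)" using fin by (rule card_image_le)
    also have "\<dots> = (k * (d + 1) + 1) ^ N" unfolding ex_def by (simp add: card_PiE)
    also have "\<dots> \<le> ((d + 1) * (k + 1)) ^ N" by (intro power_mono) auto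
    finally show "card (mon k ` ex k) \<le> (d + 1) ^ N * (k + 1) ^ N" by (simp only: power_mult_distrib)
    show "mon k ` ex k \<subseteq> RF"
    proof
      fix g assume "g \<in> mon k ` ex k"
      then obtain e where "g = mon k e" by blast
      also have "mon k e = frac (\<lambda>A. \<Prod>j<N. xp j A ^ e j) k"
        by (auto simp: mon_def frac_def restr_def U_iff x_eq fun_eq_iff intro!: prod.cong)
      also have "\<dots> \<in> RF" by (intro frac_in poly_funs_prod poly_funs_power xp(3)) auto
      finally show "g \<in> RF" .
    qed
  next
    fix V assume "csubspace X (F_mod X f \<alpha>) V \<and> mon k ` ex k \<subseteq> V"
    then have V: "csubspace X (F_mod X f \<alpha>) V" and BV: "mon k ` ex k \<subseteq> V" by blast+
    have VR: "V \<subseteq> RF" using V by (simp add: csubspace_def)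
    have Vadd: "(\<lambda>A. m A + m' A) \<in> V" if "m \<in> V" "m' \<in> V" for m m'
      using V that unfolding csubspace_def by simp
    have Vsc: "(\<lambda>A. c * m A) \<in> V" if "m \<in> V" for m c
    proof -
      have "(\<lambda>A. restr X (\<lambda>_. c) A * m A) \<in> V" using V that unfolding csubspace_def by simp
      then show ?thesis using that VR by (simp add: restr_smult subset_iff)
    qed
    have span: "restr U (\<lambda>A. g A / f A ^ k) \<in> V" if "g \<in> mono_span N x (k * (d + 1))" for g
      using that
    proof induction
      case (base e)
      have "restrict e {..<N} \<in> ex k"
        unfolding ex_def
      proof (intro PiE_I)
        fix j assume "j \<in> {..<N}"
        then have "e j \<le> (\<Sum>j<N. e j)" by (intro member_le_sum) auto
        then show "restrict e {..<N} j \<in> {..k * (d + 1)}" using base \<open>j \<in> {..<N}\<close> by simp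
      qed simp
      then have "mon k (restrict e {..<N}) \<in> V" using BV by blast
      then show ?case by (simp add: mon_def)
    next
      case (add g h)
      then have "(\<lambda>A. restr U (\<lambda>A. g A / f A ^ k) A + restr U (\<lambda>A. h A / f A ^ k) A) \<in> V" by (intro Vadd)
      moreover have "(\<lambda>A. restr U (\<lambda>A. g A / f A ^ k) A + restr U (\<lambda>A. h A / f A ^ k) A)
        = restr U (\<lambda>A. (g A + h A) / f A ^ k)" by (auto simp: restr_def fun_eq_iff add_divide_distrib)
      ultimately show ?case by simp
    next
      case (scale g c)
      then have "(\<lambda>A. c * restr U (\<lambda>A. g A / f A ^ k) A) \<in> V" by (intro Vsc)
      moreover have "(\<lambda>A. c * restr U (\<lambda>A. g A / f A ^ k) A) = restr U (\<lambda>A. c * g A / f A ^ k)"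
        by (auto simp: restr_def fun_eq_iff)
      ultimately show ?case by simp
    qed
    show "{m. (k, m) \<in> bernstein X N b x (F_mod X f \<alpha>) E} \<subseteq> V"
    proof
      fix m assume "m \<in> {m. (k, m) \<in> bernstein X N b x (F_mod X f \<alpha>) E}"
      then obtain p where p: "pdeg (k * (d + 1)) p" "m = frac p k"
        using bernstein_level[OF d, of k m \<alpha>] by (auto simp: E_def)
      from pdeg_mono_span[OF p(1)] obtain g where
        g: "g \<in> mono_span N x (k * (d + 1))" "\<forall>A\<in>X. p A = g A" by blast
      have "m = restr U (\<lambda>A. g A / f A ^ k)"
        using g(2) by (auto simp: p(2) frac_def restr_def fun_eq_iff U_iff)
      then show "m \<in> V" using span[OF g(1)] by simp
    qed
  qed
  show ?thesis unfolding holonomic_def F_mod_simps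
  proof (rule exI[of _ N], rule exI[of _ b], rule exI[of _ x], rule exI[of _ E], intro conjI)
    show "linear_coords X N b x" by (rule coords)
    show "finite E" "E \<subseteq> RF" using one by (auto simp: E_def)
    show "\<forall>P. dsubmodule X whole (F_mod X f \<alpha>) P \<and> E \<subseteq> P \<longrightarrow> P = RF" using gen by blast
    show "\<exists>C. \<forall>k. \<exists>B. finite B \<and> B \<subseteq> RF \<and> card B \<le> C * (k + 1) ^ N \<and>
      (\<forall>V. csubspace X (F_mod X f \<alpha>) V \<and> B \<subseteq> V \<longrightarrow>
        {m. (k, m) \<in> bernstein X N b x (F_mod X f \<alpha>) E} \<subseteq> V)"
      by (intro exI[of _ "(d + 1) ^ N"] allI) (rule K)
  qed
qed

end

section \<open>The characteristic variety\<close>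

inductive_set poly_span :: "('m::finite cmat \<Rightarrow> complex) set \<Rightarrow> ('m cmat \<Rightarrow> complex) set" for E where
  zero: "(\<lambda>_. 0) \<in> poly_span E"
| step: "p \<in> poly_funs \<Longrightarrow> g \<in> E \<Longrightarrow> h \<in> poly_span E \<Longrightarrow> (\<lambda>A. p A * g A + h A) \<in> poly_span E"

lemma poly_span_base: "g \<in> E \<Longrightarrow> g \<in> poly_span E"
  using poly_span.step[OF poly_funs.const[of 1] _ poly_span.zero] by simp

lemma poly_span_add: "g \<in> poly_span E \<Longrightarrow> h \<in> poly_span E \<Longrightarrow> (\<lambda>A. g A + h A) \<in> poly_span E"
proof (induction rule: poly_span.induct)
  case (step p g h')
  then show ?case using poly_span.step[of p g E "\<lambda>A. h' A + h A"] by (simp add: add.assoc)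
qed simp

lemma poly_span_pmult:
  assumes "p \<in> poly_funs" "h \<in> poly_span E" shows "(\<lambda>A. p A * h A) \<in> poly_span E"
  using assms(2)
proof induction
  case (step q g h)
  then show ?case using poly_span.step[of "\<lambda>A. p A * q A" g E "\<lambda>A. p A * h A"]
    by (simp add: assms(1) poly_funs.mult algebra_simps)
qed (simp add: poly_span.zero)

lemma poly_span_sum: "(\<And>i. i \<in> I \<Longrightarrow> g i \<in> poly_span E) \<Longrightarrow> (\<lambda>A. \<Sum>i\<in>I. g i A) \<in> poly_span E"
  by (induction I rule: infinite_finite_induct) (auto intro: poly_span.zero poly_span_add)

lemma poly_span_mono: "E \<subseteq> E' \<Longrightarrow> poly_span E \<subseteq> poly_span E'"
proof
  fix g assume "E \<subseteq> E'" "g \<in> poly_span E"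
  from this(2,1) show "g \<in> poly_span E'" by induction (auto intro: poly_span.intros)
qed

definition linear_field :: "'m::finite cmat set \<Rightarrow> ('m cmat \<Rightarrow> 'm cmat) \<Rightarrow> bool" where
  "linear_field X w \<longleftrightarrow> (\<forall>A\<in>X. w A \<in> X) \<and> (\<forall>A B. w (A + B) = w A + w B) \<and>
     (\<forall>c A. w (mscale c A) = mscale c (w A)) \<and> (\<forall>i j. (\<lambda>A. w A $ i $ j) \<in> poly_funs)"

lemma mpair_sum: "mpair (\<Sum>j\<in>I. mscale (c j) (v j)) \<xi> = (\<Sum>j\<in>I. c j * mpair (v j) \<xi>)"
proof (induction I rule: infinite_finite_induct)
  case (insert i I)
  have "mpair (v + w) \<xi> = mpair v \<xi> + mpair w \<xi>" "mpair (mscale c v) \<xi> = c * mpair v \<xi>" for c and v w :: "'a cmat"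
    by (simp_all add: mpair_def algebra_simps sum.distrib sum_distrib_left)
  then show ?case using insert by simp
qed (simp_all add: mpair_def)

context coord_space
begin

text \<open>The derivatives of \<open>f\<^sup>\<alpha>\<close> of order at most \<open>k\<close> along the coordinate directions generate the \<open>k\<close>-th
  step of the order filtration over \<open>S\<close>.\<close>

primrec gens :: "complex \<Rightarrow> nat \<Rightarrow> ('m cmat \<Rightarrow> complex) set" where
  "gens \<alpha> 0 = {restr U (\<lambda>_. 1)}"
| "gens \<alpha> (Suc k) = gens \<alpha> k \<union> (\<lambda>(j, g). nabla \<alpha> (b j) g) ` ({..<N} \<times> gens \<alpha> k)"

abbreviation "Fil \<alpha> k \<equiv> poly_span (gens \<alpha> k)"

lemma gens_finite: "finite (gens \<alpha> k)"
  by (induction k) auto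

lemma gens_RF: "gens \<alpha> k \<subseteq> RF"
proof (induction k)
  case 0
  have "restr U (\<lambda>_. 1) \<in> RF" by (intro RF_poly poly_funs.const)
  then show ?case by simp
next
  case (Suc k)
  then show ?case using b_in by auto
qed

lemma sub_facts:
  assumes "submodule Q (coord_ring X whole) (F_mod X f \<alpha>)"
  shows sub_zero: "(\<lambda>_. 0) \<in> Q"
    and sub_add: "\<And>g h. g \<in> Q \<Longrightarrow> h \<in> Q \<Longrightarrow> (\<lambda>A. g A + h A) \<in> Q"
    and sub_pmult: "\<And>p g. p \<in> poly_funs \<Longrightarrow> g \<in> Q \<Longrightarrow> (\<lambda>A. p A * g A) \<in> Q"
proof -
  note * = assms[unfolded submodule_whole_iff]
  show "(\<lambda>_. 0) \<in> Q" by (rule conjunct1[OF conjunct2[OF *]])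
  show "(\<lambda>A. g A + h A) \<in> Q" if "g \<in> Q" "h \<in> Q" for g h
    by (rule bspec[OF bspec[OF conjunct1[OF conjunct2[OF conjunct2[OF *]]] that(1)] that(2)])
  show "(\<lambda>A. p A * g A) \<in> Q" if "p \<in> poly_funs" "g \<in> Q" for p g
    by (rule bspec[OF bspec[OF conjunct2[OF conjunct2[OF conjunct2[OF *]]] that(1)] that(2)])
qed

lemma poly_span_least:
  assumes "submodule Q (coord_ring X whole) (F_mod X f \<alpha>)" "E \<subseteq> Q"
  shows "poly_span E \<subseteq> Q"
proof
  fix g assume "g \<in> poly_span E"
  then show "g \<in> Q"
  proof induction
    case zero
    show ?case by (rule sub_zero[OF assms(1)])
  next
    case (step p g h)
    then have "g \<in> Q" using assms(2) by blast
    then show ?case by (intro sub_add[OF assms(1)] sub_pmult[OF assms(1)] step)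
  qed
qed

lemma poly_span_submodule:
  assumes "E \<subseteq> RF" shows "submodule (poly_span E) (coord_ring X whole) (F_mod X f \<alpha>)"
  unfolding submodule_whole_iff
proof (intro conjI ballI)
  show "poly_span E \<subseteq> RF"
  proof
    fix g assume "g \<in> poly_span E"
    then show "g \<in> RF"
    proof induction
      case (step p g h)
      then show ?case using assms by (intro RF_add RF_pmult) auto
    qed simp
  qed
qed (auto intro: poly_span.zero poly_span_add poly_span_pmult)

lemma Fil_RF: "Fil \<alpha> k \<subseteq> RF"
  using poly_span_submodule[OF gens_RF] unfolding submodule_whole_iff by blast

lemma Fil_Suc: "Fil \<alpha> k \<subseteq> Fil \<alpha> (Suc k)"
  by (rule poly_span_mono) auto

lemma nabla_expand:
  assumes "g \<in> RF" "v \<in> X" shows "nabla \<alpha> v g = (\<lambda>A. \<Sum>j<N. x j v * nabla \<alpha> (b j) g A)"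
  by (subst x_expand[OF assms(2)], subst nabla_dir_sum) (auto intro: assms b_in)

lemma nabla_gens: assumes "g \<in> gens \<alpha> k" "v \<in> X" shows "nabla \<alpha> v g \<in> Fil \<alpha> (Suc k)"
proof -
  have "g \<in> RF" using assms gens_RF by blast
  moreover have "(\<lambda>A. x j v * nabla \<alpha> (b j) g A) \<in> Fil \<alpha> (Suc k)" if "j < N" for j
    using assms that by (intro poly_span_pmult[OF poly_funs.const] poly_span_base) auto
  ultimately show ?thesis unfolding nabla_expand[OF \<open>g \<in> RF\<close> assms(2)] by (intro poly_span_sum) auto
qed

lemma nabla_Fil: assumes "g \<in> Fil \<alpha> k" "v \<in> X" shows "nabla \<alpha> v g \<in> Fil \<alpha> (Suc k)"
  using assms(1)
proof induction
  case zero
  have "nabla \<alpha> v (\<lambda>_. 0) = (\<lambda>_. 0)" using nabla_cmult[of "\<lambda>_. 0" v \<alpha> 0] assms by simp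
  then show ?case by (simp add: poly_span.zero)
next
  case (step p g h)
  have g: "g \<in> RF" and h: "h \<in> RF" using step gens_RF Fil_RF by blast+
  have pg: "(\<lambda>A. p A * g A) \<in> RF" by (intro RF_pmult step(1) g)
  have eq: "nabla \<alpha> v (\<lambda>A. p A * g A + h A) = (\<lambda>A. (pdd v p A * g A + p A * nabla \<alpha> v g A) + nabla \<alpha> v h A)"
    unfolding nabla_add[OF pg h assms(2)] nabla_pmult[OF step(1) g assms(2)] ..
  have "g \<in> Fil \<alpha> (Suc k)" using poly_span_base[OF step(2)] Fil_Suc by blast
  then show ?case unfolding eq
    by (intro poly_span_add poly_span_pmult pdd_poly step nabla_gens assms)
qed

lemma Fil_union:
  assumes simple: "simple_dmodule X whole (F_mod X f \<alpha>)"
  shows "(\<Union>k. Fil \<alpha> k) = RF"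
proof -
  have mono: "Fil \<alpha> k \<subseteq> Fil \<alpha> l" if "k \<le> l" for k l
    using that by (induction rule: dec_induct) (use Fil_Suc in blast)+
  have "dsubmodule X whole (F_mod X f \<alpha>) (\<Union>k. Fil \<alpha> k)"
    unfolding dsubmodule_whole_iff
  proof (intro conjI ballI)
    show "(\<Union>k. Fil \<alpha> k) \<subseteq> RF" using Fil_RF by blast
    show "(\<lambda>_. 0) \<in> (\<Union>k. Fil \<alpha> k)" using poly_span.zero by blast
    fix g h assume "g \<in> (\<Union>k. Fil \<alpha> k)" "h \<in> (\<Union>k. Fil \<alpha> k)"
    then obtain k l where "g \<in> Fil \<alpha> k" "h \<in> Fil \<alpha> l" by blast
    moreover have "Fil \<alpha> k \<subseteq> Fil \<alpha> (max k l)" "Fil \<alpha> l \<subseteq> Fil \<alpha> (max k l)" by (simp_all add: mono)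
    ultimately have "(\<lambda>A. g A + h A) \<in> Fil \<alpha> (max k l)" by (intro poly_span_add) auto
    then show "(\<lambda>A. g A + h A) \<in> (\<Union>k. Fil \<alpha> k)" by blast
  next
    fix p :: "'m cmat \<Rightarrow> complex" and g assume "p \<in> poly_funs" "g \<in> (\<Union>k. Fil \<alpha> k)"
    then show "(\<lambda>A. p A * g A) \<in> (\<Union>k. Fil \<alpha> k)" using poly_span_pmult by blast
  next
    fix v g assume "v \<in> X" "g \<in> (\<Union>k. Fil \<alpha> k)"
    then show "nabla \<alpha> v g \<in> (\<Union>k. Fil \<alpha> k)" using nabla_Fil by blast
  qed
  moreover have "(\<Union>k. Fil \<alpha> k) \<noteq> {\<lambda>_. 0}"
  proof
    assume "(\<Union>k. Fil \<alpha> k) = {\<lambda>_. 0}"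
    moreover have "restr U (\<lambda>_. 1) \<in> Fil \<alpha> 0" by (rule poly_span_base) simp
    ultimately have "restr U (\<lambda>_. 1::complex) = (\<lambda>_. 0)" by blast
    moreover obtain A where "A \<in> U" using f_nonzero by (auto simp: U_iff)
    ultimately show False by (metis restr_apply(1) zero_neq_one)
  qed
  ultimately show ?thesis using simple unfolding simple_dmodule_def by auto
qed

lemma Fil_good:
  assumes simple: "simple_dmodule X whole (F_mod X f \<alpha>)"
  shows "good_filtration X (F_mod X f \<alpha>) (Fil \<alpha>)"
  unfolding good_filtration_def
proof (intro conjI allI ballI)
  fix k
  show "fin_gen_submodule X whole (F_mod X f \<alpha>) (Fil \<alpha> k)"
    unfolding fin_gen_submodule_def
  proof (intro conjI exI[of _ "gens \<alpha> k"] allI impI)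
    show "submodule (Fil \<alpha> k) (coord_ring X whole) (F_mod X f \<alpha>)" by (rule poly_span_submodule[OF gens_RF])
    show "finite (gens \<alpha> k)" by (rule gens_finite)
    show "gens \<alpha> k \<subseteq> Fil \<alpha> k" by (rule subsetI, rule poly_span_base)
    fix Q assume "submodule Q (coord_ring X whole) (F_mod X f \<alpha>) \<and> gens \<alpha> k \<subseteq> Q"
    then show "Fil \<alpha> k \<subseteq> Q" by (elim conjE) (rule poly_span_least)
  qed
  show "Fil \<alpha> k \<subseteq> Fil \<alpha> (Suc k)" by (rule Fil_Suc)
  fix v m assume v: "v \<in> X" and m: "m \<in> Fil \<alpha> k"
  have "m \<in> RF" using m Fil_RF by blast
  then show "der (F_mod X f \<alpha>) v m \<in> Fil \<alpha> (Suc k)"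
    unfolding der_F_mod[OF \<open>m \<in> RF\<close>] by (intro nabla_Fil m v)
next
  show "(\<Union>k. Fil \<alpha> k) = carrier (F_mod X f \<alpha>)" using Fil_union[OF simple] by simp
  have "Fil \<alpha> (Suc k) \<subseteq> Q" if Q: "submodule Q (coord_ring X whole) (F_mod X f \<alpha>)" and
    Fk: "Fil \<alpha> k \<subseteq> Q" and d: "\<forall>v\<in>X. \<forall>m\<in>Fil \<alpha> k. der (F_mod X f \<alpha>) v m \<in> Q" for k Q
  proof (rule poly_span_least[OF Q])
    have "nabla \<alpha> (b j) g \<in> Q" if "j < N" "g \<in> gens \<alpha> k" for j g
    proof -
      have "g \<in> Fil \<alpha> k" "g \<in> RF" using that poly_span_base gens_RF by blast+
      then show ?thesis using d b_in[OF that(1)] der_F_mod by metis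
    qed
    moreover have "gens \<alpha> k \<subseteq> Q" using Fk poly_span_base by blast
    ultimately show "gens \<alpha> (Suc k) \<subseteq> Q" by auto
  qed
  then show "\<exists>k0. \<forall>k\<ge>k0. \<forall>Q. submodule Q (coord_ring X whole) (F_mod X f \<alpha>) \<and> Fil \<alpha> k \<subseteq> Q \<and>
      (\<forall>v\<in>X. \<forall>m\<in>Fil \<alpha> k. der (F_mod X f \<alpha>) v m \<in> Q) \<longrightarrow> Fil \<alpha> (Suc k) \<subseteq> Q" by blast
qed

text \<open>The action of a linear vector field \<open>w\<close> on \<open>F\<^sub>\<alpha>\<close>, corrected by a constant so that it kills the generator
  \<open>f\<^sup>\<alpha>\<close> when \<open>w f = c f\<close>.\<close>

definition field_op :: "('m cmat \<Rightarrow> 'm cmat) \<Rightarrow> complex \<Rightarrow> complex \<Rightarrow> ('m cmat \<Rightarrow> complex) \<Rightarrow> 'm cmat \<Rightarrow> complex" where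
  "field_op w c \<alpha> m = (\<lambda>A. (\<Sum>j<N. xp j (w A) * nabla \<alpha> (b j) m A) - \<alpha> * c * m A)"

context
  fixes w :: "'m cmat \<Rightarrow> 'm cmat" and c :: complex
  assumes w: "linear_field X w" and wf: "\<And>A. A \<in> X \<Longrightarrow> pdd (w A) f A = c * f A"
begin

lemma w_in: "A \<in> X \<Longrightarrow> w A \<in> X" and w_add: "w (A + B) = w A + w B" and w_scale: "w (mscale t A) = mscale t (w A)"
  using w by (auto simp: linear_field_def)

lemma xpw_poly: assumes "j < N" shows "(\<lambda>A. xp j (w A)) \<in> poly_funs"
  using w by (intro poly_funs_compose[OF xp(3)[OF assms]]) (auto simp: linear_field_def)

lemma pdd_xpw: assumes "j < N" "v \<in> X" "A \<in> X" shows "pdd v (\<lambda>A. xp j (w A)) A = x j (w v)"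
proof -
  have "pdd v (\<lambda>A. xp j (w A)) A = pdd (w v) (xp j) (w A)"
    by (simp add: pdd_def w_add w_scale)
  then show ?thesis using assms by (simp add: pdd_xp w_in)
qed

lemma field_op_add:
  assumes "g \<in> RF" "h \<in> RF"
  shows "field_op w c \<alpha> (\<lambda>A. g A + h A) = (\<lambda>A. field_op w c \<alpha> g A + field_op w c \<alpha> h A)"
  using assms by (simp add: field_op_def nabla_add b_in sum.distrib algebra_simps)

lemma field_op_pmult:
  assumes "p \<in> poly_funs" "g \<in> RF"
  shows "field_op w c \<alpha> (\<lambda>A. p A * g A)
    = (\<lambda>A. (\<Sum>j<N. xp j (w A) * pdd (b j) p A) * g A + p A * field_op w c \<alpha> g A)"
proof
  fix A
  have "(\<Sum>j<N. xp j (w A) * nabla \<alpha> (b j) (\<lambda>A. p A * g A) A)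
    = (\<Sum>j<N. xp j (w A) * (pdd (b j) p A * g A + p A * nabla \<alpha> (b j) g A))"
    by (intro sum.cong) (simp_all add: nabla_pmult assms b_in)
  then show "field_op w c \<alpha> (\<lambda>A. p A * g A) A
    = (\<Sum>j<N. xp j (w A) * pdd (b j) p A) * g A + p A * field_op w c \<alpha> g A"
    by (simp add: field_op_def sum.distrib sum_distrib_left sum_distrib_right algebra_simps)
qed

lemma field_op_one: "field_op w c \<alpha> (restr U (\<lambda>_. 1)) = (\<lambda>_. 0)"
proof
  fix A
  have one: "restr U (\<lambda>_. 1) = frac (\<lambda>_. 1) 0" by (simp add: frac_def)
  show "field_op w c \<alpha> (restr U (\<lambda>_. 1)) A = 0"
  proof (cases "A \<in> U")
    case True
    then have A: "A \<in> X" "f A \<noteq> 0" by (auto simp: U_iff)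
    have "(\<Sum>j<N. x j (w A) * pdd (b j) f A) = c * f A"
      using wf[OF A(1)] by (subst (asm) x_expand[OF w_in[OF A(1)]]) (simp add: pdd_dir_sum f_poly)
    moreover have "(\<Sum>j<N. xp j (w A) * nabla \<alpha> (b j) (frac (\<lambda>_. 1) 0) A)
      = \<alpha> / f A * (\<Sum>j<N. x j (w A) * pdd (b j) f A)"
      using True A unfolding sum_distrib_left
      by (intro sum.cong) (simp_all add: nabla_frac poly_funs.const b_in frac_eq x_eq w_in)
    ultimately show ?thesis using True A by (simp add: field_op_def one frac_eq)
  next
    case False
    then show ?thesis by (simp add: field_op_def one nabla_frac poly_funs.const b_in frac_out)
  qed
qed

lemma field_op_in: assumes "g \<in> RF" shows "field_op w c \<alpha> g \<in> RF"
proof -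
  have "(\<lambda>A. (\<Sum>j<N. xp j (w A) * nabla \<alpha> (b j) g A) + - (\<alpha> * c * g A)) \<in> RF"
    by (intro RF_add RF_sum RF_uminus RF_cmult RF_pmult xpw_poly nabla_in b_in assms) auto
  then show ?thesis by (simp add: field_op_def)
qed

text \<open>The commutator of two vector fields, one linear and the other constant, is the constant field \<open>w v\<close>
  up to sign. Hence the operator of \<open>w\<close>, which kills the generator, does not raise the order of any of
  its derivatives.\<close>

lemma field_op_nabla:
  assumes g: "g \<in> RF" and v: "v \<in> X"
  shows "field_op w c \<alpha> (nabla \<alpha> v g) = (\<lambda>A. nabla \<alpha> v (field_op w c \<alpha> g) A - nabla \<alpha> (w v) g A)"
proof
  fix A
  show "field_op w c \<alpha> (nabla \<alpha> v g) A = nabla \<alpha> v (field_op w c \<alpha> g) A - nabla \<alpha> (w v) g A"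
  proof (cases "A \<in> U")
    case True
    then have A: "A \<in> X" by (simp add: U_iff)
    have fo: "field_op w c \<alpha> g = (\<lambda>A. (\<Sum>j<N. xp j (w A) * nabla \<alpha> (b j) g A) + (- (\<alpha> * c)) * g A)"
      by (simp add: field_op_def)
    have nsum: "nabla \<alpha> v (\<lambda>A. \<Sum>j\<in>I. h j A) = (\<lambda>A. \<Sum>j\<in>I. nabla \<alpha> v (h j) A)"
      if "\<And>j. j \<in> I \<Longrightarrow> h j \<in> RF" for I :: "nat set" and h
      using that nabla_cmult[of "\<lambda>_. 0" v \<alpha> 0] v
      by (induction I rule: infinite_finite_induct) (auto simp: nabla_add RF_sum)
    have "nabla \<alpha> v (field_op w c \<alpha> g) A
      = (\<Sum>j<N. x j (w v) * nabla \<alpha> (b j) g A + xp j (w A) * nabla \<alpha> v (nabla \<alpha> (b j) g) A)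
        + (- (\<alpha> * c)) * nabla \<alpha> v g A"
    proof -
      have s: "(\<lambda>A. \<Sum>j<N. xp j (w A) * nabla \<alpha> (b j) g A) \<in> RF"
        by (intro RF_sum RF_pmult xpw_poly nabla_in b_in g) auto
      have "nabla \<alpha> v (field_op w c \<alpha> g) A
        = (\<Sum>j<N. nabla \<alpha> v (\<lambda>A. xp j (w A) * nabla \<alpha> (b j) g A) A) + (- (\<alpha> * c)) * nabla \<alpha> v g A"
      proof -
        have "nabla \<alpha> v (\<lambda>A. \<Sum>j<N. xp j (w A) * nabla \<alpha> (b j) g A)
          = (\<lambda>A. \<Sum>j<N. nabla \<alpha> v (\<lambda>A. xp j (w A) * nabla \<alpha> (b j) g A) A)"
          by (rule nsum) (auto intro!: RF_pmult xpw_poly b_in g)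
        then show ?thesis unfolding fo nabla_add[OF s RF_cmult[OF g] v] nabla_cmult[OF g v] by simp
      qed
      moreover have "nabla \<alpha> v (\<lambda>A. xp j (w A) * nabla \<alpha> (b j) g A) A
        = x j (w v) * nabla \<alpha> (b j) g A + xp j (w A) * nabla \<alpha> v (nabla \<alpha> (b j) g) A" if "j < N" for j
        using that by (simp add: nabla_pmult xpw_poly nabla_in b_in g v pdd_xpw A)
      ultimately show ?thesis by simp
    qed
    moreover have "nabla \<alpha> (w v) g A = (\<Sum>j<N. x j (w v) * nabla \<alpha> (b j) g A)"
      by (simp add: nabla_expand[OF g w_in[OF v]])
    moreover have "nabla \<alpha> v (nabla \<alpha> (b j) g) A = nabla \<alpha> (b j) (nabla \<alpha> v g) A" if "j < N" for j
      by (simp add: nabla_commute[OF g v b_in[OF that]])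
    ultimately show ?thesis by (simp add: field_op_def sum.distrib)
  next
    case False
    then show ?thesis using g v by (simp add: RF_out field_op_in nabla_in w_in)
  qed
qed

lemma field_op_Fil: "g \<in> Fil \<alpha> k \<Longrightarrow> field_op w c \<alpha> g \<in> Fil \<alpha> k"
proof -
  have span: "field_op w c \<alpha> g \<in> Fil \<alpha> k" if gen: "\<And>e. e \<in> gens \<alpha> k \<Longrightarrow> field_op w c \<alpha> e \<in> Fil \<alpha> k"
    and "g \<in> Fil \<alpha> k" for k g
    using that(2)
  proof induction
    case zero
    have "field_op w c \<alpha> (\<lambda>_. 0) = (\<lambda>_. 0)"
      using field_op_pmult[of "\<lambda>_. 0" "\<lambda>_. 0" \<alpha>] by (simp add: poly_funs.const)
    then show ?case by (simp add: poly_span.zero)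
  next
    case (step p e h)
    have e: "e \<in> RF" and h: "h \<in> RF" using step gens_RF Fil_RF by blast+
    have eq: "field_op w c \<alpha> (\<lambda>A. p A * e A + h A)
      = (\<lambda>A. ((\<Sum>j<N. xp j (w A) * pdd (b j) p A) * e A + p A * field_op w c \<alpha> e A) + field_op w c \<alpha> h A)"
      unfolding field_op_add[OF RF_pmult[OF step(1) e] h] field_op_pmult[OF step(1) e] ..
    have "(\<lambda>A. \<Sum>j<N. xp j (w A) * pdd (b j) p A) \<in> poly_funs"
      by (intro poly_funs_sum poly_funs.mult xpw_poly pdd_poly step) auto
    then show ?case unfolding eq
      by (intro poly_span_add poly_span_pmult step gen poly_span_base)
  qed
  have gen: "field_op w c \<alpha> e \<in> Fil \<alpha> k" if "e \<in> gens \<alpha> k" for k e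
    using that
  proof (induction k arbitrary: e)
    case 0
    then show ?case by (simp add: field_op_one poly_span.zero)
  next
    case (Suc k)
    consider "e \<in> gens \<alpha> k" | j g where "j < N" "g \<in> gens \<alpha> k" "e = nabla \<alpha> (b j) g" using Suc.prems by auto
    then show ?case
    proof cases
      case 1
      then show ?thesis using Suc.IH Fil_Suc by blast
    next
      case 2
      have g: "g \<in> RF" using 2 gens_RF by blast
      have "(\<lambda>A. nabla \<alpha> (b j) (field_op w c \<alpha> g) A + (-1) * nabla \<alpha> (w (b j)) g A) \<in> Fil \<alpha> (Suc k)"
        using Suc.IH[OF 2(2)] 2
        by (intro poly_span_add poly_span_pmult[OF poly_funs.const] nabla_Fil nabla_gens w_in b_in)
      then show ?thesis using 2 by (simp add: field_op_nabla[OF g b_in])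
    qed
  qed
  show "g \<in> Fil \<alpha> k \<Longrightarrow> field_op w c \<alpha> g \<in> Fil \<alpha> k" by (rule span[OF gen])
qed

text \<open>The operator of \<open>w\<close> has order one and symbol \<open>\<langle>w y, \<xi>\<rangle>\<close>, yet it preserves each step of the
  filtration. So it acts as zero on the associated graded module.\<close>

lemma char_variety_field:
  assumes "(y, \<xi>) \<in> char_variety X (F_mod X f \<alpha>) (Fil \<alpha>)"
  shows "mpair (w y) \<xi> = 0"
proof -
  let ?M = "F_mod X f \<alpha>"
  define g where "g j = restr X (\<lambda>A. xp j (w A))" for j
  have g: "g j \<in> carrier (coord_ring X whole)" if "j < N" for j
    unfolding g_def whole_ring_iff using xpw_poly[OF that] by blast
  have "\<exists>P. symb_op X ?M P (\<lambda>y \<xi>. \<Sum>j<n. g j y * mpair (b j) \<xi>) 1 \<and>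
    (\<forall>m\<in>RF. P m = (\<lambda>A. (\<Sum>j<n. xp j (w A) * nabla \<alpha> (b j) m A) - \<alpha> * c * m A))" if "n \<le> N" for n
    using that
  proof (induction n)
    case 0
    have "restr X (\<lambda>_. - \<alpha> * c) \<in> carrier (coord_ring X whole)" unfolding whole_ring_iff by (blast intro: poly_funs.const)
    from symb_op.lower[OF symb_op.func[OF this, of ?M]] show ?case
      by (intro exI[of _ "\<lambda>m. restr X (\<lambda>_. - \<alpha> * c) \<odot>\<^bsub>?M\<^esub> m"] conjI) (auto simp: restr_smult)
  next
    case (Suc n)
    then obtain P where P: "symb_op X ?M P (\<lambda>y \<xi>. \<Sum>j<n. g j y * mpair (b j) \<xi>) 1"
      "\<forall>m\<in>RF. P m = (\<lambda>A. (\<Sum>j<n. xp j (w A) * nabla \<alpha> (b j) m A) - \<alpha> * c * m A)" by auto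
    have n: "n < N" using Suc by simp
    have Q: "symb_op X ?M (\<lambda>m. g n \<odot>\<^bsub>?M\<^esub> der ?M (b n) m) (\<lambda>y \<xi>. g n y * mpair (b n) \<xi>) 1"
      using symb_op.comp[OF symb_op.func[OF g[OF n]] symb_op.field[OF b_in[OF n]], of ?M] by simp
    have "P m \<oplus>\<^bsub>?M\<^esub> (g n \<odot>\<^bsub>?M\<^esub> der ?M (b n) m)
      = (\<lambda>A. (\<Sum>j<Suc n. xp j (w A) * nabla \<alpha> (b j) m A) - \<alpha> * c * m A)" if "m \<in> RF" for m
      using P(2) that restr_smult[OF nabla_in[OF that b_in[OF n]], of "\<lambda>A. xp n (w A)" \<alpha>]
      by (simp add: der_F_mod g_def fun_eq_iff)
    with symb_op.add[OF P(1) Q] show ?case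
      by (intro exI[of _ "\<lambda>m. P m \<oplus>\<^bsub>?M\<^esub> (g n \<odot>\<^bsub>?M\<^esub> der ?M (b n) m)"]) simp
  qed
  from this[of N] obtain P where P: "symb_op X ?M P (\<lambda>y \<xi>. \<Sum>j<N. g j y * mpair (b j) \<xi>) 1"
    "\<forall>m\<in>RF. P m = field_op w c \<alpha> m" by (auto simp: field_op_def)
  have y: "y \<in> X" using assms by (simp add: char_variety_def)
  have "\<forall>k. \<forall>m\<in>Fil \<alpha> k. P m \<in> (if k + 1 = 0 then {\<zero>\<^bsub>?M\<^esub>} else Fil \<alpha> (k + 1 - 1))"
    using P(2) field_op_Fil Fil_RF by (auto simp: subset_iff)
  then have "(\<Sum>j<N. g j y * mpair (b j) \<xi>) = 0" using assms P(1) unfolding char_variety_def by blast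
  moreover have "mpair (w y) \<xi> = (\<Sum>j<N. x j (w y) * mpair (b j) \<xi>)"
    by (subst x_expand[OF w_in[OF y]]) (rule mpair_sum)
  ultimately show ?thesis using y by (simp add: g_def x_eq w_in)
qed

end

end

section \<open>Tangent spaces of orbits\<close>

definition entry_norm :: "'m::finite cmat \<Rightarrow> real" where
  "entry_norm M = (\<Sum>i\<in>UNIV. \<Sum>j\<in>UNIV. cmod (M $ i $ j))"

lemma norm_matrix_vector_le: "norm (M *v y) \<le> entry_norm M * norm y" for M :: "'m::finite cmat"
proof -
  have "norm (M *v y) \<le> (\<Sum>i\<in>UNIV. cmod ((M *v y) $ i))"
    unfolding norm_vec_def by (rule L2_set_le_sum) simp
  also have "\<dots> \<le> (\<Sum>i\<in>UNIV. \<Sum>j\<in>UNIV. cmod (M $ i $ j) * norm y)"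
    unfolding matrix_vector_mult_def
    by (auto intro!: sum_mono order.trans[OF norm_sum] mult_left_mono Finite_Cartesian_Product.norm_nth_le simp: norm_mult)
  also have "\<dots> = entry_norm M * norm y"
    by (simp add: entry_norm_def sum_distrib_right)
  finally show ?thesis .
qed

lemma matrix_kernel_subspace: "subspace {y. (M :: 'm::finite cmat) *v y = 0}"
  by (auto simp: subspace_def matrix_vector_right_distrib matrix_vector_mul_bounded_linear linear_simps)

text \<open>Rank is constant on the orbits; it is measured by the real dimension of the kernel, which suits the
  limit along a real curve below.\<close>

lemma dim_kernel_orbit:
  fixes x :: "'m::finite cmat"
  assumes "invertible g" "invertible h"
  shows "dim {y. (g ** x ** h) *v y = 0} = dim {y. x *v y = 0}"
proof -
  obtain h' where h: "h ** h' = mat 1" "h' ** h = mat 1" using assms(2) by (auto simp: invertible_def)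
  obtain g' where g: "g' ** g = mat 1" using assms(1) by (auto simp: invertible_def)
  have "{y. (g ** x ** h) *v y = 0} = (*v) h' ` {y. x *v y = 0}"
  proof (intro equalityI subsetI)
    fix y assume "y \<in> {y. (g ** x ** h) *v y = 0}"
    then have "g' *v ((g ** x ** h) *v y) = 0" by simp
    then have "((g' ** g) ** x) *v (h *v y) = 0" by (simp only: matrix_vector_mul_assoc matrix_mul_assoc)
    then have "x *v (h *v y) = 0" by (simp add: g)
    moreover have "y = h' *v (h *v y)" by (simp add: matrix_vector_mul_assoc h)
    ultimately show "y \<in> (*v) h' ` {y. x *v y = 0}" by blast
  next
    fix y assume "y \<in> (*v) h' ` {y. x *v y = 0}"
    then obtain z where z: "y = h' *v z" "x *v z = 0" by blast
    have "(g ** x ** h) *v y = g *v (x *v ((h ** h') *v z))"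
      unfolding z(1) by (simp only: matrix_vector_mul_assoc matrix_mul_assoc)
    then show "y \<in> {y. (g ** x ** h) *v y = 0}" by (simp add: h z)
  qed
  moreover have "inj ((*v) h')"
    by (rule inj_on_inverseI[of _ "(*v) h"]) (simp add: matrix_vector_mul_assoc h)
  ultimately show ?thesis
    using dim_image_eq[of "(*v) h'" "{y. x *v y = 0}"] matrix_vector_mul_bounded_linear[of h']
    by (simp add: bounded_linear.linear inj_on_subset)
qed

text \<open>Let \<open>\<gamma>\<close> be a curve with \<open>\<gamma> 0 = x\<close> and derivative \<open>v\<close>. As \<open>\<gamma> t\<close> has the same rank as \<open>x\<close>, a kernel
  vector \<open>b\<close> of \<open>x\<close> can be followed by kernel vectors \<open>w t + b\<close> of \<open>\<gamma> t\<close> with \<open>w t\<close> in a fixed complement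
  \<open>W\<close> of the kernel of \<open>x\<close>, on which \<open>x\<close> is bounded below; this forces \<open>w t\<close> to tend to \<open>0\<close>. Pairing
  \<open>(\<gamma> t - x) (w t + b) / t = - x (w t) / t\<close> with \<open>a\<close> gives \<open>0\<close>, and in the limit \<open>a v b = 0\<close>.\<close>

lemma tangent_pairing:
  fixes x v :: "'m::finite cmat"
  assumes Y: "\<And>y. y \<in> Y \<Longrightarrow> \<exists>g h. invertible g \<and> invertible h \<and> y = g ** x ** h"
    and v: "v \<in> tangent_space Y x" and a: "a v* x = 0" and b: "x *v b = 0"
  shows "(\<Sum>i\<in>UNIV. a $ i * (v *v b) $ i) = 0"
proof (cases "b = 0")
  case False
  obtain \<gamma> where \<gamma>: "\<gamma> 0 = x" "\<And>t. \<gamma> t \<in> Y" "(\<gamma> has_vector_derivative v) (at (0::real))"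
    using v by (auto simp: tangent_space_def)
  define K where "K M = {y. (M :: 'm cmat) *v y = 0}" for M
  define W where "W = {w \<in> UNIV. \<forall>y \<in> K x. orthogonal y w}"
  have subK: "subspace (K M)" for M unfolding K_def by (rule matrix_kernel_subspace)
  have subW: "subspace W" unfolding W_def
    by (auto simp: subspace_def orthogonal_def inner_right_distrib)
  have dimW: "dim W + dim (K x) = dim (UNIV :: (complex ^ 'm) set)"
    unfolding W_def by (rule dim_subspace_orthogonal_to_vectors[OF subK subspace_UNIV]) simp
  have KW: "w = 0" if "w \<in> W" "x *v w = 0" for w
  proof -
    have "orthogonal w w" using that by (auto simp: W_def K_def)
    then show ?thesis by (simp add: orthogonal_def)
  qed
  obtain e where e: "e > 0" "\<And>w. w \<in> W \<Longrightarrow> e * norm w \<le> norm (x *v w)"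
    using injective_imp_isometric[OF closed_subspace[OF subW] subW matrix_vector_mul_bounded_linear[of x]] KW
    by (metis mult.commute)
  have bW: "b \<notin> span W"
    using KW b False span_eq_iff[THEN iffD2, OF subW] by metis
  define D where "D t = \<gamma> t - x" for t
  have exists_w: "\<exists>w\<in>W. \<gamma> t *v (w + b) = 0" if small: "entry_norm (D t) < e" for t
  proof -
    obtain g h where gh: "invertible g" "invertible h" "\<gamma> t = g ** x ** h" using Y[OF \<gamma>(2)] by blast
    have dimK: "dim (K (\<gamma> t)) = dim (K x)" unfolding gh(3) K_def by (rule dim_kernel_orbit[OF gh(1,2)])
    define W' where "W' = span (insert b W)"
    have "dim W' = dim W + 1" using bW by (simp add: W'_def dim_insert)
    then have "dim W' + dim (K (\<gamma> t)) > dim (UNIV :: (complex ^ 'm) set)" using dimW dimK by simp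
    moreover have "dim {y + z |y z. y \<in> W' \<and> z \<in> K (\<gamma> t)} + dim (W' \<inter> K (\<gamma> t)) = dim W' + dim (K (\<gamma> t))"
      by (rule dim_sums_Int) (simp_all add: W'_def subK)
    moreover have "dim {y + z |y z. y \<in> W' \<and> z \<in> K (\<gamma> t)} \<le> dim (UNIV :: (complex ^ 'm) set)"
      by (rule dim_subset) simp
    ultimately have "dim (W' \<inter> K (\<gamma> t)) \<noteq> 0" by linarith
    then obtain y where y: "y \<in> W'" "\<gamma> t *v y = 0" "y \<noteq> 0" unfolding dim_eq_0 K_def by blast
    obtain \<beta> where "y - \<beta> *\<^sub>R b \<in> span W" using y(1) unfolding W'_def span_insert by blast
    then have w: "y - \<beta> *\<^sub>R b \<in> W" using span_eq_iff[THEN iffD2, OF subW] by simp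
    have "\<beta> \<noteq> 0"
    proof
      assume "\<beta> = 0"
      then have yW: "y \<in> W" using w by simp
      have "x *v y = - (D t *v y)" using y(2) by (simp add: D_def matrix_vector_mult_diff_rdistrib)
      then have "e * norm y \<le> entry_norm (D t) * norm y"
        using e(2)[OF yW] norm_matrix_vector_le[of "D t" y] by simp
      then show False using small y(3) by (simp add: mult_le_cancel_right)
    qed
    define w' where "w' = (1 / \<beta>) *\<^sub>R (y - \<beta> *\<^sub>R b)"
    have "w' \<in> W" unfolding w'_def by (intro subspace_scale[OF subW] w)
    moreover have "w' + b = (1 / \<beta>) *\<^sub>R y" using \<open>\<beta> \<noteq> 0\<close> by (simp add: w'_def scaleR_diff_right)
    then have "\<gamma> t *v (w' + b) = 0"
      using y(2) linear_scale[OF bounded_linear.linear[OF matrix_vector_mul_bounded_linear[of "\<gamma> t"]]] by simp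
    ultimately show ?thesis by blast
  qed
  define E where "E t = (1 / t) *\<^sub>R D t" for t
  have E_lim: "(E \<longlongrightarrow> v) (at 0)"
  proof -
    have "((\<lambda>h. norm (\<gamma> h - \<gamma> 0 - h *\<^sub>R v) / norm h) \<longlongrightarrow> 0) (at 0)"
      using \<gamma>(3) unfolding has_vector_derivative_def has_derivative_at by simp
    moreover have "norm (\<gamma> h - \<gamma> 0 - h *\<^sub>R v) / norm h = norm (E h - v)" if "h \<noteq> 0" for h
    proof -
      have "E h - v = (1 / h) *\<^sub>R (\<gamma> h - \<gamma> 0 - h *\<^sub>R v)"
        using that by (simp add: E_def D_def \<gamma>(1) scaleR_diff_right)
      then show ?thesis by (simp add: divide_inverse)
    qed
    then have "eventually (\<lambda>h. norm (\<gamma> h - \<gamma> 0 - h *\<^sub>R v) / norm h = norm (E h - v)) (at 0)"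
      by (simp add: eventually_at_filter)
    ultimately have "((\<lambda>h. norm (E h - v)) \<longlongrightarrow> 0) (at 0)" by (rule Lim_transform_eventually)
    then show ?thesis by (simp add: tendsto_norm_zero_iff LIM_zero_iff)
  qed
  have D_lim: "(D \<longlongrightarrow> 0) (at 0)"
  proof -
    have "((\<lambda>t. t *\<^sub>R E t) \<longlongrightarrow> 0 *\<^sub>R v) (at 0)" by (intro tendsto_scaleR tendsto_ident_at E_lim)
    moreover have "eventually (\<lambda>t. t *\<^sub>R E t = D t) (at 0)" by (simp add: eventually_at_filter E_def)
    ultimately show ?thesis using Lim_transform_eventually by fastforce
  qed
  have N_lim: "((\<lambda>t. entry_norm (D t)) \<longlongrightarrow> 0) (at 0)"
  proof -
    have "((\<lambda>t. entry_norm (D t)) \<longlongrightarrow> entry_norm (0 :: 'm cmat)) (at 0)"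
      unfolding entry_norm_def by (intro tendsto_intros D_lim)
    then show ?thesis by (simp add: entry_norm_def)
  qed
  define w where "w t = (SOME w. w \<in> W \<and> \<gamma> t *v (w + b) = 0)" for t
  have w: "w t \<in> W" "\<gamma> t *v (w t + b) = 0" if "entry_norm (D t) < e" for t
    using someI_ex[OF exists_w[OF that, unfolded Bex_def]] by (auto simp: w_def)
  have ev: "eventually (\<lambda>t. entry_norm (D t) < e / 2) (at 0)"
    using order_tendstoD(2)[OF N_lim, of "e / 2"] e(1) by simp
  have Dw: "D t *v (w t + b) = - (x *v w t)" if "entry_norm (D t) < e" for t
  proof -
    have "D t *v (w t + b) = \<gamma> t *v (w t + b) - (x *v w t + x *v b)"
      by (simp add: D_def matrix_vector_mult_diff_rdistrib matrix_vector_right_distrib)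
    then show ?thesis using w(2)[OF that] b by simp
  qed
  have "eventually (\<lambda>t. norm (w t) \<le> (2 / e * norm b) * entry_norm (D t)) (at 0)"
    using ev
  proof eventually_elim
    case (elim t)
    then have le: "entry_norm (D t) < e" using e(1) by simp
    have "e * norm (w t) \<le> norm (D t *v (w t + b))" using e(2)[OF w(1)[OF le]] Dw[OF le] by simp
    also have "\<dots> \<le> entry_norm (D t) * (norm (w t) + norm b)"
      by (rule order.trans[OF norm_matrix_vector_le])
        (intro mult_left_mono norm_triangle_ineq, simp add: entry_norm_def sum_nonneg)
    also have "\<dots> \<le> e / 2 * norm (w t) + entry_norm (D t) * norm b"
      using mult_right_mono[OF less_imp_le[OF elim], of "norm (w t)"] by (simp add: distrib_left)
    finally show ?case using e(1) by (simp add: field_simps)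
  qed
  then have w_lim: "(w \<longlongrightarrow> 0) (at 0)"
    by (rule Lim_null_comparison) (rule tendsto_mult_right_zero[OF N_lim])
  have "((\<lambda>t. \<Sum>i\<in>UNIV. a $ i * (E t *v (w t + b)) $ i) \<longlongrightarrow> (\<Sum>i\<in>UNIV. a $ i * (v *v (0 + b)) $ i)) (at 0)"
    unfolding matrix_vector_mult_def
    by (simp only: vec_lambda_beta) (intro tendsto_intros E_lim w_lim)
  moreover have "eventually (\<lambda>t. (\<Sum>i\<in>UNIV. a $ i * (E t *v (w t + b)) $ i) = 0) (at 0)"
    using ev
  proof eventually_elim
    case (elim t)
    then have le: "entry_norm (D t) < e" using e(1) by simp
    have "(\<Sum>i\<in>UNIV. a $ i * (x *v w t) $ i) = (\<Sum>k\<in>UNIV. (a v* x) $ k * w t $ k)"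
      unfolding matrix_vector_mult_def vector_matrix_mult_def vec_lambda_beta sum_distrib_left sum_distrib_right
      by (subst sum.swap) (simp add: mult_ac)
    then have "(\<Sum>i\<in>UNIV. a $ i * (x *v w t) $ i) = 0" by (simp add: a)
    moreover have "E t *v (w t + b) = (1 / t) *\<^sub>R (D t *v (w t + b))"
      unfolding E_def matrix_vector_mult_def by (simp add: vec_eq_iff scaleR_sum_right)
    ultimately show ?case by (simp add: Dw[OF le] scaleR_sum_right[symmetric] sum_negf)
  qed
  ultimately have "(\<Sum>i\<in>UNIV. a $ i * (v *v (0 + b)) $ i) = 0"
    by (intro tendsto_unique[OF at_neq_bot _ tendsto_eventually])
  then show ?thesis by simp
qed simp

lemma generalized_inverse:
  fixes x :: "'m::finite cmat"
  shows "\<exists>y. x ** y ** x = x"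
proof -
  obtain g where g: "Vector_Spaces.linear (*s) (*s) g" "\<And>v. v \<in> range ((*v) x) \<Longrightarrow> x *v g v = v"
    using vec.linear_exists_right_inverse_on[OF matrix_vector_mul_linear_gen[of x] vec.subspace_UNIV] by auto
  have "(x ** matrix g ** x) *v z = x *v z" for z
    by (simp add: matrix_vector_mul_assoc[symmetric] matrix_works[OF g(1)] g(2))
  then show ?thesis by (metis matrix_eq)
qed

lemma matrix_diff_distrib:
  fixes A B C :: "'m::finite cmat"
  shows matrix_diff_ldistrib: "A ** (B - C) = A ** B - A ** C"
    and matrix_diff_rdistrib: "(A - B) ** C = A ** C - B ** C"
  by (simp_all add: vec_eq_iff matrix_matrix_mult_def algebra_simps sum_subtractf)

text \<open>With a generalized inverse \<open>y\<close> of \<open>x\<close>, the rows of \<open>P = 1 - x y\<close> span the left kernel of \<open>x\<close> and the columns of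
  \<open>Q = 1 - y x\<close> its right kernel, so \<open>P v Q = 0\<close>. The conditions on \<open>\<xi>\<close> say \<open>\<xi>\<^sup>T = Q \<xi>\<^sup>T P\<close>, and the pairing
  is the trace of \<open>v \<xi>\<^sup>T\<close>, that is of \<open>P v Q \<xi>\<^sup>T\<close>.\<close>

lemma tangent_conormal:
  fixes x :: "'m::finite cmat"
  assumes Y: "\<And>y. y \<in> Y \<Longrightarrow> \<exists>g h. invertible g \<and> invertible h \<and> y = g ** x ** h"
    and v: "v \<in> tangent_space Y x"
    and \<xi>: "transpose x ** \<xi> = 0" "\<xi> ** transpose x = 0"
  shows "mpair v \<xi> = 0"
proof -
  obtain y where y: "x ** y ** x = x" using generalized_inverse by blast
  define P Q where "P = mat 1 - x ** y" and "Q = mat 1 - y ** x"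
  have Px: "P ** x = 0" using y by (simp add: P_def matrix_diff_rdistrib)
  have xQ: "x ** Q = 0" using y by (simp add: Q_def matrix_diff_ldistrib matrix_mul_assoc)
  have PvQ: "P ** v ** Q = 0"
  proof -
    have "(P ** v ** Q) $ i $ j = 0" for i j
    proof -
      have "P $ i v* x = 0" using Px by (simp add: vec_eq_iff matrix_matrix_mult_def vector_matrix_mult_def mult.commute)
      moreover have "x *v column j Q = 0"
        using xQ by (simp add: vec_eq_iff matrix_matrix_mult_def matrix_vector_mult_def column_def)
      ultimately have "(\<Sum>k\<in>UNIV. P $ i $ k * (v *v column j Q) $ k) = 0"
        by (intro tangent_pairing[where Y = Y and x = x] v) (use Y in auto)
      moreover have "(P ** v ** Q) $ i $ j = (\<Sum>k\<in>UNIV. P $ i $ k * (v *v column j Q) $ k)"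
        unfolding matrix_mul_assoc[symmetric]
        by (simp add: matrix_matrix_mult_def matrix_vector_mult_def column_def)
      ultimately show ?thesis by simp
    qed
    then show ?thesis by (simp add: vec_eq_iff)
  qed
  let ?\<eta> = "transpose \<xi>"
  have \<eta>: "x ** ?\<eta> = 0" "?\<eta> ** x = 0"
    using arg_cong[OF \<xi>(2), of transpose] arg_cong[OF \<xi>(1), of transpose]
    by (simp_all add: matrix_transpose_mul transpose_def[of 0] vec_eq_iff)
  have "Q ** ?\<eta> = ?\<eta>" by (simp add: Q_def matrix_diff_rdistrib matrix_mul_assoc[symmetric] \<eta>)
  moreover have "?\<eta> ** P = ?\<eta>" by (simp add: P_def matrix_diff_ldistrib matrix_mul_assoc \<eta>)
  ultimately have "v ** ?\<eta> = (v ** Q ** ?\<eta>) ** P" by (simp add: matrix_mul_assoc[symmetric])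
  then have "trace (v ** ?\<eta>) = trace (P ** (v ** Q ** ?\<eta>))" by (simp add: trace_mul_sym[of P])
  also have "P ** (v ** Q ** ?\<eta>) = (P ** v ** Q) ** ?\<eta>" by (simp add: matrix_mul_assoc)
  finally have "trace (v ** ?\<eta>) = 0" by (simp add: PvQ trace_def)
  moreover have "mpair v \<xi> = trace (v ** ?\<eta>)"
    by (simp add: mpair_def trace_def matrix_matrix_mult_def transpose_def)
  ultimately show ?thesis by simp
qed

lemma conormal_unionI:
  fixes X :: "'m::finite cmat set"
  assumes act: "\<And>g y. g \<in> G \<Longrightarrow> \<exists>a b. invertible a \<and> invertible b \<and> act g y = a ** y ** b"
    and one: "e \<in> G" "act e y = y"
    and y: "y \<in> X" "\<xi> \<in> X" "transpose y ** \<xi> = 0" "\<xi> ** transpose y = 0"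
  shows "(y, \<xi>) \<in> conormal_union X G act"
proof -
  have "y \<in> orbit G act y" unfolding orbit_def using one by (metis imageI)
  moreover have "mpair v \<xi> = 0" if "v \<in> tangent_space (orbit G act y) y" for v
    by (rule tangent_conormal[OF _ that y(3,4)]) (use act in \<open>auto simp: orbit_def\<close>)
  ultimately have "(y, \<xi>) \<in> conormal_variety X (orbit G act y)"
    unfolding conormal_variety_def using y by (intro closure_subset[THEN subsetD]) auto
  then show ?thesis unfolding conormal_union_def using y by blast
qed

section \<open>Exactness of Koszul complexes\<close>

text \<open>The differential of the Koszul complex of the commuting operators \<open>u \<mapsto> u \<circ> act j - \<phi>\<^sub>j u\<close> on
  functionals \<open>u\<close>. Below, \<open>C\<close> is the domain of the functionals, as a subset of the type, and \<open>Lin\<close> says which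
  functionals are admitted.\<close>

definition kd :: "(nat \<Rightarrow> 'a \<Rightarrow> 'a) \<Rightarrow> (nat \<Rightarrow> 'k::comm_ring_1) \<Rightarrow> (nat set \<Rightarrow> 'a \<Rightarrow> 'k) \<Rightarrow> nat set \<Rightarrow> 'a \<Rightarrow> 'k" where
  "kd act \<phi> z J m = (\<Sum>j\<in>J. (-1) ^ card {k \<in> J. k < j} * (z (J - {j}) (act j m) - \<phi> j * z (J - {j}) m))"

lemma kd_cong: "(\<And>j m. j \<in> J \<Longrightarrow> z (J - {j}) m = z' (J - {j}) m) \<Longrightarrow> kd act \<phi> z J m = kd act \<phi> z' J m"
  by (simp add: kd_def)

lemma kd_empty [simp]: "kd act \<phi> z {} m = 0"
  by (simp add: kd_def)

lemma kd_diff: "kd act \<phi> (\<lambda>J m. c J m - s * d J m) J m = kd act \<phi> c J m - s * kd act \<phi> d J m"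
  by (simp add: kd_def sum_distrib_left sum_subtractf[symmetric] algebra_simps)

lemma kd_insert:
  assumes J: "J \<subseteq> {..<k}"
  shows "kd act \<phi> c (insert k J) m
    = kd act \<phi> (\<lambda>J. c (insert k J)) J m + (-1) ^ card J * (c J (act k m) - \<phi> k * c J m)"
proof -
  have fin: "finite J" and kJ: "k \<notin> J" using J finite_subset by auto
  have "{l \<in> insert k J. l < k} = J" using J by auto
  moreover have "{l \<in> insert k J. l < j} = {l \<in> J. l < j}" "insert k J - {j} = insert k (J - {j})" if "j \<in> J" for j
    using that J kJ by auto
  moreover have "insert k J - {k} = J" using kJ by auto
  ultimately show ?thesis
    unfolding kd_def sum.insert[OF fin kJ] by (simp add: add.commute cong: sum.cong)
qed

lemma kd_singleton [simp]: "kd act \<phi> z {j} m = z {} (act j m) - \<phi> j * z {} m"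
  using kd_insert[of "{}" j act \<phi> z m] by simp

lemma kd_shift:
  assumes comm: "\<And>i j m. m \<in> C \<Longrightarrow> act i (act j m) = act j (act i m)" and m: "m \<in> C"
  shows "kd act \<phi> (\<lambda>J m. c J (act k m) - \<phi> k * c J m) J m = kd act \<phi> c J (act k m) - \<phi> k * kd act \<phi> c J m"
  by (simp add: kd_def comm[OF m, of k] sum_distrib_left sum_subtractf[symmetric] algebra_simps)

text \<open>Induction on the number \<open>k\<close> of operators. A cocycle for \<open>k + 1\<close> operators restricts to a cocycle for
  the first \<open>k\<close> of them, which bounds some \<open>c'\<close>. After subtraction of the boundary of \<open>c'\<close>, the components
  at the index sets containing \<open>k\<close> form a cocycle \<open>z1\<close> of degree \<open>i - 1\<close>. It bounds by induction if
  \<open>i > 1\<close>. For \<open>i = 1\<close> it is an element of the common kernel of the first \<open>k\<close> operators, and the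
  assumption of surjectivity applies.\<close>

lemma koszul_exact:
  fixes \<phi> :: "nat \<Rightarrow> 'k::comm_ring_1" and act :: "nat \<Rightarrow> 'a \<Rightarrow> 'a"
  assumes act: "\<And>j m. j < N \<Longrightarrow> m \<in> C \<Longrightarrow> act j m \<in> C"
    and comm: "\<And>i j m. m \<in> C \<Longrightarrow> act i (act j m) = act j (act i m)"
    and Lin0: "Lin (\<lambda>_. 0)"
    and Lin_add: "\<And>u v. Lin u \<Longrightarrow> Lin v \<Longrightarrow> Lin (\<lambda>m. u m + v m)"
    and Lin_diff: "\<And>u v s. Lin u \<Longrightarrow> Lin v \<Longrightarrow> Lin (\<lambda>m. u m - s * v m)"
    and Lin_act: "\<And>j u. j < N \<Longrightarrow> Lin u \<Longrightarrow> Lin (\<lambda>m. u (act j m) - \<phi> j * u m)"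
    and surj: "\<And>k v. k < N \<Longrightarrow> Lin v \<Longrightarrow> (\<And>j m. j < k \<Longrightarrow> m \<in> C \<Longrightarrow> v (act j m) = \<phi> j * v m) \<Longrightarrow>
      \<exists>u. Lin u \<and> (\<forall>j<k. \<forall>m\<in>C. u (act j m) = \<phi> j * u m) \<and> (\<forall>m\<in>C. u (act k m) - \<phi> k * u m = v m)"
  shows "k \<le> N \<Longrightarrow> 1 \<le> i \<Longrightarrow> (\<And>J. J \<subseteq> {..<k} \<Longrightarrow> card J = i \<Longrightarrow> Lin (z J)) \<Longrightarrow>
    (\<And>J m. J \<subseteq> {..<k} \<Longrightarrow> card J = Suc i \<Longrightarrow> m \<in> C \<Longrightarrow> kd act \<phi> z J m = 0) \<Longrightarrow>
    \<exists>c. (\<forall>J. J \<subseteq> {..<k} \<and> Suc (card J) = i \<longrightarrow> Lin (c J)) \<and>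
        (\<forall>J. J \<subseteq> {..<k} \<and> card J = i \<longrightarrow> (\<forall>m\<in>C. z J m = kd act \<phi> c J m))"
proof (induction k arbitrary: i z)
  case 0
  then show ?case by (intro exI[of _ "\<lambda>_ _. 0"]) (auto simp: Lin0)
next
  case (Suc k)
  have k: "k < N" using Suc.prems(1) by simp
  have "\<exists>c. (\<forall>J. J \<subseteq> {..<k} \<and> Suc (card J) = i \<longrightarrow> Lin (c J)) \<and>
        (\<forall>J. J \<subseteq> {..<k} \<and> card J = i \<longrightarrow> (\<forall>m\<in>C. z J m = kd act \<phi> c J m))"
    using Suc.prems by (intro Suc.IH) (auto simp: lessThan_Suc subset_insertI2)
  then obtain c' where c'L: "\<And>J. J \<subseteq> {..<k} \<Longrightarrow> Suc (card J) = i \<Longrightarrow> Lin (c' J)"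
    and c'z: "\<And>J m. J \<subseteq> {..<k} \<Longrightarrow> card J = i \<Longrightarrow> m \<in> C \<Longrightarrow> z J m = kd act \<phi> c' J m" by blast
  have cardk: "card (insert k J) = Suc (card J)" "k \<notin> J" "insert k J \<subseteq> {..<Suc k}" if "J \<subseteq> {..<k}" for J
    using that finite_subset[OF that] by (auto simp: card_insert_if)
  define z1 where "z1 J = (\<lambda>m. z (insert k J) m - (-1) ^ (i - 1) * (c' J (act k m) - \<phi> k * c' J m))" for J
  have z1L: "Lin (z1 J)" if "J \<subseteq> {..<k}" "Suc (card J) = i" for J
    unfolding z1_def using that cardk[OF that(1)]
    by (intro Lin_diff Lin_act k c'L Suc.prems(3)) auto
  have z1: "kd act \<phi> z1 J m = 0" if "J \<subseteq> {..<k}" "card J = i" "m \<in> C" for J m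
  proof -
    have sh: "kd act \<phi> (\<lambda>J m. c' J (act k m) - \<phi> k * c' J m) J m
      = kd act \<phi> c' J (act k m) - \<phi> k * kd act \<phi> c' J m"
      by (rule kd_shift[where C = C]) (rule comm, assumption, rule that(3))
    have "kd act \<phi> z1 J m = kd act \<phi> (\<lambda>J. z (insert k J)) J m
        - (-1) ^ (i - 1) * (kd act \<phi> c' J (act k m) - \<phi> k * kd act \<phi> c' J m)"
      unfolding z1_def
        kd_diff[of act \<phi> "\<lambda>J. z (insert k J)" "(-1) ^ (i - 1)" "\<lambda>J m. c' J (act k m) - \<phi> k * c' J m"] sh ..
    also have "kd act \<phi> c' J (act k m) - \<phi> k * kd act \<phi> c' J m = z J (act k m) - \<phi> k * z J m"
      using c'z[OF that(1,2)] act[OF k that(3)] that(3) by simp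
    also have "kd act \<phi> (\<lambda>J. z (insert k J)) J m = - ((-1) ^ i * (z J (act k m) - \<phi> k * z J m))"
      using Suc.prems(4)[of "insert k J" m] kd_insert[OF that(1), of act \<phi> z m] cardk[OF that(1)] that
      by (simp add: eq_neg_iff_add_eq_0)
    also have "(-1) ^ i = - ((-1) ^ (i - 1) :: 'k)" using Suc.prems(2) by (cases i) auto
    finally show ?thesis by simp
  qed
  show ?case
  proof (cases "i = 1")
    case True
    have L1: "Lin (z1 {})" using True by (intro z1L) auto
    have L2: "z1 {} (act j m) = \<phi> j * z1 {} m" if "j < k" "m \<in> C" for j m
      using z1[of "{j}" m] that True by simp
    obtain u where u: "Lin u" "\<And>j m. j < k \<Longrightarrow> m \<in> C \<Longrightarrow> u (act j m) = \<phi> j * u m"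
      "\<And>m. m \<in> C \<Longrightarrow> u (act k m) - \<phi> k * u m = z1 {} m" using surj[OF k L1 L2] by blast
    have Lc: "Lin (c' {})" using True by (intro c'L) auto
    show ?thesis
    proof (intro exI[of _ "\<lambda>_ m. c' {} m + u m"] conjI allI impI ballI)
      show "Lin (\<lambda>m. c' {} m + u m)" by (intro Lin_add Lc u(1))
      fix J m assume J: "J \<subseteq> {..<Suc k} \<and> card J = i" and m: "m \<in> C"
      then obtain j where j: "J = {j}" "j < Suc k" using True by (auto simp: card_1_singleton_iff)
      show "z J m = kd act \<phi> (\<lambda>_ m. c' {} m + u m) J m"
      proof (cases "j = k")
        case True
        then show ?thesis using u(3)[OF m] \<open>i = 1\<close> by (simp add: j(1) z1_def algebra_simps)
      next
        case False
        then have "j < k" using j(2) by simp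
        then show ?thesis using c'z[of "{j}" m] u(2)[of j m] m True by (simp add: j(1) algebra_simps)
      qed
    qed
  next
    case False
    then have i2: "1 \<le> i - 1" "Suc (i - 1) = i" using Suc.prems(2) by auto
    have "\<exists>c. (\<forall>J. J \<subseteq> {..<k} \<and> Suc (card J) = i - 1 \<longrightarrow> Lin (c J)) \<and>
        (\<forall>J. J \<subseteq> {..<k} \<and> card J = i - 1 \<longrightarrow> (\<forall>m\<in>C. z1 J m = kd act \<phi> c J m))"
    proof (rule Suc.IH)
      show "k \<le> N" using k by simp
      show "1 \<le> i - 1" by (rule i2(1))
      show "Lin (z1 J)" if "J \<subseteq> {..<k}" "card J = i - 1" for J
        using that i2(2) by (intro z1L) auto
      show "kd act \<phi> z1 J m = 0" if "J \<subseteq> {..<k}" "card J = Suc (i - 1)" "m \<in> C" for J m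
        using that i2(2) by (intro z1) auto
    qed
    then obtain c'' where
      c'': "(\<forall>J. J \<subseteq> {..<k} \<and> Suc (card J) = i - 1 \<longrightarrow> Lin (c'' J)) \<and>
        (\<forall>J. J \<subseteq> {..<k} \<and> card J = i - 1 \<longrightarrow> (\<forall>m\<in>C. z1 J m = kd act \<phi> c'' J m))"
      by (rule exE)
    have c''L: "\<And>J. J \<subseteq> {..<k} \<Longrightarrow> Suc (card J) = i - 1 \<Longrightarrow> Lin (c'' J)"
      and c''z: "\<And>J m. J \<subseteq> {..<k} \<Longrightarrow> card J = i - 1 \<Longrightarrow> m \<in> C \<Longrightarrow> z1 J m = kd act \<phi> c'' J m"
      using c'' by auto
    define c where "c J = (if k \<in> J then c'' (J - {k}) else c' J)" for J
    have split: "k \<notin> J \<and> J \<subseteq> {..<k} \<or> (\<exists>J'. J = insert k J' \<and> J' \<subseteq> {..<k})" if "J \<subseteq> {..<Suc k}" for J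
    proof (cases "k \<in> J")
      case True
      then have "J = insert k (J - {k}) \<and> J - {k} \<subseteq> {..<k}" using that by (auto simp: less_Suc_eq)
      then show ?thesis by blast
    qed (use that in \<open>auto simp: less_Suc_eq\<close>)
    show ?thesis
    proof (intro exI[of _ c] conjI allI impI ballI)
      fix J assume J: "J \<subseteq> {..<Suc k} \<and> Suc (card J) = i"
      then consider "k \<notin> J" "J \<subseteq> {..<k}" | J' where "J = insert k J'" "J' \<subseteq> {..<k}" using split by blast
      then show "Lin (c J)"
      proof cases
        case 1 then show ?thesis using J c'L by (simp add: c_def)
      next
        case 2
        have "Suc (Suc (card J')) = i" using J 2 cardk[OF 2(2)] by simp
        then have "Lin (c'' J')" by (intro c''L 2(2)) simp
        then show ?thesis using 2 cardk[OF 2(2)] by (simp add: c_def)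
      qed
    next
      fix J m assume J: "J \<subseteq> {..<Suc k} \<and> card J = i" and m: "m \<in> C"
      then consider "k \<notin> J" "J \<subseteq> {..<k}" | J' where "J = insert k J'" "J' \<subseteq> {..<k}" using split by blast
      then show "z J m = kd act \<phi> c J m"
      proof cases
        case 1
        have "kd act \<phi> c J m = kd act \<phi> c' J m" using 1 by (intro kd_cong) (simp add: c_def)
        then show ?thesis using c'z 1 J m by simp
      next
        case 2
        note k' = cardk[OF 2(2)]
        have "kd act \<phi> (\<lambda>J. c (insert k J)) J' m = kd act \<phi> c'' J' m"
          using k' by (intro kd_cong) (simp add: c_def)
        moreover have "c J' = c' J'" using k' by (simp add: c_def)
        moreover have "card J' = i - 1" using J 2 k' by auto
        ultimately show ?thesis using c''z[OF 2(2) _ m]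
          by (simp add: 2(1) kd_insert[OF 2(2)] z1_def diff_eq_eq)
      qed
    qed
  qed
qed

section \<open>Linear functionals on spaces of functions\<close>

lemma fun_space: "vector_space (\<lambda>(\<kappa>::'k::field) (w :: 'p \<Rightarrow> 'k) A. \<kappa> * w A)"
  by unfold_locales (auto simp: fun_eq_iff algebra_simps)

text \<open>The relation \<open>R\<close> is the graph of a linear functional on a subspace. A basis of the subspace is
  extended to a basis of the whole space.\<close>

lemma partial_functional_extends:
  fixes R :: "(('p \<Rightarrow> 'k::field) \<times> 'k) set"
  assumes add: "\<And>a y b z. (a, y) \<in> R \<Longrightarrow> (b, z) \<in> R \<Longrightarrow> (\<lambda>A. a A + b A, y + z) \<in> R"
    and scale: "\<And>\<kappa> a y. (a, y) \<in> R \<Longrightarrow> (\<lambda>A. \<kappa> * a A, \<kappa> * y) \<in> R"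
    and zero: "((\<lambda>_. 0), 0) \<in> R"
    and single_valued: "\<And>y. ((\<lambda>_. 0), y) \<in> R \<Longrightarrow> y = 0"
  shows "\<exists>g. (\<forall>a b. g (\<lambda>A. a A + b A) = g a + g b) \<and> (\<forall>\<kappa> a. g (\<lambda>A. \<kappa> * a A) = \<kappa> * g a) \<and>
    (\<forall>a y. (a, y) \<in> R \<longrightarrow> g a = y)"
proof -
  interpret V: vector_space "\<lambda>(\<kappa>::'k) (w :: 'p \<Rightarrow> 'k) A. \<kappa> * w A" by (rule fun_space)
  interpret vector_space_pair "\<lambda>(\<kappa>::'k) (w :: 'p \<Rightarrow> 'k) A. \<kappa> * w A" "(*) :: 'k \<Rightarrow> 'k \<Rightarrow> 'k"
    by (intro vector_space_pair.intro fun_space vector_space_over_itself.vector_space_axioms)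
  obtain B where B: "B \<subseteq> fst ` R" "V.independent B" "fst ` R \<subseteq> V.span B"
    using V.maximal_independent_subset[of "fst ` R"] by blast
  define h where "h b = (SOME y. (b, y) \<in> R)" for b
  have h: "(b, h b) \<in> R" if "b \<in> B" for b
  proof -
    have "\<exists>y. (b, y) \<in> R" using B(1) that by force
    then show ?thesis unfolding h_def by (rule someI_ex)
  qed
  obtain g where g: "Vector_Spaces.linear (\<lambda>(\<kappa>::'k) (w :: 'p \<Rightarrow> 'k) A. \<kappa> * w A) (*) g" "\<forall>b\<in>B. g b = h b"
    using linear_independent_extend[OF B(2), of h] by blast
  interpret g: Vector_Spaces.linear "\<lambda>(\<kappa>::'k) (w :: 'p \<Rightarrow> 'k) A. \<kappa> * w A" "(*)" g by (rule g(1))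
  have g_add: "g (\<lambda>A. a A + b A) = g a + g b" for a b using g.add[of a b] by (simp add: plus_fun_def)
  have inR: "(a, g a) \<in> R" if "a \<in> V.span B" for a
    using that
  proof (induction rule: V.span_induct_alt)
    case base
    then show ?case using zero g.zero by (simp add: zero_fun_def)
  next
    case (step \<kappa> x y)
    have "(\<lambda>A. \<kappa> * x A, \<kappa> * g x) \<in> R" using h[OF step(1)] g(2) step(1) by (intro scale) auto
    from add[OF this step(2)] show ?case using g.scale[of \<kappa> x] g_add[of "\<lambda>A. \<kappa> * x A" y]
      by (simp add: plus_fun_def)
  qed
  have "g a = y" if "(a, y) \<in> R" for a y
  proof -
    have "(a, g a) \<in> R" using that B(3) by (intro inR) (auto simp: image_subset_iff)
    from add[OF that scale[OF this, of "-1"]] have "((\<lambda>_. 0), y - g a) \<in> R" by simp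
    from single_valued[OF this] show ?thesis by simp
  qed
  then show ?thesis using g_add g.scale by (intro exI[of _ g]) auto
qed

text \<open>A set of complex functions that is linearly independent over \<open>\<complex>\<close> stays independent over
  \<open>\<complex>((t))\<close>, as one sees by comparing the coefficients of the powers of \<open>t\<close>. Therefore a
  \<open>\<complex>\<close>-linear map to \<open>\<complex>((t))\<close> extends \<open>\<complex>((t))\<close>-linearly.\<close>

lemma scalar_extension:
  fixes C :: "('p \<Rightarrow> complex) set" and v :: "('p \<Rightarrow> complex) \<Rightarrow> complex fls"
  assumes C: "(\<lambda>_. 0) \<in> C" "\<And>g h. g \<in> C \<Longrightarrow> h \<in> C \<Longrightarrow> (\<lambda>A. g A + h A) \<in> C" "\<And>c g. g \<in> C \<Longrightarrow> (\<lambda>A. c * g A) \<in> C"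
    and v: "\<And>g h. g \<in> C \<Longrightarrow> h \<in> C \<Longrightarrow> v (\<lambda>A. g A + h A) = v g + v h"
      "\<And>c g. g \<in> C \<Longrightarrow> v (\<lambda>A. c * g A) = fls_const c * v g"
  shows "\<exists>V. (\<forall>a b. V (\<lambda>A. a A + b A) = V a + V b) \<and> (\<forall>\<kappa> a. V (\<lambda>A. \<kappa> * a A) = \<kappa> * V a) \<and>
    (\<forall>g\<in>C. V (\<lambda>A. fls_const (g A)) = v g)"
proof -
  interpret F: vector_space "\<lambda>(c::complex) (w :: 'p \<Rightarrow> complex) A. c * w A" by (rule fun_space)
  interpret V: vector_space "\<lambda>(\<kappa>::complex fls) (w :: 'p \<Rightarrow> complex fls) A. \<kappa> * w A" by (rule fun_space)
  interpret vector_space_pair "\<lambda>(\<kappa>::complex fls) (w :: 'p \<Rightarrow> complex fls) A. \<kappa> * w A" "(*) :: complex fls \<Rightarrow> _"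
    by (intro vector_space_pair.intro fun_space vector_space_over_itself.vector_space_axioms)
  define \<iota> where "\<iota> g = (\<lambda>A. fls_const (g A))" for g :: "'p \<Rightarrow> complex"
  have inj: "inj \<iota>"
  proof (rule injI)
    fix g h assume "\<iota> g = \<iota> h"
    then have "fls_nth (fls_const (g A)) 0 = fls_nth (fls_const (h A)) 0" for A by (simp add: \<iota>_def fun_eq_iff)
    then show "g = h" by (simp add: fun_eq_iff)
  qed
  obtain B where B: "B \<subseteq> C" "F.independent B" "C \<subseteq> F.span B"
    using F.maximal_independent_subset[of C] by blast
  have ind: "V.independent (\<iota> ` B)"
    unfolding V.independent_explicit_finite_subsets
  proof (intro allI impI ballI)
    fix S u s assume S: "S \<subseteq> \<iota> ` B" and fin: "finite S" and sum0: "(\<Sum>w\<in>S. (\<lambda>A. u w * w A)) = 0" and s: "s \<in> S"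
    obtain S' where S': "S' \<subseteq> B" "S = \<iota> ` S'" using S by (auto simp: subset_image_iff)
    have inj': "inj_on \<iota> S'" using inj by (rule inj_on_subset) simp
    have fin': "finite S'" using fin S'(2) inj' by (simp add: finite_image_iff)
    have "(\<Sum>b\<in>S'. fls_nth (u (\<iota> b)) n * b A) = 0" for n A
    proof -
      have "(\<Sum>b\<in>S'. u (\<iota> b) * fls_const (b A)) = (\<Sum>w\<in>S. (\<lambda>A. u w * w A)) A"
        unfolding S'(2) sum.reindex[OF inj'] by (induction S' rule: infinite_finite_induct) (simp_all add: \<iota>_def)
      then have "fls_nth (\<Sum>b\<in>S'. u (\<iota> b) * fls_const (b A)) n = 0" by (simp add: sum0)
      then show ?thesis by (simp add: fls_nth_sum)
    qed
    moreover have "(\<Sum>b\<in>S'. (\<lambda>A. w b * b A)) A = (\<Sum>b\<in>S'. w b * b A)" for w :: "('p \<Rightarrow> complex) \<Rightarrow> complex" and A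
      by (induction S' rule: infinite_finite_induct) simp_all
    ultimately have "(\<Sum>b\<in>S'. (\<lambda>A. fls_nth (u (\<iota> b)) n * b A)) = 0" for n by (simp add: fun_eq_iff)
    then have "fls_nth (u (\<iota> b)) n = 0" if "b \<in> S'" for b n
      using B(2)[unfolded F.independent_explicit_finite_subsets, rule_format, OF S'(1) fin' _ that,
          of "\<lambda>b. fls_nth (u (\<iota> b)) n"] by blast
    then show "u s = 0" using s by (auto simp: S'(2) fls_eq_iff)
  qed
  obtain g where g: "Vector_Spaces.linear (\<lambda>(\<kappa>::complex fls) (w :: 'p \<Rightarrow> complex fls) A. \<kappa> * w A) (*) g"
    "\<forall>w\<in>\<iota> ` B. g w = v (inv_into UNIV \<iota> w)"
    using linear_independent_extend[OF ind, of "\<lambda>w. v (inv_into UNIV \<iota> w)"] by blast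
  interpret g: Vector_Spaces.linear "\<lambda>(\<kappa>::complex fls) (w :: 'p \<Rightarrow> complex fls) A. \<kappa> * w A" "(*)" g by (rule g(1))
  have g_add: "g (\<lambda>A. a A + b A) = g a + g b" for a b using g.add[of a b] by (simp add: plus_fun_def)
  have gB: "g (\<iota> b) = v b" if "b \<in> B" for b using g(2) that by (simp add: inv_into_f_f[OF inj])
  have v0: "v (\<lambda>_. 0) = 0" using v(2)[OF C(1), of 0] by simp
  have "h \<in> C \<and> g (\<iota> h) = v h" if "h \<in> F.span B" for h
    using that
  proof (induction rule: F.span_induct_alt)
    case base
    then show ?case using C(1) g.zero v0 by (simp add: zero_fun_def \<iota>_def)
  next
    case (step c x y)
    have xC: "x \<in> C" "(\<lambda>A. c * x A) \<in> C" using step(1) B(1) C(3) by auto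
    have "\<iota> (\<lambda>A. c * x A + y A) = (\<lambda>A. (\<lambda>A. fls_const c * \<iota> x A) A + \<iota> y A)"
      by (simp add: \<iota>_def fls_plus_const)
    then have "g (\<iota> (\<lambda>A. c * x A + y A)) = fls_const c * g (\<iota> x) + g (\<iota> y)"
      by (simp only: g_add g.scale)
    then show ?case using C(2)[OF xC(2)] step v(1)[OF xC(2)] v(2)[OF xC(1)] gB[OF step(1)]
      by (simp add: plus_fun_def)
  qed
  then show ?thesis using g_add g.scale B(3) by (intro exI[of _ g]) (auto simp: \<iota>_def)
qed

section \<open>Polynomial functions over an infinite field\<close>

inductive_set kpoly :: "nat \<Rightarrow> ((nat \<Rightarrow> 'k::field) \<Rightarrow> 'k) set" for N where
  const: "(\<lambda>_. c) \<in> kpoly N"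
| coord: "j < N \<Longrightarrow> (\<lambda>B. B j) \<in> kpoly N"
| add: "P \<in> kpoly N \<Longrightarrow> Q \<in> kpoly N \<Longrightarrow> (\<lambda>B. P B + Q B) \<in> kpoly N"
| mult: "P \<in> kpoly N \<Longrightarrow> Q \<in> kpoly N \<Longrightarrow> (\<lambda>B. P B * Q B) \<in> kpoly N"

lemma kpoly_sum: "(\<And>i. i \<in> I \<Longrightarrow> P i \<in> kpoly N) \<Longrightarrow> (\<lambda>B. \<Sum>i\<in>I. P i B) \<in> kpoly N"
  by (induction I rule: infinite_finite_induct) (auto intro: kpoly.intros)

lemma kpoly_diff: "P \<in> kpoly N \<Longrightarrow> Q \<in> kpoly N \<Longrightarrow> (\<lambda>B. P B - Q B) \<in> kpoly N"
  using kpoly.add[OF _ kpoly.mult[OF kpoly.const[of "-1"]], of P N Q] by simp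

lemma kpoly_power: "P \<in> kpoly N \<Longrightarrow> (\<lambda>B. P B ^ k) \<in> kpoly N"
  by (induction k) (auto intro: kpoly.intros)

lemma kpoly_cong: "P \<in> kpoly N \<Longrightarrow> (\<And>j. j < N \<Longrightarrow> B j = B' j) \<Longrightarrow> P B = P B'"
  by (induction rule: kpoly.induct) auto

lemma kpoly_update: "P \<in> kpoly N \<Longrightarrow> (\<lambda>B. P (B(j := a))) \<in> kpoly N"
proof (induction rule: kpoly.induct)
  case (coord i)
  then show ?case by (cases "i = j") (auto intro: kpoly.intros)
qed (auto intro: kpoly.intros)

lemma kpoly_divided_difference:
  "P \<in> kpoly N \<Longrightarrow> \<exists>R\<in>kpoly N. \<forall>B. P B - P (B(j := a)) = (B j - a) * R B"
proof (induction rule: kpoly.induct)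
  case (const c)
  show ?case by (rule bexI[OF _ kpoly.const[of 0]]) simp
next
  case (coord i)
  show ?case
    by (cases "i = j") (auto intro: bexI[OF _ kpoly.const[of 0]] bexI[OF _ kpoly.const[of 1]])
next
  case (add P Q)
  then obtain R S where RS: "R \<in> kpoly N" "S \<in> kpoly N" "\<forall>B. P B - P (B(j := a)) = (B j - a) * R B"
    "\<forall>B. Q B - Q (B(j := a)) = (B j - a) * S B" by blast
  have "P B + Q B - (P (B(j := a)) + Q (B(j := a))) = (B j - a) * (R B + S B)" for B
    using RS(3,4)[rule_format, of B] by (simp add: algebra_simps)
  then show ?case
    by (intro bexI[where x = "\<lambda>B. R B + S B"] allI) (assumption | rule kpoly.add[OF RS(1,2)])+
next
  case (mult P Q)
  then obtain R S where RS: "R \<in> kpoly N" "S \<in> kpoly N" "\<forall>B. P B - P (B(j := a)) = (B j - a) * R B"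
    "\<forall>B. Q B - Q (B(j := a)) = (B j - a) * S B" by blast
  have "P B * Q B - P (B(j := a)) * Q (B(j := a)) = (B j - a) * (R B * Q B + P (B(j := a)) * S B)" for B
  proof -
    have "P B * Q B - P (B(j := a)) * Q (B(j := a))
      = (P B - P (B(j := a))) * Q B + P (B(j := a)) * (Q B - Q (B(j := a)))" by (simp add: algebra_simps)
    then show ?thesis unfolding RS(3)[rule_format] RS(4)[rule_format] by (simp add: algebra_simps)
  qed
  moreover have "(\<lambda>B. R B * Q B + P (B(j := a)) * S B) \<in> kpoly N"
    by (intro kpoly.add kpoly.mult kpoly_update RS mult)
  ultimately show ?case
    by (intro bexI[where x = "\<lambda>B. R B * Q B + P (B(j := a)) * S B"] allI) assumption+
qed

lemma kpoly_univariate: "P \<in> kpoly N \<Longrightarrow> \<exists>q. \<forall>t. P (B(j := t)) = poly q t"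
proof (induction rule: kpoly.induct)
  case (const c)
  show ?case by (rule exI[of _ "[:c:]"]) simp
next
  case (coord i)
  show ?case
  proof (cases "i = j")
    case True then show ?thesis by (intro exI[of _ "[:0, 1:]"]) simp
  next
    case False then show ?thesis by (intro exI[of _ "[:B i:]"]) simp
  qed
next
  case (add P Q)
  then obtain p q where "\<And>t. P (B(j := t)) = poly p t" "\<And>t. Q (B(j := t)) = poly q t" by blast
  then have "\<forall>t. P (B(j := t)) + Q (B(j := t)) = poly (p + q) t" by (simp only: poly_add simp_thms)
  then show ?case by blast
next
  case (mult P Q)
  then obtain p q where "\<And>t. P (B(j := t)) = poly p t" "\<And>t. Q (B(j := t)) = poly q t" by blast
  then have "\<forall>t. P (B(j := t)) * Q (B(j := t)) = poly (p * q) t" by (simp only: poly_mult simp_thms)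
  then show ?case by blast
qed

lemma kpoly_zero_line:
  assumes "P \<in> kpoly N" "infinite D" "\<And>t. t \<in> D \<Longrightarrow> P (B(j := t)) = 0"
  shows "P (B(j := t)) = 0"
proof -
  obtain q where q: "\<forall>t. P (B(j := t)) = poly q t" using kpoly_univariate[OF assms(1)] by blast
  have "q = 0"
  proof (rule ccontr)
    assume "q \<noteq> 0"
    then have "finite {t. poly q t = 0}" by (rule poly_roots_finite)
    moreover have "D \<subseteq> {t. poly q t = 0}" using assms(3) q by auto
    ultimately show False using assms(2) finite_subset by blast
  qed
  then show ?thesis using q by simp
qed

text \<open>One coordinate at a time is freed from the infinite set \<open>D\<close>, since a univariate polynomial has
  finitely many roots.\<close>

lemma kpoly_zero_on_grid:
  assumes P: "P \<in> kpoly N" and D: "infinite D" and zero: "\<And>B. (\<And>j. j < N \<Longrightarrow> B j \<in> D) \<Longrightarrow> P B = 0"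
  shows "P B = 0"
proof -
  have "\<forall>B. (\<forall>j. n \<le> j \<and> j < N \<longrightarrow> B j \<in> D) \<longrightarrow> P B = 0" if "n \<le> N" for n
    using that
  proof (induction n)
    case 0
    then show ?case using zero by auto
  next
    case (Suc n)
    show ?case
    proof (intro allI impI)
      fix B assume B: "\<forall>j. Suc n \<le> j \<and> j < N \<longrightarrow> B j \<in> D"
      have "P (B(n := t)) = 0" if "t \<in> D" for t
      proof -
        have "\<forall>j. n \<le> j \<and> j < N \<longrightarrow> (B(n := t)) j \<in> D" using B that by (auto simp: Suc_le_eq)
        then show ?thesis using Suc.IH Suc.prems by auto
      qed
      from kpoly_zero_line[OF P D this, of "B n"] show "P B = 0" by simp
    qed
  qed
  from this[of N] have "(\<forall>j. N \<le> j \<and> j < N \<longrightarrow> B j \<in> D) \<longrightarrow> P B = 0" by simp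
  then show ?thesis by (meson leD)
qed

text \<open>The Nullstellensatz for a coordinate subspace: \<open>P\<close> vanishes on \<open>{B. \<forall>j<k. B j = \<phi> j}\<close>, and the last of
  these equations is split off by a divided difference.\<close>

lemma kpoly_ideal:
  assumes "k \<le> N" "P \<in> kpoly N" "\<And>B. (\<And>j. j < k \<Longrightarrow> B j = \<phi> j) \<Longrightarrow> P B = 0"
  shows "\<exists>R. (\<forall>j<k. R j \<in> kpoly N) \<and> (\<forall>B. P B = (\<Sum>j<k. (B j - \<phi> j) * R j B))"
  using assms
proof (induction k arbitrary: P)
  case (Suc k)
  define Q where "Q = (\<lambda>B. P (B(k := \<phi> k)))"
  have Q: "Q \<in> kpoly N" unfolding Q_def by (intro kpoly_update Suc.prems)
  have "Q B = 0" if "\<And>j. j < k \<Longrightarrow> B j = \<phi> j" for B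
    unfolding Q_def using that by (intro Suc.prems(3)) (auto simp: less_Suc_eq)
  then obtain R where R: "\<forall>j<k. R j \<in> kpoly N" "\<forall>B. Q B = (\<Sum>j<k. (B j - \<phi> j) * R j B)"
    using Suc.IH[of Q] Q Suc.prems(1) by auto
  obtain S where S: "S \<in> kpoly N" "\<forall>B. P B - P (B(k := \<phi> k)) = (B k - \<phi> k) * S B"
    using kpoly_divided_difference[OF Suc.prems(2)] by blast
  have "P B = (\<Sum>j<Suc k. (B j - \<phi> j) * (R(k := S)) j B)" for B
    using S(2)[rule_format, of B] R(2)[rule_format, of B] by (simp add: Q_def algebra_simps)
  then show ?case using R(1) S(1) by (intro exI[of _ "R(k := S)"]) (auto simp: less_Suc_eq)
qed simp

section \<open>Regularity\<close>

text \<open>The operator \<open>t d/dt\<close> does not lower the order of a Laurent series.\<close>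

lemma log_derivative_regular:
  fixes s :: "complex fls"
  assumes "s \<noteq> 0"
  shows "fls_subdegree (fls_X * fls_deriv s * inverse s) \<ge> 0"
proof (cases "fls_X * fls_deriv s = 0")
  case False
  have "fls_nth (fls_X * fls_deriv s) n = of_int n * fls_nth s n" for n
    by (simp add: fls_X_times_conv_shift)
  then have "fls_subdegree s \<le> fls_subdegree (fls_X * fls_deriv s)"
    using False by (intro fls_subdegree_geI) auto
  then show ?thesis using False assms by (subst fls_subdegree_mult) auto
qed simp

lemma fls_deriv_sign: "fls_deriv ((-1) ^ n * y) = (-1) ^ n * fls_deriv y"
  by (cases "even n") simp_all

context coord_space
begin

text \<open>The \<open>\<complex>((t))\<close>-span of \<open>S\<^sub>f\<close> inside the functions with values in \<open>\<complex>((t))\<close>; it is a model of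
  \<open>\<complex>((t)) \<otimes> S\<^sub>f\<close>.\<close>

inductive_set fls_span :: "('m cmat \<Rightarrow> complex fls) set" where
  zero: "(\<lambda>_. 0) \<in> fls_span"
| step: "g \<in> RF \<Longrightarrow> w \<in> fls_span \<Longrightarrow> (\<lambda>A. \<kappa> * fls_const (g A) + w A) \<in> fls_span"

lemma fls_span_base: "g \<in> RF \<Longrightarrow> (\<lambda>A. \<kappa> * fls_const (g A)) \<in> fls_span"
  using fls_span.step[OF _ fls_span.zero] by simp

lemma fls_span_add: "w \<in> fls_span \<Longrightarrow> w' \<in> fls_span \<Longrightarrow> (\<lambda>A. w A + w' A) \<in> fls_span"
proof (induction rule: fls_span.induct)
  case (step g w \<kappa>)
  then show ?case using fls_span.step[of g "\<lambda>A. w A + w' A" \<kappa>] by (simp add: add.assoc)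
qed simp

lemma fls_span_scale: "w \<in> fls_span \<Longrightarrow> (\<lambda>A. \<kappa> * w A) \<in> fls_span"
proof (induction rule: fls_span.induct)
  case (step g w \<kappa>')
  then show ?case using fls_span.step[of g "\<lambda>A. \<kappa> * w A" "\<kappa> * \<kappa>'"] by (simp add: algebra_simps)
qed (simp add: fls_span.zero)

lemma fls_span_mult: assumes "w \<in> fls_span" "w' \<in> fls_span" shows "(\<lambda>A. w A * w' A) \<in> fls_span"
  using assms(1)
proof induction
  case (step g w \<kappa>)
  have "(\<lambda>A. \<kappa> * fls_const (g A) * w' A) \<in> fls_span"
    using assms(2)
  proof induction
    case (step h u \<nu>)
    have "(\<lambda>A. (\<kappa> * \<nu>) * fls_const (g A * h A) + \<kappa> * fls_const (g A) * u A) \<in> fls_span"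
      using step \<open>g \<in> RF\<close> by (intro fls_span.step RF_mult)
    then show ?case by (simp add: algebra_simps flip: fls_const_mult_const)
  qed (simp add: fls_span.zero)
  from fls_span_add[OF this step(3)] show ?case by (simp add: distrib_right)
qed (simp add: fls_span.zero)

abbreviation "pt A \<equiv> (\<lambda>j. fls_const (x j A))"

text \<open>Polynomials on \<open>X\<close> are evaluated at points with coordinates in \<open>\<complex>((t))\<close>.\<close>

lemma poly_extension: "p \<in> poly_funs \<Longrightarrow> \<exists>P\<in>kpoly N. \<forall>A\<in>X. fls_const (p A) = P (pt A)"
proof (induction rule: poly_funs.induct)
  case (const c)
  show ?case by (rule bexI[OF _ kpoly.const[of "fls_const c"]]) simp
next
  case (entry k l)
  have "(\<lambda>B. \<Sum>j<N. B j * fls_const (b j $ k $ l)) \<in> kpoly N"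
    by (intro kpoly_sum kpoly.mult kpoly.coord kpoly.const) auto
  moreover have "fls_const (A $ k $ l) = (\<Sum>j<N. fls_const (x j A) * fls_const (b j $ k $ l))" if "A \<in> X" for A
  proof -
    have "fls_const (\<Sum>j\<in>I. h j) = (\<Sum>j\<in>I. fls_const (h j))" for I :: "nat set" and h :: "nat \<Rightarrow> complex"
      by (induction I rule: infinite_finite_induct) (simp_all add: fls_plus_const[symmetric])
    then show ?thesis by (simp add: entry_expand[OF that])
  qed
  ultimately show ?case by (intro bexI[where x = "\<lambda>B. \<Sum>j<N. B j * fls_const (b j $ k $ l)"] ballI)
next
  case (add p q)
  then obtain P Q where PQ: "P \<in> kpoly N" "Q \<in> kpoly N" "\<forall>A\<in>X. fls_const (p A) = P (pt A)"
    "\<forall>A\<in>X. fls_const (q A) = Q (pt A)" by blast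
  show ?case by (rule bexI[OF _ kpoly.add[OF PQ(1,2)]]) (use PQ(3,4) in \<open>simp add: fls_plus_const[symmetric]\<close>)
next
  case (mult p q)
  then obtain P Q where PQ: "P \<in> kpoly N" "Q \<in> kpoly N" "\<forall>A\<in>X. fls_const (p A) = P (pt A)"
    "\<forall>A\<in>X. fls_const (q A) = Q (pt A)" by blast
  show ?case by (rule bexI[OF _ kpoly.mult[OF PQ(1,2)]]) (use PQ(3,4) in \<open>simp flip: fls_const_mult_const\<close>)
qed

text \<open>All large exponents \<open>e\<close> are allowed, so that finitely many elements get a common denominator.\<close>

lemma fls_span_numerator:
  assumes "w \<in> fls_span"
  shows "\<exists>e0. \<forall>e\<ge>e0. \<exists>P\<in>kpoly N. \<forall>A. (A \<in> U \<longrightarrow> w A * fls_const (f A) ^ e = P (pt A)) \<and> (A \<notin> U \<longrightarrow> w A = 0)"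
  using assms
proof induction
  case zero
  show ?case by (intro exI[of _ 0] allI impI bexI[OF _ kpoly.const[of 0]]) simp
next
  case (step g w \<kappa>)
  obtain p l where p: "p \<in> poly_funs" "g = frac p l" using step(1) unfolding RF_iff by blast
  obtain F where F: "F \<in> kpoly N" "\<forall>A\<in>X. fls_const (f A) = F (pt A)" using poly_extension[OF f_poly] by blast
  obtain Pp where Pp: "Pp \<in> kpoly N" "\<forall>A\<in>X. fls_const (p A) = Pp (pt A)" using poly_extension[OF p(1)] by blast
  obtain e0 where e0: "\<forall>e\<ge>e0. \<exists>P\<in>kpoly N. \<forall>A. (A \<in> U \<longrightarrow> w A * fls_const (f A) ^ e = P (pt A)) \<and> (A \<notin> U \<longrightarrow> w A = 0)"
    using step.IH by blast
  show ?case
  proof (intro exI[of _ "max l e0"] allI impI)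
    fix e assume e: "max l e0 \<le> e"
    then obtain P where P: "P \<in> kpoly N"
      "\<forall>A. (A \<in> U \<longrightarrow> w A * fls_const (f A) ^ e = P (pt A)) \<and> (A \<notin> U \<longrightarrow> w A = 0)" using e0 by auto
    have Q: "(\<lambda>B. \<kappa> * Pp B * F B ^ (e - l) + P B) \<in> kpoly N"
      by (intro kpoly.add kpoly.mult kpoly.const kpoly_power Pp F P)
    have "(\<kappa> * fls_const (g A) + w A) * fls_const (f A) ^ e = \<kappa> * Pp (pt A) * F (pt A) ^ (e - l) + P (pt A)"
      if "A \<in> U" for A
    proof -
      have A: "A \<in> X" "f A \<noteq> 0" using that by (auto simp: U_iff)
      have "g A * f A ^ e = p A * f A ^ (e - l)"
        using A e that by (simp add: p(2) frac_eq power_diff)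
      then have "fls_const (g A) * fls_const (f A) ^ e = fls_const (p A) * fls_const (f A) ^ (e - l)"
        by (simp flip: fls_const_power)
      also have "\<dots> = Pp (pt A) * F (pt A) ^ (e - l)" using A F(2) Pp(2) by simp
      finally have "\<kappa> * (fls_const (g A) * fls_const (f A) ^ e) = \<kappa> * (Pp (pt A) * F (pt A) ^ (e - l))" by simp
      then show ?thesis using P(2) that by (simp add: distrib_right mult.assoc)
    qed
    then show "\<exists>P\<in>kpoly N. \<forall>A. (A \<in> U \<longrightarrow> (\<kappa> * fls_const (g A) + w A) * fls_const (f A) ^ e = P (pt A)) \<and>
        (A \<notin> U \<longrightarrow> \<kappa> * fls_const (g A) + w A = 0)"
      using P(2) RF_out[OF step(1)] by (intro bexI[OF _ Q]) auto
  qed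
qed

lemma fls_span_kpoly:
  assumes "P \<in> kpoly N"
  shows "(\<lambda>A. if A \<in> U then P (pt A) / fls_const (f A) ^ e else 0) \<in> fls_span"
proof -
  have "(\<lambda>A. if A \<in> U then P (pt A) else 0) \<in> fls_span"
    using assms
  proof induction
    case (const c)
    have "(\<lambda>A. c * fls_const (restr U (\<lambda>_. 1) A)) \<in> fls_span" by (intro fls_span_base RF_poly poly_funs.const)
    moreover have "(\<lambda>A. c * fls_const (restr U (\<lambda>_. 1) A)) = (\<lambda>A. if A \<in> U then c else 0)"
      by (auto simp: restr_def)
    ultimately show ?case by simp
  next
    case (coord j)
    have "(\<lambda>A. 1 * fls_const (restr U (xp j) A)) \<in> fls_span" by (intro fls_span_base RF_poly xp coord)
    moreover have "(\<lambda>A. 1 * fls_const (restr U (xp j) A)) = (\<lambda>A. if A \<in> U then fls_const (x j A) else 0)"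
      using coord by (auto simp: restr_def x_eq U_iff)
    ultimately show ?case by simp
  next
    case (add P Q)
    from fls_span_add[OF add.IH] show ?case by (rule back_subst[of "\<lambda>w. w \<in> fls_span"]) auto
  next
    case (mult P Q)
    from fls_span_mult[OF mult.IH] show ?case by (rule back_subst[of "\<lambda>w. w \<in> fls_span"]) auto
  qed
  moreover have "(\<lambda>A. 1 * fls_const (frac (\<lambda>_. 1) e A)) \<in> fls_span"
    by (intro fls_span_base frac_in poly_funs.const)
  ultimately have "(\<lambda>A. (if A \<in> U then P (pt A) else 0) * (1 * fls_const (frac (\<lambda>_. 1) e A))) \<in> fls_span"
    by (rule fls_span_mult)
  moreover have "(\<lambda>A. (if A \<in> U then P (pt A) else 0) * (1 * fls_const (frac (\<lambda>_. 1) e A)))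
    = (\<lambda>A. if A \<in> U then P (pt A) / fls_const (f A) ^ e else 0)"
    by (auto simp: frac_eq divide_inverse fls_inverse_const power_inverse simp flip: fls_const_power)
  ultimately show ?thesis by simp
qed

text \<open>The equation is cleared of denominators. It then holds on \<open>X\<close>, whose points form the infinite grid of
  constant series, hence as an identity of polynomials over \<open>\<complex>((t))\<close>. On the subspace where the first
  \<open>k\<close> coordinates are \<open>\<phi>\<close> it shows that \<open>(B\<^sub>k - \<phi>\<^sub>k)\<close> times the numerator of \<open>w\<close> is zero; so the numerator itself is
  zero there, and it lies in the ideal of that subspace.\<close>

lemma regular_sequence:
  assumes k: "k < N" and w: "w \<in> fls_span" and w': "\<And>j. j < k \<Longrightarrow> w' j \<in> fls_span"
    and eq: "\<And>A. (fls_const (x k A) - \<phi> k) * w A = (\<Sum>j<k. (fls_const (x j A) - \<phi> j) * w' j A)"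
  shows "\<exists>u. (\<forall>j<k. u j \<in> fls_span) \<and> (\<forall>A. w A = (\<Sum>j<k. (fls_const (x j A) - \<phi> j) * u j A))"
proof -
  obtain F where F: "F \<in> kpoly N" "\<And>A. A \<in> X \<Longrightarrow> fls_const (f A) = F (pt A)" using poly_extension[OF f_poly] by blast
  have "\<exists>e0. \<forall>e\<ge>e0. \<exists>P\<in>kpoly N. \<forall>A. (A \<in> U \<longrightarrow> w' j A * fls_const (f A) ^ e = P (pt A)) \<and> (A \<notin> U \<longrightarrow> w' j A = 0)"
    if "j < k" for j by (rule fls_span_numerator[OF w'[OF that]])
  then obtain ej where ej: "\<And>j e. j < k \<Longrightarrow> ej j \<le> e \<Longrightarrow>
      \<exists>P\<in>kpoly N. \<forall>A. (A \<in> U \<longrightarrow> w' j A * fls_const (f A) ^ e = P (pt A)) \<and> (A \<notin> U \<longrightarrow> w' j A = 0)" by metis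
  obtain e0 where e0: "\<And>e. e0 \<le> e \<Longrightarrow>
      \<exists>P\<in>kpoly N. \<forall>A. (A \<in> U \<longrightarrow> w A * fls_const (f A) ^ e = P (pt A)) \<and> (A \<notin> U \<longrightarrow> w A = 0)"
    using fls_span_numerator[OF w] by blast
  define e where "e = e0 + (\<Sum>j<k. ej j)"
  have eje: "ej j \<le> e" if "j < k" for j
    using that member_le_sum[of j "{..<k}" ej] by (simp add: e_def)
  obtain P where P: "P \<in> kpoly N" "\<And>A. A \<in> U \<Longrightarrow> w A * fls_const (f A) ^ e = P (pt A)" "\<And>A. A \<notin> U \<Longrightarrow> w A = 0"
    using e0[of e] by (auto simp: e_def)
  have "\<exists>P\<in>kpoly N. \<forall>A. (A \<in> U \<longrightarrow> w' j A * fls_const (f A) ^ e = P (pt A))" if "j < k" for j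
    using ej[OF that eje[OF that]] by blast
  then obtain P' where P': "\<And>j. j < k \<Longrightarrow> P' j \<in> kpoly N"
    "\<And>j A. j < k \<Longrightarrow> A \<in> U \<Longrightarrow> w' j A * fls_const (f A) ^ e = P' j (pt A)" by metis
  \<comment> \<open>The factor \<open>F B\<close> makes the expression vanish also at the points of \<open>X\<close> where \<open>f\<close> is zero.\<close>
  define Q1 where "Q1 = (\<lambda>B. F B * ((B k - \<phi> k) * P B - (\<Sum>j<k. (B j - \<phi> j) * P' j B)))"
  have Q1: "Q1 \<in> kpoly N"
    unfolding Q1_def using k
    by (intro kpoly.mult kpoly_diff kpoly_sum kpoly.coord kpoly.const F P P') auto
  have infD: "infinite (range (fls_const :: complex \<Rightarrow> _))"
  proof -
    have "inj (fls_const :: complex \<Rightarrow> _)" by (rule injI) (metis fls_const_nth)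
    then show ?thesis using finite_imageD infinite_UNIV_char_0 by blast
  qed
  have Q1_zero: "Q1 B = 0" for B
  proof (rule kpoly_zero_on_grid[OF Q1 infD])
    fix B :: "nat \<Rightarrow> complex fls" assume B: "\<And>j. j < N \<Longrightarrow> B j \<in> range fls_const"
    define a where "a j = fls_nth (B j) 0" for j
    have Ba: "B j = fls_const (a j)" if "j < N" for j using B[OF that] by (auto simp: a_def)
    define A where "A = (\<Sum>j<N. mscale (a j) (b j))"
    have A: "A \<in> X" unfolding A_def by (intro sum_in b_in) auto
    have "Q1 B = Q1 (pt A)" by (rule kpoly_cong[OF Q1]) (simp add: A_def x_dual Ba)
    also have "Q1 (pt A) = 0"
    proof (cases "A \<in> U")
      case True
      have "(\<Sum>j<k. (fls_const (x j A) - \<phi> j) * P' j (pt A)) = (\<Sum>j<k. (fls_const (x j A) - \<phi> j) * w' j A) * fls_const (f A) ^ e"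
        unfolding sum_distrib_right by (intro sum.cong) (simp_all add: P'(2)[OF _ True, symmetric] mult.assoc)
      then show ?thesis by (simp add: Q1_def P(2)[OF True, symmetric] eq[symmetric] mult.assoc)
    next
      case False
      then have "F (pt A) = 0" using F(2)[OF A] A by (auto simp: U_iff)
      then show ?thesis by (simp add: Q1_def)
    qed
    finally show "Q1 B = 0" .
  qed
  define Q where "Q = (\<lambda>B. F B * P B)"
  have Q: "Q \<in> kpoly N" unfolding Q_def by (intro kpoly.mult F P)
  have Q_zero: "Q B = 0" if B: "\<And>j. j < k \<Longrightarrow> B j = \<phi> j" for B
  proof -
    have z: "Q (B(k := t)) = 0" if t: "t \<in> UNIV - {\<phi> k}" for t
    proof -
      have "(\<Sum>j<k. ((B(k := t)) j - \<phi> j) * P' j (B(k := t))) = 0" by (intro sum.neutral) (auto simp: B)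
      then have "F (B(k := t)) * ((t - \<phi> k) * P (B(k := t))) = 0"
        using Q1_zero[of "B(k := t)"] unfolding Q1_def by simp
      then show ?thesis using t by (auto simp: Q_def)
    qed
    have inf: "infinite (UNIV - {\<phi> k})"
      by (rule Diff_infinite_finite[OF _ infinite_super[OF subset_UNIV infD]]) simp
    have "Q (B(k := B k)) = 0" by (rule kpoly_zero_line[OF Q inf z])
    then show ?thesis by simp
  qed
  have "\<exists>R. (\<forall>j<k. R j \<in> kpoly N) \<and> (\<forall>B. Q B = (\<Sum>j<k. (B j - \<phi> j) * R j B))"
    by (rule kpoly_ideal[OF less_imp_le[OF k] Q Q_zero])
  then obtain R where R: "\<And>j. j < k \<Longrightarrow> R j \<in> kpoly N" "\<And>B. Q B = (\<Sum>j<k. (B j - \<phi> j) * R j B)"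
    by blast
  define u where "u j = (\<lambda>A. if A \<in> U then R j (pt A) / fls_const (f A) ^ Suc e else 0)" for j
  have "w A = (\<Sum>j<k. (fls_const (x j A) - \<phi> j) * u j A)" for A
  proof (cases "A \<in> U")
    case True
    then have A: "A \<in> X" "f A \<noteq> 0" by (auto simp: U_iff)
    have nz: "fls_const (f A) \<noteq> 0" using A by simp
    have "w A = Q (pt A) / fls_const (f A) ^ Suc e"
      using nz by (simp add: Q_def P(2)[OF True, symmetric] F(2)[OF A(1), symmetric])
    then show ?thesis using True by (simp add: R(2) u_def sum_divide_distrib)
  qed (simp add: P(3) u_def)
  moreover have "u j \<in> fls_span" if "j < k" for j unfolding u_def by (intro fls_span_kpoly R that)
  ultimately show ?thesis by blast
qed

abbreviation "act j m \<equiv> (\<lambda>A. x j A * m A)"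

lemma act_in: "j < N \<Longrightarrow> m \<in> RF \<Longrightarrow> act j m \<in> RF"
  unfolding x_smult by (intro RF_pmult xp)

lemma clinear_iff: "clinear_fls X (F_mod X f \<alpha>) u \<longleftrightarrow>
   (\<forall>m\<in>RF. \<forall>m'\<in>RF. u (\<lambda>A. m A + m' A) = u m + u m') \<and> (\<forall>c. \<forall>m\<in>RF. u (\<lambda>A. c * m A) = fls_const c * u m)"
proof -
  have "cscale X whole (F_mod X f \<alpha>) c m = (\<lambda>A. c * m A)" if "m \<in> RF" for c m
    using restr_smult[OF that, of "\<lambda>_. c"] by simp
  then show ?thesis unfolding clinear_fls_def by simp
qed

text \<open>Dually to the regular sequence, each Koszul operator is surjective on the common kernel of the
  preceding ones. Let \<open>V\<close> be the \<open>\<complex>((t))\<close>-linear extension of \<open>v\<close>. The functional \<open>u\<close> is prescribed to be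
  \<open>V w\<close> on \<open>(x\<^sub>k - \<phi>\<^sub>k) w\<close> and zero on the ideal of the preceding differences. This is consistent because
  \<open>V\<close> vanishes on that ideal and \<open>x\<^sub>k - \<phi>\<^sub>k\<close> is not a zero divisor modulo it.\<close>

lemma koszul_operator_surjective:
  assumes k: "k < N" and v: "clinear_fls X (F_mod X f \<alpha>) v"
    and ker: "\<And>j m. j < k \<Longrightarrow> m \<in> RF \<Longrightarrow> v (act j m) = \<phi> j * v m"
  shows "\<exists>u. clinear_fls X (F_mod X f \<alpha>) u \<and> (\<forall>j<k. \<forall>m\<in>RF. u (act j m) = \<phi> j * u m) \<and>
    (\<forall>m\<in>RF. u (act k m) - \<phi> k * u m = v m)"
proof -
  have v_add: "v (\<lambda>A. g A + h A) = v g + v h" if "g \<in> RF" "h \<in> RF" for g h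
    using v that unfolding clinear_iff by blast
  have v_sc: "v (\<lambda>A. c * g A) = fls_const c * v g" if "g \<in> RF" for c g
    using v that unfolding clinear_iff by blast
  have "\<exists>V. (\<forall>a b. V (\<lambda>A. a A + b A) = V a + V b) \<and> (\<forall>\<kappa> a. V (\<lambda>A. \<kappa> * a A) = \<kappa> * V a) \<and>
    (\<forall>g\<in>RF. V (\<lambda>A. fls_const (g A)) = v g)"
    by (rule scalar_extension[OF RF_zero RF_add RF_cmult v_add v_sc])
  then obtain V where V: "\<And>a b. V (\<lambda>A. a A + b A) = V a + V b" "\<And>\<kappa> a. V (\<lambda>A. \<kappa> * a A) = \<kappa> * V a"
    "\<And>g. g \<in> RF \<Longrightarrow> V (\<lambda>A. fls_const (g A)) = v g"
    by (elim exE conjE) (rule that, (drule spec, erule spec | erule spec | erule (1) bspec)+)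
  have V0: "V (\<lambda>_. 0) = 0" using V(2)[of 0 "\<lambda>_. 0"] by simp
  have V_sum: "V (\<lambda>A. \<Sum>j\<in>I. h j A) = (\<Sum>j\<in>I. V (h j))" for I :: "nat set" and h
    by (induction I rule: infinite_finite_induct) (simp_all add: V0 V(1))
  have V_ker: "V (\<lambda>A. (fls_const (x j A) - \<phi> j) * w A) = 0" if "w \<in> fls_span" "j < k" for w j
    using that(1)
  proof induction
    case zero
    then show ?case by (simp add: V0)
  next
    case (step g w \<kappa>)
    have "(\<lambda>A. (fls_const (x j A) - \<phi> j) * (\<kappa> * fls_const (g A) + w A))
      = (\<lambda>A. (\<kappa> * fls_const (x j A * g A) + (- (\<kappa> * \<phi> j)) * fls_const (g A)) + (fls_const (x j A) - \<phi> j) * w A)"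
      by (simp add: algebra_simps flip: fls_const_mult_const)
    moreover have "V (\<lambda>A. fls_const (x j A * g A)) = \<phi> j * v g"
      using V(3)[OF act_in[of j g]] ker[OF that(2) step(1)] that(2) k step(1) by simp
    ultimately show ?case using step
      by (simp only: V(1) V(2)[of \<kappa> "\<lambda>A. fls_const (x j A * g A)"] V(2)[of "- (\<kappa> * \<phi> j)" "\<lambda>A. fls_const (g A)"] V(3)) simp
  qed
  define R where "R = {(a, y). \<exists>w\<in>fls_span. \<exists>w'. (\<forall>j<k. w' j \<in> fls_span) \<and> y = V w \<and>
      a = (\<lambda>A. (\<Sum>j<k. (fls_const (x j A) - \<phi> j) * w' j A) + (fls_const (x k A) - \<phi> k) * w A)}"
  have RI: "((\<lambda>A. (\<Sum>j<k. (fls_const (x j A) - \<phi> j) * w' j A) + (fls_const (x k A) - \<phi> k) * w A), V w) \<in> R"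
    if "w \<in> fls_span" "\<And>j. j < k \<Longrightarrow> w' j \<in> fls_span" for w w'
    using that unfolding R_def by blast
  have "\<exists>g. (\<forall>a b. g (\<lambda>A. a A + b A) = g a + g b) \<and> (\<forall>\<kappa> a. g (\<lambda>A. \<kappa> * a A) = \<kappa> * g a) \<and>
      (\<forall>a y. (a, y) \<in> R \<longrightarrow> g a = y)"
  proof (rule partial_functional_extends)
    fix a y a' y' assume "(a, y) \<in> R" "(a', y') \<in> R"
    then obtain w w1 w' w1' where *: "w \<in> fls_span" "w' \<in> fls_span" "\<And>j. j < k \<Longrightarrow> w1 j \<in> fls_span"
      "\<And>j. j < k \<Longrightarrow> w1' j \<in> fls_span" "y = V w" "y' = V w'"
      "a = (\<lambda>A. (\<Sum>j<k. (fls_const (x j A) - \<phi> j) * w1 j A) + (fls_const (x k A) - \<phi> k) * w A)"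
      "a' = (\<lambda>A. (\<Sum>j<k. (fls_const (x j A) - \<phi> j) * w1' j A) + (fls_const (x k A) - \<phi> k) * w' A)"
      unfolding R_def by blast
    have "((\<lambda>A. (\<Sum>j<k. (fls_const (x j A) - \<phi> j) * (w1 j A + w1' j A)) + (fls_const (x k A) - \<phi> k) * (w A + w' A)),
       V (\<lambda>A. w A + w' A)) \<in> R"
      using RI[of "\<lambda>A. w A + w' A" "\<lambda>j A. w1 j A + w1' j A"] * fls_span_add by simp
    then show "((\<lambda>A. a A + a' A), y + y') \<in> R" unfolding *(5-8) V(1)
      by (rule back_subst[of "\<lambda>p. p \<in> R"]) (simp add: fun_eq_iff distrib_left sum.distrib add_ac)
  next
    fix \<kappa> a y assume "(a, y) \<in> R"
    then obtain w w1 where *: "w \<in> fls_span" "\<And>j. j < k \<Longrightarrow> w1 j \<in> fls_span" "y = V w"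
      "a = (\<lambda>A. (\<Sum>j<k. (fls_const (x j A) - \<phi> j) * w1 j A) + (fls_const (x k A) - \<phi> k) * w A)"
      unfolding R_def by blast
    have "((\<lambda>A. (\<Sum>j<k. (fls_const (x j A) - \<phi> j) * (\<kappa> * w1 j A)) + (fls_const (x k A) - \<phi> k) * (\<kappa> * w A)),
       V (\<lambda>A. \<kappa> * w A)) \<in> R"
      using RI[of "\<lambda>A. \<kappa> * w A" "\<lambda>j A. \<kappa> * w1 j A"] * fls_span_scale by simp
    then show "((\<lambda>A. \<kappa> * a A), \<kappa> * y) \<in> R" unfolding *(3,4) V(2)
      by (rule back_subst[of "\<lambda>p. p \<in> R"]) (simp add: fun_eq_iff distrib_left sum_distrib_left mult_ac)
  next
    show "((\<lambda>_. 0), 0) \<in> R" using RI[OF fls_span.zero fls_span.zero] by (simp add: V0)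
  next
    fix y assume "((\<lambda>_. 0), y) \<in> R"
    then obtain w w1 where *: "w \<in> fls_span" "\<And>j. j < k \<Longrightarrow> w1 j \<in> fls_span" "y = V w"
      "(\<lambda>_. 0) = (\<lambda>A. (\<Sum>j<k. (fls_const (x j A) - \<phi> j) * w1 j A) + (fls_const (x k A) - \<phi> k) * w A)"
      unfolding R_def by blast
    have "(fls_const (x k A) - \<phi> k) * w A = (\<Sum>j<k. (fls_const (x j A) - \<phi> j) * ((-1) * w1 j A))" for A
      using fun_cong[OF *(4), of A] by (simp add: sum_negf eq_neg_iff_add_eq_0 add.commute)
    then obtain u where u: "\<And>j. j < k \<Longrightarrow> u j \<in> fls_span" "\<And>A. w A = (\<Sum>j<k. (fls_const (x j A) - \<phi> j) * u j A)"
      using regular_sequence[OF k *(1), of "\<lambda>j A. (-1) * w1 j A" \<phi>] fls_span_scale[OF *(2)] by blast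
    have "w = (\<lambda>A. \<Sum>j<k. (fls_const (x j A) - \<phi> j) * u j A)" using u(2) by blast
    then have "V w = (\<Sum>j<k. V (\<lambda>A. (fls_const (x j A) - \<phi> j) * u j A))" by (simp only: V_sum)
    also have "\<dots> = 0" by (intro sum.neutral) (simp add: V_ker u(1))
    finally show "y = 0" by (simp add: *(3))
  qed
  then obtain g where g: "\<And>a b. g (\<lambda>A. a A + b A) = g a + g b" "\<And>\<kappa> a. g (\<lambda>A. \<kappa> * a A) = \<kappa> * g a"
    "\<And>a y. (a, y) \<in> R \<Longrightarrow> g a = y" by blast
  define u where "u m = g (\<lambda>A. fls_const (m A))" for m
  have diff: "u (act j m) - \<phi> j * u m = g (\<lambda>A. (fls_const (x j A) - \<phi> j) * fls_const (m A))" for j m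
  proof -
    have "(\<lambda>A. (fls_const (x j A) - \<phi> j) * fls_const (m A)) = (\<lambda>A. fls_const (x j A * m A) + (- \<phi> j) * fls_const (m A))"
      by (simp add: algebra_simps)
    then show ?thesis by (simp only: g(1) g(2) u_def) simp
  qed
  have \<iota>: "(\<lambda>A. fls_const (m A)) \<in> fls_span" if "m \<in> RF" for m using fls_span_base[OF that, of 1] by simp
  show ?thesis
  proof (intro exI[of _ u] conjI allI impI ballI)
    have "u (\<lambda>A. m A + m' A) = u m + u m'" for m m' by (simp add: u_def g(1) flip: fls_plus_const)
    moreover have "u (\<lambda>A. c * m A) = fls_const c * u m" for c m by (simp add: u_def g(2) flip: fls_const_mult_const)
    ultimately show "clinear_fls X (F_mod X f \<alpha>) u" by (simp add: clinear_iff)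
  next
    fix m assume m: "m \<in> RF"
    have "((\<lambda>A. (fls_const (x k A) - \<phi> k) * fls_const (m A)), V (\<lambda>A. fls_const (m A))) \<in> R"
      using RI[OF \<iota>[OF m] fls_span.zero] by simp
    then show "u (act k m) - \<phi> k * u m = v m" unfolding diff by (simp add: g(3) V(3) m)
  next
    fix j m assume j: "j < k" and m: "m \<in> RF"
    have "((\<lambda>A. (\<Sum>i<k. (fls_const (x i A) - \<phi> i) * (if i = j then fls_const (m A) else 0)) + (fls_const (x k A) - \<phi> k) * 0), V (\<lambda>_. 0)) \<in> R"
    proof (rule RI[OF fls_span.zero])
      fix i show "(\<lambda>A. if i = j then fls_const (m A) else 0) \<in> fls_span"
        by (cases "i = j") (simp_all add: \<iota>[OF m] fls_span.zero)
    qed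
    then have "((\<lambda>A. (fls_const (x j A) - \<phi> j) * fls_const (m A)), 0) \<in> R"
      using j by (simp add: V0 if_distrib[of "\<lambda>y. _ * y"] cong: if_cong)
    then have "u (act j m) - \<phi> j * u m = 0" unfolding diff by (rule g(3))
    then show "u (act j m) = \<phi> j * u m" by simp
  qed
qed

lemma koszul_diff_F_mod: "koszul_diff x \<phi> (F_mod X f \<alpha>) z J m = kd act \<phi> z J m"
  by (simp add: koszul_diff_def kd_def)

lemma clinear_act: "j < N \<Longrightarrow> clinear_fls X (F_mod X f \<alpha>) u \<Longrightarrow>
    clinear_fls X (F_mod X f \<alpha>) (\<lambda>m. u (act j m) - \<phi> j * u m)"
proof -
  assume j: "j < N" and u: "clinear_fls X (F_mod X f \<alpha>) u"
  have u_add: "u (\<lambda>A. m A + m' A) = u m + u m'" if "m \<in> RF" "m' \<in> RF" for m m'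
    using u that unfolding clinear_iff by blast
  have u_sc: "u (\<lambda>A. c * m A) = fls_const c * u m" if "m \<in> RF" for m c
    using u that unfolding clinear_iff by blast
  have "u (act j (\<lambda>A. m A + m' A)) = u (act j m) + u (act j m')" if "m \<in> RF" "m' \<in> RF" for m m'
    using u_add[OF act_in[OF j that(1)] act_in[OF j that(2)]] by (simp add: distrib_left)
  moreover have "u (act j (\<lambda>A. c * m A)) = fls_const c * u (act j m)" if "m \<in> RF" for m c
    using u_sc[OF act_in[OF j that], of c] by (simp add: mult.left_commute)
  ultimately show ?thesis unfolding clinear_iff by (simp add: u_add u_sc algebra_simps)
qed

lemma koszul_vanishing:
  assumes "cocycle X N x \<phi> (F_mod X f \<alpha>) i z" "1 \<le> i"
  shows "\<exists>c. (\<forall>J. J \<subseteq> {..<N} \<and> Suc (card J) = i \<longrightarrow> clinear_fls X (F_mod X f \<alpha>) (c J)) \<and>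
    (\<forall>J. J \<subseteq> {..<N} \<and> card J = i \<longrightarrow> (\<forall>m\<in>RF. z J m = kd act \<phi> c J m))"
proof (rule koszul_exact[where N = N and C = RF])
  show "N \<le> N" "1 \<le> i" using assms(2) by auto
  show "act j m \<in> RF" if "j < N" "m \<in> RF" for j m by (rule act_in[OF that])
  show "act i (act j m) = act j (act i m)" for i j m by (simp add: mult.left_commute)
  show "clinear_fls X (F_mod X f \<alpha>) (\<lambda>_. 0)" by (simp add: clinear_iff)
  show "clinear_fls X (F_mod X f \<alpha>) (\<lambda>m. u m + v m)"
    if "clinear_fls X (F_mod X f \<alpha>) u" "clinear_fls X (F_mod X f \<alpha>) v" for u v
    using that unfolding clinear_iff by (simp add: algebra_simps)
  show "clinear_fls X (F_mod X f \<alpha>) (\<lambda>m. u m - s * v m)"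
    if "clinear_fls X (F_mod X f \<alpha>) u" "clinear_fls X (F_mod X f \<alpha>) v" for u v s
    using that unfolding clinear_iff by (simp add: algebra_simps)
  show "clinear_fls X (F_mod X f \<alpha>) (\<lambda>m. u (act j m) - \<phi> j * u m)"
    if "j < N" "clinear_fls X (F_mod X f \<alpha>) u" for j u by (rule clinear_act[OF that])
  show "\<exists>u. clinear_fls X (F_mod X f \<alpha>) u \<and> (\<forall>j<k. \<forall>m\<in>RF. u (act j m) = \<phi> j * u m) \<and>
      (\<forall>m\<in>RF. u (act k m) - \<phi> k * u m = v m)"
    if "k < N" "clinear_fls X (F_mod X f \<alpha>) v"
      "\<And>j m. j < k \<Longrightarrow> m \<in> RF \<Longrightarrow> v (act j m) = \<phi> j * v m" for k v
    by (rule koszul_operator_surjective[OF that])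
  show "clinear_fls X (F_mod X f \<alpha>) (z J)" if "J \<subseteq> {..<N}" "card J = i" for J
    using assms(1) that by (simp add: cocycle_def cochain_def)
  show "kd act \<phi> z J m = 0" if "J \<subseteq> {..<N}" "card J = Suc i" "m \<in> RF" for J m
    using assms(1) that unfolding cocycle_def koszul_diff_F_mod by simp
qed

text \<open>The connection \<open>pull_conn\<close> of the pullback, in terms of \<open>nabla\<close>.\<close>

definition pc :: "(nat \<Rightarrow> complex fls) \<Rightarrow> complex \<Rightarrow> (('m cmat \<Rightarrow> complex) \<Rightarrow> complex fls) \<Rightarrow> ('m cmat \<Rightarrow> complex) \<Rightarrow> complex fls" where
  "pc \<phi> \<alpha> u m = fls_deriv (u m) - (\<Sum>j<N. fls_deriv (\<phi> j) * u (nabla \<alpha> (b j) m))"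

lemma pull_conn_F_mod: "m \<in> RF \<Longrightarrow> pull_conn N b \<phi> (F_mod X f \<alpha>) u m = pc \<phi> \<alpha> u m"
  by (simp add: pull_conn_def pc_def der_F_mod)

lemma pc_cong: "(\<And>m. m \<in> RF \<Longrightarrow> u m = v m) \<Longrightarrow> m \<in> RF \<Longrightarrow> pc \<phi> \<alpha> u m = pc \<phi> \<alpha> v m"
  by (simp add: pc_def nabla_in b_in)

lemma pc_clinear: assumes "clinear_fls X (F_mod X f \<alpha>) u" shows "clinear_fls X (F_mod X f \<alpha>) (pc \<phi> \<alpha> u)"
  using assms unfolding clinear_iff pc_def
  by (simp add: nabla_add nabla_cmult nabla_in b_in sum.distrib sum_distrib_left algebra_simps)

lemma pc_act:
  assumes u: "clinear_fls X (F_mod X f \<alpha>) u" and j: "j < N" and m: "m \<in> RF"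
  shows "pc \<phi> \<alpha> (\<lambda>m. u (act j m) - \<phi> j * u m) m = pc \<phi> \<alpha> u (act j m) - \<phi> j * pc \<phi> \<alpha> u m"
proof -
  have u_add: "u (\<lambda>A. m A + m' A) = u m + u m'" if "m \<in> RF" "m' \<in> RF" for m m'
    using u that unfolding clinear_iff by blast
  have u_sc: "u (\<lambda>A. c * m A) = fls_const c * u m" if "m \<in> RF" for m c
    using u that unfolding clinear_iff by blast
  have comm: "u (nabla \<alpha> (b l) (act j m)) = (if l = j then u m else 0) + u (act j (nabla \<alpha> (b l) m))" if l: "l < N" for l
  proof -
    have "nabla \<alpha> (b l) (act j m) = (\<lambda>A. x j (b l) * m A + act j (nabla \<alpha> (b l) m) A)"
    proof
      fix A
      have "nabla \<alpha> (b l) (act j m) A = pdd (b l) (xp j) A * m A + xp j A * nabla \<alpha> (b l) m A"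
        unfolding x_smult[OF j m] nabla_pmult[OF xp(3)[OF j] m b_in[OF l]] ..
      then show "nabla \<alpha> (b l) (act j m) A = x j (b l) * m A + act j (nabla \<alpha> (b l) m) A"
        using pdd_xp[OF j b_in[OF l], of A] x_eq[OF j, of A] RF_out[OF m, of A] nabla_out[OF m, of A]
        by (cases "A \<in> U") (auto simp: U_iff)
    qed
    then have "u (nabla \<alpha> (b l) (act j m)) = fls_const (x j (b l)) * u m + u (act j (nabla \<alpha> (b l) m))"
      using u_add[OF RF_cmult[OF m] act_in[OF j nabla_in[OF m b_in[OF l]]], of "x j (b l)"] u_sc[OF m] by simp
    then show ?thesis using l j by (simp add: x_b)
  qed
  have "(\<Sum>l<N. fls_deriv (\<phi> l) * u (nabla \<alpha> (b l) (act j m)))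
    = fls_deriv (\<phi> j) * u m + (\<Sum>l<N. fls_deriv (\<phi> l) * u (act j (nabla \<alpha> (b l) m)))"
  proof -
    have "(\<Sum>l<N. fls_deriv (\<phi> l) * u (nabla \<alpha> (b l) (act j m)))
      = (\<Sum>l<N. (if l = j then fls_deriv (\<phi> l) * u m else 0) + fls_deriv (\<phi> l) * u (act j (nabla \<alpha> (b l) m)))"
      by (intro sum.cong) (simp_all add: comm distrib_left)
    then show ?thesis using j by (simp add: sum.distrib)
  qed
  then show ?thesis
    by (simp add: pc_def sum_subtractf sum_distrib_left algebra_simps)
qed

lemma pc_kd:
  assumes c: "\<And>j. j \<in> J \<Longrightarrow> clinear_fls X (F_mod X f \<alpha>) (c (J - {j}))" and J: "J \<subseteq> {..<N}" and m: "m \<in> RF"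
  shows "pc \<phi> \<alpha> (kd act \<phi> c J) m = kd act \<phi> (\<lambda>J. pc \<phi> \<alpha> (c J)) J m"
proof -
  have "pc \<phi> \<alpha> (\<lambda>m. \<Sum>j\<in>J. (-1) ^ n j * h j m) m = (\<Sum>j\<in>J. (-1) ^ n j * pc \<phi> \<alpha> (h j) m)"
    for n :: "nat \<Rightarrow> nat" and h
  proof -
    have ds: "fls_deriv (\<Sum>j\<in>J. g j) = (\<Sum>j\<in>J. fls_deriv (g j))" for g :: "nat \<Rightarrow> complex fls"
      by (induction J rule: infinite_finite_induct) simp_all
    have "(\<Sum>l<N. fls_deriv (\<phi> l) * (\<Sum>j\<in>J. (-1) ^ n j * h j (nabla \<alpha> (b l) m)))
      = (\<Sum>j\<in>J. (-1) ^ n j * (\<Sum>l<N. fls_deriv (\<phi> l) * h j (nabla \<alpha> (b l) m)))"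
      unfolding sum_distrib_left by (subst sum.swap) (simp add: mult.left_commute)
    then show ?thesis
      unfolding pc_def ds fls_deriv_sign right_diff_distrib sum_subtractf by simp
  qed
  then have "pc \<phi> \<alpha> (kd act \<phi> c J) m
    = (\<Sum>j\<in>J. (-1) ^ card {k \<in> J. k < j} * pc \<phi> \<alpha> (\<lambda>m. c (J - {j}) (act j m) - \<phi> j * c (J - {j}) m) m)"
    unfolding kd_def[abs_def] .
  also have "\<dots> = kd act \<phi> (\<lambda>J. pc \<phi> \<alpha> (c J)) J m"
    unfolding kd_def using J by (intro sum.cong refl arg_cong2[where f = "(*)"] pc_act c m) auto
  finally show ?thesis .
qed

text \<open>The cocycles of degree zero. Such a functional is a multiple of the evaluation at the germ \<open>\<phi>\<close>, and
  multiplication by a polynomial acts on it through the value of the polynomial at \<open>\<phi>\<close>.\<close>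

definition germ_functional :: "(nat \<Rightarrow> complex fls) \<Rightarrow> complex \<Rightarrow> (('m cmat \<Rightarrow> complex) \<Rightarrow> complex fls) \<Rightarrow> bool" where
  "germ_functional \<phi> \<alpha> u \<longleftrightarrow>
     clinear_fls X (F_mod X f \<alpha>) u \<and> (\<forall>j<N. \<forall>m\<in>RF. u (act j m) = \<phi> j * u m)"

lemma germ_functional_facts:
  assumes "germ_functional \<phi> \<alpha> u"
  shows germ_add: "m \<in> RF \<Longrightarrow> m' \<in> RF \<Longrightarrow> u (\<lambda>A. m A + m' A) = u m + u m'"
    and germ_scale: "m \<in> RF \<Longrightarrow> u (\<lambda>A. c * m A) = fls_const c * u m"
    and germ_act: "j < N \<Longrightarrow> m \<in> RF \<Longrightarrow> u (act j m) = \<phi> j * u m"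
    and germ_clinear: "clinear_fls X (F_mod X f \<alpha>) u"
  using assms unfolding germ_functional_def clinear_iff by simp_all

lemma germ_scalar:
  assumes "p \<in> poly_funs"
  shows "\<exists>s. \<forall>u. germ_functional \<phi> \<alpha> u \<longrightarrow> (\<forall>m\<in>RF. u (\<lambda>A. p A * m A) = s * u m)"
  using assms
proof induction
  case (const c)
  show ?case by (rule exI[of _ "fls_const c"]) (simp add: germ_scale)
next
  case (entry k l)
  show ?case
  proof (intro exI[of _ "\<Sum>j<N. fls_const (b j $ k $ l) * \<phi> j"] allI impI ballI)
    fix u m assume u: "germ_functional \<phi> \<alpha> u" and m: "m \<in> RF"
    note u_add = germ_add[OF u] and u_sc = germ_scale[OF u]
    have u0: "u (\<lambda>_. 0) = 0" using u_sc[OF RF_zero, of 0] by simp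
    have us: "u (\<lambda>A. \<Sum>j\<in>I. g j A) = (\<Sum>j\<in>I. u (g j))" if "\<And>j. j \<in> I \<Longrightarrow> g j \<in> RF" for I :: "nat set" and g
      using that by (induction I rule: infinite_finite_induct) (simp_all add: u0 u_add RF_sum)
    have "(\<lambda>A. A $ k $ l * m A) = (\<lambda>A. \<Sum>j<N. b j $ k $ l * act j m A)"
    proof
      fix A show "A $ k $ l * m A = (\<Sum>j<N. b j $ k $ l * act j m A)"
        using entry_expand[of A k l] RF_out[OF m, of A]
        by (cases "A \<in> U") (auto simp: U_iff sum_distrib_left sum_distrib_right mult_ac)
    qed
    then have "u (\<lambda>A. A $ k $ l * m A) = (\<Sum>j<N. u (\<lambda>A. b j $ k $ l * act j m A))"
      using us[of "{..<N}" "\<lambda>j A. b j $ k $ l * act j m A"] act_in[OF _ m] by (simp add: RF_cmult)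
    also have "\<dots> = (\<Sum>j<N. fls_const (b j $ k $ l) * (\<phi> j * u m))"
      using m by (intro sum.cong) (simp_all add: u_sc act_in germ_act[OF u])
    finally show "u (\<lambda>A. A $ k $ l * m A) = (\<Sum>j<N. fls_const (b j $ k $ l) * \<phi> j) * u m"
      by (simp add: sum_distrib_right mult.assoc)
  qed
next
  case (add p q)
  obtain s where st1: "\<forall>u. germ_functional \<phi> \<alpha> u \<longrightarrow> (\<forall>m\<in>RF. u (\<lambda>A. p A * m A) = s * u m)"
    using add.IH(1) ..
  obtain t where st2: "\<forall>u. germ_functional \<phi> \<alpha> u \<longrightarrow> (\<forall>m\<in>RF. u (\<lambda>A. q A * m A) = t * u m)"
    using add.IH(2) ..
  note st = st1 st2
  show ?case
  proof (intro exI[of _ "s + t"] allI impI ballI)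
    fix u m assume u: "germ_functional \<phi> \<alpha> u" and m: "m \<in> RF"
    have pm: "(\<lambda>A. p A * m A) \<in> RF" and qm: "(\<lambda>A. q A * m A) \<in> RF" using add m by (auto intro: RF_pmult)
    then have "u (\<lambda>A. p A * m A + q A * m A) = u (\<lambda>A. p A * m A) + u (\<lambda>A. q A * m A)"
      by (rule germ_add[OF u])
    then show "u (\<lambda>A. (p A + q A) * m A) = (s + t) * u m"
      using st(1)[rule_format, OF u m] st(2)[rule_format, OF u m] by (simp add: distrib_right)
  qed
next
  case (mult p q)
  obtain s where st1: "\<forall>u. germ_functional \<phi> \<alpha> u \<longrightarrow> (\<forall>m\<in>RF. u (\<lambda>A. p A * m A) = s * u m)"
    using mult.IH(1) ..
  obtain t where st2: "\<forall>u. germ_functional \<phi> \<alpha> u \<longrightarrow> (\<forall>m\<in>RF. u (\<lambda>A. q A * m A) = t * u m)"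
    using mult.IH(2) ..
  note st = st1 st2
  show ?case
  proof (intro exI[of _ "s * t"] allI impI ballI)
    fix u m assume u: "germ_functional \<phi> \<alpha> u" and m: "m \<in> RF"
    have qm: "(\<lambda>A. q A * m A) \<in> RF" using mult m by (auto intro: RF_pmult)
    have "u (\<lambda>A. p A * (q A * m A)) = s * u (\<lambda>A. q A * m A)" using st(1)[rule_format, OF u qm] .
    also have "u (\<lambda>A. q A * m A) = t * u m" using st(2)[rule_format, OF u m] .
    finally show "u (\<lambda>A. p A * q A * m A) = s * t * u m" by (simp add: mult.assoc)
  qed
qed

text \<open>Let \<open>s\<close> be the value of \<open>f\<close> along the germ. If \<open>s = 0\<close> then \<open>u = 0\<close>, as \<open>f\<close> is invertible in \<open>S\<^sub>f\<close>. Otherwise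
  \<open>u\<close> is determined by its value \<open>u one\<close> on the generator \<open>f\<^sup>\<alpha>\<close>, and so is its image under the connection. The
  ratio of the two is the logarithmic derivative of \<open>u one\<close> minus \<open>\<alpha>\<close> times that of \<open>s\<close>, by the chain
  rule.\<close>

lemma kernel_connection_regular:
  assumes u: "germ_functional \<phi> \<alpha> u"
  shows "\<exists>a. \<forall>m\<in>RF. fls_X * pc \<phi> \<alpha> u m = fps_to_fls a * u m"
proof -
  define one where "one = restr U (\<lambda>_. 1 :: complex)"
  have one: "one \<in> RF" unfolding one_def by (intro RF_poly poly_funs.const)
  obtain s where s': "\<forall>u. germ_functional \<phi> \<alpha> u \<longrightarrow> (\<forall>m\<in>RF. u (\<lambda>A. f A * m A) = s * u m)"
    using germ_scalar[OF f_poly, of \<phi> \<alpha>] ..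
  have s: "u (\<lambda>A. f A * m A) = s * u m" if "germ_functional \<phi> \<alpha> u" "m \<in> RF" for u m
    using s' that by simp
  have "pc \<phi> \<alpha> u (act j m) = \<phi> j * pc \<phi> \<alpha> u m" if "j < N" "m \<in> RF" for j m
  proof -
    have "pc \<phi> \<alpha> (\<lambda>m. u (act j m) - \<phi> j * u m) m = pc \<phi> \<alpha> (\<lambda>_. 0) m"
      using germ_act[OF u that(1)] by (intro pc_cong that(2)) simp
    moreover have "pc \<phi> \<alpha> (\<lambda>_. 0) m = 0" by (simp add: pc_def)
    ultimately show ?thesis using pc_act[OF germ_clinear[OF u] that, of \<phi>] by simp
  qed
  then have u': "germ_functional \<phi> \<alpha> (pc \<phi> \<alpha> u)"
    using pc_clinear[OF germ_clinear[OF u]] by (simp add: germ_functional_def)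
  have scaled: "s ^ l * v (frac p l) = t * v one"
    if v: "germ_functional \<phi> \<alpha> v"
      and t: "v (\<lambda>A. p A * one A) = t * v one" and p: "p \<in> poly_funs" for v p l t
  proof -
    have "v (\<lambda>A. f A ^ i * frac p l A) = s ^ i * v (frac p l)" for i
    proof (induction i)
      case (Suc i)
      have "(\<lambda>A. f A ^ i * frac p l A) \<in> RF" by (intro RF_pmult poly_funs_power f_poly frac_in p)
      from s[OF v this] Suc show ?case by (simp add: mult.assoc)
    qed simp
    moreover have "(\<lambda>A. f A ^ l * frac p l A) = (\<lambda>A. p A * one A)"
      by (auto simp: fun_eq_iff frac_def restr_def one_def U_iff)
    ultimately show ?thesis using t by metis
  qed
  show ?thesis
  proof (cases "\<forall>m\<in>RF. u m = 0")
    case True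
    then have "pc \<phi> \<alpha> u m = 0" if "m \<in> RF" for m using that by (simp add: pc_def nabla_in b_in)
    then show ?thesis by (intro exI[of _ 0]) simp
  next
    case False
    then obtain m0 where m0: "m0 \<in> RF" "u m0 \<noteq> 0" by blast
    have s0: "s \<noteq> 0"
    proof
      assume "s = 0"
      have "(\<lambda>A. m0 A / f A ^ 1) \<in> RF" by (intro RF_div_f m0)
      moreover have "(\<lambda>A. f A * (m0 A / f A ^ 1)) = m0" using RF_out[OF m0(1)] by (auto simp: fun_eq_iff U_iff)
      ultimately have "u m0 = s * u (\<lambda>A. m0 A / f A ^ 1)" using s[OF u] by metis
      then show False using m0(2) \<open>s = 0\<close> by simp
    qed
    have c0: "u one \<noteq> 0"
    proof
      assume "u one = 0"
      obtain p l where p: "p \<in> poly_funs" "m0 = frac p l" using m0(1) unfolding RF_iff by blast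
      obtain t where "\<forall>u. germ_functional \<phi> \<alpha> u \<longrightarrow> (\<forall>m\<in>RF. u (\<lambda>A. p A * m A) = t * u m)"
        using germ_scalar[OF p(1), of \<phi> \<alpha>] ..
      then have "u (\<lambda>A. p A * one A) = t * u one" using u one by simp
      from scaled[OF u this p(1), of l] show False using \<open>u one = 0\<close> s0 m0(2) p(2) by simp
    qed
    have ratio: "pc \<phi> \<alpha> u m = (pc \<phi> \<alpha> u one * inverse (u one)) * u m" if m: "m \<in> RF" for m
    proof -
      obtain p l where p: "p \<in> poly_funs" "m = frac p l" using m unfolding RF_iff by blast
      obtain t where t': "\<forall>u. germ_functional \<phi> \<alpha> u \<longrightarrow> (\<forall>m\<in>RF. u (\<lambda>A. p A * m A) = t * u m)"
        using germ_scalar[OF p(1), of \<phi> \<alpha>] ..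
      have t: "v (\<lambda>A. p A * one A) = t * v one" if "germ_functional \<phi> \<alpha> v" for v using t' that one by simp
      have 1: "s ^ l * u m = t * u one" using scaled[OF u t[OF u] p(1)] p(2) by simp
      have 2: "s ^ l * pc \<phi> \<alpha> u m = t * pc \<phi> \<alpha> u one" using scaled[OF u' t[OF u'] p(1)] p(2) by simp
      have "s ^ l * (pc \<phi> \<alpha> u m * u one) = (s ^ l * pc \<phi> \<alpha> u m) * u one" by (simp only: mult.assoc)
      also have "\<dots> = pc \<phi> \<alpha> u one * (t * u one)" unfolding 2 by (simp only: mult_ac)
      also have "\<dots> = s ^ l * (pc \<phi> \<alpha> u one * u m)" unfolding 1[symmetric] by (simp only: mult_ac)
      finally have "pc \<phi> \<alpha> u m * u one = pc \<phi> \<alpha> u one * u m" using s0 by simp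
      then show ?thesis using c0 by (simp add: field_simps)
    qed
    define m1 where "m1 = frac (\<lambda>_. 1) 1"
    have m1: "m1 \<in> RF" unfolding m1_def by (intro frac_in poly_funs.const)
    have fm1: "(\<lambda>A. f A * m1 A) = one" by (auto simp: fun_eq_iff m1_def one_def frac_def restr_def U_iff)
    have um1: "s * u m1 = u one" using s[OF u m1] fm1 by simp
    note u_add = germ_add[OF u] and u_sc = germ_scale[OF u]
    \<comment> \<open>The chain rule for \<open>f\<close> along the germ, read off from the connection commuting with \<open>f\<close>.\<close>
    have chain: "(\<Sum>j<N. fls_deriv (\<phi> j) * u (\<lambda>A. pdd (b j) f A * m1 A)) = fls_deriv s * u m1"
    proof -
      have pm1: "(\<lambda>A. pdd (b j) f A * m1 A) \<in> RF" for j by (intro RF_pmult pdd_poly f_poly m1)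
      have fm: "(\<lambda>A. f A * nabla \<alpha> (b j) m1 A) \<in> RF" if "j < N" for j by (intro RF_pmult f_poly nabla_in m1 b_in that)
      have "s * pc \<phi> \<alpha> u m1 = pc \<phi> \<alpha> u (\<lambda>A. f A * m1 A)" using s[OF u' m1] by simp
      also have "\<dots> = fls_deriv (s * u m1) - (\<Sum>j<N. fls_deriv (\<phi> j) * (u (\<lambda>A. pdd (b j) f A * m1 A) + s * u (nabla \<alpha> (b j) m1)))"
        unfolding pc_def s[OF u m1]
        by (intro arg_cong2[where f = "(-)"] refl sum.cong)
          (simp add: nabla_pmult f_poly m1 b_in u_add pm1 fm s[OF u nabla_in[OF m1 b_in]])
      finally show ?thesis
        by (simp add: pc_def sum.distrib distrib_left sum_distrib_left algebra_simps)
    qed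
    have "nabla \<alpha> (b j) one = (\<lambda>A. \<alpha> * (pdd (b j) f A * m1 A))" if "j < N" for j
    proof -
      have o: "one = frac (\<lambda>_. 1) 0" by (simp add: one_def frac_def)
      have "nabla \<alpha> (b j) one = frac (\<lambda>A. \<alpha> * pdd (b j) f A) 1"
        unfolding o using nabla_frac[OF poly_funs.const b_in[OF that], of \<alpha> 1 0] by simp
      then show ?thesis by (auto simp: m1_def frac_def restr_def fun_eq_iff)
    qed
    then have "(\<Sum>j<N. fls_deriv (\<phi> j) * u (nabla \<alpha> (b j) one)) = fls_const \<alpha> * (\<Sum>j<N. fls_deriv (\<phi> j) * u (\<lambda>A. pdd (b j) f A * m1 A))"
      unfolding sum_distrib_left
      by (intro sum.cong refl) (simp add: u_sc RF_pmult pdd_poly f_poly m1 mult.left_commute)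
    then have "pc \<phi> \<alpha> u one = fls_deriv (u one) - fls_const \<alpha> * (fls_deriv s * u m1)"
      by (simp add: pc_def chain)
    moreover have "u m1 = u one * inverse s" using um1 s0 by (simp add: field_simps)
    ultimately have pc1: "pc \<phi> \<alpha> u one = fls_deriv (u one) - fls_const \<alpha> * (fls_deriv s * (u one * inverse s))" by simp
    have "fls_X * (pc \<phi> \<alpha> u one * inverse (u one)) = fls_X * fls_deriv (u one) * inverse (u one)
      + (- fls_const \<alpha>) * (fls_X * fls_deriv s * inverse s) * (u one * inverse (u one))"
      unfolding pc1 by (simp add: algebra_simps)
    then have q: "fls_X * (pc \<phi> \<alpha> u one * inverse (u one))
      = fls_X * fls_deriv (u one) * inverse (u one) + (- fls_const \<alpha>) * (fls_X * fls_deriv s * inverse s)"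
      using c0 by simp
    have "fls_subdegree (fls_X * (pc \<phi> \<alpha> u one * inverse (u one))) \<ge> 0"
    proof (rule fls_subdegree_ge0I)
      fix n :: int assume n: "n < 0"
      have "fls_nth (fls_X * fls_deriv r * inverse r) n = 0" if "r \<noteq> 0" for r :: "complex fls"
        using log_derivative_regular[OF that] n by (intro fls_eq0_below_subdegree) simp
      then show "fls_nth (fls_X * (pc \<phi> \<alpha> u one * inverse (u one))) n = 0"
        unfolding q using c0 s0 by (simp flip: fls_const_uminus)
    qed
    then have a: "fps_to_fls (fls_regpart (fls_X * (pc \<phi> \<alpha> u one * inverse (u one)))) = fls_X * (pc \<phi> \<alpha> u one * inverse (u one))"
      by (rule fls_regpart_to_fls_trivial)
    show ?thesis
      by (intro exI[of _ "fls_regpart (fls_X * (pc \<phi> \<alpha> u one * inverse (u one)))"] ballI, unfold a, subst ratio)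
        (simp_all add: mult.assoc)
  qed
qed

text \<open>In positive degrees a cocycle is a boundary, and its derivative is the boundary of the derivative; in
  degree zero the cocycle itself spans a module of rank one that is stable under \<open>t \<nabla>\<close>.\<close>

lemma F_mod_regular: "regular X (F_mod X f \<alpha>)"
  unfolding regular_def
proof (rule exI[of _ N], rule exI[of _ b], rule exI[of _ x], intro conjI coords allI impI)
  fix \<phi> i z assume z: "cocycle X N x \<phi> (F_mod X f \<alpha>) i z"
  have "\<exists>a. coboundary X N x \<phi> (F_mod X f \<alpha>) i
    (\<lambda>J m. fls_X * pull_conn N b \<phi> (F_mod X f \<alpha>) (z J) m - fps_to_fls a * z J m)"
  proof (cases "i = 0")
    case True
    have zl: "clinear_fls X (F_mod X f \<alpha>) (z {})" using z True by (simp add: cocycle_def cochain_def)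
    have "z {} (act j m) = \<phi> j * z {} m" if "j < N" "m \<in> RF" for j m
    proof -
      have "\<forall>J. J \<subseteq> {..<N} \<and> card J = Suc i \<longrightarrow> (\<forall>m\<in>carrier (F_mod X f \<alpha>). kd act \<phi> z J m = 0)"
        using z unfolding cocycle_def koszul_diff_F_mod by (rule conjunct2)
      from this[rule_format, of "{j}" m] show ?thesis using that True by simp
    qed
    then have "germ_functional \<phi> \<alpha> (z {})" using zl by (simp add: germ_functional_def)
    from kernel_connection_regular[OF this] obtain a where
      a: "\<forall>m\<in>RF. fls_X * pc \<phi> \<alpha> (z {}) m = fps_to_fls a * z {} m" by blast
    show ?thesis
    proof (rule exI[of _ a], unfold coboundary_def koszul_diff_F_mod, rule exI[of _ "\<lambda>_ _. 0"], intro conjI allI impI ballI)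
      fix J m assume J: "J \<subseteq> {..<N} \<and> card J = i" and m: "m \<in> carrier (F_mod X f \<alpha>)"
      then have "J = {}" using True finite_subset[of J "{..<N}"] by auto
      then show "fls_X * pull_conn N b \<phi> (F_mod X f \<alpha>) (z J) m - fps_to_fls a * z J m = kd act \<phi> (\<lambda>_ _. 0) J m"
        using a m by (simp add: pull_conn_F_mod)
    qed (use True in simp)
  next
    case False
    obtain c where c: "\<And>J. J \<subseteq> {..<N} \<Longrightarrow> Suc (card J) = i \<Longrightarrow> clinear_fls X (F_mod X f \<alpha>) (c J)"
      "\<And>J m. J \<subseteq> {..<N} \<Longrightarrow> card J = i \<Longrightarrow> m \<in> RF \<Longrightarrow> z J m = kd act \<phi> c J m"
      using koszul_vanishing[OF z] False by (auto simp: Suc_le_eq)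
    show ?thesis
    proof (rule exI[of _ 0], unfold coboundary_def koszul_diff_F_mod,
        rule exI[of _ "\<lambda>J m. fls_X * pc \<phi> \<alpha> (c J) m"], intro conjI allI impI ballI)
      fix k assume "Suc k = i"
      then show "cochain X N (F_mod X f \<alpha>) k (\<lambda>J m. fls_X * pc \<phi> \<alpha> (c J) m)"
        unfolding cochain_def using pc_clinear[OF c(1)] by (auto simp: clinear_iff algebra_simps)
    next
      fix J m assume J: "J \<subseteq> {..<N} \<and> card J = i" and m: "m \<in> carrier (F_mod X f \<alpha>)"
      then have mR: "m \<in> RF" by simp
      have fin: "finite J" using J finite_subset by blast
      have cl: "clinear_fls X (F_mod X f \<alpha>) (c (J - {j}))" if "j \<in> J" for j
        using J that fin card_Suc_Diff1[OF fin that] by (intro c(1)) auto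
      have "pull_conn N b \<phi> (F_mod X f \<alpha>) (z J) m = pc \<phi> \<alpha> (kd act \<phi> c J) m"
        unfolding pull_conn_F_mod[OF mR] using J c(2) by (intro pc_cong mR) auto
      also have "\<dots> = kd act \<phi> (\<lambda>J. pc \<phi> \<alpha> (c J)) J m" using J by (intro pc_kd cl mR) auto
      finally show "fls_X * pull_conn N b \<phi> (F_mod X f \<alpha>) (z J) m - fps_to_fls 0 * z J m
        = kd act \<phi> (\<lambda>J m. fls_X * pc \<phi> \<alpha> (c J) m) J m"
        by (simp add: kd_def sum_distrib_left algebra_simps)
    qed
  qed
  then obtain a where a: "coboundary X N x \<phi> (F_mod X f \<alpha>) i
    (\<lambda>J m. fls_X * pull_conn N b \<phi> (F_mod X f \<alpha>) (z J) m - fps_to_fls a * z J m)" by blast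
  show "\<exists>r Z. \<exists>a :: nat \<Rightarrow> nat \<Rightarrow> complex fps. 0 < r \<and> Z 0 = z \<and> (\<forall>k<r. cocycle X N x \<phi> (F_mod X f \<alpha>) i (Z k)) \<and>
      (\<forall>k<r. coboundary X N x \<phi> (F_mod X f \<alpha>) i
        (\<lambda>J m. fls_X * pull_conn N b \<phi> (F_mod X f \<alpha>) (Z k J) m - (\<Sum>l<r. fps_to_fls (a k l) * Z l J m)))"
    using z a by (intro exI[of _ 1] exI[of _ "\<lambda>_. z"] exI[of _ "\<lambda>_ _. a"]) simp
qed

end

section \<open>Local systems\<close>

lemma mat1_mult [simp]: "(A ** B) $ 1 $ 1 = A $ 1 $ 1 * B $ 1 $ 1" for A B :: "complex ^ 1 ^ 1"
  by (simp add: matrix_matrix_mult_def UNIV_1)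

lemma mat1_nonzero: "invertible A \<Longrightarrow> A $ 1 $ 1 \<noteq> 0" for A :: "complex ^ 1 ^ 1"
proof
  assume "invertible A" "A $ 1 $ 1 = 0"
  then obtain B where "A ** B = mat 1" by (auto simp: invertible_def)
  then have "(A ** B) $ 1 $ 1 = 1" by (simp add: mat_def)
  then show False using \<open>A $ 1 $ 1 = 0\<close> by simp
qed

lemma mat1_eq_iff: "A = B \<longleftrightarrow> A $ 1 $ 1 = B $ 1 $ 1" for A B :: "complex ^ 1 ^ 1"
  by (simp add: vec_eq_iff forall_1)

lemma mat1_invertible: "c \<noteq> 0 \<Longrightarrow> invertible (mat c :: complex ^ 1 ^ 1)"
  unfolding invertible_def by (rule exI[of _ "mat (1 / c)"]) (simp add: mat1_eq_iff mat_def)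

lemma poly_funs_line:
  assumes "p \<in> poly_funs" shows "\<exists>q. \<forall>t. p (A + mscale t v) = poly q t"
  using assms
proof induction
  case (const c)
  show ?case by (rule exI[of _ "[:c:]"]) simp
next
  case (entry i j)
  show ?case by (rule exI[of _ "[:A $ i $ j, v $ i $ j:]"]) simp
next
  case (add p q)
  then obtain p' q' where "\<forall>t. p (A + mscale t v) = poly p' t" "\<forall>t. q (A + mscale t v) = poly q' t" by blast
  then show ?case by (intro exI[of _ "p' + q'"]) simp
next
  case (mult p q)
  then obtain p' q' where "\<forall>t. p (A + mscale t v) = poly p' t" "\<forall>t. q (A + mscale t v) = poly q' t" by blast
  then show ?case by (intro exI[of _ "p' * q'"]) simp
qed

lemma continuous_mscale: "continuous_on S (\<lambda>t. A + mscale t v)"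
  unfolding mscale_def
  by (intro continuous_intros)

text \<open>The factor by which \<open>f\<^sup>\<alpha>\<close> is multiplied under continuation along \<open>p\<close>. The winding number of a path that is
  not closed is complex and also accounts for the change of the modulus of \<open>f\<close>.\<close>

definition hol :: "('x \<Rightarrow> complex) \<Rightarrow> complex \<Rightarrow> (real \<Rightarrow> 'x) \<Rightarrow> complex" where
  "hol f \<alpha> p = exp (2 * of_real pi * \<i> * \<alpha> * winding_number (f \<circ> p) 0)"

lemma hol_nonzero [simp]: "hol f \<alpha> p \<noteq> 0"
  by (simp add: hol_def)

lemma hol_lift:
  assumes "path q" "\<And>t. t \<in> {0..1} \<Longrightarrow> f (p t) = exp (q t)"
  shows "hol f \<alpha> p = exp (\<alpha> * (q 1 - q 0))"
proof -
  have "winding_number (f \<circ> p) 0 = winding_number (exp \<circ> q) 0"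
    using assms(2) by (intro winding_number_cong) auto
  also have "\<dots> = (q 1 - q 0) / (2 * of_real pi * \<i>)"
    using winding_number_compose_exp[OF assms(1)] by (simp add: pathstart_def pathfinish_def)
  finally have e: "2 * of_real pi * \<i> * winding_number (f \<circ> p) 0 = q 1 - q 0" by (simp add: field_simps)
  have "2 * of_real pi * \<i> * \<alpha> * winding_number (f \<circ> p) 0 = \<alpha> * (2 * of_real pi * \<i> * winding_number (f \<circ> p) 0)"
    by (simp only: mult_ac)
  then show ?thesis unfolding hol_def by (simp only: e)
qed

context matrix_space
begin

text \<open>On the complex line through two points of \<open>U\<close> there are finitely many zeros of \<open>f\<close>, and a path in the
  line avoids them.\<close>

lemma U_path_connected: "path_connected U"
  unfolding path_connected_def
proof (intro ballI)
  fix A B assume A: "A \<in> U" and B: "B \<in> U"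
  define v where "v = B - A"
  have v: "v \<in> X"
    using add_in[of B "mscale (-1) A"] scale_in[of A "-1"] A B by (simp add: v_def U_iff)
  define Z where "Z = {t. f (A + mscale t v) = 0}"
  obtain q where q: "\<forall>t. f (A + mscale t v) = poly q t" using poly_funs_line[OF f_poly] by blast
  have "poly q 0 \<noteq> 0" using q[rule_format, of 0] A by (simp add: U_iff)
  then have "q \<noteq> 0" by auto
  then have "finite Z" using poly_roots_finite[of q] q by (simp add: Z_def)
  then have "path_connected (- Z)" by (intro path_connected_complement_countable) (auto intro: countable_finite)
  moreover have "0 \<in> - Z" "1 \<in> - Z" using A B by (auto simp: Z_def v_def U_iff)
  ultimately obtain g where g: "path g" "path_image g \<subseteq> - Z" "pathstart g = 0" "pathfinish g = 1"
    unfolding path_connected_def by blast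
  show "\<exists>g. path g \<and> path_image g \<subseteq> U \<and> pathstart g = A \<and> pathfinish g = B"
  proof (intro exI[of _ "(\<lambda>t. A + mscale t v) \<circ> g"] conjI)
    show "path ((\<lambda>t. A + mscale t v) \<circ> g)" by (rule path_continuous_image[OF g(1) continuous_mscale])
    show "path_image ((\<lambda>t. A + mscale t v) \<circ> g) \<subseteq> U"
      using g(2) A v by (auto simp: path_image_compose Z_def U_iff intro: line_in)
    show "pathstart ((\<lambda>t. A + mscale t v) \<circ> g) = A" using g(3) by (simp add: pathstart_compose)
    show "pathfinish ((\<lambda>t. A + mscale t v) \<circ> g) = B" using g(4) by (simp add: pathfinish_compose v_def)
  qed
qed

lemma f_path: "path p \<Longrightarrow> path (f \<circ> p)"
  by (rule path_continuous_image) (auto intro: poly_funs_continuous f_poly)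

lemma f_path_avoids: "path_image p \<subseteq> U \<Longrightarrow> 0 \<notin> path_image (f \<circ> p)"
  by (auto simp: path_image_compose U_iff)

lemma hol_join:
  assumes "path p" "path q" "path_image p \<subseteq> U" "path_image q \<subseteq> U" "pathfinish p = pathstart q"
  shows "hol f \<alpha> (p +++ q) = hol f \<alpha> p * hol f \<alpha> q"
proof -
  have "winding_number (f \<circ> (p +++ q)) 0 = winding_number (f \<circ> p) 0 + winding_number (f \<circ> q) 0"
    unfolding path_compose_join
    by (intro winding_number_join f_path f_path_avoids assms) (simp add: pathstart_compose pathfinish_compose assms(5))
  then show ?thesis by (simp add: hol_def distrib_left exp_add)
qed

text \<open>A local system of rank one on a connected space is determined by its monodromy up to a change of frames
  \<open>s\<close>. The frame at \<open>A\<close> is obtained from the one at a base point by transport along a chosen path, and its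
  dependence on the path is controlled by the monodromy of a loop.\<close>

lemma local_system_normal_form:
  fixes L :: "(real \<Rightarrow> 'm cmat) \<Rightarrow> complex ^ 1 ^ 1"
  assumes L: "local_system U L" and mono: "has_monodromy U f \<alpha> L"
  shows "\<exists>s. (\<forall>A\<in>U. s A \<noteq> 0) \<and>
    (\<forall>p. path p \<and> path_image p \<subseteq> U \<longrightarrow> L p $ 1 $ 1 = hol f \<alpha> p * s (pathfinish p) / s (pathstart p))"
proof -
  define l where "l p = L p $ 1 $ 1" for p
  have l_nz: "l p \<noteq> 0" if "path p" "path_image p \<subseteq> U" for p
    using L that unfolding l_def local_system_def by (intro mat1_nonzero) blast
  have l_join: "l (p +++ q) = l p * l q"
    if "path p" "path q" "path_image p \<subseteq> U" "path_image q \<subseteq> U" "pathfinish p = pathstart q" for p q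
    using L that unfolding l_def local_system_def by simp
  have l_loop: "l p = hol f \<alpha> p" if "path p" "path_image p \<subseteq> U" "pathfinish p = pathstart p" for p
    using mono that unfolding l_def has_monodromy_def hol_def by (simp add: mat_def)
  obtain A0 where A0: "A0 \<in> U" using f_nonzero by (auto simp: U_iff)
  have "\<exists>g. path g \<and> path_image g \<subseteq> U \<and> pathstart g = A0 \<and> pathfinish g = A" if "A \<in> U" for A
    using U_path_connected that A0 unfolding path_connected_def by blast
  then obtain \<gamma> where \<gamma>: "path (\<gamma> A)" "path_image (\<gamma> A) \<subseteq> U" "pathstart (\<gamma> A) = A0" "pathfinish (\<gamma> A) = A"
    if "A \<in> U" for A by metis
  define s where "s A = l (\<gamma> A) / hol f \<alpha> (\<gamma> A)" for A
  have "l p = hol f \<alpha> p * s (pathfinish p) / s (pathstart p)" if p: "path p" "path_image p \<subseteq> U" for p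
  proof -
    let ?A = "pathstart p" and ?B = "pathfinish p"
    have AB: "?A \<in> U" "?B \<in> U" using p by auto
    note gA = \<gamma>[OF AB(1)] and gB = \<gamma>[OF AB(2)]
    define r where "r = reversepath (\<gamma> ?B)"
    have r: "path r" "path_image r \<subseteq> U" "pathstart r = ?B" "pathfinish r = A0" using gB by (auto simp: r_def)
    have i: "path_image (\<gamma> ?A +++ p) \<subseteq> U" using gA p by (auto simp: path_image_join)
    have 1: "l (\<gamma> ?A) * l p * l r = hol f \<alpha> (\<gamma> ?A) * hol f \<alpha> p * hol f \<alpha> r"
    proof -
      have "l ((\<gamma> ?A +++ p) +++ r) = hol f \<alpha> ((\<gamma> ?A +++ p) +++ r)"
        using gA p r i by (intro l_loop) (auto simp: path_image_join)
      then show ?thesis using gA p r i by (simp add: l_join hol_join)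
    qed
    have 2: "l (\<gamma> ?B) * l r = hol f \<alpha> (\<gamma> ?B) * hol f \<alpha> r"
    proof -
      have "l (\<gamma> ?B +++ r) = hol f \<alpha> (\<gamma> ?B +++ r)"
        using gB r by (intro l_loop) (auto simp: path_image_join)
      then show ?thesis using gB r by (simp add: l_join hol_join)
    qed
    have nz: "l (\<gamma> ?A) \<noteq> 0" "l (\<gamma> ?B) \<noteq> 0" "l r \<noteq> 0" using gA gB r by (simp_all add: l_nz)
    have "hol f \<alpha> r = l (\<gamma> ?B) * l r / hol f \<alpha> (\<gamma> ?B)" using 2 by (simp add: field_simps)
    with 1 have "l (\<gamma> ?A) * l p = hol f \<alpha> (\<gamma> ?A) * hol f \<alpha> p * (l (\<gamma> ?B) / hol f \<alpha> (\<gamma> ?B))"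
      using nz by (simp add: field_simps)
    then show ?thesis using nz by (simp add: s_def field_simps)
  qed
  moreover have "s A \<noteq> 0" if "A \<in> U" for A using l_nz \<gamma>[OF that] by (simp add: s_def)
  ultimately show ?thesis unfolding l_def by blast
qed

text \<open>Formally \<open>f\<^sup>\<alpha>(g A) = \<kappa>(g)\<^sup>c\<^sup>\<alpha> f\<^sup>\<alpha>(A)\<close>, and for \<open>c * \<alpha> = k\<close> the factor \<open>\<kappa>(g)\<^sup>k\<close> is a single valued
  character. It serves as equivariant structure, after correction by the frames.\<close>

lemma equivariant_if_integral:
  fixes L :: "(real \<Rightarrow> 'm cmat) \<Rightarrow> complex ^ 1 ^ 1" and G :: "'g::topological_space set" and c :: nat
  assumes L: "local_system U L" and mono: "has_monodromy U f \<alpha> L" and int: "of_nat c * \<alpha> = of_int k"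
    and act: "\<And>g A. g \<in> G \<Longrightarrow> A \<in> U \<Longrightarrow> act g A \<in> U"
    and f_act: "\<And>g A. g \<in> G \<Longrightarrow> A \<in> U \<Longrightarrow> f (act g A) = \<kappa> g ^ c * f A"
    and \<kappa>: "\<And>g. g \<in> G \<Longrightarrow> \<kappa> g \<noteq> 0"
    and mul: "\<And>g h. g \<in> G \<Longrightarrow> h \<in> G \<Longrightarrow> \<kappa> (gmul g h) = \<kappa> g * \<kappa> h"
      "\<And>g h A. g \<in> G \<Longrightarrow> h \<in> G \<Longrightarrow> A \<in> U \<Longrightarrow> act (gmul g h) A = act g (act h A)"
    and path_\<kappa>: "\<And>p. path p \<Longrightarrow> path_image p \<subseteq> G \<Longrightarrow> path (\<kappa> \<circ> p)"
    and path_act: "\<And>p q. path p \<Longrightarrow> path q \<Longrightarrow> path_image p \<subseteq> G \<Longrightarrow> path (\<lambda>t. act (p t) (q t))"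
  shows "equivariant G gmul act U L"
proof -
  obtain s where s: "\<And>A. A \<in> U \<Longrightarrow> s A \<noteq> 0"
    "\<And>p. path p \<Longrightarrow> path_image p \<subseteq> U \<Longrightarrow> L p $ 1 $ 1 = hol f \<alpha> p * s (pathfinish p) / s (pathstart p)"
    using local_system_normal_form[OF L mono] by blast
  have hol_act: "hol f \<alpha> (\<lambda>t. act (p t) (q t)) * \<kappa> (p 0) powi k = \<kappa> (p 1) powi k * hol f \<alpha> q"
    if p: "path p" "path_image p \<subseteq> G" and q: "path q" "path_image q \<subseteq> U" for p q
  proof -
    have pG: "p t \<in> G" and qU: "q t \<in> U" if "t \<in> {0..1}" for t using p q that by (auto simp: path_image_def)
    have "0 \<notin> path_image (\<kappa> \<circ> p)" using \<kappa> p(2) by (auto simp: path_image_compose)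
    from winding_number_as_continuous_log[OF path_\<kappa>[OF p] this] obtain a where
      a: "path a" "\<And>t. t \<in> {0..1} \<Longrightarrow> (\<kappa> \<circ> p) t = 0 + exp (a t)" by blast
    from winding_number_as_continuous_log[OF f_path[OF q(1)] f_path_avoids[OF q(2)]] obtain b where
      b: "path b" "\<And>t. t \<in> {0..1} \<Longrightarrow> (f \<circ> q) t = 0 + exp (b t)" by blast
    have "path (\<lambda>t. of_nat c * a t + b t)" using a(1) b(1) unfolding path_def by (intro continuous_intros)
    moreover have "f (act (p t) (q t)) = exp (of_nat c * a t + b t)" if "t \<in> {0..1}" for t
      using f_act[OF pG[OF that] qU[OF that]] a(2)[OF that] b(2)[OF that]
      by (simp add: exp_add exp_of_nat_mult)
    ultimately have "hol f \<alpha> (\<lambda>t. act (p t) (q t)) = exp (\<alpha> * ((of_nat c * a 1 + b 1) - (of_nat c * a 0 + b 0)))"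
      by (rule hol_lift)
    also have "\<alpha> * ((of_nat c * a 1 + b 1) - (of_nat c * a 0 + b 0))
        = (of_nat c * \<alpha>) * a 1 - (of_nat c * \<alpha>) * a 0 + \<alpha> * (b 1 - b 0)" by (simp add: algebra_simps)
    also have "exp \<dots> = exp (of_int k * a 1) / exp (of_int k * a 0) * exp (\<alpha> * (b 1 - b 0))"
      unfolding int by (simp add: exp_add exp_diff)
    also have "exp (\<alpha> * (b 1 - b 0)) = hol f \<alpha> q" using b by (subst hol_lift[of b]) auto
    also have "exp (of_int k * a 1) = \<kappa> (p 1) powi k" using a(2)[of 1] by (simp add: exp_power_int)
    also have "exp (of_int k * a 0) = \<kappa> (p 0) powi k" using a(2)[of 0] by (simp add: exp_power_int)
    finally show ?thesis using \<kappa>[OF pG[of 0]] by (simp add: field_simps)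
  qed
  define \<theta> :: "'g \<Rightarrow> 'm cmat \<Rightarrow> complex ^ 1 ^ 1" where "\<theta> g A = mat (\<kappa> g powi k * s (act g A) / s A)" for g A
  show ?thesis unfolding equivariant_def
  proof (intro exI[of _ \<theta>] conjI ballI allI impI)
    fix g A assume "g \<in> G" "A \<in> U"
    then show "invertible (\<theta> g A)" unfolding \<theta>_def using \<kappa> s(1) act by (intro mat1_invertible) simp
  next
    fix p q assume pq: "path p \<and> path_image p \<subseteq> G \<and> path q \<and> path_image q \<subseteq> U"
    have pG: "p t \<in> G" and qU: "q t \<in> U" if "t \<in> {0..1}" for t using pq that by (auto simp: path_image_def)
    have "path_image (\<lambda>t. act (p t) (q t)) \<subseteq> U" using pG qU act by (auto simp: path_image_def)
    moreover have "path (\<lambda>t. act (p t) (q t))" using pq by (intro path_act) auto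
    ultimately have "L (\<lambda>t. act (p t) (q t)) $ 1 $ 1
      = hol f \<alpha> (\<lambda>t. act (p t) (q t)) * s (act (p 1) (q 1)) / s (act (p 0) (q 0))"
      by (simp add: s(2) pathstart_def pathfinish_def)
    moreover have "L q $ 1 $ 1 = hol f \<alpha> q * s (q 1) / s (q 0)"
      using pq by (simp add: s(2) pathstart_def pathfinish_def)
    moreover have "s (q 0) \<noteq> 0" "s (q 1) \<noteq> 0" "s (act (p 0) (q 0)) \<noteq> 0"
      using s(1) act pG qU by auto
    moreover have "hol f \<alpha> (\<lambda>t. act (p t) (q t)) * \<kappa> (p 0) powi k = \<kappa> (p 1) powi k * hol f \<alpha> q"
      using pq by (intro hol_act) auto
    ultimately show "L (\<lambda>t. act (p t) (q t)) ** \<theta> (pathstart p) (pathstart q) = \<theta> (pathfinish p) (pathfinish q) ** L q"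
      by (simp add: mat1_eq_iff \<theta>_def mat_def pathstart_def pathfinish_def mult.commute mult.left_commute)
  next
    fix g h A assume gh: "g \<in> G" "h \<in> G" "A \<in> U"
    then have "s A \<noteq> 0" "s (act h A) \<noteq> 0" using s(1) act by auto
    then show "\<theta> (gmul g h) A = \<theta> g (act h A) ** \<theta> h A"
      using gh by (simp add: mat1_eq_iff \<theta>_def mat_def mul power_int_mult_distrib)
  qed
qed

lemma poly_has_derivative: "p \<in> poly_funs \<Longrightarrow> (p has_derivative (\<lambda>h. pdd h p A)) (at A)"
proof (induction rule: poly_funs.induct)
  case (entry i j)
  have "bounded_linear (\<lambda>A :: 'a cmat. A $ i $ j)"
    by (rule bounded_linear_compose[OF bounded_linear_vec_nth bounded_linear_vec_nth])
  from bounded_linear_imp_has_derivative[OF this] show ?case by simp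
next
  case (mult p q)
  from has_derivative_mult[OF mult.IH] show ?case
    by (rule back_subst[of "\<lambda>d. (_ has_derivative d) _"]) (simp add: pdd_mult mult fun_eq_iff algebra_simps)
qed (auto simp: pdd_add intro: has_derivative_add)

text \<open>Near \<open>y\<close> the branch \<open>(f z / f y)\<^sup>\<alpha>\<close> is given by the principal logarithm, and \<open>m \<mapsto> m * (f / f y)\<^sup>\<alpha>\<close> is
  a solution, up to a constant.\<close>

lemma F_mod_local_system:
  fixes L :: "(real \<Rightarrow> 'm cmat) \<Rightarrow> complex ^ 1 ^ 1"
  assumes L: "local_system U L" and mono: "has_monodromy U f \<alpha> L"
  shows "has_local_system X f (F_mod X f \<alpha>) L"
proof -
  obtain s where s: "\<And>A. A \<in> U \<Longrightarrow> s A \<noteq> 0"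
    "\<And>p. path p \<Longrightarrow> path_image p \<subseteq> U \<Longrightarrow> L p $ 1 $ 1 = hol f \<alpha> p * s (pathfinish p) / s (pathstart p)"
    using local_system_normal_form[OF L mono] by blast
  define \<psi> :: "'m cmat \<Rightarrow> complex ^ 1 \<Rightarrow> ('m cmat \<Rightarrow> complex) \<Rightarrow> complex" where "\<psi> y w m = w $ 1 * m y / s y" for y w m
  define one where "one = restr U (\<lambda>_. 1 :: complex)"
  have one: "one \<in> RF" unfolding one_def by (intro RF_poly poly_funs.const)
  show ?thesis unfolding has_local_system_def
  proof (intro exI[of _ \<psi>] conjI ballI allI)
    fix y w w' m assume "y \<in> U"
    show "\<psi> y (w + w') m = \<psi> y w m + \<psi> y w' m" by (simp add: \<psi>_def algebra_simps add_divide_distrib)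
  next
    fix y c w m show "\<psi> y (c *s w) m = c * \<psi> y w m" by (simp add: \<psi>_def)
  next
    fix y w show "\<psi> y w \<in> fibre_dual X f (F_mod X f \<alpha>) y"
      by (simp add: fibre_dual_def \<psi>_def algebra_simps add_divide_distrib)
  next
    fix y l assume y: "y \<in> U" and l: "l \<in> fibre_dual X f (F_mod X f \<alpha>) y"
    have lm: "l m = m y * l one" if "m \<in> RF" for m
    proof -
      have "l (\<lambda>A. m A * one A) = m y * l one" using l that one by (simp add: fibre_dual_def)
      moreover have "(\<lambda>A. m A * one A) = m" using RF_out[OF that] by (auto simp: one_def restr_def fun_eq_iff)
      ultimately show ?thesis by simp
    qed
    show "\<exists>!w. \<forall>m\<in>carrier (F_mod X f \<alpha>). \<psi> y w m = l m"
    proof (rule ex1I[of _ "vec (l one * s y)"])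
      show "\<forall>m\<in>carrier (F_mod X f \<alpha>). \<psi> y (vec (l one * s y)) m = l m" using s(1)[OF y] by (simp add: \<psi>_def lm)
      fix w assume "\<forall>m\<in>carrier (F_mod X f \<alpha>). \<psi> y w m = l m"
      then have "\<psi> y w one = l one" using one by simp
      then show "w = vec (l one * s y)" using s(1)[OF y] y by (simp add: \<psi>_def one_def vec_eq_iff forall_1 field_simps)
    qed
  next
    fix y and w :: "complex ^ 1" assume y: "y \<in> U"
    have fy: "f y \<noteq> 0" and yX: "y \<in> X" using y by (auto simp: U_iff)
    define V where "V = X \<inter> f -` ball (f y) (cmod (f y))"
    define \<phi> where "\<phi> z = exp (\<alpha> * Ln (f z / f y))" for z
    define u where "u m z = w $ 1 / s y * m z * \<phi> z" for m :: "'m cmat \<Rightarrow> complex" and z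
    have V_open: "openin (top_of_set X) V" unfolding V_def
      by (intro continuous_openin_preimage_gen poly_funs_continuous f_poly open_ball)
    have VU: "V \<subseteq> U" by (auto simp: V_def U_iff dist_norm)
    have yV: "y \<in> V" using fy yX by (auto simp: V_def)
    have slit: "f z / f y \<notin> \<real>\<^sub>\<le>\<^sub>0" if "z \<in> V" for z
    proof -
      have "cmod (1 - f z / f y) < 1"
      proof -
        have "1 - f z / f y = (f y - f z) / f y" using fy by (simp add: field_simps)
        moreover have "cmod (f y - f z) < cmod (f y)" using that by (simp add: V_def dist_norm)
        ultimately show ?thesis using fy by (simp add: norm_divide)
      qed
      then have "Re (1 - f z / f y) < 1" using complex_Re_le_cmod order.strict_trans1 by blast
      then show ?thesis by (auto simp: complex_nonpos_Reals_iff)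
    qed
    have sol: "solution X f (F_mod X f \<alpha>) V u"
      unfolding solution_def
    proof (intro ballI conjI)
      fix z m m' show "u (m \<oplus>\<^bsub>F_mod X f \<alpha>\<^esub> m') z = u m z + u m' z" by (simp add: u_def distrib_left distrib_right)
    next
      fix z m g show "u (g \<odot>\<^bsub>F_mod X f \<alpha>\<^esub> m) z = g z * u m z" by (simp add: u_def)
    next
      fix z m assume z: "z \<in> V" and "m \<in> carrier (F_mod X f \<alpha>)"
      then have m: "m \<in> RF" by simp
      then obtain p k where p: "p \<in> poly_funs" "m = frac p k" unfolding RF_iff by blast
      have zU: "z \<in> U" and zX: "z \<in> X" and fz: "f z \<noteq> 0" using z VU by (auto simp: U_iff)
      define C where "C = w $ 1 / s y"
      define g where "g c = C * exp (\<alpha> * Ln (c / f y)) / c ^ k" for c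
      have "((\<lambda>c. C * exp (\<alpha> * Ln (c / f y)) / c ^ k) has_field_derivative
          (C * (exp (\<alpha> * Ln (f z / f y)) * (\<alpha> * (1 / f y / (f z / f y)))) * f z ^ k
            - C * exp (\<alpha> * Ln (f z / f y)) * (of_nat k * f z ^ (k - 1))) / (f z ^ k * f z ^ k)) (at (f z))"
        using slit[OF z] fz fy by (auto intro!: derivative_eq_intros)
      moreover have "(C * (exp (\<alpha> * Ln (f z / f y)) * (\<alpha> * (1 / f y / (f z / f y)))) * f z ^ k
            - C * exp (\<alpha> * Ln (f z / f y)) * (of_nat k * f z ^ (k - 1))) / (f z ^ k * f z ^ k)
          = g (f z) * (\<alpha> - of_nat k) / f z"
        using fz fy by (cases k) (auto simp: g_def field_simps)
      ultimately have g': "(g has_field_derivative g (f z) * (\<alpha> - of_nat k) / f z) (at (f z))"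
        unfolding g_def[abs_def] by simp
      have "((\<lambda>A. g (f A)) has_derivative (\<lambda>h. g (f z) * (\<alpha> - of_nat k) / f z * pdd h f z)) (at z)"
        using has_derivative_compose[OF poly_has_derivative[OF f_poly, of z] g'[unfolded has_field_derivative_def]]
        by simp
      from has_derivative_mult[OF poly_has_derivative[OF p(1), of z] this]
      have D: "((\<lambda>A. p A * g (f A)) has_derivative
          (\<lambda>h. p z * (g (f z) * (\<alpha> - of_nat k) / f z * pdd h f z) + pdd h p z * g (f z))) (at z within X)"
        by (rule has_derivative_at_withinI)
      obtain d where d: "d > 0" "ball z d \<inter> X \<subseteq> V" using V_open z by (auto simp: openin_contains_ball)
      have um: "u m A = p A * g (f A)" if "A \<in> V" for A
        by (simp add: u_def p(2) frac_eq[OF subsetD[OF VU that]] g_def C_def \<phi>_def)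
      have near: "p A * g (f A) = u m A" if "A \<in> X" "dist A z < d" for A
      proof -
        have "A \<in> ball z d \<inter> X" using that by (simp add: dist_commute)
        from subsetD[OF d(2) this] show ?thesis by (rule um[symmetric])
      qed
      show "\<exists>D. (u m has_derivative D) (at z within X) \<and> (\<forall>h\<in>X. D h = u (der (F_mod X f \<alpha>) h m) z)"
      proof (intro exI conjI ballI)
        show "(u m has_derivative
          (\<lambda>h. p z * (g (f z) * (\<alpha> - of_nat k) / f z * pdd h f z) + pdd h p z * g (f z))) (at z within X)"
          by (rule has_derivative_transform_within[OF D d(1) zX]) (rule near)
        fix h assume h: "h \<in> X"
        show "p z * (g (f z) * (\<alpha> - of_nat k) / f z * pdd h f z) + pdd h p z * g (f z) = u (der (F_mod X f \<alpha>) h m) z"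
          unfolding der_F_mod[OF m] unfolding p(2) nabla_frac[OF p(1) h] using fz s(1)[OF y]
          by (simp add: u_def frac_eq[OF zU] g_def C_def \<phi>_def field_simps)
      qed
    qed
    have transport: "\<psi> (pathfinish p) (L p *v w) m = u m (pathfinish p)"
      if p: "path p" "path_image p \<subseteq> V" "pathstart p = y" for p m
    proof -
      have pU: "path_image p \<subseteq> U" using p(2) VU by blast
      have pV: "p t \<in> V" if "t \<in> {0..1}" for t using p(2) that by (auto simp: path_image_def)
      define q where "q t = Ln (f (p t) / f y) + Ln (f y)" for t
      have "path (f \<circ> p)" by (rule f_path[OF p(1)])
      then have "path q" unfolding q_def path_def
        using slit pV fy by (intro continuous_intros) (auto simp: o_def)
      moreover have "f (p t) = exp (q t)" if "t \<in> {0..1}" for t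
        using VU pV[OF that] fy by (auto simp: q_def exp_add U_iff)
      ultimately have "hol f \<alpha> p = exp (\<alpha> * (q 1 - q 0))" by (rule hol_lift)
      then have "hol f \<alpha> p = \<phi> (pathfinish p)"
        using p(3) fy by (simp add: q_def \<phi>_def pathstart_def pathfinish_def)
      moreover have "(L p *v w) $ 1 = L p $ 1 $ 1 * w $ 1" by (simp add: matrix_vector_mult_def UNIV_1)
      moreover have "pathfinish p \<in> U" using pU by auto
      ultimately show ?thesis using s(2)[OF p(1) pU] s(1)[of "pathfinish p"] p(3) by (simp add: \<psi>_def u_def)
    qed
    show "\<exists>V u. openin (top_of_set X) V \<and> y \<in> V \<and> V \<subseteq> U \<and> solution X f (F_mod X f \<alpha>) V u \<and>
       (\<forall>p. path p \<and> path_image p \<subseteq> V \<and> pathstart p = y \<longrightarrow>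
         (\<forall>m\<in>carrier (F_mod X f \<alpha>). \<psi> (pathfinish p) (L p *v w) m = u m (pathfinish p)))"
      using V_open yV VU sol transport by blast
  qed
qed

lemma F_mod_integrable_connection: "integrable_connection X f (F_mod X f \<alpha>)"
proof -
  interpret M: module "coord_ring X f" "F_mod X f \<alpha>" using F_mod_dmodule by (simp add: dmodule_def)
  define one where "one = restr U (\<lambda>_. 1 :: complex)"
  have one: "one \<in> RF" unfolding one_def by (intro RF_poly poly_funs.const)
  have "RF \<subseteq> Q" if Q: "submodule Q (coord_ring X f) (F_mod X f \<alpha>)" "one \<in> Q" for Q
  proof
    fix g assume g: "g \<in> RF"
    from M.submoduleE(4)[OF Q(1) g Q(2)] have "(\<lambda>A. g A * one A) \<in> Q" by simp
    moreover have "(\<lambda>A. g A * one A) = g" using RF_out[OF g] by (auto simp: one_def restr_def fun_eq_iff)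
    ultimately show "g \<in> Q" by simp
  qed
  then have "fin_gen_submodule X f (F_mod X f \<alpha>) RF"
    unfolding fin_gen_submodule_def using M.carrier_is_submodule one
    by (intro conjI exI[of _ "{one}"]) auto
  then show ?thesis by (simp add: integrable_connection_def F_mod_dmodule)
qed

text \<open>Since \<open>f\<close> already acts invertibly, the localization at \<open>f\<close> does not change the underlying set.\<close>

lemma F_mod_restriction: "is_restriction X f (F_mod X f \<alpha>) (F_mod X f \<alpha>)"
  unfolding is_restriction_def
proof (intro conjI exI[of _ "\<lambda>m. m"] ballI impI)
  fix g m assume "m \<in> carrier (F_mod X f \<alpha>)"
  then show "g \<odot>\<^bsub>F_mod X f \<alpha>\<^esub> m = restr U g \<odot>\<^bsub>F_mod X f \<alpha>\<^esub> m"
    using RF_out[of m] by (auto simp: fun_eq_iff restr_def)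
next
  fix m assume "m = \<zero>\<^bsub>F_mod X f \<alpha>\<^esub>"
  then show "\<exists>k. restr X (\<lambda>A. f A ^ k) \<odot>\<^bsub>F_mod X f \<alpha>\<^esub> m = \<zero>\<^bsub>F_mod X f \<alpha>\<^esub>" by simp
next
  fix n assume n: "n \<in> carrier (F_mod X f \<alpha>)"
  then have "restr U (\<lambda>A. f A ^ 0) \<odot>\<^bsub>F_mod X f \<alpha>\<^esub> n = n"
    using RF_out[of n] by (auto simp: fun_eq_iff restr_def)
  then show "\<exists>k. \<exists>m\<in>carrier (F_mod X f \<alpha>). restr U (\<lambda>A. f A ^ k) \<odot>\<^bsub>F_mod X f \<alpha>\<^esub> n = m" using n by blast
qed (simp_all add: F_mod_dmodule F_mod_dmodule_whole)

lemma F_mod_minimal_extension: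
  assumes simple: "simple_dmodule X whole (F_mod X f \<alpha>)"
  shows "minimal_extension X f (F_mod X f \<alpha>) (F_mod X f \<alpha>)"
proof -
  let ?M = "F_mod X f \<alpha>"
  define one where "one = restr U (\<lambda>_. 1 :: complex)"
  have one: "one \<in> RF" unfolding one_def by (intro RF_poly poly_funs.const)
  obtain A0 where A0: "A0 \<in> U" using f_nonzero by (auto simp: U_iff)
  then have A0': "A0 \<in> X" "f A0 \<noteq> 0" by (auto simp: U_iff)
  have pow: "restr X (\<lambda>A. f A ^ k) \<odot>\<^bsub>?M\<^esub> one \<noteq> (\<lambda>_. 0)" for k
  proof
    assume "restr X (\<lambda>A. f A ^ k) \<odot>\<^bsub>?M\<^esub> one = (\<lambda>_. 0)"
    then have "restr X (\<lambda>A. f A ^ k) A0 * one A0 = 0" by (simp add: fun_eq_iff)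
    then show False using A0 A0' by (simp add: one_def)
  qed
  have dich: "P = {\<lambda>_. 0} \<or> P = RF" if "dsubmodule X whole ?M P" for P
    using simple that by (simp add: simple_dmodule_def)
  show ?thesis unfolding minimal_extension_def
  proof (intro conjI allI impI)
    show "is_restriction X f ?M ?M" by (rule F_mod_restriction)
  next
    fix P assume P: "dsubmodule X whole ?M P \<and> (\<forall>m\<in>P. \<exists>k. restr X (\<lambda>A. f A ^ k) \<odot>\<^bsub>?M\<^esub> m = \<zero>\<^bsub>?M\<^esub>)"
    have "P \<noteq> RF"
    proof
      assume "P = RF"
      then obtain k where "restr X (\<lambda>A. f A ^ k) \<odot>\<^bsub>?M\<^esub> one = \<zero>\<^bsub>?M\<^esub>" using P one by blast
      then show False using pow[of k] by simp
    qed
    then show "P = {\<zero>\<^bsub>?M\<^esub>}" using dich P by auto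
  next
    fix P assume P: "dsubmodule X whole ?M P \<and> (\<forall>m\<in>carrier ?M. \<exists>k. restr X (\<lambda>A. f A ^ k) \<odot>\<^bsub>?M\<^esub> m \<in> P)"
    then obtain k where "restr X (\<lambda>A. f A ^ k) \<odot>\<^bsub>?M\<^esub> one \<in> P" using one by auto
    then have "P \<noteq> {\<lambda>_. 0}" using pow[of k] by blast
    then show "P = carrier ?M" using dich P by auto
  qed
qed

text \<open>The conditions on the simple object follow from simplicity, as soon as the points that the
  symmetries of \<open>f\<close> allow in the characteristic variety belong to \<open>\<Lambda>\<close>.\<close>

lemma F_mod_simple_object:
  fixes L :: "(real \<Rightarrow> 'm cmat) \<Rightarrow> complex ^ 1 ^ 1"
  assumes simple: "simple_dmodule X whole (F_mod X f \<alpha>)"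
    and L: "local_system U L" "has_monodromy U f \<alpha> L"
    and \<Lambda>: "\<And>y \<xi>. y \<in> X \<Longrightarrow> \<xi> \<in> X \<Longrightarrow>
      (\<And>w c. linear_field X w \<Longrightarrow> (\<And>A. A \<in> X \<Longrightarrow> pdd (w A) f A = c * f A) \<Longrightarrow> mpair (w y) \<xi> = 0) \<Longrightarrow> (y, \<xi>) \<in> \<Lambda>"
  shows "simple_object_of X f \<Lambda> L (F_mod X f \<alpha>)"
proof -
  obtain N b x where "coord_space X f N b x" using coord_space_exists by blast
  then interpret C: coord_space X f N b x .
  have "char_variety X (F_mod X f \<alpha>) (C.Fil \<alpha>) \<subseteq> \<Lambda>"
  proof
    fix z assume z: "z \<in> char_variety X (F_mod X f \<alpha>) (C.Fil \<alpha>)"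
    obtain y \<xi> where yx: "z = (y, \<xi>)" by (cases z)
    have "y \<in> X" "\<xi> \<in> X" using z by (auto simp: char_variety_def yx)
    then show "z \<in> \<Lambda>" unfolding yx
      using C.char_variety_field[OF _ _ z[unfolded yx]] by (intro \<Lambda>) auto
  qed
  then have "mod_rh X \<Lambda> (F_mod X f \<alpha>)"
    unfolding mod_rh_def
    using F_mod_dmodule_whole C.F_mod_holonomic[OF simple] C.F_mod_regular C.Fil_good[OF simple] by blast
  then show ?thesis unfolding simple_object_of_def
    using simple F_mod_integrable_connection F_mod_local_system[OF L] F_mod_minimal_extension[OF simple] by blast
qed

end

section \<open>The simple object of a polarized space\<close>

lemma sum_unit: "(\<Sum>j\<in>UNIV. unit k $ j * g j) = g k" for g :: "'m::finite \<Rightarrow> complex"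
  using sum.delta[of UNIV k g] by (simp add: unit_nth if_distrib[of "\<lambda>x. x * _"] cong: if_cong)

lemma mpair_pol: "mpair (pol \<sigma> a b) \<xi> =
  (\<Sum>i\<in>UNIV. a $ i * (\<Sum>j\<in>UNIV. b $ j * \<xi> $ i $ j)) + \<sigma> * (\<Sum>i\<in>UNIV. b $ i * (\<Sum>j\<in>UNIV. a $ j * \<xi> $ i $ j))"
  by (simp add: mpair_def algebra_simps sum.distrib sum_distrib_left)

lemma mpair_pol_unit_left:
  assumes "\<sigma> = 0 \<or> \<sigma> * \<sigma> = 1 \<and> (\<forall>i j. \<xi> $ j $ i = \<sigma> * \<xi> $ i $ j)"
  shows "mpair (pol \<sigma> (unit i) a) \<xi> = (1 + \<sigma> * \<sigma>) * (\<Sum>j\<in>UNIV. \<xi> $ i $ j * a $ j)"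
proof -
  have "mpair (pol \<sigma> (unit i) a) \<xi> = (\<Sum>j\<in>UNIV. a $ j * \<xi> $ i $ j) + \<sigma> * (\<Sum>j\<in>UNIV. a $ j * \<xi> $ j $ i)"
    by (simp add: mpair_pol sum_unit)
  moreover have "\<sigma> * (\<Sum>j\<in>UNIV. a $ j * \<xi> $ j $ i) = \<sigma> * \<sigma> * (\<Sum>j\<in>UNIV. a $ j * \<xi> $ i $ j)"
  proof (cases "\<sigma> = 0")
    case False
    then have "\<xi> $ j $ i = \<sigma> * \<xi> $ i $ j" for j using assms by blast
    then show ?thesis by (simp add: sum_distrib_left mult_ac)
  qed simp
  ultimately show ?thesis by (simp add: algebra_simps)
qed

lemma mpair_pol_unit_right:
  assumes "\<sigma> = 0 \<or> \<sigma> * \<sigma> = 1 \<and> (\<forall>i j. \<xi> $ j $ i = \<sigma> * \<xi> $ i $ j)"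
  shows "mpair (pol \<sigma> a (unit i)) \<xi> = (1 + \<sigma> * \<sigma>) * (\<Sum>j\<in>UNIV. a $ j * \<xi> $ j $ i)"
proof -
  have "mpair (pol \<sigma> a (unit i)) \<xi> = (\<Sum>j\<in>UNIV. a $ j * \<xi> $ j $ i) + \<sigma> * (\<Sum>j\<in>UNIV. a $ j * \<xi> $ i $ j)"
    by (simp add: mpair_pol sum_unit)
  moreover have "\<sigma> * (\<Sum>j\<in>UNIV. a $ j * \<xi> $ i $ j) = \<sigma> * \<sigma> * (\<Sum>j\<in>UNIV. a $ j * \<xi> $ j $ i)"
  proof (cases "\<sigma> = 0")
    case False
    then have "\<xi> $ i $ j = \<sigma> * \<xi> $ j $ i" for j using assms by blast
    then show ?thesis by (simp add: sum_distrib_left mult_ac)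
  qed simp
  ultimately show ?thesis by (simp add: algebra_simps)
qed

context polarized_space
begin

lemma row_field_linear: "linear_field X (\<lambda>A. pol \<sigma> (unit i) (A $ k))"
  unfolding linear_field_def
proof (intro conjI ballI allI)
  fix a b show "(\<lambda>A. pol \<sigma> (unit i) (A $ k) $ a $ b) \<in> poly_funs"
    unfolding pol_nth by (intro poly_funs.intros)
qed (simp_all add: pol_in vec_eq_iff algebra_simps)

lemma column_field_linear: "linear_field X (\<lambda>A. pol \<sigma> (column k A) (unit i))"
  unfolding linear_field_def
proof (intro conjI ballI allI)
  fix a b show "(\<lambda>A. pol \<sigma> (column k A) (unit i) $ a $ b) \<in> poly_funs"
    unfolding pol_nth column_def vec_lambda_beta by (intro poly_funs.intros)
qed (simp_all add: pol_in vec_eq_iff column_def algebra_simps)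

text \<open>The family \<open>\<R>\<close> consists of the index sets of the minors. One goes down from \<open>UNIV\<close>, with minor \<open>f\<close>, to
  the empty set, whose minor is the constant \<open>f J\<close>.\<close>

lemma lowering_chain:
  assumes P: "dsubmodule X whole (F_mod X f \<alpha>) P"
    and block: "\<And>R k l. R \<in> \<R> \<Longrightarrow> k \<in> R \<Longrightarrow> l \<notin> R \<Longrightarrow> J $ k $ l = 0"
    and shrink: "\<And>R. R \<in> \<R> \<Longrightarrow> R \<noteq> {} \<Longrightarrow> \<exists>i\<in>R. \<exists>i'\<in>R. \<exists>R'\<in>\<R>. \<exists>\<kappa>. R' \<subset> R \<and> \<kappa> \<noteq> 0 \<and>
      (\<forall>A\<in>X. pdd (pol \<sigma> (unit i') (unit i)) f (cut J R A) = \<kappa> * f (cut J R' A))"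
    and fJ: "f J \<noteq> 0"
    and nz: "\<And>n. c * (\<alpha> + of_int m) + c + of_nat n \<noteq> 0"
  shows "R \<in> \<R> \<Longrightarrow> tw (\<lambda>A. f (cut J R A)) m \<in> P \<Longrightarrow> tw (\<lambda>_. 1) m \<in> P"
proof (induction "card R" arbitrary: R rule: less_induct)
  case less
  show ?case
  proof (cases "R = {}")
    case True
    have "cut J {} A = J" for A by (simp add: vec_eq_iff)
    then have "(\<lambda>A. (1 / f J) * tw (\<lambda>A. f (cut J R A)) m A) = tw (\<lambda>_. 1) m"
      using True fJ by (simp add: tw_def restr_def fun_eq_iff)
    then show ?thesis using dsub_cmult[OF P less.prems(2), of "1 / f J"] by simp
  next
    case False
    then obtain i i' R' \<kappa> where *: "i \<in> R" "i' \<in> R" "R' \<in> \<R>" "R' \<subset> R" "\<kappa> \<noteq> 0"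
      "\<And>A. A \<in> X \<Longrightarrow> pdd (pol \<sigma> (unit i') (unit i)) f (cut J R A) = \<kappa> * f (cut J R' A)"
      using shrink[OF less.prems(1)] by blast
    have "tw (\<lambda>A. pdd (pol \<sigma> (unit i') (unit i)) f (cut J R A)) m \<in> P"
      by (rule lowering_step[OF P *(1,2) block[OF less.prems(1)] less.prems(2) nz])
    from dsub_cmult[OF P this, of "1 / \<kappa>"]
    have "(\<lambda>A. (1 / \<kappa>) * tw (\<lambda>A. pdd (pol \<sigma> (unit i') (unit i)) f (cut J R A)) m A) \<in> P" .
    moreover have "(\<lambda>A. (1 / \<kappa>) * tw (\<lambda>A. pdd (pol \<sigma> (unit i') (unit i)) f (cut J R A)) m A) = tw (\<lambda>A. f (cut J R' A)) m"
      using *(5,6) by (auto simp: tw_def restr_def fun_eq_iff U_iff)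
    ultimately have "tw (\<lambda>A. f (cut J R' A)) m \<in> P" by simp
    then show ?thesis using *(3,4) by (intro less.hyps[of R'] psubset_card_mono) auto
  qed
qed

lemma simple_object:
  fixes L :: "(real \<Rightarrow> 'm cmat) \<Rightarrow> complex ^ 1 ^ 1"
  assumes c: "c = of_nat n"
    and block: "UNIV \<in> \<R>" "\<And>R k l. R \<in> \<R> \<Longrightarrow> k \<in> R \<Longrightarrow> l \<notin> R \<Longrightarrow> J $ k $ l = 0"
    and shrink: "\<And>R. R \<in> \<R> \<Longrightarrow> R \<noteq> {} \<Longrightarrow> \<exists>i\<in>R. \<exists>i'\<in>R. \<exists>R'\<in>\<R>. \<exists>\<kappa>. R' \<subset> R \<and> \<kappa> \<noteq> 0 \<and>
      (\<forall>A\<in>X. pdd (pol \<sigma> (unit i') (unit i)) f (cut J R A) = \<kappa> * f (cut J R' A))"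
    and fJ: "f J \<noteq> 0"
    and \<sigma>: "\<sigma> = 0 \<or> \<sigma> * \<sigma> = 1 \<and> (\<forall>\<xi>\<in>X. \<forall>i j. \<xi> $ j $ i = \<sigma> * \<xi> $ i $ j)"
    and L: "local_system U L" "has_monodromy U f \<alpha> L"
    and nonint: "\<And>k. of_nat n * \<alpha> \<noteq> of_int k"
    and \<Lambda>: "\<And>y \<xi>. y \<in> X \<Longrightarrow> \<xi> \<in> X \<Longrightarrow> transpose y ** \<xi> = 0 \<Longrightarrow> \<xi> ** transpose y = 0 \<Longrightarrow> (y, \<xi>) \<in> \<Lambda>"
  shows "simple_object_of X f \<Lambda> L (F_mod X f \<alpha>)"
proof (rule F_mod_simple_object[OF _ L])
  show "simple_dmodule X whole (F_mod X f \<alpha>)"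
  proof (rule simple_if_lowering)
    fix P m assume P: "dsubmodule X whole (F_mod X f \<alpha>) P" and m: "tw f m \<in> P"
    have nz: "c * (\<alpha> + of_int m) + c + of_nat l \<noteq> 0" for l
    proof
      assume "c * (\<alpha> + of_int m) + c + of_nat l = 0"
      then have "of_nat n * \<alpha> = of_int (- (int n * m + int n + int l))"
        by (simp add: c algebra_simps add_eq_0_iff)
      then show False using nonint by blast
    qed
    have "cut J UNIV A = A" for A by (simp add: vec_eq_iff)
    then have "tw (\<lambda>A. f (cut J UNIV A)) m \<in> P" using m by simp
    then show "tw (\<lambda>_. 1) m \<in> P"
      using lowering_chain[where \<R> = \<R> and R = UNIV and \<alpha> = \<alpha> and m = m and P = P] P block shrink fJ nz by blast
  qed
next
  fix y \<xi> assume y: "y \<in> X" and \<xi>: "\<xi> \<in> X"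
    and sym: "\<And>w c. linear_field X w \<Longrightarrow> (\<And>A. A \<in> X \<Longrightarrow> pdd (w A) f A = c * f A) \<Longrightarrow> mpair (w y) \<xi> = 0"
  have s: "\<sigma> = 0 \<or> \<sigma> * \<sigma> = 1 \<and> (\<forall>i j. \<xi> $ j $ i = \<sigma> * \<xi> $ i $ j)" using \<sigma> \<xi> by blast
  then have s2: "1 + \<sigma> * \<sigma> \<noteq> 0" by auto
  have 1: "mpair (pol \<sigma> (unit i) (y $ k)) \<xi> = 0" for i k
    using sym[OF row_field_linear[of i k], of "if i = k then c else 0"] row_inv[of _ i k] by (cases "i = k") auto
  have 2: "mpair (pol \<sigma> (column k y) (unit i)) \<xi> = 0" for i k
    using sym[OF column_field_linear[of k i], of "if i = k then c else 0"] col_inv[of _ k i] by (cases "i = k") auto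
  have "\<xi> ** transpose y = 0"
    using 1 s2 unfolding mpair_pol_unit_left[OF s] by (simp add: vec_eq_iff matrix_matrix_mult_def transpose_def)
  moreover have "transpose y ** \<xi> = 0"
    using 2 s2 unfolding mpair_pol_unit_right[OF s] by (simp add: vec_eq_iff matrix_matrix_mult_def transpose_def column_def)
  ultimately show "(y, \<xi>) \<in> \<Lambda>" by (intro \<Lambda> y \<xi>)
qed

end

section \<open>The determinant\<close>

lemma det_poly: "det \<in> poly_funs"
  unfolding det_def[abs_def] by (intro poly_funs_sum poly_funs.mult poly_funs.const poly_funs_prod poly_funs.entry)

lemma det_add_row:
  "det (A + mscale t (pol 0 (unit i) b)) = det A + t * det (\<chi> k. if k = i then b else A $ k)" for A :: "'m::finite cmat"
proof -
  have "A + mscale t (pol 0 (unit i) b) = (\<chi> k. if k = i then A $ k + t *s b else A $ k)"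
    by (simp add: vec_eq_iff unit_nth)
  moreover have "(\<chi> k. if k = i then A $ k else A $ k) = A" by (simp add: vec_eq_iff)
  ultimately show ?thesis by (simp add: det_row_add[of i "\<lambda>k. A $ k"] det_row_mul[of i])
qed

lemma pdd_det_row: "pdd (pol 0 (unit i) b) det A = det (\<chi> k. if k = i then b else A $ k)" for A :: "'m::finite cmat"
  by (rule pdd_eqI) (auto simp: det_add_row intro!: derivative_eq_intros)

lemma pdd_det_column: "pdd (pol 0 a (unit i)) det A = det (\<chi> k. if k = i then a else column k A)" for A :: "'m::finite cmat"
proof -
  have "transpose (A + mscale t (pol 0 a (unit i))) = transpose A + mscale t (pol 0 (unit i) a)" for t
    by (simp add: vec_eq_iff transpose_def)
  then have "det (A + mscale t (pol 0 a (unit i))) = det (transpose A + mscale t (pol 0 (unit i) a))" for t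
    by (metis det_transpose)
  then have "pdd (pol 0 a (unit i)) det A = pdd (pol 0 (unit i) a) det (transpose A)" by (simp add: pdd_def)
  also have "\<dots> = det (\<chi> k. if k = i then a else column k A)" 
    unfolding pdd_det_row by (rule arg_cong[of _ _ det]) (auto simp: vec_eq_iff transpose_def column_def)
  finally show ?thesis .
qed

lemma det_replace_row: "det (\<chi> r. if r = i then A $ k else A $ r) = (if i = k then det A else 0)" for A :: "'m::finite cmat"
proof (cases "i = k")
  case True
  then have "(\<chi> r. if r = i then A $ k else A $ r) = A" by (simp add: vec_eq_iff)
  then show ?thesis using True by simp
next
  case False
  then have "det (\<chi> r. if r = i then A $ k else A $ r) = 0"
    by (intro det_identical_rows[of i k]) (auto simp: row_def)
  then show ?thesis using False by simp
qed

lemma det_row_inv: "pdd (pol 0 (unit i) (A $ k)) det A = (if i = k then det A else 0)" for A :: "'m::finite cmat"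
  by (simp add: pdd_det_row det_replace_row)

lemma det_col_inv: "pdd (pol 0 (column k A) (unit i)) det A = (if i = k then det A else 0)" for A :: "'m::finite cmat"
proof -
  have "(\<chi> r. if r = i then column k A else column r A) = (\<chi> r. if r = i then transpose A $ k else transpose A $ r)"
    by (simp add: vec_eq_iff transpose_def column_def)
  then show ?thesis by (simp add: pdd_det_column det_replace_row)
qed

lemma det_elementary: "det (mat 1 + mscale t (matrix_unit i k) :: 'm::finite cmat) = 1 + (if i = k then t else 0)"
proof -
  have "matrix_unit i k = pol 0 (unit i) ((mat 1 :: 'm cmat) $ k)"
    by (simp add: vec_eq_iff matrix_unit_def unit_nth mat_def)
  then show ?thesis by (simp add: det_add_row det_replace_row)
qed

text \<open>Once row \<open>i\<close> is the unit vector, column \<open>i\<close> can be replaced by the unit vector as well. The two formulas for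
  the derivative, in terms of rows and of columns, give this without an expansion.\<close>

lemma pdd_det_cut:
  fixes A :: "'m::finite cmat"
  shows "pdd (pol 0 (unit i) (unit i)) det (cut (mat 1) R A) = det (cut (mat 1) (R - {i}) A)"
proof -
  define B where "B = cut (mat 1) R A"
  define B' where "B' = (\<chi> k. if k = i then unit i else B $ k)"
  have "pdd (pol 0 (unit i) (unit i)) det B = det B'" by (simp add: pdd_det_row B'_def)
  also have "det B' = det (\<chi> k. if k = i then unit i else B' $ k)"
    by (rule arg_cong[of _ _ det]) (simp add: B'_def vec_eq_iff)
  also have "\<dots> = pdd (pol 0 (unit i) (unit i)) det B'" by (simp add: pdd_det_row)
  also have "\<dots> = det (\<chi> k. if k = i then unit i else column k B')" by (rule pdd_det_column)
  also have "(\<chi> k. if k = i then unit i else column k B') = transpose (cut (mat 1) (R - {i}) A)"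
    by (auto simp: vec_eq_iff transpose_def column_def B'_def B_def unit_nth mat_def)
  also have "det \<dots> = det (cut (mat 1) (R - {i}) A)" by (rule det_transpose)
  finally show ?thesis by (simp add: B_def)
qed

lemma continuous_matrix_mult:
  fixes f g :: "'a::topological_space \<Rightarrow> 'm::finite cmat"
  shows "continuous_on S f \<Longrightarrow> continuous_on S g \<Longrightarrow> continuous_on S (\<lambda>t. f t ** g t)"
  unfolding matrix_matrix_mult_def by (intro continuous_intros)

lemma continuous_transpose:
  fixes f :: "'a::topological_space \<Rightarrow> 'm::finite cmat"
  shows "continuous_on S f \<Longrightarrow> continuous_on S (\<lambda>t. transpose (f t))"
  unfolding transpose_def by (intro continuous_intros)

lemma GL_det: "g \<in> GL \<Longrightarrow> det g \<noteq> 0"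
  by (simp add: GL_def invertible_det_nz)

lemma GL_transpose: "g \<in> GL \<Longrightarrow> invertible (transpose g)"
  by (simp add: GL_def invertible_det_nz)

lemma act1_mult: "act1 (g ** h) A = act1 g (act1 h A)"
  by (simp add: act1_def matrix_transpose_mul matrix_mul_assoc)

lemma act2_mult: "act2 (pair_mul g h) A = act2 g (act2 h A)"
  by (simp add: act2_def pair_mul_def matrix_transpose_mul matrix_mul_assoc)

lemma act1_factors: "g \<in> GL \<Longrightarrow> \<exists>a b. invertible a \<and> invertible b \<and> act1 g y = a ** y ** b"
  unfolding act1_def using GL_transpose[of g] by (auto simp: GL_def)

lemma act1_one: "act1 (mat 1) A = A" "mat 1 \<in> GL"
  by (simp_all add: act1_def transpose_mat GL_def invertible_det_nz)

lemma act1_path: "path p \<Longrightarrow> path q \<Longrightarrow> path (\<lambda>t. act1 (p t) (q t))"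
  unfolding act1_def path_def by (intro continuous_matrix_mult continuous_transpose)

lemma det_path: "path p \<Longrightarrow> path (det \<circ> p)" for p :: "real \<Rightarrow> 'm::finite cmat"
  by (rule path_continuous_image) (auto intro: poly_funs_continuous det_poly)

theorem general_matrices:
  fixes L :: "(real \<Rightarrow> 'n::finite cmat) \<Rightarrow> complex ^ 1 ^ 1"
  assumes L: "local_system (basic_open UNIV det) L" "has_monodromy (basic_open UNIV det) det \<alpha> L"
    and neq: "\<not> equivariant (GL \<times> GL) pair_mul act2 (basic_open UNIV det) L"
  shows "simple_object_of UNIV det (conormal_union UNIV (GL \<times> GL) act2) L (F_mod UNIV det \<alpha>)"
proof -
  have "polarized_space UNIV det 0 1 (mat 1 :: 'n cmat)"
  proof unfold_locales
    show "\<exists>A\<in>UNIV. det (A :: 'n cmat) \<noteq> 0" by (rule bexI[of _ "mat 1"]) simp_all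
  qed (simp_all add: det_poly det_row_inv det_col_inv)
  then interpret polarized_space UNIV det 0 1 "mat 1 :: 'n cmat" .
  have nonint: "of_nat 1 * \<alpha> \<noteq> of_int k" for k
  proof
    assume k: "of_nat 1 * \<alpha> = of_int k"
    have "equivariant (GL \<times> GL) pair_mul act2 U L"
    proof (rule equivariant_if_integral[OF L k, where \<kappa> = "\<lambda>g. det (fst g) * det (snd g)"])
      fix p :: "real \<Rightarrow> 'n cmat \<times> 'n cmat" assume p: "path p"
      have "continuous_on {0..1} (\<lambda>t. fst (p t))" "continuous_on {0..1} (\<lambda>t. snd (p t))"
        using p unfolding path_def by (intro continuous_intros; assumption)+
      note c = this
      show "path ((\<lambda>g. det (fst g) * det (snd g)) \<circ> p)"
        unfolding path_def o_def
        by (intro continuous_on_mult continuous_on_compose2[OF poly_funs_continuous[OF det_poly]] c) auto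
      fix q :: "real \<Rightarrow> 'n cmat" assume "path q"
      then show "path (\<lambda>t. act2 (p t) (q t))"
        unfolding path_def act2_def by (intro continuous_matrix_mult continuous_transpose c)
    next
      show "det (act2 g A) = (det (fst g) * det (snd g)) ^ 1 * det A" for g and A :: "'n cmat"
        by (simp add: act2_def det_mul)
      then show "act2 g A \<in> U" if "g \<in> GL \<times> GL" "A \<in> U" for g A
        using that by (auto simp: U_iff GL_det)
    qed (auto simp: act2_mult[unfolded pair_mul_def] GL_det det_mul pair_mul_def)
    then show False using neq by simp
  qed
  show ?thesis
  proof (rule simple_object[where n = 1 and \<R> = UNIV, OF _ _ _ _ _ _ L nonint])
    fix R :: "'n set" assume "R \<noteq> {}"
    then obtain i where i: "i \<in> R" by blast
    show "\<exists>i\<in>R. \<exists>i'\<in>R. \<exists>R'\<in>UNIV. \<exists>\<kappa>. R' \<subset> R \<and> \<kappa> \<noteq> 0 \<and>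
        (\<forall>A\<in>UNIV. pdd (pol 0 (unit i') (unit i)) det (cut (mat 1) R A) = \<kappa> * det (cut (mat 1) R' A))"
      using i by (intro bexI[OF _ i] bexI[of _ "R - {i}"] exI[of _ 1]) (auto simp: pdd_det_cut)
  next
    fix y \<xi> :: "'n cmat" assume *: "transpose y ** \<xi> = 0" "\<xi> ** transpose y = 0"
    show "(y, \<xi>) \<in> conormal_union UNIV (GL \<times> GL) act2"
    proof (rule conormal_unionI[where e = "(mat 1, mat 1)"])
      show "\<exists>a b. invertible a \<and> invertible b \<and> act2 g y = a ** y ** b" if "g \<in> GL \<times> GL" for g and y :: "'n cmat"
        using that GL_transpose[of "snd g"] unfolding act2_def GL_def
        by (intro exI[of _ "fst g"] exI[of _ "transpose (snd g)"]) (auto simp: mem_Times_iff)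
      show "(mat 1, mat 1) \<in> GL \<times> GL" by (simp add: act1_one)
      show "act2 (mat 1, mat 1) y = y" by (simp add: act2_def transpose_mat)
    qed (use * in auto)
  next
    show "det (mat 1 :: 'n cmat) \<noteq> 0" by simp
  qed (auto simp: mat_def)
qed

theorem symmetric_matrices:
  fixes L :: "(real \<Rightarrow> 'n::finite cmat) \<Rightarrow> complex ^ 1 ^ 1"
  assumes L: "local_system (basic_open sym_mats det) L" "has_monodromy (basic_open sym_mats det) det \<alpha> L"
    and neq: "\<not> equivariant GL (**) act1 (basic_open sym_mats det) L"
  shows "simple_object_of sym_mats det (conormal_union sym_mats GL act1) L (F_mod sym_mats det \<alpha>)"
proof -
  have sym_iff: "A \<in> sym_mats \<longleftrightarrow> (\<forall>i j. A $ i $ j = A $ j $ i)" for A :: "'n cmat"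
    unfolding sym_mats_def by (auto simp: vec_eq_iff transpose_def)
  have pol1: "pol 1 a b = pol 0 a b + pol 0 b a" for a b :: "complex ^ 'n" by (simp add: vec_eq_iff)
  have col: "column k A = A $ k" if "A \<in> sym_mats" for A :: "'n cmat" and k
    using that by (simp add: sym_iff column_def vec_eq_iff)
  have inv: "pdd (pol 1 (unit i) (A $ k)) det A = (if i = k then 2 * det A else 0)" if "A \<in> sym_mats" for A :: "'n cmat" and i k
    unfolding pol1 pdd_dir_linear(1)[OF det_poly] using det_row_inv[of i A k] det_col_inv[of k A i] col[OF that] by simp
  have "polarized_space sym_mats det 1 2 (mat 1 :: 'n cmat)"
  proof unfold_locales
    show "\<exists>A\<in>sym_mats. det (A :: 'n cmat) \<noteq> 0" by (rule bexI[of _ "mat 1"]) (simp_all add: sym_mats_def transpose_mat)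
    show "pdd (pol 1 (column k A) (unit i)) det A = (if i = k then 2 * det A else 0)" if "A \<in> sym_mats" for A :: "'n cmat" and i k
    proof -
      have "pol 1 (column k A) (unit i) = pol 1 (unit i) (A $ k)" by (simp add: vec_eq_iff col[OF that] mult.commute)
      then show ?thesis by (simp add: inv[OF that])
    qed
  qed (auto simp: det_poly inv sym_iff mat_def)
  then interpret polarized_space sym_mats det 1 2 "mat 1 :: 'n cmat" .
  have act_in: "act1 g A \<in> sym_mats" if "A \<in> sym_mats" for g A :: "'n cmat"
    using that by (simp add: sym_mats_def act1_def matrix_transpose_mul matrix_mul_assoc)
  have nonint: "of_nat 2 * \<alpha> \<noteq> of_int k" for k
  proof
    assume k: "of_nat 2 * \<alpha> = of_int k"
    have "equivariant GL (**) act1 U L"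
    proof (rule equivariant_if_integral[OF L k, where \<kappa> = det])
      show "det (act1 g A) = det g ^ 2 * det A" if "g \<in> GL" "A \<in> U" for g A
        by (simp add: act1_def det_mul power2_eq_square)
      show "act1 g A \<in> U" if "g \<in> GL" "A \<in> U" for g A
        using that GL_det[of g] act_in by (simp add: U_iff) (simp add: act1_def det_mul)
    qed (auto simp: act1_mult GL_det det_mul act1_path det_path)
    then show False using neq by simp
  qed
  show ?thesis
  proof (rule simple_object[where n = 2 and \<R> = UNIV, OF _ _ _ _ _ _ L nonint])
    fix R :: "'n set" assume "R \<noteq> {}"
    then obtain i where i: "i \<in> R" by blast
    have "pdd (pol 1 (unit i) (unit i)) det (cut (mat 1) R A) = 2 * det (cut (mat 1) (R - {i}) A)" for A :: "'n cmat"
      unfolding pol1 pdd_dir_linear(1)[OF det_poly] pdd_det_cut by simp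
    then show "\<exists>i\<in>R. \<exists>i'\<in>R. \<exists>R'\<in>UNIV. \<exists>\<kappa>. R' \<subset> R \<and> \<kappa> \<noteq> 0 \<and>
        (\<forall>A\<in>sym_mats. pdd (pol 1 (unit i') (unit i)) det (cut (mat 1) R A) = \<kappa> * det (cut (mat 1) R' A))"
      using i by (intro bexI[OF _ i] bexI[of _ "R - {i}"] exI[of _ 2]) auto
  next
    fix y \<xi> :: "'n cmat" assume *: "y \<in> sym_mats" "\<xi> \<in> sym_mats" "transpose y ** \<xi> = 0" "\<xi> ** transpose y = 0"
    show "(y, \<xi>) \<in> conormal_union sym_mats GL act1"
      by (rule conormal_unionI[where e = "mat 1"]) (use * act1_factors act1_one in auto)
  next
    show "det (mat 1 :: 'n cmat) \<noteq> 0" by simp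
  qed (auto simp: mat_def sym_iff)
qed

section \<open>The Pfaffian\<close>

abbreviation pairs_prod :: "('n::finite + 'n) cmat \<Rightarrow> ('n + 'n \<Rightarrow> 'n + 'n) \<Rightarrow> complex" where
  "pairs_prod A p \<equiv> \<Prod>i\<in>UNIV. A $ p (Inl i) $ p (Inr i)"

lemma pfaffian_poly: "pfaffian \<in> poly_funs"
proof -
  have "(\<lambda>A. \<Sum>p | p permutes UNIV. of_int (sign p) * pairs_prod A p) \<in> poly_funs"
    by (intro poly_funs_sum poly_funs.mult poly_funs.const poly_funs_prod poly_funs.entry)
  from poly_funs.mult[OF this poly_funs.const[of "1 / (2 ^ CARD('a) * fact CARD('a))"]]
  show ?thesis by (simp add: pfaffian_def[abs_def])
qed

lemma prod_sum_type: "(\<Prod>a\<in>UNIV. g a) = (\<Prod>i\<in>UNIV. g (Inl i) * g (Inr i))"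
  for g :: "'n::finite + 'n \<Rightarrow> complex"
  unfolding UNIV_Plus_UNIV[symmetric] prod.Plus[OF finite finite] by (simp add: prod.distrib)

text \<open>The sum is the determinant of the matrix with columns \<open>\<kappa> a\<close> of \<open>g\<close>, which has a repeated column unless \<open>\<kappa>\<close>
  is a permutation.\<close>

lemma sum_permutations_rows:
  fixes g :: "'m::finite cmat"
  shows "(\<Sum>p | p permutes UNIV. of_int (sign p) * (\<Prod>a\<in>UNIV. g $ p a $ \<kappa> a))
    = (if \<kappa> permutes UNIV then of_int (sign \<kappa>) * det g else 0)"
proof -
  have "(\<Sum>p | p permutes UNIV. of_int (sign p) * (\<Prod>a\<in>UNIV. g $ p a $ \<kappa> a)) = det (\<chi> a. transpose g $ \<kappa> a)"
    by (simp add: det_def transpose_def)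
  also have "\<dots> = (if \<kappa> permutes UNIV then of_int (sign \<kappa>) * det g else 0)"
  proof (cases "inj \<kappa>")
    case True
    then have "\<kappa> permutes UNIV" by (intro bij_imp_permutes) (simp_all add: bij_def finite_UNIV_inj_surj)
    then show ?thesis by (simp add: det_permute_rows)
  next
    case False
    then obtain a b where "a \<noteq> b" "\<kappa> a = \<kappa> b" by (auto simp: inj_on_def)
    then have "det (\<chi> a. transpose g $ \<kappa> a) = 0" by (intro det_identical_rows[of a b]) (simp_all add: row_def)
    then show ?thesis using False permutes_inj by auto
  qed
  finally show ?thesis .
qed

text \<open>Each factor of \<open>\<Prod>\<^sub>i (g A g\<^sup>T)\<close> is a sum over pairs of indices. The product becomes a sum over maps \<open>h\<close>
  from \<open>'n\<close> to pairs, that is over maps \<open>\<kappa>\<close> of \<open>'n + 'n\<close> to itself, and the sum over \<open>p\<close> leaves the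
  permutations \<open>\<kappa>\<close>, each with the factor \<open>sign \<kappa> * det g\<close>.\<close>

lemma pfaffian_congruence: "pfaffian (act1 g A) = det g * pfaffian A"
  for A :: "('n::finite + 'n) cmat"
proof -
  define \<kappa> :: "('n \<Rightarrow> ('n + 'n) \<times> ('n + 'n)) \<Rightarrow> 'n + 'n \<Rightarrow> 'n + 'n"
    where "\<kappa> h = case_sum (fst \<circ> h) (snd \<circ> h)" for h
  define w where "w h = (\<Prod>i\<in>UNIV. A $ fst (h i) $ snd (h i))" for h :: "'n \<Rightarrow> ('n + 'n) \<times> ('n + 'n)"
  have entry: "act1 g A $ a $ b = (\<Sum>x\<in>UNIV. A $ fst x $ snd x * (g $ a $ fst x * g $ b $ snd x))" for a b
  proof -
    have "act1 g A $ a $ b = (\<Sum>l\<in>UNIV. \<Sum>k\<in>UNIV. A $ k $ l * (g $ a $ k * g $ b $ l))"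
      by (simp add: act1_def matrix_matrix_mult_def transpose_def sum_distrib_left sum_distrib_right mult_ac)
    also have "\<dots> = (\<Sum>k\<in>UNIV. \<Sum>l\<in>UNIV. A $ k $ l * (g $ a $ k * g $ b $ l))" by (rule sum.swap)
    finally show ?thesis by (simp add: sum.cartesian_product case_prod_unfold flip: UNIV_Times_UNIV)
  qed
  have expand: "pairs_prod (act1 g A) p = (\<Sum>h\<in>UNIV. w h * (\<Prod>a\<in>UNIV. g $ p a $ \<kappa> h a))" for p
    unfolding entry w_def \<kappa>_def prod_sum_type
    by (subst prod_sum_PiE) (simp_all add: PiE_UNIV_domain prod.distrib)
  have "(\<Sum>p | p permutes UNIV. of_int (sign p) * pairs_prod (act1 g A) p)
    = (\<Sum>h\<in>UNIV. w h * (\<Sum>p | p permutes UNIV. of_int (sign p) * (\<Prod>a\<in>UNIV. g $ p a $ \<kappa> h a)))"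
    unfolding expand sum_distrib_left by (subst sum.swap) (simp add: mult_ac)
  also have "\<dots> = (\<Sum>h\<in>UNIV. if \<kappa> h permutes UNIV then w h * (of_int (sign (\<kappa> h)) * det g) else 0)"
    unfolding sum_permutations_rows by (intro sum.cong) auto
  also have "\<dots> = (\<Sum>h | \<kappa> h permutes UNIV. w h * (of_int (sign (\<kappa> h)) * det g))"
    by (simp add: sum.inter_filter[symmetric])
  also have "\<dots> = (\<Sum>p | p permutes UNIV. det g * (of_int (sign p) * pairs_prod A p))"
  proof (rule sum.reindex_bij_witness[where j = \<kappa> and i = "\<lambda>p i. (p (Inl i), p (Inr i))"])
    fix p :: "'n + 'n \<Rightarrow> 'n + 'n"
    show "\<kappa> (\<lambda>i. (p (Inl i), p (Inr i))) = p"
      by (auto simp: \<kappa>_def fun_eq_iff split: sum.split)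
    then show "p \<in> {p. p permutes UNIV} \<Longrightarrow> (\<lambda>i. (p (Inl i), p (Inr i))) \<in> {h. \<kappa> h permutes UNIV}" by simp
  qed (auto simp: \<kappa>_def w_def)
  finally show ?thesis by (simp add: pfaffian_def sum_distrib_left)
qed

lemma pfaffian_scale: "pfaffian (\<chi> a b. d a * d b * A $ a $ b) = (\<Prod>a\<in>UNIV. d a) * pfaffian A"
  for A :: "('n::finite + 'n) cmat"
proof -
  have "(\<Prod>i\<in>UNIV. d (p (Inl i)) * d (p (Inr i))) = (\<Prod>a\<in>UNIV. d a)" if "p permutes UNIV" for p :: "'n + 'n \<Rightarrow> 'n + 'n"
    using prod.permute[OF that, of d] by (simp add: prod_sum_type o_def)
  then have "pairs_prod (\<chi> a b. d a * d b * A $ a $ b) p = (\<Prod>a\<in>UNIV. d a) * pairs_prod A p" if "p permutes UNIV" for p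
    using that by (simp add: prod.distrib)
  then have "(\<Sum>p | p permutes UNIV. of_int (sign p) * pairs_prod (\<chi> a b. d a * d b * A $ a $ b) p)
    = (\<Prod>a\<in>UNIV. d a) * (\<Sum>p | p permutes UNIV. of_int (sign p) * pairs_prod A p)"
    unfolding sum_distrib_left by (intro sum.cong) (auto simp: mult_ac)
  then show ?thesis by (simp add: pfaffian_def)
qed

lemma pfaffian_scale_one:
  "pfaffian (\<chi> a b. (if a = i then s else 1) * (if b = i then s else 1) * A $ a $ b) = s * pfaffian A"
  for A :: "('n::finite + 'n) cmat"
  using pfaffian_scale[of "\<lambda>a. if a = i then s else 1" A] by simp

lemma pfaffian_zero_row: "(\<And>b. A $ i $ b = 0) \<Longrightarrow> (\<And>a. A $ a $ i = 0) \<Longrightarrow> pfaffian A = 0"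
  for A :: "('n::finite + 'n) cmat"
proof -
  assume *: "\<And>b. A $ i $ b = 0" "\<And>a. A $ a $ i = 0"
  have "(\<chi> a b. (if a = i then 0 else 1) * (if b = i then 0 else 1) * A $ a $ b) = A"
    using * by (auto simp: vec_eq_iff)
  then show ?thesis using pfaffian_scale_one[of i 0 A] by simp
qed

text \<open>Rescaling row and column \<open>i\<close> by \<open>s\<close> multiplies the Pfaffian by \<open>s\<close>. So the Pfaffian is linear in the entries
  of this row and column, and the derivative is computed by substitution.\<close>

lemma pfaffian_row_linear:
  fixes Z :: "('n::finite + 'n) cmat"
  assumes "\<And>b. Z $ i $ b = 0" "\<And>a. Z $ a $ i = 0" "v $ i = 0"
  shows "pdd (pol (-1) (unit i) v) pfaffian Z = pfaffian (Z + pol (-1) (unit i) v)"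
proof (rule pdd_eqI)
  have "pfaffian (Z + mscale s (pol (-1) (unit i) v)) = s * pfaffian (Z + pol (-1) (unit i) v)" for s
  proof -
    have "(\<chi> a b. (if a = i then s else 1) * (if b = i then s else 1) * (Z + pol (-1) (unit i) v) $ a $ b)
      = Z + mscale s (pol (-1) (unit i) v)"
      using assms by (auto simp: vec_eq_iff unit_nth algebra_simps)
    then show ?thesis using pfaffian_scale_one[of i s "Z + pol (-1) (unit i) v"] by simp
  qed
  then show "((\<lambda>s. pfaffian (Z + mscale s (pol (-1) (unit i) v))) has_field_derivative
      pfaffian (Z + pol (-1) (unit i) v)) (at 0)"
    by (auto intro!: derivative_eq_intros)
qed

lemma skew_mats_nth:
  assumes "A \<in> skew_mats" shows "A $ a $ b = - A $ b $ a"
proof -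
  have "transpose A = - A" using assms by (simp add: skew_mats_def)
  from arg_cong[OF this, of "\<lambda>M. M $ b $ a"] show ?thesis by (simp add: transpose_def)
qed

lemma skew_matsI:
  assumes "\<And>a b. A $ a $ b = - A $ b $ a" shows "A \<in> skew_mats"
proof -
  have "transpose A $ b $ a = (- A) $ b $ a" for a b using assms[of a b] by (simp add: transpose_def)
  then show ?thesis unfolding skew_mats_def mem_Collect_eq vec_eq_iff by blast
qed

text \<open>The derivative by a pair of entries is the complementary minor. By linearity in row \<open>i'\<close> the derivative
  along \<open>W\<close> is the Pfaffian of \<open>Z + W\<close>, where row and column \<open>i'\<close> of \<open>B\<close> are replaced by unit vectors. In the
  expansion of \<open>Z + W\<close> along row \<open>i\<close>, the terms other than that of \<open>i'\<close> have a zero row \<open>i'\<close>.\<close>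

lemma pdd_pfaffian_pair:
  fixes B :: "('n::finite + 'n) cmat"
  assumes B: "B \<in> skew_mats" and ne: "i \<noteq> i'"
  defines "W \<equiv> pol (-1) (unit i') (unit i)"
  shows "pdd W pfaffian B = pfaffian (\<chi> a b. if a \<in> {i, i'} \<or> b \<in> {i, i'} then W $ a $ b else B $ a $ b)"
proof -
  have sk: "B $ a $ b = - B $ b $ a" for a b
    by (rule skew_mats_nth[OF B])
  have diag: "B $ a $ a = 0" for a using sk[of a a] by simp
  have col: "B $ a $ k = (if a = k then 0 else - B $ k $ a)" for a k using sk[of a k] diag by simp
  define Z where "Z = (\<chi> a b. if a = i' \<or> b = i' then 0 else B $ a $ b)"
  define Y where "Y = (\<chi> a b. if a \<in> {i, i'} \<or> b \<in> {i, i'} then 0 else B $ a $ b)"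
  define v where "v = (\<chi> k. if k = i then 0 else if k = i' then -1 else B $ i $ k)"
  have row: "B + mscale s W = Z + pol (-1) (unit i') (B $ i' + s *s unit i)" for s
    using col[of _ i'] by (auto simp: vec_eq_iff Z_def W_def unit_nth algebra_simps)
  have "pfaffian (B + mscale s W) = pdd (pol (-1) (unit i') (B $ i')) pfaffian Z + s * pdd W pfaffian Z" for s
  proof -
    have "pfaffian (B + mscale s W) = pdd (pol (-1) (unit i') (B $ i' + s *s unit i)) pfaffian Z"
      unfolding row by (rule pfaffian_row_linear[symmetric]) (use ne diag in \<open>auto simp: Z_def unit_nth\<close>)
    also have "pol (-1) (unit i') (B $ i' + s *s unit i) = pol (-1) (unit i') (B $ i') + mscale s W"
      by (simp add: vec_eq_iff W_def algebra_simps)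
    finally show ?thesis by (simp add: pdd_dir_linear[OF pfaffian_poly])
  qed
  then have "pdd W pfaffian B = pdd W pfaffian Z"
    by (intro pdd_eqI) (auto intro!: derivative_eq_intros)
  also have "\<dots> = pfaffian (Z + W)"
    unfolding W_def by (rule pfaffian_row_linear) (use ne in \<open>auto simp: Z_def unit_nth\<close>)
  also have "Z + W = Y + pol (-1) (unit i) v"
    using col[of _ i] ne by (auto simp: vec_eq_iff Z_def Y_def W_def v_def unit_nth)
  also have "pfaffian \<dots> = pdd (pol (-1) (unit i) v) pfaffian Y"
    by (rule pfaffian_row_linear[symmetric]) (auto simp: Y_def v_def)
  also have "\<dots> = (\<Sum>k\<in>UNIV. v $ k * pdd (pol (-1) (unit i) (unit k)) pfaffian Y)"
    unfolding pol_expand_right[of "-1" "unit i" v] by (rule pdd_dir_sum[OF pfaffian_poly])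
  also have "\<dots> = (\<Sum>k\<in>UNIV. if k = i' then - pdd (pol (-1) (unit i) (unit k)) pfaffian Y else 0)"
  proof (rule sum.cong[OF refl])
    fix k
    have "pdd (pol (-1) (unit i) (unit k)) pfaffian Y = 0" if "k \<noteq> i'" "k \<noteq> i"
    proof -
      have "pdd (pol (-1) (unit i) (unit k)) pfaffian Y = pfaffian (Y + pol (-1) (unit i) (unit k))"
        by (rule pfaffian_row_linear) (use that in \<open>auto simp: Y_def unit_nth\<close>)
      also have "\<dots> = 0" by (rule pfaffian_zero_row[of _ i']) (use that ne in \<open>auto simp: Y_def unit_nth\<close>)
      finally show ?thesis .
    qed
    then show "v $ k * pdd (pol (-1) (unit i) (unit k)) pfaffian Y
      = (if k = i' then - pdd (pol (-1) (unit i) (unit k)) pfaffian Y else 0)"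
      using ne by (auto simp: v_def)
  qed
  also have "\<dots> = (-1) * pdd (pol (-1) (unit i) (unit i')) pfaffian Y" by simp
  also have "\<dots> = pdd (mscale (-1) (pol (-1) (unit i) (unit i'))) pfaffian Y"
    by (simp only: pdd_dir_linear(2)[OF pfaffian_poly])
  also have "mscale (-1) (pol (-1) (unit i) (unit i')) = W" by (simp add: W_def vec_eq_iff)
  also have "pdd W pfaffian Y = pfaffian (Y + W)"
    unfolding W_def by (rule pfaffian_row_linear) (use ne in \<open>auto simp: Y_def unit_nth\<close>)
  also have "Y + W = (\<chi> a b. if a \<in> {i, i'} \<or> b \<in> {i, i'} then W $ a $ b else B $ a $ b)"
    by (auto simp: vec_eq_iff Y_def W_def unit_nth)
  finally show ?thesis .
qed

lemma matrix_add_rdistrib: "(B + C) ** A = B ** A + C ** A" for A B C :: "'m::finite cmat"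
  by (simp add: vec_eq_iff matrix_matrix_mult_def sum.distrib algebra_simps)

lemma act1_elementary:
  fixes A :: "'m::finite cmat"
  assumes "A \<in> skew_mats"
  shows "act1 (mat 1 + mscale t (matrix_unit i k)) A = A + mscale t (pol (-1) (unit i) (A $ k))
    + mscale (t * t) (act1 (matrix_unit i k) A)"
proof -
  have sk: "A $ a $ k = - A $ k $ a" for a
    by (rule skew_mats_nth[OF assms])
  let ?E = "matrix_unit i k :: 'm cmat"
  have 1: "?E ** A = pol 0 (unit i) (A $ k)"
    by (simp add: vec_eq_iff matrix_matrix_mult_def matrix_unit_def unit_nth if_distrib[of "\<lambda>x. x * _"] cong: if_cong)
  have 2: "A ** transpose ?E = pol 0 (column k A) (unit i)"
    by (simp add: vec_eq_iff matrix_matrix_mult_def matrix_unit_def transpose_def column_def unit_nth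
        if_distrib[of "\<lambda>x. _ * x"] cong: if_cong)
  have m: "mscale t B ** C = mscale t (B ** C)" "B ** mscale t C = mscale t (B ** C)" for B C :: "'m cmat"
    by (simp_all add: vec_eq_iff matrix_matrix_mult_def sum_distrib_left mult_ac)
  have tr: "transpose (mat 1 + mscale t ?E) = mat 1 + mscale t (transpose ?E)"
    by (auto simp: vec_eq_iff transpose_def mat_def)
  have "act1 (mat 1 + mscale t ?E) A = A + mscale t (A ** transpose ?E) + (mscale t (?E ** A) + mscale (t * t) (act1 ?E A))"
    unfolding act1_def tr by (simp add: matrix_add_ldistrib matrix_add_rdistrib m vec_eq_iff algebra_simps)
  moreover have "mscale t (pol (-1) (unit i) (A $ k)) = mscale t (?E ** A) + mscale t (A ** transpose ?E)"
    unfolding 1 2 by (simp add: vec_eq_iff column_def sk algebra_simps)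
  ultimately show ?thesis by (simp only: add_ac)
qed

lemma pfaffian_row_inv:
  fixes A :: "('n::finite + 'n) cmat"
  assumes "A \<in> skew_mats"
  shows "pdd (pol (-1) (unit i) (A $ k)) pfaffian A = (if i = k then pfaffian A else 0)"
proof -
  have "((\<lambda>t. pfaffian (act1 (mat 1 + mscale t (matrix_unit i k)) A)) has_field_derivative
      pdd (pol (-1) (unit i) (A $ k)) pfaffian A) (at 0)"
    unfolding act1_elementary[OF assms] by (rule has_pdd_curve[OF pfaffian_poly])
  moreover have "((\<lambda>t. pfaffian (act1 (mat 1 + mscale t (matrix_unit i k)) A)) has_field_derivative
      (if i = k then pfaffian A else 0)) (at 0)"
    unfolding pfaffian_congruence det_elementary by (auto intro!: derivative_eq_intros)
  ultimately show ?thesis by (rule DERIV_unique)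
qed

definition standard_skew :: "('n::finite + 'n) cmat" where
  "standard_skew = (\<chi> a b. case (a, b) of (Inl i, Inr j) \<Rightarrow> if i = j then 1 else 0
     | (Inr i, Inl j) \<Rightarrow> if i = j then -1 else 0 | _ \<Rightarrow> 0)"

lemma standard_skew_nth [simp]:
  "standard_skew $ Inl i $ Inl j = 0" "standard_skew $ Inr i $ Inr j = 0"
  "standard_skew $ Inl i $ Inr j = (if i = j then 1 else 0)"
  "standard_skew $ Inr i $ Inl j = (if i = j then -1 else 0)"
  by (simp_all add: standard_skew_def)

lemma standard_skew_antisym: "standard_skew $ a $ b = - standard_skew $ b $ a"
  by (cases a; cases b) auto

text \<open>The permutation is the product of two conjugate permutations, one on each summand.\<close>

lemma sign_map_sum:
  fixes \<pi> :: "'n::finite \<Rightarrow> 'n"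
  assumes "bij \<pi>"
  shows "sign (map_sum \<pi> \<pi>) = 1"
proof -
  define s :: "'n + 'n \<Rightarrow> 'n + 'n" where "s = case_sum Inr Inl"
  have perm: "permutation p" if "bij p" for p :: "'n + 'n \<Rightarrow> 'n + 'n"
    using that by (simp add: permutation)
  have ss: "s \<circ> s = id" by (auto simp: s_def fun_eq_iff split: sum.split)
  then have s: "bij s" by (rule o_bij) fact
  define q :: "'n + 'n \<Rightarrow> 'n + 'n" where "q = map_sum \<pi> id"
  have l: "bij q" unfolding q_def
  proof (rule o_bij)
    show "map_sum (inv_into UNIV \<pi>) id \<circ> map_sum \<pi> id = id" "map_sum \<pi> id \<circ> map_sum (inv_into UNIV \<pi>) id = id"
      using surj_iff[THEN iffD1, OF bij_is_surj[OF assms]]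
      by (simp_all add: map_sum.comp map_sum.id bij_is_inj[OF assms])
  qed
  have "map_sum \<pi> \<pi> = q \<circ> (s \<circ> q \<circ> s)"
    by (auto simp: q_def s_def fun_eq_iff split: sum.split elim!: sumE)
  then have "sign (map_sum \<pi> \<pi>) = sign q * (sign s * sign q * sign s)"
    by (simp only: sign_compose perm bij_comp s l)
  then show ?thesis by (simp add: sign_def)
qed

text \<open>A nonzero term comes from a permutation that maps pairs \<open>{Inl i, Inr i}\<close> to pairs. Exchanging the two
  elements of a pair changes the sign of the permutation and of one factor, hence does not change the
  term; after some exchanges the permutation maps \<open>Inl\<close> to \<open>Inl\<close>, and then it is even.\<close>

lemma standard_skew_terms:
  fixes p :: "'n::finite + 'n \<Rightarrow> 'n + 'n"
  assumes "p permutes UNIV"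
  shows "of_int (sign p) * pairs_prod standard_skew p \<in> {0, 1}"
  using assms
proof (induction "card {i. p (Inl i) \<in> range Inr}" arbitrary: p rule: less_induct)
  case less
  show ?case
  proof (cases "pairs_prod standard_skew p = 0")
    case False
    then have nz: "standard_skew $ p (Inl i) $ p (Inr i) \<noteq> 0" for i by (simp add: prod_zero_iff)
    show ?thesis
    proof (cases "\<exists>i. p (Inl i) \<in> range Inr")
      case True
      then obtain i k where i: "p (Inl i) = Inr k" by auto
      with nz[of i] have i': "p (Inr i) = Inl k" by (cases "p (Inr i)") (auto split: if_splits)
      define \<tau> where "\<tau> = Transposition.transpose (Inl i :: 'n + 'n) (Inr i)"
      have \<tau>: "\<tau> permutes UNIV" by (simp add: \<tau>_def permutes_swap_id)
      have q: "p \<circ> \<tau> permutes UNIV" by (rule permutes_compose[OF \<tau> less.prems])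
      have "{j. (p \<circ> \<tau>) (Inl j) \<in> range Inr} = {j. p (Inl j) \<in> range Inr} - {i}"
        using i' by (auto simp: \<tau>_def Transposition.transpose_def)
      then have "card {j. (p \<circ> \<tau>) (Inl j) \<in> range Inr} < card {j. p (Inl j) \<in> range Inr}"
        by (intro psubset_card_mono) (use i in auto)
      from less.hyps[OF this q] have "of_int (sign (p \<circ> \<tau>)) * pairs_prod standard_skew (p \<circ> \<tau>) \<in> {0, 1 :: complex}" .
      moreover have sgn: "sign (p \<circ> \<tau>) = - sign p"
        using less.prems \<tau> by (simp add: sign_compose permutation_permutes[THEN iffD2] \<tau>_def sign_swap_id
            permutes_imp_permutation[OF finite])
      have prd: "pairs_prod standard_skew (p \<circ> \<tau>) = - pairs_prod standard_skew p"
      proof -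
        have "pairs_prod standard_skew (p \<circ> \<tau>)
          = standard_skew $ p (Inr i) $ p (Inl i) * (\<Prod>j\<in>UNIV - {i}. standard_skew $ p (Inl j) $ p (Inr j))"
          by (subst prod.remove[of _ i]) (auto simp: \<tau>_def Transposition.transpose_def intro!: prod.cong)
        also have "\<dots> = - pairs_prod standard_skew p"
          by (subst (2) prod.remove[of _ i]) (simp_all add: standard_skew_antisym[of "p (Inr i)"])
        finally show ?thesis .
      qed
      have "of_int (sign (p \<circ> \<tau>)) * pairs_prod standard_skew (p \<circ> \<tau>) = of_int (sign p) * pairs_prod standard_skew p"
        unfolding sgn prd by simp
      ultimately show ?thesis by (simp only:)
    next
      case False
      define \<pi> where "\<pi> i = projl (p (Inl i))" for i
      have l: "p (Inl i) = Inl (\<pi> i)" for i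
        using False by (cases "p (Inl i)") (auto simp: \<pi>_def)
      have r: "p (Inr i) = Inr (\<pi> i)" for i
        using nz[of i] l[of i] by (cases "p (Inr i)") (auto split: if_splits)
      have "inj \<pi>"
      proof (rule injI)
        fix x y assume "\<pi> x = \<pi> y"
        then have "p (Inl x) = p (Inl y)" by (simp add: l)
        then show "x = y" using permutes_inj[OF less.prems] by (auto dest: injD)
      qed
      then have "bij \<pi>" by (simp add: bij_def finite_UNIV_inj_surj)
      moreover have "p = map_sum \<pi> \<pi>"
      proof
        fix a show "p a = map_sum \<pi> \<pi> a" by (cases a) (simp_all add: l r)
      qed
      ultimately show ?thesis by (simp add: sign_map_sum)
    qed
  qed simp
qed

lemma pfaffian_standard_skew: "pfaffian (standard_skew :: ('n::finite + 'n) cmat) \<noteq> 0"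
proof -
  define T where "T p = of_int (sign p) * pairs_prod standard_skew p" for p :: "'n + 'n \<Rightarrow> 'n + 'n"
  let ?P = "{p :: 'n + 'n \<Rightarrow> 'n + 'n. p permutes UNIV}"
  have "(\<Sum>p\<in>?P. T p) = (\<Sum>p\<in>?P. if T p = 1 then 1 else 0)"
    using standard_skew_terms by (intro sum.cong) (auto simp: T_def)
  also have "\<dots> = of_nat (card {p\<in>?P. T p = 1})" by (subst sum.inter_filter[symmetric]) simp_all
  finally have "(\<Sum>p\<in>?P. T p) = of_nat (card {p\<in>?P. T p = 1})" .
  moreover have "id \<in> {p\<in>?P. T p = 1}" by (simp add: T_def permutes_id)
  ultimately have "(\<Sum>p\<in>?P. T p) \<noteq> 0" by (auto simp: card_eq_0_iff simp del: mem_Collect_eq)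
  then show ?thesis by (simp add: pfaffian_def T_def)
qed

theorem skew_matrices:
  fixes L :: "(real \<Rightarrow> ('n::finite + 'n) cmat) \<Rightarrow> complex ^ 1 ^ 1"
  assumes L: "local_system (basic_open skew_mats pfaffian) L" "has_monodromy (basic_open skew_mats pfaffian) pfaffian \<alpha> L"
    and neq: "\<not> equivariant GL (**) act1 (basic_open skew_mats pfaffian) L"
  shows "simple_object_of skew_mats pfaffian (conormal_union skew_mats GL act1) L (F_mod skew_mats pfaffian \<alpha>)"
proof -
  have J: "(standard_skew :: ('n + 'n) cmat) \<in> skew_mats" by (rule skew_matsI) (rule standard_skew_antisym)
  have "polarized_space skew_mats pfaffian (-1) 1 (standard_skew :: ('n + 'n) cmat)"
  proof unfold_locales
    show "\<exists>A\<in>skew_mats. pfaffian (A :: ('n + 'n) cmat) \<noteq> 0" using J pfaffian_standard_skew by blast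
    show "(0 :: ('n + 'n) cmat) \<in> skew_mats" by (rule skew_matsI) simp
    show "A + B \<in> skew_mats" if AB: "A \<in> skew_mats" "B \<in> skew_mats" for A B :: "('n + 'n) cmat"
    proof (rule skew_matsI)
      fix a b show "(A + B) $ a $ b = - (A + B) $ b $ a"
        using skew_mats_nth[OF AB(1), of a b] skew_mats_nth[OF AB(2), of a b] by simp
    qed
    show "mscale c A \<in> skew_mats" if A: "A \<in> skew_mats" for c and A :: "('n + 'n) cmat"
    proof (rule skew_matsI)
      fix a b show "mscale c A $ a $ b = - mscale c A $ b $ a" using skew_mats_nth[OF A, of a b] by simp
    qed
    show "pol (-1) a b \<in> skew_mats" for a b :: "complex ^ ('n + 'n)" by (rule skew_matsI) simp
    show "pdd (pol (-1) (column k A) (unit i)) pfaffian A = (if i = k then 1 * pfaffian A else 0)"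
      if A: "A \<in> skew_mats" for A :: "('n + 'n) cmat" and i k
    proof -
      have "column k A $ a = - A $ k $ a" for a using skew_mats_nth[OF A, of a k] by (simp add: column_def)
      then have "pol (-1) (column k A) (unit i) = pol (-1) (unit i) (A $ k)" by (simp add: vec_eq_iff)
      then show ?thesis by (simp add: pfaffian_row_inv[OF A])
    qed
    show "cut standard_skew R A \<in> skew_mats" if A: "A \<in> skew_mats" for A :: "('n + 'n) cmat" and R
    proof (rule skew_matsI)
      fix a b show "cut standard_skew R A $ a $ b = - cut standard_skew R A $ b $ a"
        using skew_mats_nth[OF A, of a b] standard_skew_antisym[of a b] by simp
    qed
  qed (simp_all add: pfaffian_poly pfaffian_row_inv)
  then interpret polarized_space skew_mats pfaffian "-1" 1 "standard_skew :: ('n + 'n) cmat" .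
  have act_in: "act1 g A \<in> skew_mats" if "A \<in> skew_mats" for g A :: "('n + 'n) cmat"
  proof -
    have tA: "transpose A = - A" using that by (simp add: skew_mats_def)
    have m: "B ** (- A) ** C = - (B ** A ** C)" for B C :: "('n + 'n) cmat"
      by (simp add: vec_eq_iff matrix_matrix_mult_def sum_negf)
    have "transpose (act1 g A) = g ** transpose A ** transpose g"
      by (simp add: act1_def matrix_transpose_mul matrix_mul_assoc)
    then show ?thesis unfolding skew_mats_def tA m by (simp add: act1_def)
  qed
  have nonint: "of_nat 1 * \<alpha> \<noteq> of_int k" for k
  proof
    assume k: "of_nat 1 * \<alpha> = of_int k"
    have "equivariant GL (**) act1 U L"
    proof (rule equivariant_if_integral[OF L k, where \<kappa> = det])
      show "act1 g A \<in> U" if "g \<in> GL" "A \<in> U" for g A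
        using that GL_det[of g] act_in by (simp add: U_iff pfaffian_congruence)
    qed (auto simp: act1_mult GL_det det_mul act1_path det_path pfaffian_congruence)
    then show False using neq by simp
  qed
  \<comment> \<open>The minors are Pfaffians, so the index sets are unions of the pairs \<open>{Inl q, Inr q}\<close>.\<close>
  define \<R> where "\<R> = range (\<lambda>Q :: 'n set. Inl ` Q \<union> Inr ` Q)"
  show ?thesis
  proof (rule simple_object[where n = 1 and \<R> = \<R>, OF _ _ _ _ _ _ L nonint])
    have "(UNIV :: ('n + 'n) set) = Inl ` UNIV \<union> Inr ` UNIV" by (rule UNIV_sum)
    then show "UNIV \<in> \<R>" unfolding \<R>_def by blast
    show "standard_skew $ k $ l = 0" if "R \<in> \<R>" "k \<in> R" "l \<notin> R" for R and k l :: "'n + 'n"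
      using that by (cases k; cases l) (auto simp: \<R>_def)
  next
    fix R assume "R \<in> \<R>" "R \<noteq> {}"
    then obtain Q q where R: "R = Inl ` Q \<union> Inr ` Q" and q: "q \<in> Q" by (auto simp: \<R>_def)
    define R' where "R' = Inl ` (Q - {q}) \<union> Inr ` (Q - {q})"
    have "pdd (pol (-1) (unit (Inl q)) (unit (Inr q))) pfaffian (cut standard_skew R A) = 1 * pfaffian (cut standard_skew R' A)"
      if A: "A \<in> skew_mats" for A :: "('n + 'n) cmat"
    proof -
      let ?W = "pol (-1) (unit (Inl q)) (unit (Inr q)) :: ('n + 'n) cmat"
      have "(if a \<in> {Inr q, Inl q} \<or> b \<in> {Inr q, Inl q} then ?W $ a $ b else cut standard_skew R A $ a $ b)
        = cut standard_skew R' A $ a $ b" for a b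
        by (cases a; cases b) (auto simp: R R'_def unit_nth)
      then have "(\<chi> a b. if a \<in> {Inr q, Inl q} \<or> b \<in> {Inr q, Inl q} then ?W $ a $ b else cut standard_skew R A $ a $ b)
        = cut standard_skew R' A"
        unfolding vec_eq_iff vec_lambda_beta by blast
      then show ?thesis unfolding pdd_pfaffian_pair[OF cut_in[OF A] Inr_not_Inl] by simp
    qed
    moreover have "R' \<in> \<R>" "R' \<subset> R" "Inr q \<in> R" "Inl q \<in> R" using q by (auto simp: R R'_def \<R>_def)
    ultimately show "\<exists>i\<in>R. \<exists>i'\<in>R. \<exists>R'\<in>\<R>. \<exists>\<kappa>. R' \<subset> R \<and> \<kappa> \<noteq> 0 \<and>
        (\<forall>A\<in>skew_mats. pdd (pol (-1) (unit i') (unit i)) pfaffian (cut standard_skew R A) = \<kappa> * pfaffian (cut standard_skew R' A))"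
      by (intro bexI[of _ "Inr q"] bexI[of _ "Inl q"] bexI[of _ R'] exI[of _ 1]) auto
  next
    fix y \<xi> :: "('n + 'n) cmat" assume *: "y \<in> skew_mats" "\<xi> \<in> skew_mats" "transpose y ** \<xi> = 0" "\<xi> ** transpose y = 0"
    show "(y, \<xi>) \<in> conormal_union skew_mats GL act1"
      by (rule conormal_unionI[where e = "mat 1"]) (use * act1_factors act1_one in auto)
  next
    show "pfaffian (standard_skew :: ('n + 'n) cmat) \<noteq> 0" by (rule pfaffian_standard_skew)
    show "-1 = (0::complex) \<or> -1 * -1 = (1::complex) \<and> (\<forall>\<xi>\<in>skew_mats. \<forall>i j. (\<xi> :: ('n + 'n) cmat) $ j $ i = -1 * \<xi> $ i $ j)"
    proof -
      have "\<xi> $ j $ i = - 1 * \<xi> $ i $ j" if "\<xi> \<in> skew_mats" for \<xi> :: "('n + 'n) cmat" and i j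
        using skew_mats_nth[OF that, of j i] by (simp only: mult_minus1)
      moreover have "- 1 * - 1 = (1 :: complex)" by simp
      ultimately show ?thesis by blast
    qed
  qed auto
qed

theorem theorem7p1:
  fixes \<alpha> :: complex
  shows
    "(\<forall>L :: (real \<Rightarrow> 'n::finite cmat) \<Rightarrow> complex ^ 1 ^ 1.
        local_system (basic_open UNIV det) L \<and>
        has_monodromy (basic_open UNIV det) det \<alpha> L \<and>
        \<not> equivariant (GL \<times> GL) pair_mul act2 (basic_open UNIV det) L \<longrightarrow>
        simple_object_of UNIV det (conormal_union UNIV (GL \<times> GL) act2) L (F_mod UNIV det \<alpha>))
   \<and> (\<forall>L :: (real \<Rightarrow> 'n cmat) \<Rightarrow> complex ^ 1 ^ 1.
        local_system (basic_open sym_mats det) L \<and>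
        has_monodromy (basic_open sym_mats det) det \<alpha> L \<and>
        \<not> equivariant GL (**) act1 (basic_open sym_mats det) L \<longrightarrow>
        simple_object_of sym_mats det (conormal_union sym_mats GL act1) L (F_mod sym_mats det \<alpha>))
   \<and> (\<forall>L :: (real \<Rightarrow> ('n + 'n) cmat) \<Rightarrow> complex ^ 1 ^ 1.
        local_system (basic_open skew_mats pfaffian) L \<and>
        has_monodromy (basic_open skew_mats pfaffian) pfaffian \<alpha> L \<and>
        \<not> equivariant GL (**) act1 (basic_open skew_mats pfaffian) L \<longrightarrow>
        simple_object_of skew_mats pfaffian (conormal_union skew_mats GL act1) L
          (F_mod skew_mats pfaffian \<alpha>))"
  using general_matrices symmetric_matrices skew_matrices by (intro conjI allI impI) (elim conjE; blast)+

end
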